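(* Let $N\geq 3$, $\alpha\in(0,2)$, and let $g:\mathbb{R}^N\to\mathbb{R}$ be a function (possibly sign-changing) such that $g\in L^1_{\rm loc}(\mathbb{R}^N)$ and $g^+=g_1+g_2\neq 0$, where $g_1\in L^{\frac{N}{2-\alpha}}(\mathbb{R}^N)$, $\lim_{x\to y}|x-y|^{2-\alpha}g_2(x)=0$ for all $y\in\mathbb{R}^N$, and $\lim_{|x|\to\infty}|x|^{2-\alpha}g_2(x)=0$. Then the problem $$-\operatorname{div}(|x|^\alpha\nabla u(x))=\lambda g(x)u(x),\qquad x\in\mathbb{R}^N,$$ has an unbounded, increasing sequence of positive eigenvalues $\lambda$.
   Context: $g^+=\max\{g,0\}$ denotes the positive part of $g$. $W^{1,2}_\alpha(\mathbb{R}^N)$ denotes the closure (completion) of $C_0^\infty(\mathbb{R}^N)$ under the norm $\|u\|_\alpha^2=\int_{\mathbb{R}^N}|x|^\alpha|\nabla u|^2\,dx$. It is a Hilbert space with scalar product $\langle u,v\rangle_\alpha=\int_{\mathbb{R}^N}|x|^\alpha\nabla u\cdot\nabla v\,dx$, and it is regarded as a space of functions via the Sobolev type inequality $\left(\int_{\mathbb{R}^N}|u|^{2^\star_\alpha}dx\right)^{2/2^\star_\alpha}\leq C_\alpha\int_{\mathbb{R}^N}|x|^\alpha|\nabla u|^2\,dx$, $2^\star_\alpha=\frac{2N}{N-2+\alpha}$. A number $\lambda>0$ is an eigenvalue of the problem if there exists $u_\lambda\in W^{1,2}_\alpha(\mathbb{R}^N)\setminus\{0\}$ such that $\int_{\mathbb{R}^N}|x|^\alpha\nabla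 u_\lambda\cdot\nabla\varphi\,dx=\lambda\int_{\mathbb{R}^N}g(x)u_\lambda\varphi\,dx$ for all $\varphi\in W^{1,2}_\alpha(\mathbb{R}^N)$; such $u_\lambda$ is called an eigenvector (eigenfunction) corresponding to $\lambda$. *)

theory Defs
  imports "HOL-Analysis.Analysis"
begin

definition partial_deriv :: "'n::finite \<Rightarrow> (real ^ 'n \<Rightarrow> real) \<Rightarrow> real ^ 'n \<Rightarrow> real" where
  "partial_deriv i f x = frechet_derivative f (at x) (axis i 1)"

definition gradient :: "(real ^ 'n::finite \<Rightarrow> real) \<Rightarrow> real ^ 'n \<Rightarrow> real ^ 'n" where
  "gradient f x = (\<chi> i. partial_deriv i f x)"

primrec C_k :: "nat \<Rightarrow> (real ^ 'n::finite \<Rightarrow> real) \<Rightarrow> bool" where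
  "C_k 0 f \<longleftrightarrow> continuous_on UNIV f"
| "C_k (Suc k) f \<longleftrightarrow> (\<forall>x. f differentiable (at x)) \<and> (\<forall>i. C_k k (partial_deriv i f))"

definition test_functions :: "(real ^ 'n::finite \<Rightarrow> real) set" where
  "test_functions = {f. (\<forall>k. C_k k f) \<and> compact (closure {x. f x \<noteq> 0})}"

definition locally_integrable :: "(real ^ 'n::finite \<Rightarrow> real) \<Rightarrow> bool" where
  "locally_integrable f \<longleftrightarrow> (\<forall>K. compact K \<longrightarrow> set_integrable lebesgue K f)"

definition in_Lp :: "real \<Rightarrow> (real ^ 'n::finite \<Rightarrow> real) \<Rightarrow> bool" where
  "in_Lp p f \<longleftrightarrow> f \<in> borel_measurable lebesgue \<and> integrable lebesgue (\<lambda>x. \<bar>f x\<bar> powr p)"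

definition critical_exponent :: "nat \<Rightarrow> real \<Rightarrow> real" where
  "critical_exponent N \<alpha> = 2 * real N / (real N - 2 + \<alpha>)"

(* The completion of the test functions, realised as functions: by the Sobolev inequality a
   sequence that is Cauchy in the weighted gradient norm also converges in L^{2*}. Its limit u
   there is the function representing the element of the completion, and the limit G of the
   gradients in the weighted L^2 space is the gradient of that element. *)
definition has_weighted_gradient ::
    "real \<Rightarrow> (real ^ 'n::finite \<Rightarrow> real) \<Rightarrow> (real ^ 'n \<Rightarrow> real ^ 'n) \<Rightarrow> bool" where
  "has_weighted_gradient \<alpha> u G \<longleftrightarrow>
     u \<in> borel_measurable lebesgue \<and> G \<in> borel_measurable lebesgue \<and>
     (\<exists>\<phi> :: nat \<Rightarrow> real ^ 'n \<Rightarrow> real. (\<forall>n. \<phi> n \<in> test_functions) \<and>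
        (\<lambda>n. \<integral>\<^sup>+ x. ennreal (norm x powr \<alpha> * (norm (gradient (\<phi> n) x - G x))\<^sup>2) \<partial>lebesgue)
          \<longlonglongrightarrow> 0 \<and>
        (\<lambda>n. \<integral>\<^sup>+ x. ennreal (\<bar>\<phi> n x - u x\<bar> powr critical_exponent CARD('n) \<alpha>) \<partial>lebesgue)
          \<longlonglongrightarrow> 0)"

definition weighted_sobolev :: "real \<Rightarrow> (real ^ 'n::finite \<Rightarrow> real) set" where
  "weighted_sobolev \<alpha> = {u. \<exists>G. has_weighted_gradient \<alpha> u G}"

(* For 0 < \<alpha> < 2 and N \<ge> 3, G is locally integrable and equals the distributional gradient
   of u, so it is determined by u almost everywhere and the choice below is immaterial. *)
definition weighted_gradient ::
    "real \<Rightarrow> (real ^ 'n::finite \<Rightarrow> real) \<Rightarrow> real ^ 'n \<Rightarrow> real ^ 'n" where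
  "weighted_gradient \<alpha> u = (SOME G. has_weighted_gradient \<alpha> u G)"

definition weighted_inner ::
    "real \<Rightarrow> (real ^ 'n::finite \<Rightarrow> real) \<Rightarrow> (real ^ 'n \<Rightarrow> real) \<Rightarrow> real" where
  "weighted_inner \<alpha> u v =
     (\<integral>x. norm x powr \<alpha> * (weighted_gradient \<alpha> u x \<bullet> weighted_gradient \<alpha> v x) \<partial>lebesgue)"

(* Since g is only locally integrable, existence of the right-hand integral has to be required:
   the Bochner integral of a non-integrable function is 0 by convention. *)
definition is_eigenfunction ::
    "real \<Rightarrow> (real ^ 'n::finite \<Rightarrow> real) \<Rightarrow> real \<Rightarrow> (real ^ 'n \<Rightarrow> real) \<Rightarrow> bool" where
  "is_eigenfunction \<alpha> g \<mu> u \<longleftrightarrow>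
     u \<in> weighted_sobolev \<alpha> \<and> \<not> (AE x in lebesgue. u x = 0) \<and>
     (\<forall>\<phi> \<in> weighted_sobolev \<alpha>.
        integrable lebesgue (\<lambda>x. g x * u x * \<phi> x) \<and>
        weighted_inner \<alpha> u \<phi> = \<mu> * (\<integral>x. g x * u x * \<phi> x \<partial>lebesgue))"

definition is_eigenvalue :: "real \<Rightarrow> (real ^ 'n::finite \<Rightarrow> real) \<Rightarrow> real \<Rightarrow> bool" where
  "is_eigenvalue \<alpha> g \<mu> \<longleftrightarrow> 0 < \<mu> \<and> (\<exists>u. is_eigenfunction \<alpha> g \<mu> u)"

end

theory Submission
  imports Defs "HOL-Library.Diagonal_Subsequence"
begin

text \<open>Let $X$ be the space of all $u$ in the weighted Sobolev space with $\int g^-u^2 < \infty$. Hardy's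
  and Sobolev's inequalities show that $u \mapsto \int g^+u^2$ is weakly continuous on bounded sets: up to
  $\varepsilon\|u\|_\alpha^2$ it is bounded by the squares of finitely many averages of $u$. Hence
  $B(u) = \int g^+u^2 - \int g^-u^2$ attains its maximum over the unit sphere of $X$ on the orthogonal complement
  of finitely many earlier maximisers. The maximum is positive because near each of infinitely many points
  there is a test function with $B > 0$; finitely many of these with disjoint supports span a space that meets
  any such complement. The maximisers are
  orthonormal, so compactness forces the maxima $\mu$ to accumulate only at $0$, and $\lambda = 1/\mu$ is
  unbounded. A maximiser satisfies the equation only against $X$; a Kato type inequality bounds
  $\int g^-|u\varphi|$ by $\|\varphi\|_\alpha$, which extends the equation to the whole Sobolev space.\<close>

section \<open>Smooth functions and test functions\<close>

text \<open>Two degeneracies shape the proof. The weight |x|^\<alpha> vanishes at the origin, so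
  unweighted inequalities do not apply directly. Hardy's inequality is the substitute: it yields
  Sobolev's inequality through averages over balls B(y, t|y|) with t \<le> 1/2, on which |x| is
  comparable to |y|, and it controls the term u grad \<eta> that a cut-off \<eta> away from the
  origin produces, so that the classical translation estimate is available on annuli. The second
  degeneracy is g^-: being merely locally integrable, it has no bound by the energy. Its quadratic
  form is therefore made part of the norm of X, where Fatou's lemma is enough for completeness. For
  the same reason a maximiser is produced by strong convergence: its defect form is positive
  semidefinite, and the parallelogram law turns compactness of the g^+ part into a Cauchy sequence
  in the norm of X. Compactness itself is kept as an inequality with finitely many averages, because
  an inequality for test functions passes to the completion by Fatou's lemma.\<close>

definition smooth :: "(real ^ 'n::finite \<Rightarrow> real) \<Rightarrow> bool" where
  "smooth f \<longleftrightarrow> (\<forall>k. C_k k f)"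

lemma partial_deriv_eqI:
  "(f has_derivative F) (at x) \<Longrightarrow> partial_deriv i f x = F (axis i 1)"
  unfolding partial_deriv_def using frechet_derivative_at by metis

lemma has_derivative_gradient:
  fixes f :: "real ^ 'n::finite \<Rightarrow> real"
  assumes "f differentiable (at x)"
  shows "(f has_derivative (\<lambda>h. gradient f x \<bullet> h)) (at x)"
proof -
  let ?F = "frechet_derivative f (at x)"
  have d: "(f has_derivative ?F) (at x)"
    using assms frechet_derivative_works by blast
  then have lin: "linear ?F"
    using has_derivative_linear by blast
  have "?F h = gradient f x \<bullet> h" for h
  proof -
    have "?F h = ?F (\<Sum>i\<in>UNIV. h $ i *\<^sub>R axis i 1)"
      by (metis basis_expansion scalar_mult_eq_scaleR)
    also have "\<dots> = (\<Sum>i\<in>UNIV. h $ i * ?F (axis i 1))"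
      using lin by (simp add: linear_sum linear_cmul)
    also have "\<dots> = gradient f x \<bullet> h"
      by (simp add: gradient_def partial_deriv_def inner_vec_def mult.commute)
    finally show ?thesis .
  qed
  then have "?F = (\<lambda>h. gradient f x \<bullet> h)" by blast
  with d show ?thesis by simp
qed

lemma gradient_eqI:
  fixes f :: "real ^ 'n::finite \<Rightarrow> real"
  assumes "(f has_derivative (\<lambda>h. v \<bullet> h)) (at x)"
  shows "gradient f x = v"
  by (simp add: gradient_def vec_eq_iff partial_deriv_eqI[OF assms] inner_axis)

lemma C_k_Suc_imp: "C_k (Suc k) f \<Longrightarrow> C_k k f"
proof (induction k arbitrary: f)
  case 0
  then show ?case
    by (auto simp: continuous_on_eq_continuous_within differentiable_imp_continuous_within)
next
  case (Suc k)
  then show ?case by (metis C_k.simps(2))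
qed

lemma C_k_const: "C_k k (\<lambda>_. c)"
proof (induction k arbitrary: c)
  case (Suc k)
  have "partial_deriv i (\<lambda>_. c) = (\<lambda>_. 0)" for i :: 'a
    by (rule ext) (simp add: partial_deriv_eqI[OF has_derivative_const])
  with Suc show ?case by simp
qed simp

lemma C_k_component: "C_k k (\<lambda>x::real^'n::finite. x $ j)"
proof (cases k)
  case 0
  then show ?thesis by (simp add: continuous_on_component)
next
  case (Suc l)
  have d: "((\<lambda>x::real^'n. x $ j) has_derivative (\<lambda>x. x $ j)) (at x)" for x
    by (rule bounded_linear.has_derivative[OF bounded_linear_vec_nth]) simp
  then have "partial_deriv i (\<lambda>x::real^'n. x $ j) = (\<lambda>_. axis i 1 $ j)" for i
    by (intro ext partial_deriv_eqI)
  then show ?thesis using d by (auto simp: Suc C_k_const differentiable_def)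
qed

lemma C_k_add: "C_k k f \<Longrightarrow> C_k k g \<Longrightarrow> C_k k (\<lambda>x. f x + g x)"
proof (induction k arbitrary: f g)
  case 0
  then show ?case by (auto intro: continuous_intros)
next
  case (Suc k)
  have "partial_deriv i (\<lambda>x. f x + g x) = (\<lambda>x. partial_deriv i f x + partial_deriv i g x)" for i
  proof
    fix x
    have "((\<lambda>x. f x + g x) has_derivative
       (\<lambda>h. frechet_derivative f (at x) h + frechet_derivative g (at x) h)) (at x)"
      using Suc.prems by (intro has_derivative_add) (auto simp: frechet_derivative_works[symmetric])
    then show "partial_deriv i (\<lambda>x. f x + g x) x = partial_deriv i f x + partial_deriv i g x"
      by (simp add: partial_deriv_eqI) (simp add: partial_deriv_def)
  qed
  with Suc show ?case by (auto intro: differentiable_add)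
qed

lemma C_k_mult: "C_k k f \<Longrightarrow> C_k k g \<Longrightarrow> C_k k (\<lambda>x. f x * g x)"
proof (induction k arbitrary: f g)
  case 0
  then show ?case by (auto intro: continuous_intros)
next
  case (Suc k)
  have "partial_deriv i (\<lambda>x. f x * g x) =
      (\<lambda>x. f x * partial_deriv i g x + partial_deriv i f x * g x)" for i
  proof
    fix x
    have "((\<lambda>x. f x * g x) has_derivative
       (\<lambda>h. f x * frechet_derivative g (at x) h + frechet_derivative f (at x) h * g x)) (at x)"
      using Suc.prems by (intro has_derivative_mult) (auto simp: frechet_derivative_works[symmetric])
    then show "partial_deriv i (\<lambda>x. f x * g x) x = f x * partial_deriv i g x + partial_deriv i f x * g x"
      by (simp add: partial_deriv_eqI) (simp add: partial_deriv_def)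
  qed
  moreover have "C_k k f" "C_k k g" using Suc.prems C_k_Suc_imp by blast+
  ultimately show ?case using Suc by (auto intro!: C_k_add differentiable_mult)
qed

text \<open>The outer function comes with its whole tower of derivatives \<open>hs\<close>, because
  \<open>C_k\<close> speaks only of functions on \<open>real ^ 'n\<close>. The induction generalises
  over the level \<open>j\<close>: a partial derivative of \<open>hs j\<close> composed with
  \<open>f\<close> is a partial derivative of \<open>f\<close> times \<open>hs (Suc j)\<close>
  composed with \<open>f\<close>.\<close>

lemma C_k_compose:
  fixes hs :: "nat \<Rightarrow> real \<Rightarrow> real"
  assumes hs: "\<And>j t. (hs j has_real_derivative hs (Suc j) t) (at t)"
  shows "C_k k f \<Longrightarrow> C_k k (\<lambda>x. hs j (f x))"
proof (induction k arbitrary: f j)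
  case 0
  have "continuous_on UNIV (hs j)"
    using hs DERIV_continuous_on by (metis)
  with 0 show ?case
    by (auto intro: continuous_on_compose2)
next
  case (Suc k)
  have d: "((\<lambda>x. hs j (f x)) has_derivative
       (\<lambda>h. frechet_derivative f (at x) h * hs (Suc j) (f x))) (at x)" for x
  proof -
    have "(hs j has_derivative (\<lambda>h. h * hs (Suc j) (f x))) (at (f x))"
      using hs[of j "f x"] by (simp add: has_field_derivative_def mult.commute[of _ "hs (Suc j) (f x)"])
    moreover have "(f has_derivative frechet_derivative f (at x)) (at x)"
      using Suc.prems by (auto simp: frechet_derivative_works[symmetric])
    ultimately show ?thesis
      using diff_chain_at[of f _ x "hs j"] by (auto simp: o_def)
  qed
  then have "partial_deriv i (\<lambda>x. hs j (f x)) = (\<lambda>x. partial_deriv i f x * hs (Suc j) (f x))" for i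
    using partial_deriv_eqI[OF d] by (auto simp: partial_deriv_def[of _ f])
  moreover have "C_k k f" using Suc.prems C_k_Suc_imp by blast
  moreover have "(\<lambda>x. hs j (f x)) differentiable (at x)" for x
    using d by (auto simp: differentiable_def)
  ultimately show ?case using Suc by (auto intro!: C_k_mult)
qed

lemma smooth_const [simp]: "smooth (\<lambda>_. c)"
  and smooth_component [simp]: "smooth (\<lambda>x. x $ j)"
  by (auto simp: smooth_def C_k_const C_k_component)

lemma smooth_add: "smooth f \<Longrightarrow> smooth g \<Longrightarrow> smooth (\<lambda>x. f x + g x)"
  and smooth_mult: "smooth f \<Longrightarrow> smooth g \<Longrightarrow> smooth (\<lambda>x. f x * g x)"
  by (auto simp: smooth_def intro: C_k_add C_k_mult)

lemma smooth_compose: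
  fixes hs :: "nat \<Rightarrow> real \<Rightarrow> real"
  assumes "\<And>j t. (hs j has_real_derivative hs (Suc j) t) (at t)" "hs 0 = h" "smooth f"
  shows "smooth (\<lambda>x. h (f x))"
  using C_k_compose[of hs _ f 0] assms by (auto simp: smooth_def)

lemma smooth_cmult: "smooth f \<Longrightarrow> smooth (\<lambda>x. c * f x)"
  by (rule smooth_mult) auto

lemma smooth_diff: "smooth f \<Longrightarrow> smooth g \<Longrightarrow> smooth (\<lambda>x. f x - g x)"
  using smooth_add[of f "\<lambda>x. -1 * g x"] smooth_cmult[of g "-1"] by simp

lemma smooth_sum: "(\<And>i. i \<in> I \<Longrightarrow> smooth (f i)) \<Longrightarrow> smooth (\<lambda>x. \<Sum>i\<in>I. f i x)"
  by (induction I rule: infinite_finite_induct) (auto intro: smooth_add)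

lemma smooth_prod: "(\<And>i. i \<in> I \<Longrightarrow> smooth (f i)) \<Longrightarrow> smooth (\<lambda>x. \<Prod>i\<in>I. f i x)"
  by (induction I rule: infinite_finite_induct) (auto intro: smooth_mult)

lemma smooth_norm_sq: "smooth (\<lambda>x::real^'n::finite. (norm (x - c))\<^sup>2)"
proof -
  have "(\<lambda>x::real^'n. (norm (x - c))\<^sup>2) = (\<lambda>x. \<Sum>i\<in>UNIV. (x $ i - c $ i) * (x $ i - c $ i))"
    by (rule ext) (simp add: power2_norm_eq_inner inner_vec_def)
  then show ?thesis by (auto intro!: smooth_sum smooth_mult smooth_diff)
qed

lemma smooth_differentiable: "smooth f \<Longrightarrow> f differentiable (at x)"
  unfolding smooth_def by (metis C_k.simps(2))

lemma smooth_partial_deriv: "smooth f \<Longrightarrow> smooth (partial_deriv i f)"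
  unfolding smooth_def by (metis C_k.simps(2))

lemma smooth_continuous: "smooth f \<Longrightarrow> continuous_on A f"
  unfolding smooth_def by (metis C_k.simps(1) continuous_on_subset top_greatest)

lemma smooth_has_derivative: "smooth f \<Longrightarrow> (f has_derivative (\<lambda>h. gradient f x \<bullet> h)) (at x)"
  by (intro has_derivative_gradient smooth_differentiable)

lemma continuous_gradient: "smooth f \<Longrightarrow> continuous_on A (gradient f)"
  unfolding gradient_def[abs_def]
  by (intro continuous_on_vec_lambda smooth_continuous smooth_partial_deriv)

lemma gradient_linear:
  assumes "smooth f" "smooth g"
  shows "gradient (\<lambda>x. a * f x + b * g x) x = a *\<^sub>R gradient f x + b *\<^sub>R gradient g x"
  by (rule gradient_eqI)
    (auto intro!: derivative_eq_intros smooth_has_derivative assms simp: inner_add_left)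

lemma gradient_mult:
  assumes "smooth f" "smooth g"
  shows "gradient (\<lambda>x. f x * g x) x = f x *\<^sub>R gradient g x + g x *\<^sub>R gradient f x"
  by (rule gradient_eqI)
    (auto intro!: derivative_eq_intros smooth_has_derivative assms simp: inner_add_left mult.commute)

lemma gradient_compose:
  assumes "smooth f" "(h has_real_derivative h') (at (f x))"
  shows "gradient (\<lambda>x. h (f x)) x = h' *\<^sub>R gradient f x"
proof (rule gradient_eqI)
  have "(h has_derivative (\<lambda>t. h' * t)) (at (f x))"
    using assms by (simp add: has_field_derivative_def)
  from diff_chain_at[OF smooth_has_derivative[OF assms(1)] this]
  show "((\<lambda>x. h (f x)) has_derivative (\<bullet>) (h' *\<^sub>R gradient f x)) (at x)"
    by (simp add: o_def inner_scaleR_left[abs_def])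
qed

text \<open>arctan serves later as a smooth bounded substitute for the sign function, inside test
  functions of the form \<phi> arctan(k v \<phi>).\<close>

lemma smooth_arctan: assumes "smooth f" shows "smooth (\<lambda>x. arctan (f x))"
proof -
  \<comment> \<open>The derivative of order j + 1 of arctan is p_j(t) / (1 + t^2)^(j+1); the
    quotient rule gives p_(j+1) = p_j' (1 + t^2) - 2 (j + 1) t p_j.\<close>
  define p where "p = rec_nat (1 :: real poly)
    (\<lambda>j p. pderiv p * [:1, 0, 1:] - smult (2 * real (j + 1)) ([:0, 1:] * p))"
  define hs where "hs j t = (case j of 0 \<Rightarrow> arctan t | Suc j \<Rightarrow> poly (p j) t / (1 + t\<^sup>2) ^ (j + 1))"
    for j t
  have pos: "1 + t\<^sup>2 > 0" "1 + t * t > 0" for t :: real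
    using zero_le_power2[of t] by (auto simp: add_pos_nonneg power2_eq_square)
  have "(hs j has_real_derivative hs (Suc j) t) (at t)" for j t
  proof (cases j)
    case 0
    then show ?thesis using DERIV_arctan[of t]
      by (simp add: hs_def[abs_def] p_def inverse_eq_divide)
  next
    case (Suc i)
    have "((\<lambda>t. poly (p i) t / (1 + t\<^sup>2) ^ (i + 1)) has_real_derivative
        (poly (pderiv (p i)) t * (1 + t\<^sup>2) ^ (i + 1) -
          poly (p i) t * (real (i + 1) * (1 + t\<^sup>2) ^ i * (2 * t))) /
        ((1 + t\<^sup>2) ^ (i + 1) * (1 + t\<^sup>2) ^ (i + 1))) (at t)"
    proof (rule DERIV_divide[OF poly_DERIV])
      show "((\<lambda>t. (1 + t\<^sup>2) ^ (i + 1)) has_real_derivative real (i + 1) * (1 + t\<^sup>2) ^ i * (2 * t)) (at t)"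
        by (rule derivative_eq_intros refl)+ simp
    qed (use pos[of t] in simp)
    also have "(poly (pderiv (p i)) t * (1 + t\<^sup>2) ^ (i + 1) -
          poly (p i) t * (real (i + 1) * (1 + t\<^sup>2) ^ i * (2 * t))) /
        ((1 + t\<^sup>2) ^ (i + 1) * (1 + t\<^sup>2) ^ (i + 1)) = poly (p (Suc i)) t / (1 + t\<^sup>2) ^ (Suc i + 1)"
    proof -
      have alg: "(a * w ^ (i + 1) - b * (r * w ^ i * s)) / (w ^ (i + 1) * w ^ (i + 1)) =
          (a * w - b * (r * s)) / w ^ (Suc i + 1)" if "w \<noteq> 0" for a b r s w :: real
        using that by (simp add: field_simps)
      have "poly (p (Suc i)) t = poly (pderiv (p i)) t * (1 + t\<^sup>2) - poly (p i) t * (real (i + 1) * (2 * t))"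
        by (simp add: p_def power2_eq_square algebra_simps)
      then show ?thesis using alg[of "1 + t\<^sup>2"] pos[of t] by simp
    qed
    finally show ?thesis by (simp add: hs_def[abs_def] Suc)
  qed
  then show ?thesis
    by (rule smooth_compose[where hs = hs]) (auto simp: hs_def assms)
qed

section \<open>The flat exponential exp(-1/t)\<close>

definition flat_exp :: "real \<Rightarrow> real" where
  "flat_exp t = (if t > 0 then exp (- (1 / t)) else 0)"

lemma flat_exp_nonneg: "0 \<le> flat_exp t"
  and flat_exp_pos: "t > 0 \<Longrightarrow> 0 < flat_exp t"
  and flat_exp_eq_0: "t \<le> 0 \<Longrightarrow> flat_exp t = 0"
  and flat_exp_le_1: "flat_exp t \<le> 1"
  by (auto simp: flat_exp_def)

lemma flat_exp_mono: "s \<le> t \<Longrightarrow> flat_exp s \<le> flat_exp t"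
  by (auto simp: flat_exp_def frac_le)

lemma poly_times_exp_tendsto_0:
  fixes p :: "real poly"
  shows "((\<lambda>s. poly p s * exp (- s)) \<longlongrightarrow> 0) at_top"
proof -
  have "((\<lambda>s. \<Sum>i\<le>degree p. coeff p i * (s ^ i / exp s)) \<longlongrightarrow> (\<Sum>i\<le>degree p. coeff p i * 0)) at_top"
    by (intro tendsto_intros tendsto_power_div_exp_0)
  then show ?thesis
    by (simp add: poly_altdef sum_distrib_right exp_minus divide_inverse mult.assoc)
qed

lemma smooth_flat_exp: assumes "smooth f" shows "smooth (\<lambda>x. flat_exp (f x))"
proof -
  \<comment> \<open>Each derivative of exp(-1/t) is a polynomial in s = 1/t times exp(-s), and d/dt
    = -s^2 d/ds gives p_(j+1)(s) = s^2 (p_j(s) - p_j'(s)).\<close>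
  define p where "p = rec_nat (1 :: real poly) (\<lambda>j p. [:0, 0, 1:] * (p - pderiv p))"
  define hs where "hs j t = (if t > 0 then poly (p j) (1 / t) * exp (- (1 / t)) else 0)"
    for j and t :: real
  have "(hs j has_real_derivative hs (Suc j) t) (at t)" for j t
  proof (cases "t = 0")
    case False
    consider "t > 0" | "t < 0" using False by linarith
    then show ?thesis
    proof cases
      case 1
      have "((\<lambda>t. poly (p j) (1 / t) * exp (- (1 / t))) has_real_derivative
          (poly (pderiv (p j)) (1 / t) * (- 1 / t\<^sup>2) * exp (- (1 / t)) +
          exp (- (1 / t)) * (1 / t\<^sup>2) * poly (p j) (1 / t))) (at t)"
        using 1 by (auto intro!: derivative_eq_intros DERIV_chain2[OF poly_DERIV]
           simp: power2_eq_square)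
      also have "(poly (pderiv (p j)) (1 / t) * (- 1 / t\<^sup>2) * exp (- (1 / t)) +
          exp (- (1 / t)) * (1 / t\<^sup>2) * poly (p j) (1 / t)) = hs (Suc j) t"
        using 1 by (simp add: hs_def p_def field_simps power2_eq_square)
      finally show ?thesis
        by (rule DERIV_cong_ev[THEN iffD1, rotated -1])
          (use 1 eventually_nhds_in_open[of "{0<..}" t] in \<open>auto simp: hs_def elim!: eventually_mono\<close>)
    next
      case 2
      have "((\<lambda>t. 0) has_real_derivative 0) (at t)" by simp
      then have "(hs j has_real_derivative 0) (at t)"
        by (rule DERIV_cong_ev[THEN iffD1, rotated -1])
          (use 2 eventually_nhds_in_open[of "{..<0}" t] in \<open>auto simp: hs_def elim!: eventually_mono\<close>)
      then show ?thesis using 2 by (simp add: hs_def)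
    qed
  next
    case True
    \<comment> \<open>At 0 the difference quotient of \<open>hs j\<close> from the right is s p_j(s)
      exp(-s) with s = 1/t, which tends to 0; from the left it is constantly 0.\<close>
    have "((\<lambda>t. poly ([:0, 1:] * p j) (inverse t) * exp (- inverse t)) \<longlongrightarrow> 0) (at_right 0)"
      using filterlim_compose[OF poly_times_exp_tendsto_0 filterlim_inverse_at_top_right] .
    then have r: "((\<lambda>t. hs j t / t) \<longlongrightarrow> 0) (at_right 0)"
      by (rule Lim_transform_eventually)
        (auto simp: hs_def eventually_at_filter field_simps)
    have l: "((\<lambda>t. hs j t / t) \<longlongrightarrow> 0) (at_left 0)"
      by (rule tendsto_eventually) (auto simp: hs_def eventually_at_filter)
    have "((\<lambda>t. hs j t / t) \<longlongrightarrow> 0) (at 0)"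
      using l r filterlim_split_at by blast
    then show ?thesis using True
      by (simp add: hs_def has_field_derivative_iff)
  qed
  then show ?thesis
    by (rule smooth_compose[where hs = hs])
      (auto simp: hs_def p_def flat_exp_def assms intro!: ext)
qed

section \<open>Test functions: closure properties, supports and bounds\<close>

lemma test_functions_iff:
  "f \<in> test_functions \<longleftrightarrow> smooth f \<and> bounded {x. f x \<noteq> 0}"
  by (auto simp: test_functions_def smooth_def)

lemma test_functionsI:
  "smooth f \<Longrightarrow> (\<And>x. f x \<noteq> 0 \<Longrightarrow> x \<in> B) \<Longrightarrow> bounded B \<Longrightarrow> f \<in> test_functions"
  by (auto simp: test_functions_iff intro: bounded_subset)

lemma test_smooth: "f \<in> test_functions \<Longrightarrow> smooth f"
  by (simp add: test_functions_iff)

lemma test_linear: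
  "f \<in> test_functions \<Longrightarrow> g \<in> test_functions \<Longrightarrow> (\<lambda>x. a * f x + b * g x) \<in> test_functions"
  by (rule test_functionsI[where B = "{x. f x \<noteq> 0} \<union> {x. g x \<noteq> 0}"])
    (auto simp: test_functions_iff intro: smooth_add smooth_cmult)

lemma test_mult: "f \<in> test_functions \<Longrightarrow> smooth g \<Longrightarrow> (\<lambda>x. f x * g x) \<in> test_functions"
  by (rule test_functionsI[where B = "{x. f x \<noteq> 0}"])
    (auto simp: test_functions_iff intro: smooth_mult)

lemma test_support:
  assumes "f \<in> test_functions"
  obtains R where "R > 0" "\<And>x. norm x \<ge> R \<Longrightarrow> f x = 0" "\<And>x. norm x \<ge> R \<Longrightarrow> gradient f x = 0"
proof -
  obtain r where r: "\<And>x. f x \<noteq> 0 \<Longrightarrow> norm x \<le> r"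
    using assms by (auto simp: test_functions_iff bounded_iff)
  show ?thesis
  proof (rule that[of "\<bar>r\<bar> + 1"])
    fix x :: "real ^ 'a" assume x: "norm x \<ge> \<bar>r\<bar> + 1"
    show "f x = 0" using r[of x] x by force
    have "((\<lambda>_. 0) has_derivative (\<lambda>h. 0 \<bullet> h)) (at x)" by simp
    then have "(f has_derivative (\<lambda>h. 0 \<bullet> h)) (at x)"
    proof (rule has_derivative_transform_within_open)
      show "open {x :: real ^ 'a. norm x > r}" by (intro open_Collect_less continuous_intros)
    qed (use x r in force)+
    then show "gradient f x = 0" by (rule gradient_eqI)
  qed auto
qed

lemma test_bounded:
  assumes "f \<in> test_functions"
  obtains M where "\<And>x. \<bar>f x\<bar> \<le> M" "\<And>x. norm (gradient f x) \<le> M"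
proof -
  obtain R where R: "R > 0" "\<And>x. norm x \<ge> R \<Longrightarrow> f x = 0" "\<And>x. norm x \<ge> R \<Longrightarrow> gradient f x = 0"
    using test_support[OF assms] by metis
  have "compact (f ` cball 0 R)" "compact (gradient f ` cball 0 R)"
    using assms by (auto intro!: compact_continuous_image smooth_continuous continuous_gradient test_smooth)
  then obtain a b where "\<forall>x\<in>cball 0 R. \<bar>f x\<bar> \<le> a" "\<forall>x\<in>cball 0 R. norm (gradient f x) \<le> b"
    by (fastforce dest!: compact_imp_bounded simp: bounded_iff)
  then have a: "\<And>x. norm x \<le> R \<Longrightarrow> \<bar>f x\<bar> \<le> a" and b: "\<And>x. norm x \<le> R \<Longrightarrow> norm (gradient f x) \<le> b"
    by auto
  have "0 \<le> a" using a[of 0] R(1) by force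
  show ?thesis
  proof (rule that[of "max a b"])
    fix x show "\<bar>f x\<bar> \<le> max a b" "norm (gradient f x) \<le> max a b"
      using a[of x] b[of x] R(2,3)[of x] \<open>0 \<le> a\<close> by (cases "norm x \<le> R"; force)+
  qed
qed

text \<open>The parameter \<open>m\<close> is a sharpness: with m = 1 this is an ordinary cut-off,
  and as m grows the functions converge to the indicator of the open ball, since m (r^2 - |x - c|^2)
  tends to infinity exactly inside it.\<close>

definition bump :: "real ^ 'n::finite \<Rightarrow> real \<Rightarrow> real \<Rightarrow> real ^ 'n \<Rightarrow> real" where
  "bump c r m x = flat_exp (m * (r\<^sup>2 - (norm (x - c))\<^sup>2))"

lemma smooth_bump: "smooth (bump c r m)"
  unfolding bump_def[abs_def]
  by (intro smooth_flat_exp smooth_cmult smooth_diff smooth_norm_sq) auto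

lemma bump_nonneg: "0 \<le> bump c r m x" and bump_le_1: "bump c r m x \<le> 1"
  by (auto simp: bump_def flat_exp_nonneg flat_exp_le_1)

lemma bump_eq_0:
  assumes "0 \<le> r" "0 \<le> m" "x \<notin> ball c r" shows "bump c r m x = 0"
proof -
  have "r\<^sup>2 \<le> (norm (x - c))\<^sup>2"
    using assms by (intro power_mono) (auto simp: dist_norm norm_minus_commute)
  then have "m * (r\<^sup>2 - (norm (x - c))\<^sup>2) \<le> 0"
    using assms by (simp add: mult_nonneg_nonpos)
  then show ?thesis by (simp add: bump_def flat_exp_eq_0)
qed

lemma bump_test: "0 \<le> r \<Longrightarrow> 0 \<le> m \<Longrightarrow> bump c r m \<in> test_functions"
  by (rule test_functionsI[where B = "ball c r"]) (use bump_eq_0 smooth_bump in force)+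

lemma bump_tendsto:
  assumes "0 \<le> r"
  shows "(\<lambda>m. bump c r (real m) x) \<longlonglongrightarrow> indicator (ball c r) x"
proof (cases "x \<in> ball c r")
  case True
  then have "(norm (x - c))\<^sup>2 < r\<^sup>2"
    by (intro power_strict_mono) (auto simp: dist_norm norm_minus_commute)
  then have d: "r\<^sup>2 - (norm (x - c))\<^sup>2 > 0" by simp
  have "(\<lambda>m. exp (- (inverse (real m) * inverse (r\<^sup>2 - (norm (x - c))\<^sup>2)))) \<longlonglongrightarrow> exp (- (0 * inverse (r\<^sup>2 - (norm (x - c))\<^sup>2)))"
    by (intro tendsto_intros lim_inverse_n)
  then have "(\<lambda>m. bump c r (real m) x) \<longlonglongrightarrow> exp (- (0 * inverse (r\<^sup>2 - (norm (x - c))\<^sup>2)))"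
    by (rule Lim_transform_eventually)
      (use d in \<open>auto simp: bump_def flat_exp_def inverse_eq_divide eventually_sequentially intro!: exI[of _ 1]\<close>)
  then show ?thesis using True by simp
next
  case False
  then show ?thesis using assms by (simp add: bump_eq_0)
qed

section \<open>Integral inequalities for test functions\<close>

lemma integrable_bounded_support:
  fixes f :: "'a::euclidean_space \<Rightarrow> real"
  assumes "continuous_on UNIV f" "\<And>x. norm x \<ge> R \<Longrightarrow> f x = 0"
  shows "integrable lborel f"
proof -
  have "integrable lborel (\<lambda>x. indicator (cball 0 R) x *\<^sub>R f x)"
    by (rule borel_integrable_compact) (auto intro: continuous_on_subset[OF assms(1)])
  also have "(\<lambda>x. indicator (cball 0 R) x *\<^sub>R f x) = f"
    using assms(2) by (force simp: indicator_def)
  finally show ?thesis .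
qed

lemma powr_half_sq: "0 < a \<Longrightarrow> (a\<^sup>2) powr (b / 2) = a powr (b::real)"
  using powr_powr[of a 2 "b / 2"] by simp

text \<open>Translation invariance of the measure takes the place of Fubini and boundary terms:
  every difference quotient of \<open>F\<close> in direction \<open>e\<close> has integral 0, and
  the quotients converge to \<open>D\<close> under a common bound.\<close>

lemma integral_directional_derivative_zero:
  fixes F D :: "'a::euclidean_space \<Rightarrow> real"
  assumes F: "continuous_on UNIV F" and D: "continuous_on UNIV D"
    and deriv: "\<And>x. ((\<lambda>t. F (x + t *\<^sub>R e)) has_real_derivative D x) (at 0)"
    and R: "\<And>x. norm x \<ge> R \<Longrightarrow> F x = 0" "\<And>x. norm x \<ge> R \<Longrightarrow> D x = 0"
  shows "(LBINT x. D x) = 0"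
proof -
  have "compact (D ` cball 0 R)"
    by (rule compact_continuous_image[OF continuous_on_subset[OF D]]) auto
  then obtain M where "\<forall>x\<in>cball 0 R. \<bar>D x\<bar> \<le> M"
    by (auto dest!: compact_imp_bounded simp: bounded_iff)
  then have M: "\<bar>D x\<bar> \<le> max M 0" for x
    using R(2)[of x] by (cases "norm x \<le> R") (auto simp: le_max_iff_disj)
  have deriv': "((\<lambda>t. F (x + t *\<^sub>R e)) has_real_derivative D (x + s *\<^sub>R e)) (at s)" for x s
    using deriv[of "x + s *\<^sub>R e"] DERIV_shift[of "\<lambda>t. F (x + t *\<^sub>R e)" _ 0 s]
    by (simp add: algebra_simps)
  have lip: "\<bar>F (x + t *\<^sub>R e) - F x\<bar> \<le> t * max M 0" if "t > 0" for x t
  proof -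
    obtain s where "F (x + t *\<^sub>R e) - F (x + 0 *\<^sub>R e) = (t - 0) * D (x + s *\<^sub>R e)"
      using MVT2[OF \<open>t > 0\<close>, of "\<lambda>t. F (x + t *\<^sub>R e)" "\<lambda>s. D (x + s *\<^sub>R e)"] deriv' by blast
    then show ?thesis using M[of "x + s *\<^sub>R e"] that by (simp add: abs_mult mult_left_mono)
  qed
  define s where "s n = inverse (real (Suc n))" for n
  have s: "s n > 0" "s n \<le> 1" for n by (auto simp: s_def inverse_eq_divide)
  define f where "f n x = (F (x + s n *\<^sub>R e) - F x) / s n" for n x
  have int_F: "integrable lborel F" using integrable_bounded_support[OF F R(1)] .
  have [measurable]: "F \<in> borel_measurable borel" "D \<in> borel_measurable borel"
    using F D by (auto intro: borel_measurable_continuous_onI)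
  have "(LBINT x. f n x) = 0" for n
  proof -
    have d: "lborel = distr lborel borel (\<lambda>x. s n *\<^sub>R e + x)" by (simp add: lborel_distr_plus)
    have i: "integrable lborel (\<lambda>x. F (s n *\<^sub>R e + x))"
      using int_F by (subst (asm) d) (simp add: integrable_distr_eq)
    have "(LBINT x. F x) = (LBINT x. F (s n *\<^sub>R e + x))"
      by (subst d) (simp add: integral_distr)
    then show ?thesis using i int_F by (simp add: f_def add.commute)
  qed
  moreover have "(\<lambda>n. LBINT x. f n x) \<longlonglongrightarrow> (LBINT x. D x)"
  \<comment> \<open>The steps \<open>s n\<close> are at most 1, so all quotients vanish outside the
    radius R + |e|; the mean value theorem bounds them by the supremum of |D|.\<close>
  proof (rule integral_dominated_convergence[where
        w = "\<lambda>x. indicator (cball 0 (R + norm e)) x * max M 0"])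
    show "integrable lborel (\<lambda>x. indicator (cball 0 (R + norm e)) x * max M 0)"
      by (intro integrable_mult_left integrable_real_indicator) (auto intro: emeasure_bounded_finite[simplified])
    have "s \<longlonglongrightarrow> 0" unfolding s_def by (rule LIMSEQ_inverse_real_of_nat)
    then have "filterlim s (at 0) sequentially"
      using s by (auto simp: filterlim_at intro!: always_eventually less_imp_neq[symmetric])
    from filterlim_compose[OF _ this] deriv
    have "(\<lambda>n. (F (x + s n *\<^sub>R e) - F (x + 0 *\<^sub>R e)) / (s n - 0)) \<longlonglongrightarrow> D x" for x
      unfolding has_field_derivative_iff by blast
    then show "AE x in lborel. (\<lambda>n. f n x) \<longlonglongrightarrow> D x" by (simp add: f_def)
    have "norm (f n x) \<le> indicator (cball 0 (R + norm e)) x * max M 0" for n x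
    proof (cases "norm x \<le> R + norm e")
      case True
      then show ?thesis using lip[OF s(1), of x n] s(1)[of n]
        by (simp add: f_def divide_le_eq mult.commute)
    next
      case False
      have "norm (x + s n *\<^sub>R e) \<ge> norm x - norm (s n *\<^sub>R e)"
        using norm_diff_ineq[of x "s n *\<^sub>R e"] by simp
      moreover have "norm (s n *\<^sub>R e) \<le> norm e" using s[of n] by (simp add: mult_left_le_one_le)
      moreover have "norm e \<ge> 0" by simp
      ultimately have "norm (x + s n *\<^sub>R e) \<ge> R" "norm x \<ge> R" using False by linarith+
      then show ?thesis using R(1) False by (simp add: f_def)
    qed
    then show "AE x in lborel. norm (f n x) \<le> indicator (cball 0 (R + norm e)) x * max M 0" for n
      by simp
  qed (auto simp: f_def)
  ultimately show ?thesis by (simp add: LIMSEQ_const_iff)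
qed

section \<open>Hardy's inequality around an arbitrary centre\<close>

lemma smooth_line:
  assumes "smooth w"
  shows "((\<lambda>t. w (x + t *\<^sub>R v)) has_real_derivative gradient w (x + s *\<^sub>R v) \<bullet> v) (at s)"
proof -
  have "((\<lambda>t. x + t *\<^sub>R v) has_derivative (\<lambda>t. t *\<^sub>R v)) (at s)"
    by (auto intro!: derivative_eq_intros)
  from diff_chain_at[OF this smooth_has_derivative[OF assms]]
  moreover have "(\<lambda>t. t * (gradient w (x + s *\<^sub>R v) \<bullet> v)) = (*) (gradient w (x + s *\<^sub>R v) \<bullet> v)"
    by (simp add: fun_eq_iff)
  ultimately show ?thesis by (simp add: has_field_derivative_def o_def)
qed

lemma continuous_line:
  assumes "smooth w" shows "continuous_on A (\<lambda>t. gradient w (x + t *\<^sub>R v))"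
  by (rule continuous_on_compose2[OF continuous_gradient[OF assms]])
    (auto intro!: continuous_intros)

lemma smooth_measurable: "smooth w \<Longrightarrow> w \<in> borel_measurable borel"
  by (intro borel_measurable_continuous_onI smooth_continuous)

lemma gradient_measurable: "smooth w \<Longrightarrow> gradient w \<in> borel_measurable borel"
  by (intro borel_measurable_continuous_onI continuous_gradient)

text \<open>The vector field is $z(|z|^2+\varepsilon)^{(\alpha-2)/2}$ with $z = x - y$: its divergence is at
  least $(N+\alpha-2)(|z|^2+\varepsilon)^{(\alpha-2)/2}$, and its flux against $w^2$ vanishes.\<close>

lemma hardy_regularized:
  fixes w :: "real ^ 'n::finite \<Rightarrow> real"
  assumes w: "w \<in> test_functions" and \<alpha>: "0 < \<alpha>" "\<alpha> < 2" and N: "3 \<le> CARD('n)" and \<epsilon>: "\<epsilon> > 0"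
  shows "(\<integral>\<^sup>+x. ennreal (((norm (x - y))\<^sup>2 + \<epsilon>) powr ((\<alpha> - 2) / 2) * (w x)\<^sup>2) \<partial>lborel)
    \<le> 4 * (\<integral>\<^sup>+x. ennreal (norm (x - y) powr \<alpha> * (norm (gradient w x))\<^sup>2) \<partial>lborel)"
proof -
  obtain R where R: "R > 0" "\<And>x. norm x \<ge> R \<Longrightarrow> w x = 0" "\<And>x. norm x \<ge> R \<Longrightarrow> gradient w x = 0"
    using test_support[OF w] by metis
  note sw = test_smooth[OF w]
  define p where "p = (\<alpha> - 2) / 2"
  define \<rho> where "\<rho> x = (norm (x - y))\<^sup>2 + \<epsilon>" for x
  have \<rho>: "\<rho> x > 0" "\<rho> x \<ge> (norm (x - y))\<^sup>2" for x using \<epsilon> by (auto simp: \<rho>_def add_nonneg_pos)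
  \<comment> \<open>\<open>D i\<close> is the i-th partial derivative of w^2 z_i \<rho>^p with z = x
    - y, so the sum over i is the divergence of the vector field w^2 \<rho>^p z.\<close>
  define D where "D i x = 2 * w x * (gradient w x $ i) * (x - y) $ i * \<rho> x powr p
    + (w x)\<^sup>2 * (\<rho> x powr p + 2 * p * ((x - y) $ i)\<^sup>2 * \<rho> x powr (p - 1))" for i x
  have cont_\<rho>: "continuous_on UNIV (\<lambda>x. \<rho> x powr a)" for a
    unfolding \<rho>_def using \<epsilon>
    by (intro continuous_intros) (auto simp: add_nonneg_eq_0_iff)
  have cont: "continuous_on UNIV w" "continuous_on UNIV (gradient w)"
    using sw smooth_continuous continuous_gradient by blast+
  have contD: "continuous_on UNIV (D i)" for i
    unfolding D_def[abs_def] by (intro continuous_intros cont cont_\<rho>)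
  have "(LBINT x. D i x) = 0" for i
  proof (rule integral_directional_derivative_zero[where e = "axis i 1" and R = R])
    show "continuous_on UNIV (\<lambda>x. (w x)\<^sup>2 * (x - y) $ i * \<rho> x powr p)"
      by (intro continuous_intros cont cont_\<rho>)
    fix x
    have d: "((\<lambda>t. w (x + t *\<^sub>R axis i 1)) has_real_derivative gradient w x $ i) (at 0)"
      using smooth_line[OF sw, of x "axis i 1" 0] by (simp add: inner_axis)
    have n: "(norm (x + t *\<^sub>R axis i 1 - y))\<^sup>2 = (norm (x - y))\<^sup>2 + 2 * t * (x - y) $ i + t\<^sup>2" for t
      using power2_norm_eq_inner[of "(x - y) + t *\<^sub>R axis i 1"] power2_norm_eq_inner[of "x - y"]
      by (simp add: inner_simps inner_axis inner_axis' power2_eq_square algebra_simps)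
    have "((\<lambda>t. (norm (x - y))\<^sup>2 + 2 * t * (x - y) $ i + t\<^sup>2 + \<epsilon>) has_real_derivative 2 * (x - y) $ i) (at 0)"
      by (auto intro!: derivative_eq_intros)
    then have "((\<lambda>t. \<rho> (x + t *\<^sub>R axis i 1)) has_real_derivative 2 * (x - y) $ i) (at 0)"
      by (simp add: \<rho>_def n)
    from has_real_derivative_powr[THEN DERIV_chain2, OF _ this, of p] \<rho>
    have d\<rho>: "((\<lambda>t. \<rho> (x + t *\<^sub>R axis i 1) powr p) has_real_derivative
        p * \<rho> x powr (p - 1) * (2 * (x - y) $ i)) (at 0)" by simp
    have dz: "((\<lambda>t. (x + t *\<^sub>R axis i 1 - y) $ i) has_real_derivative 1) (at 0)"
      by (auto intro!: derivative_eq_intros)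
    show "((\<lambda>t. (w (x + t *\<^sub>R axis i 1))\<^sup>2 * (x + t *\<^sub>R axis i 1 - y) $ i * \<rho> (x + t *\<^sub>R axis i 1) powr p)
       has_real_derivative D i x) (at 0)"
      by (rule DERIV_cong[OF DERIV_mult[OF DERIV_mult[OF DERIV_power[OF d, of 2] dz] d\<rho>]])
        (simp add: D_def power2_eq_square algebra_simps)
  qed (use R contD in \<open>auto simp: D_def\<close>)
  moreover have intD: "integrable lborel (D i)" for i
    by (rule integrable_bounded_support[OF contD, of R]) (use R in \<open>auto simp: D_def\<close>)
  ultimately have zero: "(LBINT x. \<Sum>i\<in>UNIV. D i x) = 0"
    by (simp add: Bochner_Integration.integral_sum)
  \<comment> \<open>Young's inequality spends half of the good term on the cross term 2 w (grad w .
    z) and pays with the factor 2 on the gradient; the remaining half is what produces the constant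
    4.\<close>
  have pw: "1/2 * (\<rho> x powr p * (w x)\<^sup>2) \<le>
    (\<Sum>i\<in>UNIV. D i x) + 2 * (norm (x - y) powr \<alpha> * (norm (gradient w x))\<^sup>2)" for x
  proof -
    let ?z = "x - y" and ?N = "real CARD('n)" and ?g = "gradient w x"
    define P where "P = \<rho> x powr p"
    define Q where "Q = P / \<rho> x"
    have P: "P \<ge> 0" by (simp add: P_def)
    have P1: "\<rho> x powr (p - 1) = Q"
      using \<rho>(1)[of x] by (simp add: P_def Q_def powr_diff)
    have sumD: "(\<Sum>i\<in>UNIV. D i x) = 2 * w x * (?g \<bullet> ?z) * P + (w x)\<^sup>2 * (?N * P + 2 * p * (norm ?z)\<^sup>2 * Q)"
    proof -
      have "(\<Sum>i\<in>UNIV. D i x) = (\<Sum>i\<in>UNIV. 2 * w x * P * (?g $ i * ?z $ i) + (w x)\<^sup>2 * P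
          + (w x)\<^sup>2 * 2 * p * Q * (?z $ i * ?z $ i))"
        by (rule sum.cong) (simp_all add: D_def P1 P_def[symmetric] power2_eq_square algebra_simps)
      also have "\<dots> = 2 * w x * P * (?g \<bullet> ?z) + ?N * ((w x)\<^sup>2 * P) + (w x)\<^sup>2 * 2 * p * Q * (norm ?z)\<^sup>2"
        by (simp add: sum.distrib sum_distrib_left[symmetric] inner_vec_def power2_norm_eq_inner)
      finally show ?thesis by (simp add: algebra_simps)
    qed
    have "(norm ?z)\<^sup>2 * Q \<le> P"
      using \<rho>[of x] P by (simp add: Q_def divide_le_eq mult_left_mono mult.commute)
    then have "2 * p * P \<le> 2 * p * ((norm ?z)\<^sup>2 * Q)"
      using \<alpha> by (intro mult_left_mono_neg) (auto simp: p_def)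
    then have "?N * P + 2 * p * P \<le> ?N * P + 2 * p * (norm ?z)\<^sup>2 * Q" by (simp add: mult.assoc)
    \<comment> \<open>The dimension enters here: N + 2p = N + \<alpha> - 2 \<ge> 1 because N \<ge> 3
      and \<alpha> > 0.\<close>
    moreover have "1 * P \<le> (?N + 2 * p) * P"
      using P N \<alpha> by (intro mult_right_mono) (auto simp: p_def field_simps)
    ultimately have 1: "(w x)\<^sup>2 * P \<le> (w x)\<^sup>2 * (?N * P + 2 * p * (norm ?z)\<^sup>2 * Q)"
      by (intro mult_left_mono) (auto simp: algebra_simps)
    have "\<bar>w x * (?g \<bullet> ?z)\<bar> \<le> \<bar>w x\<bar> * (norm ?g * norm ?z)"
      by (simp add: abs_mult Cauchy_Schwarz_ineq2 mult_left_mono)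
    moreover have "0 \<le> (\<bar>w x\<bar> / 2 - norm ?g * norm ?z)\<^sup>2" by simp
    ultimately have "- (2 * w x * (?g \<bullet> ?z)) \<le> (w x)\<^sup>2 / 2 + 2 * (norm ?g * norm ?z)\<^sup>2"
      unfolding power2_diff by (simp add: power_mult_distrib power_divide)
    then have "- (2 * w x * (?g \<bullet> ?z)) * P \<le> ((w x)\<^sup>2 / 2 + 2 * (norm ?g * norm ?z)\<^sup>2) * P"
      using P by (rule mult_right_mono)
    then have 2: "- (2 * w x * (?g \<bullet> ?z) * P) \<le> (w x)\<^sup>2 * P / 2 + 2 * (norm ?g)\<^sup>2 * ((norm ?z)\<^sup>2 * P)"
      by (simp add: power_mult_distrib algebra_simps)
    have "(norm ?z)\<^sup>2 * P \<le> norm ?z powr \<alpha>"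
    proof (cases "?z = 0")
      case False
      have "P \<le> ((norm ?z)\<^sup>2) powr p"
        unfolding P_def using \<rho>[of x] False \<alpha> by (intro powr_mono2') (auto simp: p_def)
      also have "\<dots> = norm ?z powr (\<alpha> - 2)"
        using False powr_half_sq[of "norm ?z" "\<alpha> - 2"] by (simp add: p_def)
      finally have "(norm ?z)\<^sup>2 * P \<le> (norm ?z)\<^sup>2 * norm ?z powr (\<alpha> - 2)"
        by (simp add: mult_left_mono)
      then show ?thesis using False by (simp add: powr_diff)
    qed simp
    then have "2 * (norm ?g)\<^sup>2 * ((norm ?z)\<^sup>2 * P) \<le> 2 * (norm ?g)\<^sup>2 * norm ?z powr \<alpha>"
      by (intro mult_left_mono) auto
    with 1 2 sumD show ?thesis by (simp add: P_def[symmetric] algebra_simps)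
  qed
  have i1: "integrable lborel (\<lambda>x. \<rho> x powr p * (w x)\<^sup>2)"
    by (rule integrable_bounded_support[of _ R])
      (use R in \<open>auto intro!: continuous_intros cont cont_\<rho>\<close>)
  have i2: "integrable lborel (\<lambda>x. norm (x - y) powr \<alpha> * (norm (gradient w x))\<^sup>2)"
    by (rule integrable_bounded_support[of _ R])
      (use R \<alpha> in \<open>auto intro!: continuous_intros continuous_on_powr' cont\<close>)
  have "(LBINT x. 1/2 * (\<rho> x powr p * (w x)\<^sup>2)) \<le> (LBINT x. (\<Sum>i\<in>UNIV. D i x) +
      2 * (norm (x - y) powr \<alpha> * (norm (gradient w x))\<^sup>2))"
    by (rule integral_mono[OF _ _ pw]) (use i1 i2 intD in auto)
  also have "\<dots> = (LBINT x. \<Sum>i\<in>UNIV. D i x) + (LBINT x. 2 * (norm (x - y) powr \<alpha> * (norm (gradient w x))\<^sup>2))"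
    by (rule Bochner_Integration.integral_add) (use i2 intD in auto)
  finally have "(LBINT x. \<rho> x powr p * (w x)\<^sup>2) \<le> 4 * (LBINT x. norm (x - y) powr \<alpha> * (norm (gradient w x))\<^sup>2)"
    using zero by simp
  then have "ennreal (LBINT x. \<rho> x powr p * (w x)\<^sup>2)
      \<le> ennreal (4 * (LBINT x. norm (x - y) powr \<alpha> * (norm (gradient w x))\<^sup>2))" by (rule ennreal_leI)
  also have "\<dots> = 4 * ennreal (LBINT x. norm (x - y) powr \<alpha> * (norm (gradient w x))\<^sup>2)"
    by (simp add: ennreal_mult')
  finally show ?thesis
    using i1 i2 by (simp add: nn_integral_eq_integral \<rho>_def p_def)
qed

text \<open>The regularised weights increase to the singular one as \<epsilon> tends to 0 and the
  right-hand side does not depend on \<epsilon>, so Fatou's lemma suffices.\<close>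

lemma hardy:
  fixes w :: "real ^ 'n::finite \<Rightarrow> real"
  assumes w: "w \<in> test_functions" and \<alpha>: "0 < \<alpha>" "\<alpha> < 2" and N: "3 \<le> CARD('n)"
  shows "(\<integral>\<^sup>+x. ennreal (norm (x - y) powr (\<alpha> - 2) * (w x)\<^sup>2) \<partial>lborel)
    \<le> 4 * (\<integral>\<^sup>+x. ennreal (norm (x - y) powr \<alpha> * (norm (gradient w x))\<^sup>2) \<partial>lborel)" (is "_ \<le> ?B")
proof -
  let ?f = "\<lambda>n x. ennreal (((norm (x - y))\<^sup>2 + inverse (real (Suc n))) powr ((\<alpha> - 2) / 2) * (w x)\<^sup>2)"
  have [measurable]: "w \<in> borel_measurable borel" using smooth_measurable test_smooth w by blast
  have "ennreal (norm (x - y) powr (\<alpha> - 2) * (w x)\<^sup>2) \<le> liminf (\<lambda>n. ?f n x)" for x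
  \<comment> \<open>At x = y the left-hand side is 0, since \<open>0 powr a = 0\<close> by
    convention.\<close>
  proof (cases "x = y")
    case False
    have "(\<lambda>n. ?f n x) \<longlonglongrightarrow> ennreal (((norm (x - y))\<^sup>2 + 0) powr ((\<alpha> - 2) / 2) * (w x)\<^sup>2)"
      using False by (intro tendsto_intros LIMSEQ_inverse_real_of_nat) auto
    then show ?thesis using False powr_half_sq[of "norm (x - y)" "\<alpha> - 2"]
      by (simp add: tendsto_iff_Liminf_eq_Limsup)
  qed simp
  then have "(\<integral>\<^sup>+x. ennreal (norm (x - y) powr (\<alpha> - 2) * (w x)\<^sup>2) \<partial>lborel)
      \<le> (\<integral>\<^sup>+x. liminf (\<lambda>n. ?f n x) \<partial>lborel)" by (intro nn_integral_mono)
  also have "\<dots> \<le> liminf (\<lambda>n. \<integral>\<^sup>+x. ?f n x \<partial>lborel)" by (rule nn_integral_liminf) measurable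
  also have "\<dots> \<le> ?B"
    by (rule Liminf_le) (auto intro!: always_eventually hardy_regularized w \<alpha> N)
  finally show ?thesis .
qed

section \<open>Increments along segments and translations\<close>

lemma increment_le:
  fixes w :: "real ^ 'n::finite \<Rightarrow> real"
  assumes w: "smooth w" and T: "0 \<le> T"
  shows "ennreal \<bar>w (x + T *\<^sub>R v) - w x\<bar>
    \<le> (\<integral>\<^sup>+t. ennreal (norm (gradient w (x + t *\<^sub>R v)) * norm v) * indicator {0..T} t \<partial>lborel)"
proof -
  have c: "continuous_on A (\<lambda>t. gradient w (x + t *\<^sub>R v) \<bullet> v)" for A :: "real set"
    by (intro continuous_intros continuous_line w)
  have "(LBINT t. (gradient w (x + t *\<^sub>R v) \<bullet> v) * indicator {0..T} t) = w (x + T *\<^sub>R v) - w (x + 0 *\<^sub>R v)"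
    by (rule integral_FTC_Icc_real[OF T smooth_line[OF w]])
      (use c[of UNIV] in \<open>simp add: continuous_on_eq_continuous_at\<close>)
  moreover have "integrable lborel (\<lambda>t. (gradient w (x + t *\<^sub>R v) \<bullet> v) * indicator {0..T} t)"
    using borel_integrable_compact[OF _ c, of "{0..T}"] by (simp add: mult.commute)
  ultimately have "ennreal \<bar>w (x + T *\<^sub>R v) - w x\<bar>
      \<le> (\<integral>\<^sup>+t. norm ((gradient w (x + t *\<^sub>R v) \<bullet> v) * indicator {0..T} t) \<partial>lborel)"
    using integral_norm_bound_ennreal[of lborel "\<lambda>t. (gradient w (x + t *\<^sub>R v) \<bullet> v) * indicator {0..T} t"]
    by simp
  also have "\<dots> \<le> (\<integral>\<^sup>+t. ennreal (norm (gradient w (x + t *\<^sub>R v)) * norm v) * indicator {0..T} t \<partial>lborel)"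
    by (intro nn_integral_mono) (auto split: split_indicator intro!: ennreal_leI Cauchy_Schwarz_ineq2)
  finally show ?thesis .
qed

lemma nn_integral_lborel_shift:
  fixes f :: "'a::euclidean_space \<Rightarrow> ennreal"
  assumes [measurable]: "f \<in> borel_measurable borel"
  shows "(\<integral>\<^sup>+x. f (c + x) \<partial>lborel) = (\<integral>\<^sup>+x. f x \<partial>lborel)"
proof -
  have "(\<integral>\<^sup>+x. f x \<partial>lborel) = (\<integral>\<^sup>+x. f x \<partial>distr lborel borel ((+) c))" by (simp add: lborel_distr_plus)
  then show ?thesis by (simp add: nn_integral_distr)
qed

text \<open>Cauchy-Schwarz along the segment from x to x + z, then Tonelli and translation
  invariance. This is the source of all compactness below: a function with square-integrable
  gradient is close to its averages over small balls.\<close>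

lemma translation_estimate:
  fixes w :: "real ^ 'n::finite \<Rightarrow> real"
  assumes w: "smooth w"
  shows "(\<integral>\<^sup>+x. ennreal ((w (x + z) - w x)\<^sup>2) \<partial>lborel)
    \<le> ennreal ((norm z)\<^sup>2) * (\<integral>\<^sup>+x. ennreal ((norm (gradient w x))\<^sup>2) \<partial>lborel)"
proof -
  let ?g = "\<lambda>x t. ennreal ((norm (gradient w (t *\<^sub>R z + x)))\<^sup>2)"
  have [measurable]: "w \<in> borel_measurable borel" "gradient w \<in> borel_measurable borel"
    using w smooth_measurable gradient_measurable by auto
  have "ennreal ((w (x + z) - w x)\<^sup>2) \<le> (\<integral>\<^sup>+t. ennreal ((norm z)\<^sup>2) * ?g x t * indicator {0..1} t \<partial>lborel)" for x
  proof -
    have "ennreal ((w (x + z) - w x)\<^sup>2) = (ennreal \<bar>w (x + 1 *\<^sub>R z) - w x\<bar>)\<^sup>2"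
      by (subst ennreal_power) auto
    also have "\<dots> \<le> (\<integral>\<^sup>+t. ennreal (norm (gradient w (x + t *\<^sub>R z)) * norm z) * indicator {0..1} t \<partial>lborel)\<^sup>2"
      by (intro power_mono increment_le w) auto
    also have "\<dots> = (\<integral>\<^sup>+t. (ennreal (norm (gradient w (x + t *\<^sub>R z)) * norm z) * indicator {0..1} t) * indicator {0..1} t \<partial>lborel)\<^sup>2"
      by (intro arg_cong[where f = "\<lambda>x. x\<^sup>2"] nn_integral_cong) (auto split: split_indicator)
    also have "\<dots> \<le> (\<integral>\<^sup>+t. (ennreal (norm (gradient w (x + t *\<^sub>R z)) * norm z) * indicator {0..1} t)\<^sup>2 \<partial>lborel)
        * (\<integral>\<^sup>+t. (indicator {0..1::real} t)\<^sup>2 \<partial>lborel)"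
      by (rule Cauchy_Schwarz_nn_integral) measurable
    also have "(\<integral>\<^sup>+t. (indicator {0..1::real} t)\<^sup>2 \<partial>lborel) = (\<integral>\<^sup>+t. indicator {0..1::real} t \<partial>lborel)"
      by (intro nn_integral_cong) (auto split: split_indicator)
    also have "\<dots> = 1" by simp
    also have "(\<integral>\<^sup>+t. (ennreal (norm (gradient w (x + t *\<^sub>R z)) * norm z) * indicator {0..1} t)\<^sup>2 \<partial>lborel)
       = (\<integral>\<^sup>+t. ennreal ((norm z)\<^sup>2) * ?g x t * indicator {0..1} t \<partial>lborel)"
      by (intro nn_integral_cong)
        (auto split: split_indicator simp: ennreal_power power_mult_distrib add.commute mult.commute simp flip: ennreal_mult)
    finally show ?thesis by simp
  qed
  then have "(\<integral>\<^sup>+x. ennreal ((w (x + z) - w x)\<^sup>2) \<partial>lborel)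
      \<le> (\<integral>\<^sup>+x. \<integral>\<^sup>+t. ennreal ((norm z)\<^sup>2) * ?g x t * indicator {0..1} t \<partial>lborel \<partial>lborel)"
    by (intro nn_integral_mono)
  also have "\<dots> = (\<integral>\<^sup>+t. \<integral>\<^sup>+x. ennreal ((norm z)\<^sup>2) * ?g x t * indicator {0..1} t \<partial>lborel \<partial>lborel)"
    by (rule lborel_pair.Fubini'[symmetric]) measurable
  also have "\<dots> = (\<integral>\<^sup>+t. ennreal ((norm z)\<^sup>2) * (\<integral>\<^sup>+x. ?g x t \<partial>lborel) * indicator {0..1} t \<partial>lborel)"
    by (simp add: nn_integral_cmult nn_integral_multc)
  also have "\<dots> = (\<integral>\<^sup>+t. ennreal ((norm z)\<^sup>2) * (\<integral>\<^sup>+x. ennreal ((norm (gradient w x))\<^sup>2) \<partial>lborel) * indicator {0..1} (t::real) \<partial>lborel)"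
    by (intro nn_integral_cong, subst nn_integral_lborel_shift[of "\<lambda>x. ennreal ((norm (gradient w x))\<^sup>2)"]) auto
  finally show ?thesis by (simp add: nn_integral_cmult_indicator)
qed

section \<open>The weighted Sobolev inequality\<close>

text \<open>The integral over the ball B(y, t|y|), divided by (t|y|)^N but not by the volume of the
  unit ball. The radius is proportional to |y|, so for t \<le> 1/2 the ball keeps away from the
  origin and every power of |x| is comparable on it to the same power of |y|.\<close>

definition ball_mean :: "real \<Rightarrow> (real ^ 'n::finite \<Rightarrow> ennreal) \<Rightarrow> real ^ 'n \<Rightarrow> ennreal" where
  "ball_mean t F y = (\<integral>\<^sup>+z. F (y + (t * norm y) *\<^sub>R z) * indicator (ball 0 1) z \<partial>lborel)"

lemma ball_borel [measurable]: "ball c r \<in> sets (borel :: 'a::metric_space measure)"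
  by (intro borel_open open_ball)

lemma ball_mean_measurable [measurable]:
  assumes [measurable]: "F \<in> borel_measurable borel" and "t \<in> borel_measurable M" "y \<in> borel_measurable M"
  shows "(\<lambda>x. ball_mean (t x) F (y x)) \<in> borel_measurable M"
proof -
  have "(\<lambda>(t, y). ball_mean t F y) \<in> borel_measurable (borel \<Otimes>\<^sub>M borel)"
    unfolding ball_mean_def by measurable
  from measurable_compose[OF measurable_Pair[OF assms(2,3)] this] show ?thesis by simp
qed

lemma ball_mean_eq:
  fixes F :: "real ^ 'n::finite \<Rightarrow> ennreal"
  assumes [measurable]: "F \<in> borel_measurable borel" and y: "y \<noteq> 0" and t: "t > 0"
  shows "ball_mean t F y = ennreal ((t * norm y) powr (- real CARD('n))) *
    (\<integral>\<^sup>+x. F x * indicator (ball y (t * norm y)) x \<partial>lborel)"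
proof -
  let ?r = "t * norm y" and ?N = "CARD('n)"
  have r: "?r > 0" using y t by simp
  have "(\<integral>\<^sup>+x. F x * indicator (ball y ?r) x \<partial>lborel) =
    (\<integral>\<^sup>+x. F x * indicator (ball y ?r) x \<partial>density (distr lborel borel (\<lambda>x. y + ?r *\<^sub>R x)) (\<lambda>_. \<bar>?r\<bar>^?N))"
    by (subst lborel_affine[of ?r y]) (use r in auto)
  also have "\<dots> = (\<integral>\<^sup>+x. ennreal (?r ^ ?N) * (F (y + ?r *\<^sub>R x) * indicator (ball y ?r) (y + ?r *\<^sub>R x)) \<partial>lborel)"
    using r by (simp add: nn_integral_density nn_integral_distr ennreal_power)
  also have "\<dots> = (\<integral>\<^sup>+x. ennreal (?r ^ ?N) * (F (y + ?r *\<^sub>R x) * indicator (ball 0 1) x) \<partial>lborel)"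
    using r y t by (intro nn_integral_cong) (auto simp: dist_norm indicator_def abs_mult mult_less_cancel_left1)
  also have "\<dots> = ennreal (?r ^ ?N) * ball_mean t F y"
    unfolding ball_mean_def by (rule nn_integral_cmult) measurable
  finally have e: "(\<integral>\<^sup>+x. F x * indicator (ball y ?r) x \<partial>lborel) = ennreal (?r ^ ?N) * ball_mean t F y" .
  have "?r powr (- real ?N) * ?r ^ ?N = 1"
    using zero_less_power[OF r, of ?N] unfolding powr_minus powr_realpow[OF r] by (metis left_inverse less_irrefl)
  then have "ennreal (?r powr (- real ?N)) * (ennreal (?r ^ ?N) * ball_mean t F y) = ball_mean t F y"
    using r by (simp flip: mult.assoc ennreal_mult')
  with e show ?thesis by simp
qed

lemma ball_scaled_norm:
  fixes x y :: "'a::real_normed_vector"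
  assumes "t \<le> 1/2" "x \<in> ball y (t * norm y)"
  shows "norm x \<le> 2 * norm y" "norm y \<le> 2 * norm x"
proof -
  have "norm (x - y) \<le> 1/2 * norm y"
    using assms mult_right_mono[of t "1/2" "norm y"] by (simp add: dist_norm norm_minus_commute)
  then show "norm x \<le> 2 * norm y" "norm y \<le> 2 * norm x"
    using norm_triangle_ineq2[of x y] norm_triangle_ineq3[of x y] by auto
qed

text \<open>On the ball |x| \<le> 2|y|, hence |x|^(2-\<alpha>) \<le> 4 |y|^(2-\<alpha>), and the
  weighted integral bounds the plain one. This is the crude pointwise bound used for all but one
  factor in the interpolation below.\<close>

lemma ball_mean_le:
  fixes F :: "real ^ 'n::finite \<Rightarrow> ennreal"
  assumes F [measurable]: "F \<in> borel_measurable borel" and y: "y \<noteq> 0" and t: "0 < t" "t \<le> 1/2"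
    and \<alpha>: "0 < \<alpha>" "\<alpha> < 2"
    and H: "(\<integral>\<^sup>+x. ennreal (norm x powr (\<alpha> - 2)) * F x \<partial>lborel) \<le> ennreal H"
  shows "ball_mean t F y \<le> ennreal (4 * t powr (- real CARD('n)) * norm y powr (2 - \<alpha> - real CARD('n)) * H)"
proof -
  let ?N = "real CARD('n)"
  have "F x * indicator (ball y (t * norm y)) x \<le> ennreal (4 * norm y powr (2 - \<alpha>)) * (ennreal (norm x powr (\<alpha> - 2)) * F x)" for x
  proof (cases "x \<in> ball y (t * norm y)")
    case True
    note xy = ball_scaled_norm[OF t(2) True]
    have nx: "norm x > 0" using xy(2) y by (auto simp: zero_less_norm_iff)
    have "1 = norm x powr (2 - \<alpha>) * norm x powr (\<alpha> - 2)"
      using nx by (simp flip: powr_add)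
    also have "norm x powr (2 - \<alpha>) \<le> (2 * norm y) powr (2 - \<alpha>)"
      using xy \<alpha> by (intro powr_mono2) auto
    also have "\<dots> = 2 powr (2 - \<alpha>) * norm y powr (2 - \<alpha>)" by (simp add: powr_mult)
    also have "2 powr (2 - \<alpha>) \<le> (2::real) powr 2" using \<alpha> by (intro powr_mono) auto
    finally have "1 \<le> 4 * norm y powr (2 - \<alpha>) * norm x powr (\<alpha> - 2)"
      by (simp add: mult_right_mono)
    then have "ennreal 1 \<le> ennreal (4 * norm y powr (2 - \<alpha>) * norm x powr (\<alpha> - 2))" by (rule ennreal_leI)
    then have "ennreal 1 * F x \<le> ennreal (4 * norm y powr (2 - \<alpha>) * norm x powr (\<alpha> - 2)) * F x"
      by (rule mult_right_mono) simp
    then show ?thesis using True by (simp add: ennreal_mult' mult.assoc)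
  qed simp
  then have "(\<integral>\<^sup>+x. F x * indicator (ball y (t * norm y)) x \<partial>lborel) \<le>
      (\<integral>\<^sup>+x. ennreal (4 * norm y powr (2 - \<alpha>)) * (ennreal (norm x powr (\<alpha> - 2)) * F x) \<partial>lborel)"
    by (intro nn_integral_mono)
  also have "\<dots> = ennreal (4 * norm y powr (2 - \<alpha>)) * (\<integral>\<^sup>+x. ennreal (norm x powr (\<alpha> - 2)) * F x \<partial>lborel)"
    by (rule nn_integral_cmult) measurable
  also have "\<dots> \<le> ennreal (4 * norm y powr (2 - \<alpha>)) * ennreal H" using H by (rule mult_left_mono) simp
  also have "\<dots> = ennreal (4 * norm y powr (2 - \<alpha>) * H)" by (simp add: ennreal_mult')
  finally have "ball_mean t F y \<le> ennreal ((t * norm y) powr (- ?N)) * ennreal (4 * norm y powr (2 - \<alpha>) * H)"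
    unfolding ball_mean_eq[OF F y t(1)] by (rule mult_left_mono) simp
  also have "\<dots> = ennreal ((t * norm y) powr (- ?N) * (4 * norm y powr (2 - \<alpha>) * H))"
    by (simp add: ennreal_mult')
  also have "(t * norm y) powr (- ?N) * (4 * norm y powr (2 - \<alpha>) * H) =
      4 * t powr (- ?N) * (norm y powr (- ?N) * norm y powr (2 - \<alpha>)) * H"
    using t by (simp add: powr_mult)
  also have "norm y powr (- ?N) * norm y powr (2 - \<alpha>) = norm y powr (2 - \<alpha> - ?N)"
    by (simp flip: powr_add)
  finally show ?thesis .
qed

lemma AE_lborel_nonzero: "AE x in lborel. x \<noteq> (0::'a::euclidean_space)"
  by (rule AE_I'[of "{0}"]) auto

text \<open>Averaging does not spoil the weighted integral, uniformly in t. By Tonelli it suffices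
  to integrate the kernel in y: the centres y whose ball contains x lie in B(x, 2t|x|), where |y| is
  comparable to |x|, and the volume t^N cancels the normalisation t^(-N).\<close>

lemma ball_mean_weighted:
  fixes F :: "real ^ 'n::finite \<Rightarrow> ennreal"
  assumes F [measurable]: "F \<in> borel_measurable borel" and t: "0 < t" "t \<le> 1/2"
    and \<alpha>: "0 < \<alpha>" "\<alpha> < 2" and N: "3 \<le> CARD('n)"
    and H: "(\<integral>\<^sup>+x. ennreal (norm x powr (\<alpha> - 2)) * F x \<partial>lborel) \<le> ennreal H"
  shows "(\<integral>\<^sup>+y. ennreal (norm y powr (\<alpha> - 2)) * ball_mean t F y \<partial>lborel)
     \<le> ennreal (unit_ball_vol (real CARD('n)) * 4 ^ (CARD('n) + 1) * H)"
proof -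
  let ?N = "real CARD('n)" and ?\<omega> = "unit_ball_vol (real CARD('n))"
  \<comment> \<open>The ball condition is written as an indicator of pairs, so that the kernel is
    jointly measurable and the order of integration may be exchanged.\<close>
  define K where "K = (\<lambda>(x::real^'n) (y::real^'n). ennreal (norm y powr (\<alpha> - 2) * (t * norm y) powr (- ?N))
      * indicator {p. dist (fst p) (snd p) < t * norm (snd p)} (x, y))"
  have [measurable]: "{p::(real^'n)\<times>(real^'n). dist (fst p) (snd p) < t * norm (snd p)} \<in> sets (borel \<Otimes>\<^sub>M borel)"
    unfolding borel_prod by (intro borel_open open_Collect_less continuous_intros)
  have [measurable]: "(\<lambda>p. K (fst p) (snd p)) \<in> borel_measurable (borel \<Otimes>\<^sub>M borel)"
    unfolding K_def by simp
  have [measurable]: "(\<lambda>x. K (f x) (h x)) \<in> borel_measurable M"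
    if "f \<in> borel_measurable M" "h \<in> borel_measurable M" for f h :: "_ \<Rightarrow> real^'n" and M
    using measurable_compose[OF measurable_Pair[OF that] \<open>(\<lambda>p. K (fst p) (snd p)) \<in> borel_measurable (borel \<Otimes>\<^sub>M borel)\<close>]
    by simp
  have "(\<integral>\<^sup>+y. ennreal (norm y powr (\<alpha> - 2)) * ball_mean t F y \<partial>lborel) =
      (\<integral>\<^sup>+y. \<integral>\<^sup>+x. F x * K x y \<partial>lborel \<partial>lborel)"
  proof (rule nn_integral_cong_AE, rule AE_mp[OF AE_lborel_nonzero], rule AE_I2, rule impI)
    fix y :: "real ^ 'n" assume "y \<noteq> 0"
    then have "ennreal (norm y powr (\<alpha> - 2)) * ball_mean t F y =
      ennreal (norm y powr (\<alpha> - 2) * (t * norm y) powr (- ?N)) * (\<integral>\<^sup>+x. F x * indicator (ball y (t * norm y)) x \<partial>lborel)"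
      by (simp add: ball_mean_eq[OF F _ t(1)] ennreal_mult' mult.assoc)
    also have "\<dots> = (\<integral>\<^sup>+x. ennreal (norm y powr (\<alpha> - 2) * (t * norm y) powr (- ?N)) * (F x * indicator (ball y (t * norm y)) x) \<partial>lborel)"
      by (rule nn_integral_cmult[symmetric]) measurable
    also have "\<dots> = (\<integral>\<^sup>+x. F x * K x y \<partial>lborel)"
      by (intro nn_integral_cong) (auto simp: K_def indicator_def dist_commute mult.commute)
    finally show "ennreal (norm y powr (\<alpha> - 2)) * ball_mean t F y = (\<integral>\<^sup>+x. F x * K x y \<partial>lborel)" .
  qed
  also have "\<dots> = (\<integral>\<^sup>+x. \<integral>\<^sup>+y. F x * K x y \<partial>lborel \<partial>lborel)"
    by (rule lborel_pair.Fubini') measurable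
  also have "\<dots> = (\<integral>\<^sup>+x. F x * (\<integral>\<^sup>+y. K x y \<partial>lborel) \<partial>lborel)"
    by (intro nn_integral_cong nn_integral_cmult) measurable
  also have "\<dots> \<le> (\<integral>\<^sup>+x. F x * (ennreal (?\<omega> * 4 ^ (CARD('n) + 1)) * ennreal (norm x powr (\<alpha> - 2))) \<partial>lborel)"
  proof (rule nn_integral_mono_AE, rule AE_mp[OF AE_lborel_nonzero], rule AE_I2, rule impI, rule mult_left_mono)
    fix x :: "real ^ 'n" assume x: "x \<noteq> 0"
    let ?C = "t powr (- ?N) * (norm x / 2) powr (\<alpha> - 2 - ?N)"
    have "K x y \<le> ennreal ?C * indicator (ball x (2 * t * norm x)) y" for y
    proof (cases "dist x y < t * norm y")
      case True
      then have xb: "x \<in> ball y (t * norm y)" by (simp add: dist_commute)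
      note xy = ball_scaled_norm[OF t(2) xb]
      have "t * norm y \<le> t * (2 * norm x)" using xy t by (intro mult_left_mono) auto
      then have "y \<in> ball x (2 * t * norm x)" using True by simp
      moreover have "norm y powr (\<alpha> - 2) * (t * norm y) powr (- ?N) \<le> ?C"
      proof -
        have "norm y powr (\<alpha> - 2) * (t * norm y) powr (- ?N) = t powr (- ?N) * norm y powr (\<alpha> - 2 - ?N)"
          using t by (simp add: powr_mult flip: powr_add)
        also have "\<dots> \<le> ?C"
          using xy x \<alpha> by (intro mult_left_mono powr_mono2') auto
        finally show ?thesis .
      qed
      ultimately show ?thesis using True by (simp add: K_def ennreal_leI)
    qed (simp add: K_def)
    then have "(\<integral>\<^sup>+y. K x y \<partial>lborel) \<le> (\<integral>\<^sup>+y. ennreal ?C * indicator (ball x (2 * t * norm x)) y \<partial>lborel)"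
      by (intro nn_integral_mono)
    also have "\<dots> = ennreal ?C * ennreal (?\<omega> * (2 * t * norm x) ^ CARD('n))"
      using t by (simp add: nn_integral_cmult emeasure_ball)
    also have "\<dots> = ennreal (?C * (?\<omega> * (2 * t * norm x) ^ CARD('n)))"
      by (simp add: ennreal_mult')
    \<comment> \<open>One factor 2^N comes from the radius 2t|x|; the other 2^(N+2-\<alpha>) is lost
      in |y| \<ge> |x|/2. Below, 2^(2-\<alpha>) \<le> 4 gives 4^(N+1).\<close>
    also have "?C * (?\<omega> * (2 * t * norm x) ^ CARD('n)) = ?\<omega> * 4 ^ CARD('n) * 2 powr (2 - \<alpha>) * norm x powr (\<alpha> - 2)"
    proof -
      have a: "(2 * t * norm x) ^ CARD('n) = 2 powr ?N * t powr ?N * norm x powr ?N"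
        using t x by (simp add: power_mult_distrib powr_realpow)
      have b: "(norm x / 2) powr (\<alpha> - 2 - ?N) = norm x powr (\<alpha> - 2 - ?N) * 2 powr (2 - \<alpha> + ?N)"
        using x by (simp add: powr_divide) (simp add: divide_inverse algebra_simps flip: powr_minus)
      have c: "t powr (- ?N) * t powr ?N = 1" using t by (simp flip: powr_add)
      have d: "norm x powr (\<alpha> - 2 - ?N) * norm x powr ?N = norm x powr (\<alpha> - 2)" by (simp flip: powr_add)
      have e: "2 powr (2 - \<alpha> + ?N) * 2 powr ?N = 4 ^ CARD('n) * 2 powr (2 - \<alpha>)"
      proof -
        have "2 powr (2 - \<alpha> + ?N) * 2 powr ?N = 2 powr (2 - \<alpha>) * (2 powr ?N * 2 powr ?N)"
          by (simp add: powr_add)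
        also have "2 powr ?N * 2 powr ?N = (2 * 2 :: real) ^ CARD('n)"
          by (simp only: powr_realpow zero_less_numeral power_mult_distrib)
        finally show ?thesis by simp
      qed
      have "?C * (?\<omega> * (2 * t * norm x) ^ CARD('n)) = ?\<omega> * (t powr (- ?N) * t powr ?N) *
         (norm x powr (\<alpha> - 2 - ?N) * norm x powr ?N) * (2 powr (2 - \<alpha> + ?N) * 2 powr ?N)"
        unfolding a b by (simp add: mult_ac)
      then show ?thesis unfolding c d e by (simp add: mult_ac)
    qed
    also have "\<dots> \<le> ?\<omega> * 4 ^ (CARD('n) + 1) * norm x powr (\<alpha> - 2)"
    proof -
      have "2 powr (2 - \<alpha>) \<le> (2::real) powr 2" using \<alpha> by (intro powr_mono) auto
      then have "?\<omega> * 4 ^ CARD('n) * 2 powr (2 - \<alpha>) * norm x powr (\<alpha> - 2) \<le> ?\<omega> * 4 ^ CARD('n) * 4 * norm x powr (\<alpha> - 2)"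
        by (intro mult_right_mono mult_left_mono) auto
      then show ?thesis by simp
    qed
    finally show "(\<integral>\<^sup>+y. K x y \<partial>lborel) \<le> ennreal (?\<omega> * 4 ^ (CARD('n) + 1)) * ennreal (norm x powr (\<alpha> - 2))"
      by (simp add: ennreal_mult' ennreal_leI)
  qed simp
  also have "\<dots> = (\<integral>\<^sup>+x. ennreal (?\<omega> * 4 ^ (CARD('n) + 1)) * (ennreal (norm x powr (\<alpha> - 2)) * F x) \<partial>lborel)"
    by (intro nn_integral_cong) (simp add: mult_ac)
  also have "\<dots> = ennreal (?\<omega> * 4 ^ (CARD('n) + 1)) * (\<integral>\<^sup>+x. ennreal (norm x powr (\<alpha> - 2)) * F x \<partial>lborel)"
    by (rule nn_integral_cmult) measurable
  also have "\<dots> \<le> ennreal (?\<omega> * 4 ^ (CARD('n) + 1)) * ennreal H" using H by (rule mult_left_mono) simp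
  finally show ?thesis by (simp add: ennreal_mult')
qed

text \<open>If h exceeds the threshold d, then h = h^(1-q) h^q \<le> d^(1-q) (h^2)^(q/2), where one
  factor h^2 is kept as \<omega>S and the remaining power is estimated by the crude bound s. The
  result is linear in S, so it can be integrated afterwards.\<close>

lemma interpolate_le:
  fixes h S :: ennreal
  assumes hS: "h\<^sup>2 \<le> ennreal \<omega> * S" and S: "S \<le> ennreal s" and "0 \<le> \<omega>" "0 \<le> s" and d: "0 < d" and q: "2 < q"
  shows "h \<le> ennreal d + ennreal (d powr (1 - q) * (\<omega> * s) powr (q / 2 - 1) * \<omega>) * S"
proof -
  obtain S' where S': "S = ennreal S'" "0 \<le> S'" "S' \<le> s"
    using S assms(4) by (metis ennreal_cases ennreal_le_iff ennreal_less_top less_le_trans not_less top_greatest top.not_eq_extremum)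
  have "h\<^sup>2 \<le> ennreal (\<omega> * S')" using hS S' assms(3) by (simp add: ennreal_mult')
  then have "h \<noteq> top" by (auto simp: power2_eq_square top_unique ennreal_mult_eq_top_iff)
  then obtain h' where h': "h = ennreal h'" "0 \<le> h'" by (cases h) auto
  have le: "h'\<^sup>2 \<le> \<omega> * S'"
    using \<open>h\<^sup>2 \<le> ennreal (\<omega> * S')\<close> h' S' assms(3) by (simp add: ennreal_power)
  have "h' \<le> d + d powr (1 - q) * (\<omega> * s) powr (q / 2 - 1) * \<omega> * S'"
  proof (cases "h' \<le> d")
    case True
    then show ?thesis using S' assms(3) by (intro add_increasing2) auto
  next
    case False
    then have "h' > d" "h' > 0" using d by auto
    have "h' powr q = h'\<^sup>2 * (h'\<^sup>2) powr (q / 2 - 1)"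
    proof -
      have "h' powr q = h' powr 2 * h' powr (q - 2)" by (simp flip: powr_add)
      also have "h' powr (q - 2) = (h'\<^sup>2) powr (q / 2 - 1)"
        using powr_half_sq[of h' "q - 2"] \<open>h' > 0\<close> by (simp add: diff_divide_distrib)
      finally show ?thesis using \<open>h' > 0\<close> by simp
    qed
    also have "\<dots> \<le> (\<omega> * S') * (\<omega> * s) powr (q / 2 - 1)"
      using le q S' assms(3) \<open>h' > 0\<close>
      by (intro mult_mono powr_mono2) (auto intro: order_trans mult_left_mono)
    finally have hq: "h' powr q \<le> (\<omega> * S') * (\<omega> * s) powr (q / 2 - 1)" .
    have "h' = h' powr (1 - q) * h' powr q" using \<open>h' > 0\<close> by (simp flip: powr_add)
    also have "\<dots> \<le> d powr (1 - q) * ((\<omega> * S') * (\<omega> * s) powr (q / 2 - 1))"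
      using hq \<open>h' > d\<close> d q by (intro mult_mono powr_mono2') auto
    finally show ?thesis using d by (simp add: mult_ac)
  qed
  then have "ennreal h' \<le> ennreal (d + d powr (1 - q) * (\<omega> * s) powr (q / 2 - 1) * \<omega> * S')"
    by (rule ennreal_leI)
  also have "\<dots> = ennreal d + ennreal (d powr (1 - q) * (\<omega> * s) powr (q / 2 - 1) * \<omega>) * ennreal S'"
    using d S' assms(3) by (subst ennreal_plus) (auto simp: ennreal_mult)
  finally show ?thesis using h' S' by simp
qed

text \<open>The two identities express the scaling that singles out this exponent: the first turns
  the powers of |y| into the Hardy weight |y|^(\<alpha>-2), the second turns the powers of t into
  t^(\<alpha>/2-1), which is integrable at 0.\<close>

lemma critical_exponent_props:
  fixes \<alpha> :: real
  assumes "0 < \<alpha>" "\<alpha> < 2" "3 \<le> N"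
  defines "q \<equiv> critical_exponent N \<alpha>"
  shows "q > 2" "(real N - 2 + \<alpha>) * (q / 2 - 1) = 2 - \<alpha>"
    "(1 - \<alpha> / 2) * (q - 1) - real N * (q / 2 - 1) = \<alpha> / 2 - 1"
proof -
  define D where "D = real N - 2 + \<alpha>"
  have D: "D > 0" using assms(1-3) by (simp add: D_def)
  have q: "q = 2 * real N / D" by (simp add: q_def critical_exponent_def D_def)
  have N: "real N = D + 2 - \<alpha>" by (simp add: D_def)
  have q2: "q / 2 = real N / D" unfolding q by simp
  have e: "(real N - 2 + \<alpha>) * (q / 2 - 1) = D * (real N / D - 1)" unfolding q2 D_def ..
  show "q > 2" using assms(1-3) D by (simp add: q less_divide_eq) (simp add: D_def)
  show "(real N - 2 + \<alpha>) * (q / 2 - 1) = 2 - \<alpha>"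
  proof -
    have "D * (real N / D - 1) = real N - D" using D by (simp add: right_diff_distrib)
    then show ?thesis unfolding e by (simp add: D_def)
  qed
  show "(1 - \<alpha> / 2) * (q - 1) - real N * (q / 2 - 1) = \<alpha> / 2 - 1"
  proof -
    have D': "D \<noteq> 0" using D by simp
    have "(1 - \<alpha> / 2) * (2 * n / D - 1) - n * (n / D - 1) = \<alpha> / 2 - 1" if "n = D + 2 - \<alpha>" for n
      unfolding that using D' by (simp add: divide_simps) (simp add: algebra_simps)
    from this[OF N] show ?thesis unfolding q2 unfolding q .
  qed
qed

lemma nn_integral_powr_interval:
  fixes e :: real
  assumes "e > -1"
  shows "(\<integral>\<^sup>+t. ennreal (t powr e) * indicator {0..1/2} t \<partial>lborel) = ennreal ((1/2) powr (e + 1) / (e + 1))"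
proof -
  have "(\<integral>\<^sup>+t. ennreal (indicator {0..1/2} t * t powr e) \<partial>lborel) = ennreal ((1/2) powr (e + 1) / (e + 1))"
    by (rule nn_integral_has_integral_lebesgue) (use assms has_integral_powr_from_0[of e "1/2"] in auto)
  moreover have "(\<lambda>t. ennreal (indicator {0..1/2} t * t powr e)) = (\<lambda>t. ennreal (t powr e) * indicator {0..1/2} t)"
    by (auto simp: indicator_def fun_eq_iff)
  ultimately show ?thesis by simp
qed

lemma ball_mean_square:
  fixes f :: "real ^ 'n::finite \<Rightarrow> ennreal"
  assumes [measurable]: "f \<in> borel_measurable borel"
  shows "(ball_mean t f y)\<^sup>2 \<le> ennreal (unit_ball_vol (real CARD('n))) * ball_mean t (\<lambda>x. (f x)\<^sup>2) y"
proof -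
  let ?i = "indicator (ball 0 1) :: real ^ 'n \<Rightarrow> ennreal"
  have "(ball_mean t f y)\<^sup>2 = (\<integral>\<^sup>+z. (f (y + (t * norm y) *\<^sub>R z) * ?i z) * ?i z \<partial>lborel)\<^sup>2"
    unfolding ball_mean_def
    by (intro arg_cong[where f = "\<lambda>x. x\<^sup>2"] nn_integral_cong) (auto split: split_indicator)
  also have "\<dots> \<le> (\<integral>\<^sup>+z. (f (y + (t * norm y) *\<^sub>R z) * ?i z)\<^sup>2 \<partial>lborel) * (\<integral>\<^sup>+z. (?i z)\<^sup>2 \<partial>lborel)"
    by (rule Cauchy_Schwarz_nn_integral) measurable
  also have "(\<integral>\<^sup>+z. (?i z)\<^sup>2 \<partial>lborel) = (\<integral>\<^sup>+z. ?i z \<partial>lborel)"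
    by (intro nn_integral_cong) (auto split: split_indicator)
  also have "(\<integral>\<^sup>+z. (f (y + (t * norm y) *\<^sub>R z) * ?i z)\<^sup>2 \<partial>lborel) = ball_mean t (\<lambda>x. (f x)\<^sup>2) y"
    unfolding ball_mean_def by (intro nn_integral_cong) (auto split: split_indicator)
  finally show ?thesis by (simp add: emeasure_ball mult.commute)
qed

text \<open>With the threshold $d = c\,t^{\alpha/2-1}$ in \<open>interpolate_le\<close> all powers of $t$ combine to
  the integrable weight $t^{\alpha/2-1}$.\<close>

lemma ball_mean_interpolate:
  fixes f :: "real ^ 'n::finite \<Rightarrow> ennreal"
  assumes f [measurable]: "f \<in> borel_measurable borel" and y: "y \<noteq> 0" and t: "0 < t" "t \<le> 1/2"
    and \<alpha>: "0 < \<alpha>" "\<alpha> < 2" and N: "3 \<le> CARD('n)" and c: "0 < c"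
    and H: "(\<integral>\<^sup>+x. ennreal (norm x powr (\<alpha> - 2)) * (f x)\<^sup>2 \<partial>lborel) \<le> ennreal 4"
  defines "\<omega> \<equiv> unit_ball_vol (real CARD('n))" and "q \<equiv> critical_exponent CARD('n) \<alpha>"
  shows "ball_mean t f y \<le> ennreal (t powr (\<alpha> / 2 - 1)) * (ennreal c +
    ennreal (c powr (1 - q) * ((16 * \<omega>) powr (q / 2 - 1) * \<omega>)) *
      (ennreal (norm y powr (\<alpha> - 2)) * ball_mean t (\<lambda>x. (f x)\<^sup>2) y))"
proof -
  let ?N = "real CARD('n)"
  note q = critical_exponent_props[OF \<alpha> N, folded q_def]
  define d where "d = c * t powr (\<alpha> / 2 - 1)"
  define s where "s = 4 * t powr (- ?N) * norm y powr (2 - \<alpha> - ?N) * 4"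
  have \<omega>: "\<omega> > 0" by (simp add: \<omega>_def)
  have d: "d > 0" using c t by (simp add: d_def)
  have "ball_mean t f y \<le> ennreal d + ennreal (d powr (1 - q) * (\<omega> * s) powr (q / 2 - 1) * \<omega>) * ball_mean t (\<lambda>x. (f x)\<^sup>2) y"
  proof (rule interpolate_le)
    show "(ball_mean t f y)\<^sup>2 \<le> ennreal \<omega> * ball_mean t (\<lambda>x. (f x)\<^sup>2) y"
      unfolding \<omega>_def by (rule ball_mean_square[OF f])
    show "ball_mean t (\<lambda>x. (f x)\<^sup>2) y \<le> ennreal s"
      unfolding s_def by (rule ball_mean_le[OF _ y t \<alpha> H]) measurable
  qed (use \<omega> d q in \<open>auto simp: s_def\<close>)
  also have "d powr (1 - q) * (\<omega> * s) powr (q / 2 - 1) * \<omega> =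
      t powr (\<alpha> / 2 - 1) * (c powr (1 - q) * ((16 * \<omega>) powr (q / 2 - 1) * \<omega>)) * norm y powr (\<alpha> - 2)"
  proof -
    have 1: "d powr (1 - q) = c powr (1 - q) * t powr ((\<alpha> / 2 - 1) * (1 - q))"
      using c t by (simp add: d_def powr_mult powr_powr)
    have "\<omega> * s = (16 * \<omega>) * (t powr (- ?N) * norm y powr (2 - \<alpha> - ?N))" by (simp add: s_def)
    then have "(\<omega> * s) powr (q / 2 - 1) = (16 * \<omega>) powr (q / 2 - 1) *
        (t powr (- ?N * (q / 2 - 1)) * norm y powr ((2 - \<alpha> - ?N) * (q / 2 - 1)))"
      using \<omega> by (simp add: powr_mult powr_powr)
    also have "(2 - \<alpha> - ?N) * (q / 2 - 1) = \<alpha> - 2"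
      using q(2) by (simp add: algebra_simps)
    finally have 2: "(\<omega> * s) powr (q / 2 - 1) = (16 * \<omega>) powr (q / 2 - 1) *
        (t powr (- ?N * (q / 2 - 1)) * norm y powr (\<alpha> - 2))" .
    have "t powr ((\<alpha> / 2 - 1) * (1 - q)) * t powr (- ?N * (q / 2 - 1)) = t powr ((\<alpha> / 2 - 1) * (1 - q) + - ?N * (q / 2 - 1))"
      by (rule powr_add[symmetric])
    also have "(\<alpha> / 2 - 1) * (1 - q) + - ?N * (q / 2 - 1) = \<alpha> / 2 - 1"
    proof -
      have "(\<alpha> / 2 - 1) * (1 - q) = (1 - \<alpha> / 2) * (q - 1)" by (simp add: field_simps)
      then show ?thesis using q(3) by simp
    qed
    finally have 3: "t powr ((\<alpha> / 2 - 1) * (1 - q)) * t powr (- ?N * (q / 2 - 1)) = t powr (\<alpha> / 2 - 1)" .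
    have "d powr (1 - q) * (\<omega> * s) powr (q / 2 - 1) * \<omega> =
      (t powr ((\<alpha> / 2 - 1) * (1 - q)) * t powr (- ?N * (q / 2 - 1))) *
      (c powr (1 - q) * ((16 * \<omega>) powr (q / 2 - 1) * \<omega>)) * norm y powr (\<alpha> - 2)"
      unfolding 1 2 by (simp only: mult_ac)
    then show ?thesis unfolding 3 .
  qed
  finally have "ball_mean t f y \<le> ennreal d + ennreal (t powr (\<alpha> / 2 - 1) * (c powr (1 - q) * ((16 * \<omega>) powr (q / 2 - 1) * \<omega>)) *
      norm y powr (\<alpha> - 2)) * ball_mean t (\<lambda>x. (f x)\<^sup>2) y" .
  also have "\<dots> = ennreal (t powr (\<alpha> / 2 - 1)) * (ennreal c +
    ennreal (c powr (1 - q) * ((16 * \<omega>) powr (q / 2 - 1) * \<omega>)) *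
      (ennreal (norm y powr (\<alpha> - 2)) * ball_mean t (\<lambda>x. (f x)\<^sup>2) y))"
  proof -
    have "ennreal d = ennreal (t powr (\<alpha> / 2 - 1)) * ennreal c"
      using c by (simp add: d_def ennreal_mult mult.commute)
    moreover have "ennreal (t powr (\<alpha> / 2 - 1) * (c powr (1 - q) * ((16 * \<omega>) powr (q / 2 - 1) * \<omega>)) * norm y powr (\<alpha> - 2)) =
      ennreal (t powr (\<alpha> / 2 - 1)) * (ennreal (c powr (1 - q) * ((16 * \<omega>) powr (q / 2 - 1) * \<omega>)) * ennreal (norm y powr (\<alpha> - 2)))"
      using \<omega> by (simp add: ennreal_mult mult.assoc)
    ultimately show ?thesis by (simp add: distrib_left mult.assoc)
  qed
  finally show ?thesis .
qed

text \<open>The fundamental theorem of calculus along the segments from y to y + |y|z/2, integrated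
  over z in the unit ball. Along such a segment |y| \<le> 2|x|, which converts the length |y| of the
  segment into the weight |x| beside the gradient; |x| |grad u| obeys the same weighted square bound
  as u.\<close>

lemma pointwise_by_means:
  fixes u :: "real ^ 'n::finite \<Rightarrow> real"
  assumes u: "smooth u"
  shows "ennreal (unit_ball_vol (real CARD('n)) * \<bar>u y\<bar>) \<le> ball_mean (1/2) (\<lambda>x. ennreal \<bar>u x\<bar>) y +
    2 * (\<integral>\<^sup>+t. ball_mean t (\<lambda>x. ennreal (norm x * norm (gradient u x))) y * indicator {0..1/2} t \<partial>lborel)"
proof -
  let ?i = "indicator (ball 0 1) :: real ^ 'n \<Rightarrow> ennreal" and ?I = "indicator {0..1/2} :: real \<Rightarrow> ennreal"
  let ?x = "\<lambda>t z. y + (t * norm y) *\<^sub>R z"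
  let ?f = "\<lambda>x. ennreal (norm x * norm (gradient u x))"
  have [measurable]: "u \<in> borel_measurable borel" "gradient u \<in> borel_measurable borel"
    using u smooth_measurable gradient_measurable by auto
  have pw: "ennreal \<bar>u y\<bar> * ?i z \<le> ennreal \<bar>u (?x (1/2) z)\<bar> * ?i z + (\<integral>\<^sup>+t. 2 * ?f (?x t z) * ?i z * ?I t \<partial>lborel)" for z
  proof (cases "z \<in> ball 0 1")
    case True
    have "ennreal \<bar>u (y + (1/2) *\<^sub>R (norm y *\<^sub>R z)) - u y\<bar> \<le>
       (\<integral>\<^sup>+t. ennreal (norm (gradient u (y + t *\<^sub>R (norm y *\<^sub>R z))) * norm (norm y *\<^sub>R z)) * ?I t \<partial>lborel)"
      by (rule increment_le[OF u]) simp
    also have "\<dots> \<le> (\<integral>\<^sup>+t. 2 * ?f (?x t z) * ?i z * ?I t \<partial>lborel)"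
    proof (rule nn_integral_mono)
      fix t :: real
      show "ennreal (norm (gradient u (y + t *\<^sub>R (norm y *\<^sub>R z))) * norm (norm y *\<^sub>R z)) * ?I t \<le> 2 * ?f (?x t z) * ?i z * ?I t"
      proof (cases "t \<in> {0..1/2}")
        case t: True
        have z: "norm z \<le> 1" using True by simp
        have "t * norm y * norm z \<le> 1/2 * norm y * 1"
          using t z by (intro mult_mono) auto
        then have "norm y \<le> 2 * norm (?x t z)"
          using t norm_triangle_ineq4[of "?x t z" "(t * norm y) *\<^sub>R z"] by (auto simp: abs_mult)
        moreover have "norm y * norm z \<le> norm y" using z by (simp add: mult_left_le)
        ultimately have "norm y * norm z \<le> 2 * norm (?x t z)" by linarith
        then have "norm (gradient u (?x t z)) * (norm y * norm z) \<le> norm (gradient u (?x t z)) * (2 * norm (?x t z))"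
          by (rule mult_left_mono) simp
        then have "ennreal (norm (gradient u (?x t z)) * (norm y * norm z)) \<le> ennreal (2 * (norm (?x t z) * norm (gradient u (?x t z))))"
          by (intro ennreal_leI) (simp add: mult_ac)
        then show ?thesis using t True by (simp add: ennreal_mult')
      qed simp
    qed
    finally have *: "ennreal \<bar>u (?x (1/2) z) - u y\<bar> \<le> (\<integral>\<^sup>+t. 2 * ?f (?x t z) * ?i z * ?I t \<partial>lborel)" by simp
    have "ennreal \<bar>u y\<bar> \<le> ennreal (\<bar>u (?x (1/2) z)\<bar> + \<bar>u (?x (1/2) z) - u y\<bar>)"
      by (rule ennreal_leI) auto
    also have "\<dots> = ennreal \<bar>u (?x (1/2) z)\<bar> + ennreal \<bar>u (?x (1/2) z) - u y\<bar>" by simp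
    also have "\<dots> \<le> ennreal \<bar>u (?x (1/2) z)\<bar> + (\<integral>\<^sup>+t. 2 * ?f (?x t z) * ?i z * ?I t \<partial>lborel)"
      using * by (rule add_left_mono)
    finally show ?thesis using True by simp
  qed simp
  have "ennreal (unit_ball_vol (real CARD('n)) * \<bar>u y\<bar>) = (\<integral>\<^sup>+z. ennreal \<bar>u y\<bar> * ?i z \<partial>lborel)"
    by (simp add: nn_integral_cmult_indicator emeasure_ball ennreal_mult' mult.commute)
  also have "\<dots> \<le> (\<integral>\<^sup>+z. ennreal \<bar>u (?x (1/2) z)\<bar> * ?i z + (\<integral>\<^sup>+t. 2 * ?f (?x t z) * ?i z * ?I t \<partial>lborel) \<partial>lborel)"
    by (intro nn_integral_mono pw)
  also have "\<dots> = ball_mean (1/2) (\<lambda>x. ennreal \<bar>u x\<bar>) y + (\<integral>\<^sup>+z. (\<integral>\<^sup>+t. 2 * ?f (?x t z) * ?i z * ?I t \<partial>lborel) \<partial>lborel)"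
    unfolding ball_mean_def by (rule nn_integral_add) measurable
  also have "(\<integral>\<^sup>+z. (\<integral>\<^sup>+t. 2 * ?f (?x t z) * ?i z * ?I t \<partial>lborel) \<partial>lborel) =
     (\<integral>\<^sup>+t. (\<integral>\<^sup>+z. 2 * ?f (?x t z) * ?i z * ?I t \<partial>lborel) \<partial>lborel)"
    by (rule lborel_pair.Fubini'[symmetric]) measurable
  also have "\<dots> = (\<integral>\<^sup>+t. 2 * (ball_mean t ?f y * ?I t) \<partial>lborel)"
  proof (rule nn_integral_cong)
    fix t :: real
    have "(\<integral>\<^sup>+z. 2 * ?f (?x t z) * ?i z * ?I t \<partial>lborel) = (\<integral>\<^sup>+z. (2 * ?I t) * (?f (?x t z) * ?i z) \<partial>lborel)"
      by (intro nn_integral_cong) (simp only: mult_ac)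
    also have "\<dots> = (2 * ?I t) * (\<integral>\<^sup>+z. ?f (?x t z) * ?i z \<partial>lborel)" by (rule nn_integral_cmult) measurable
    finally show "(\<integral>\<^sup>+z. 2 * ?f (?x t z) * ?i z * ?I t \<partial>lborel) = 2 * (ball_mean t ?f y * ?I t)"
      by (simp add: ball_mean_def mult_ac)
  qed
  also have "\<dots> = 2 * (\<integral>\<^sup>+t. ball_mean t ?f y * ?I t \<partial>lborel)" by (rule nn_integral_cmult) measurable
  finally show ?thesis .
qed

lemma ennreal_mult_mult: "0 \<le> a \<Longrightarrow> 0 \<le> b \<Longrightarrow> ennreal a * (ennreal b * X) = ennreal (a * b) * X"
  by (simp add: ennreal_mult mult.assoc)

text \<open>Optimisation over the threshold, in the manner of Hedberg: c is proportional to a, so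
  that the first term is exactly half of the left side and is absorbed; the power c^(1-q) then
  supplies the missing a^(q-1). An infinite right-hand side has to be treated separately before
  anything can be subtracted.\<close>

lemma power_from_threshold:
  fixes X :: ennreal
  assumes "\<omega> > 0" "M > 0" "K \<ge> 0" "q > 2" "0 \<le> a"
    and le: "\<And>c. c > 0 \<Longrightarrow> ennreal (\<omega> * a) \<le> ennreal (c * M) + ennreal (c powr (1 - q) * K) * X"
  shows "ennreal (a powr q) \<le> ennreal (2 / \<omega> * (\<omega> / (2 * M)) powr (1 - q) * K) * X"
proof (cases "a > 0")
  case True
  define c where "c = \<omega> / (2 * M) * a"
  have c: "c > 0" using assms True by (simp add: c_def)
  have cM: "c * M = \<omega> * a / 2" using assms by (simp add: c_def)
  show ?thesis
  proof (cases "ennreal (c powr (1 - q) * K) * X = top")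
    case t: True
    then have "X = top" "K \<noteq> 0" using assms by (auto simp: ennreal_mult_eq_top_iff)
    then have "0 < 2 / \<omega> * (\<omega> / (2 * M)) powr (1 - q) * K" using assms by simp
    then have "ennreal (2 / \<omega> * (\<omega> / (2 * M)) powr (1 - q) * K) \<noteq> 0" by (simp only: ennreal_eq_0_iff not_le)
    then show ?thesis using \<open>X = top\<close> by (simp add: ennreal_mult_top)
  next
    case False
    then obtain r where r: "ennreal (c powr (1 - q) * K) * X = ennreal r" "r \<ge> 0"
      by (metis ennreal_cases)
    have "ennreal (\<omega> * a) \<le> ennreal (\<omega> * a / 2) + ennreal r"
      using le[OF c] unfolding r(1) cM .
    also have "\<dots> = ennreal (\<omega> * a / 2 + r)"
      using r(2) assms(1) True by (intro ennreal_plus[symmetric]) auto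
    finally have "\<omega> * a / 2 \<le> r" using r(2) assms(1) True by (simp only: ennreal_le_iff add_nonneg_nonneg mult_nonneg_nonneg divide_nonneg_pos less_imp_le zero_less_numeral)
    have "a powr q = 2 / \<omega> * a powr (q - 1) * (\<omega> * a / 2)"
      using assms True by (simp add: powr_diff)
    also have "\<dots> \<le> 2 / \<omega> * a powr (q - 1) * r"
      using \<open>\<omega> * a / 2 \<le> r\<close> assms by (intro mult_left_mono) auto
    finally have "ennreal (a powr q) \<le> ennreal (2 / \<omega> * a powr (q - 1) * r)" by (rule ennreal_leI)
    also have "\<dots> = ennreal (2 / \<omega> * a powr (q - 1)) * (ennreal (c powr (1 - q) * K) * X)"
      unfolding r(1) using assms by (intro ennreal_mult) (auto simp: r)
    also have "\<dots> = ennreal (2 / \<omega> * a powr (q - 1) * (c powr (1 - q) * K)) * X"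
      by (rule ennreal_mult_mult) (use assms(1,3) in auto)
    also have "2 / \<omega> * a powr (q - 1) * (c powr (1 - q) * K) = 2 / \<omega> * (\<omega> / (2 * M)) powr (1 - q) * K * (a powr (q - 1) * a powr (1 - q))"
    proof -
      have "c powr (1 - q) = (\<omega> / (2 * M)) powr (1 - q) * a powr (1 - q)"
        unfolding c_def by (rule powr_mult)
      then show ?thesis by simp
    qed
    also have "a powr (q - 1) * a powr (1 - q) = 1" using True by (simp flip: powr_add)
    finally show ?thesis by simp
  qed
next
  case False
  with \<open>0 \<le> a\<close> have "a = 0" by simp
  then show ?thesis by simp
qed

text \<open>Both u and |x| |grad u| have a square integral against |x|^(\<alpha>-2) of at most 4:
  the first by Hardy's inequality, the second by the definition of the energy. The pointwise formula
  by means, interpolation and optimisation in the threshold bound |u|^q by weighted means of these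
  squares, which are linear and integrate to a constant. Energy at most 1 is enough by
  homogeneity.\<close>

theorem sobolev:
  assumes \<alpha>: "0 < \<alpha>" "\<alpha> < 2" and N: "3 \<le> CARD('n::finite)"
  obtains C where "C > 0" "\<And>u :: real ^ 'n \<Rightarrow> real. u \<in> test_functions \<Longrightarrow>
    (\<integral>\<^sup>+x. ennreal (norm x powr \<alpha> * (norm (gradient u x))\<^sup>2) \<partial>lborel) \<le> 1 \<Longrightarrow>
    (\<integral>\<^sup>+x. ennreal (\<bar>u x\<bar> powr critical_exponent CARD('n) \<alpha>) \<partial>lborel) \<le> ennreal C"
proof -
  define \<omega> where "\<omega> = unit_ball_vol (real CARD('n))"
  define q where "q = critical_exponent CARD('n) \<alpha>"
  note q = critical_exponent_props[OF \<alpha> N, folded q_def]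
  \<comment> \<open>\<open>e\<close> is the power of t left over by the interpolation, \<kappa> its
    value at t = 1/2 and \<open>m\<close> its integral over [0, 1/2]; \<open>M\<close> collects the
    coefficients of the threshold c, and the 4 in \<open>V\<close> is the Hardy constant.\<close>
  define e where "e = \<alpha> / 2 - 1"
  define \<kappa> where "\<kappa> = (1/2::real) powr e"
  define m where "m = (1/2::real) powr (e + 1) / (e + 1)"
  define M where "M = \<kappa> + 2 * m"
  define K where "K = (16 * \<omega>) powr (q / 2 - 1) * \<omega>"
  define V where "V = \<omega> * 4 ^ (CARD('n) + 1) * 4"
  define L where "L = 2 / \<omega> * (\<omega> / (2 * M)) powr (1 - q) * K"
  have e: "e > -1" using \<alpha> by (simp add: e_def)
  have \<omega>: "\<omega> > 0" by (simp add: \<omega>_def)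
  have \<kappa>m: "\<kappa> > 0" "m > 0" using e by (auto simp: \<kappa>_def m_def)
  then have M: "M > 0" by (simp add: M_def)
  have K: "K > 0" using \<omega> by (simp add: K_def)
  have pos: "\<omega> > 0" "\<kappa> > 0" "m > 0" "M > 0" "K > 0" "V > 0" "L > 0"
    using \<omega> \<kappa>m M K by (simp_all add: V_def L_def)
  have m: "(\<integral>\<^sup>+t. ennreal (t powr e) * indicator {0..1/2} t \<partial>lborel) = ennreal m"
    unfolding m_def by (rule nn_integral_powr_interval[OF e])
  show ?thesis
  proof (rule that[of "L * (M * V)"])
    show "0 < L * (M * V)" using pos by simp
    fix u :: "real ^ 'n \<Rightarrow> real"
    assume u: "u \<in> test_functions" and E: "(\<integral>\<^sup>+x. ennreal (norm x powr \<alpha> * (norm (gradient u x))\<^sup>2) \<partial>lborel) \<le> 1"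
    note su = test_smooth[OF u]
    let ?f1 = "\<lambda>x. ennreal \<bar>u x\<bar>" and ?f2 = "\<lambda>x. ennreal (norm x * norm (gradient u x))"
    have [measurable]: "u \<in> borel_measurable borel" "gradient u \<in> borel_measurable borel"
      using su smooth_measurable gradient_measurable by auto
    have H1: "(\<integral>\<^sup>+x. ennreal (norm x powr (\<alpha> - 2)) * (?f1 x)\<^sup>2 \<partial>lborel) \<le> ennreal 4"
    proof -
      have "(\<integral>\<^sup>+x. ennreal (norm x powr (\<alpha> - 2)) * (?f1 x)\<^sup>2 \<partial>lborel) = (\<integral>\<^sup>+x. ennreal (norm (x - 0) powr (\<alpha> - 2) * (u x)\<^sup>2) \<partial>lborel)"
        by (intro nn_integral_cong) (simp add: ennreal_mult ennreal_power)
      also have "\<dots> \<le> 4 * (\<integral>\<^sup>+x. ennreal (norm (x - 0) powr \<alpha> * (norm (gradient u x))\<^sup>2) \<partial>lborel)"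
        by (rule hardy[OF u \<alpha> N])
      also have "\<dots> \<le> 4 * 1" using E by (intro mult_left_mono) auto
      finally show ?thesis by simp
    qed
    have H2: "(\<integral>\<^sup>+x. ennreal (norm x powr (\<alpha> - 2)) * (?f2 x)\<^sup>2 \<partial>lborel) \<le> ennreal 4"
    proof -
      have "norm x powr (\<alpha> - 2) * (norm x)\<^sup>2 = norm x powr \<alpha>" for x :: "real ^ 'n"
        by (cases "x = 0") (auto simp: powr_diff)
      then have "(\<integral>\<^sup>+x. ennreal (norm x powr (\<alpha> - 2)) * (?f2 x)\<^sup>2 \<partial>lborel) = (\<integral>\<^sup>+x. ennreal (norm x powr \<alpha> * (norm (gradient u x))\<^sup>2) \<partial>lborel)"
        by (intro nn_integral_cong) (simp add: ennreal_mult ennreal_power power_mult_distrib flip: mult.assoc ennreal_mult)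
      then show ?thesis using E by (metis (no_types, lifting) order_trans one_le_numeral ennreal_numeral)
    qed
    define J1 where "J1 y = ennreal (norm y powr (\<alpha> - 2)) * ball_mean (1/2) (\<lambda>x. (?f1 x)\<^sup>2) y" for y
    define J2 where "J2 t y = ennreal (norm y powr (\<alpha> - 2)) * ball_mean t (\<lambda>x. (?f2 x)\<^sup>2) y" for t y
    \<comment> \<open>The two contributions to the pointwise formula: the single mean of u at t =
      1/2, and the means of |x| |grad u| over all t, with the factor 2 of that formula.\<close>
    define J where "J y = ennreal \<kappa> * J1 y + 2 * (\<integral>\<^sup>+t. ennreal (t powr e) * J2 t y * indicator {0..1/2} t \<partial>lborel)" for y
    have [measurable]: "(\<lambda>y. J1 y) \<in> borel_measurable borel" unfolding J1_def by measurable
    have mJ2: "(\<lambda>p. J2 (fst p) (snd p)) \<in> borel_measurable (borel \<Otimes>\<^sub>M borel)" unfolding J2_def by measurable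
    have [measurable]: "(\<lambda>x. J2 (a x) (b x)) \<in> borel_measurable M"
      if "a \<in> borel_measurable M" "b \<in> borel_measurable M" for a b and M :: "'z measure"
      using measurable_compose[OF measurable_Pair[OF that] mJ2] by simp
    have intJ1: "(\<integral>\<^sup>+y. J1 y \<partial>lborel) \<le> ennreal V"
      unfolding J1_def V_def \<omega>_def by (rule ball_mean_weighted[OF _ _ _ \<alpha> N H1]) auto
    have intJ2: "(\<integral>\<^sup>+y. J2 t y \<partial>lborel) \<le> ennreal V" if "0 < t" "t \<le> 1/2" for t
      unfolding J2_def V_def \<omega>_def by (rule ball_mean_weighted[OF _ that \<alpha> N H2]) auto
    have pw: "ennreal (\<bar>u y\<bar> powr q) \<le> ennreal L * J y" if y: "y \<noteq> 0" for y
      unfolding L_def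
    proof (rule power_from_threshold)
      fix c :: real assume c: "c > 0"
      have b: "ball_mean t ?f2 y * indicator {0..1/2} t \<le>
         ennreal c * (ennreal (t powr e) * indicator {0..1/2} t) + ennreal (c powr (1 - q) * K) * (ennreal (t powr e) * J2 t y * indicator {0..1/2} t)"
        if "t \<noteq> 0" for t
      proof (cases "t \<in> {0..1/2}")
        case True
        then have "ball_mean t ?f2 y \<le> ennreal (t powr e) * (ennreal c + ennreal (c powr (1 - q) * K) * J2 t y)"
          unfolding e_def K_def J2_def q_def \<omega>_def
          by (intro ball_mean_interpolate[OF _ y _ _ \<alpha> N c H2]) (use that in auto)
        then show ?thesis using True by (simp add: distrib_left mult_ac)
      qed simp
      have "(\<integral>\<^sup>+t. ball_mean t ?f2 y * indicator {0..1/2} t \<partial>lborel) \<le>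
         (\<integral>\<^sup>+t. ennreal c * (ennreal (t powr e) * indicator {0..1/2} t) + ennreal (c powr (1 - q) * K) * (ennreal (t powr e) * J2 t y * indicator {0..1/2} t) \<partial>lborel)"
        by (rule nn_integral_mono_AE, rule AE_mp[OF AE_lborel_nonzero]) (auto intro!: b)
      also have "\<dots> = ennreal c * ennreal m + ennreal (c powr (1 - q) * K) * (\<integral>\<^sup>+t. ennreal (t powr e) * J2 t y * indicator {0..1/2} t \<partial>lborel)"
        by (simp add: nn_integral_add nn_integral_cmult m)
      finally have b2: "2 * (\<integral>\<^sup>+t. ball_mean t ?f2 y * indicator {0..1/2} t \<partial>lborel) \<le>
         2 * (ennreal c * ennreal m + ennreal (c powr (1 - q) * K) * (\<integral>\<^sup>+t. ennreal (t powr e) * J2 t y * indicator {0..1/2} t \<partial>lborel))"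
        by (rule mult_left_mono) simp
      have b1: "ball_mean (1/2) ?f1 y \<le> ennreal \<kappa> * (ennreal c + ennreal (c powr (1 - q) * K) * J1 y)"
        unfolding \<kappa>_def e_def K_def J1_def q_def \<omega>_def
        by (intro ball_mean_interpolate[OF _ y _ _ \<alpha> N c H1]) auto
      have "ennreal (\<omega> * \<bar>u y\<bar>) \<le> ball_mean (1/2) ?f1 y + 2 * (\<integral>\<^sup>+t. ball_mean t ?f2 y * indicator {0..1/2} t \<partial>lborel)"
        unfolding \<omega>_def by (rule pointwise_by_means[OF su])
      also have "\<dots> \<le> ennreal \<kappa> * (ennreal c + ennreal (c powr (1 - q) * K) * J1 y) +
         2 * (ennreal c * ennreal m + ennreal (c powr (1 - q) * K) * (\<integral>\<^sup>+t. ennreal (t powr e) * J2 t y * indicator {0..1/2} t \<partial>lborel))"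
        by (rule add_mono[OF b1 b2])
      also have "\<dots> = ennreal c * (ennreal \<kappa> + 2 * ennreal m) + ennreal (c powr (1 - q) * K) * J y"
        by (simp add: J_def distrib_left mult_ac)
      also have "ennreal \<kappa> + 2 * ennreal m = ennreal M"
        using pos by (simp add: M_def ennreal_mult')
      also have "ennreal c * ennreal M = ennreal (c * M)" using pos c by (simp add: ennreal_mult)
      finally show "ennreal (\<omega> * \<bar>u y\<bar>) \<le> ennreal (c * M) + ennreal (c powr (1 - q) * K) * J y" .
    qed (use pos q in auto)
    have "AE y in lborel. ennreal (\<bar>u y\<bar> powr q) \<le> ennreal L * J y"
      using AE_lborel_nonzero by eventually_elim (rule pw)
    then have "(\<integral>\<^sup>+y. ennreal (\<bar>u y\<bar> powr q) \<partial>lborel) \<le> (\<integral>\<^sup>+y. ennreal L * J y \<partial>lborel)"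
      by (rule nn_integral_mono_AE)
    also have "\<dots> = ennreal L * (ennreal \<kappa> * (\<integral>\<^sup>+y. J1 y \<partial>lborel) +
       2 * (\<integral>\<^sup>+y. \<integral>\<^sup>+t. ennreal (t powr e) * J2 t y * indicator {0..1/2} t \<partial>lborel \<partial>lborel))"
      unfolding J_def by (simp add: nn_integral_cmult nn_integral_add)
    also have "(\<integral>\<^sup>+y. \<integral>\<^sup>+t. ennreal (t powr e) * J2 t y * indicator {0..1/2} t \<partial>lborel \<partial>lborel)
       = (\<integral>\<^sup>+t. \<integral>\<^sup>+y. ennreal (t powr e) * J2 t y * indicator {0..1/2} t \<partial>lborel \<partial>lborel)"
      by (rule lborel_pair.Fubini'[symmetric]) measurable
    also have "\<dots> \<le> (\<integral>\<^sup>+t. ennreal V * (ennreal (t powr e) * indicator {0..1/2} t) \<partial>lborel)"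
    proof (rule nn_integral_mono)
      fix t :: real
      have "(\<integral>\<^sup>+y. ennreal (t powr e) * J2 t y * indicator {0..1/2} t \<partial>lborel) =
          ennreal (t powr e) * (\<integral>\<^sup>+y. J2 t y \<partial>lborel) * indicator {0..1/2} t"
        by (simp add: nn_integral_cmult nn_integral_multc)
      also have "\<dots> \<le> ennreal (t powr e) * ennreal V * indicator {0..1/2} t"
        using intJ2[of t] by (cases "t = 0") (auto split: split_indicator intro!: mult_left_mono)
      finally show "(\<integral>\<^sup>+y. ennreal (t powr e) * J2 t y * indicator {0..1/2} t \<partial>lborel) \<le> ennreal V * (ennreal (t powr e) * indicator {0..1/2} t)"
        by (simp add: mult_ac)
    qed
    also have "\<dots> = ennreal V * ennreal m" by (simp add: nn_integral_cmult m)
    finally have "(\<integral>\<^sup>+y. ennreal (\<bar>u y\<bar> powr q) \<partial>lborel) \<le> ennreal L * (ennreal \<kappa> * (\<integral>\<^sup>+y. J1 y \<partial>lborel) + 2 * (ennreal V * ennreal m))"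
      by (simp add: mult_left_mono add_left_mono)
    also have "\<dots> \<le> ennreal L * (ennreal \<kappa> * ennreal V + 2 * (ennreal V * ennreal m))"
      using intJ1 by (intro mult_left_mono add_right_mono) auto
    also have "\<dots> = ennreal (L * (M * V))"
    proof -
      have a: "ennreal \<kappa> * ennreal V = ennreal (\<kappa> * V)" "2 * (ennreal V * ennreal m) = ennreal (2 * (V * m))"
        using pos by (simp_all add: ennreal_mult)
      have "ennreal \<kappa> * ennreal V + 2 * (ennreal V * ennreal m) = ennreal (\<kappa> * V + 2 * (V * m))"
        unfolding a using pos by (intro ennreal_plus[symmetric]) auto
      also have "\<kappa> * V + 2 * (V * m) = M * V" by (simp add: M_def algebra_simps)
      finally show ?thesis using pos by (simp add: ennreal_mult)
    qed
    finally show "(\<integral>\<^sup>+x. ennreal (\<bar>u x\<bar> powr critical_exponent CARD('n) \<alpha>) \<partial>lborel) \<le> ennreal (L * (M * V))"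
      by (simp add: q_def)
  qed
qed

section \<open>Localised estimates\<close>

definition energy :: "real \<Rightarrow> (real ^ 'n::finite \<Rightarrow> real) \<Rightarrow> ennreal" where
  "energy \<alpha> u = (\<integral>\<^sup>+x. ennreal (norm x powr \<alpha> * (norm (gradient u x))\<^sup>2) \<partial>lborel)"

lemma hardy_origin:
  fixes u :: "real ^ 'n::finite \<Rightarrow> real"
  assumes "u \<in> test_functions" "0 < \<alpha>" "\<alpha> < 2" "3 \<le> CARD('n)"
  shows "(\<integral>\<^sup>+x. ennreal (norm x powr (\<alpha> - 2) * (u x)\<^sup>2) \<partial>lborel) \<le> 4 * energy \<alpha> u"
  using hardy[OF assms, of 0] by (simp add: energy_def)

text \<open>On the support of \<eta> the weight is bounded below, so \<eta> grad u is controlled by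
  the energy; u grad \<eta> is controlled by Hardy's inequality. Hence \<eta>u has finite unweighted
  Dirichlet integral, and unweighted arguments become available.\<close>

lemma cutoff_gradient:
  fixes \<eta> :: "real ^ 'n::finite \<Rightarrow> real"
  assumes \<alpha>: "0 < \<alpha>" "\<alpha> < 2" and N: "3 \<le> CARD('n)"
    and \<eta>: "\<eta> \<in> test_functions" and s: "s > 0" "\<And>x. norm x < s \<Longrightarrow> \<eta> x = 0"
  obtains C where "C > 0" "\<And>u. u \<in> test_functions \<Longrightarrow>
    (\<integral>\<^sup>+x. ennreal ((norm (gradient (\<lambda>x. \<eta> x * u x) x))\<^sup>2) \<partial>lborel) \<le> ennreal C * energy \<alpha> u"
proof -
  obtain M where M: "\<And>x. \<bar>\<eta> x\<bar> \<le> M" "\<And>x. norm (gradient \<eta> x) \<le> M"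
    using test_bounded[OF \<eta>] by metis
  obtain R where R: "R > 0" "\<And>x. norm x \<ge> R \<Longrightarrow> \<eta> x = 0" "\<And>x. norm x \<ge> R \<Longrightarrow> gradient \<eta> x = 0"
    using test_support[OF \<eta>] by metis
  have g0: "gradient \<eta> x = 0" if "norm x < s" for x
  proof (rule gradient_eqI)
    have "((\<lambda>_. 0) has_derivative (\<lambda>h. 0 \<bullet> h)) (at x)" by simp
    then show "(\<eta> has_derivative (\<lambda>h. 0 \<bullet> h)) (at x)"
    proof (rule has_derivative_transform_within_open)
      show "open {x :: real ^ 'n. norm x < s}" by (intro open_Collect_less continuous_intros)
    qed (use that s in force)+
  qed
  define a where "a = 2 * M\<^sup>2 * s powr (- \<alpha>)"
  define b where "b = 2 * M\<^sup>2 * R powr (2 - \<alpha>)"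
  have ab: "a \<ge> 0" "b \<ge> 0" by (auto simp: a_def b_def)
  show ?thesis
  \<comment> \<open>The 4 is the constant of Hardy's inequality; the summand 1 makes the constant
    positive.\<close>
  proof (rule that[of "a + 4 * b + 1"])
    show "a + 4 * b + 1 > 0" using ab by simp
    fix u :: "real ^ 'n \<Rightarrow> real" assume u: "u \<in> test_functions"
    have [measurable]: "u \<in> borel_measurable borel" "gradient u \<in> borel_measurable borel"
      using u test_smooth smooth_measurable gradient_measurable by blast+
    have pw: "(norm (gradient (\<lambda>x. \<eta> x * u x) x))\<^sup>2 \<le>
      a * (norm x powr \<alpha> * (norm (gradient u x))\<^sup>2) + b * (norm x powr (\<alpha> - 2) * (u x)\<^sup>2)" for x
    proof (cases "norm x < s \<or> norm x \<ge> R")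
      case True
      then have "\<eta> x = 0" "gradient \<eta> x = 0" using R s g0 by auto
      then show ?thesis using ab by (simp add: gradient_mult[OF test_smooth[OF \<eta>] test_smooth[OF u]])
    next
      case False
      have x: "norm x > 0" "s \<le> norm x" "norm x \<le> R" using False s by auto
      have "norm (\<eta> x *\<^sub>R gradient u x + u x *\<^sub>R gradient \<eta> x) \<le> \<bar>\<eta> x\<bar> * norm (gradient u x) + \<bar>u x\<bar> * norm (gradient \<eta> x)"
        by (metis norm_triangle_ineq norm_scaleR)
      also have "\<dots> \<le> M * norm (gradient u x) + \<bar>u x\<bar> * M"
        using M by (intro add_mono mult_right_mono mult_left_mono) auto
      finally have "(norm (\<eta> x *\<^sub>R gradient u x + u x *\<^sub>R gradient \<eta> x))\<^sup>2 \<le> (M * norm (gradient u x) + \<bar>u x\<bar> * M)\<^sup>2"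
        by (intro power_mono) auto
      also have "\<dots> \<le> 2 * M\<^sup>2 * (norm (gradient u x))\<^sup>2 + 2 * M\<^sup>2 * (u x)\<^sup>2"
        using sum_squares_bound[of "M * norm (gradient u x)" "\<bar>u x\<bar> * M"]
        by (simp add: power2_sum power_mult_distrib) (simp add: algebra_simps)
      also have "\<dots> \<le> a * (norm x powr \<alpha> * (norm (gradient u x))\<^sup>2) + b * (norm x powr (\<alpha> - 2) * (u x)\<^sup>2)"
      proof (rule add_mono)
        have "1 = s powr (- \<alpha>) * s powr \<alpha>" using s by (simp flip: powr_add)
        also have "\<dots> \<le> s powr (- \<alpha>) * norm x powr \<alpha>"
          using x s \<alpha> by (intro mult_left_mono powr_mono2) auto
        finally have "2 * M\<^sup>2 * (norm (gradient u x))\<^sup>2 * 1 \<le> 2 * M\<^sup>2 * (norm (gradient u x))\<^sup>2 * (s powr (- \<alpha>) * norm x powr \<alpha>)"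
          by (intro mult_left_mono) auto
        then show "2 * M\<^sup>2 * (norm (gradient u x))\<^sup>2 \<le> a * (norm x powr \<alpha> * (norm (gradient u x))\<^sup>2)"
          by (simp add: a_def mult_ac)
        have "1 = norm x powr (2 - \<alpha>) * norm x powr (\<alpha> - 2)" using x by (simp flip: powr_add)
        also have "\<dots> \<le> R powr (2 - \<alpha>) * norm x powr (\<alpha> - 2)"
          using x \<alpha> by (intro mult_right_mono powr_mono2) auto
        finally have "2 * M\<^sup>2 * (u x)\<^sup>2 * 1 \<le> 2 * M\<^sup>2 * (u x)\<^sup>2 * (R powr (2 - \<alpha>) * norm x powr (\<alpha> - 2))"
          by (intro mult_left_mono) auto
        then show "2 * M\<^sup>2 * (u x)\<^sup>2 \<le> b * (norm x powr (\<alpha> - 2) * (u x)\<^sup>2)"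
          by (simp add: b_def mult_ac)
      qed
      finally show ?thesis by (simp add: gradient_mult[OF test_smooth[OF \<eta>] test_smooth[OF u]])
    qed
    have "(\<integral>\<^sup>+x. ennreal ((norm (gradient (\<lambda>x. \<eta> x * u x) x))\<^sup>2) \<partial>lborel) \<le>
      (\<integral>\<^sup>+x. ennreal a * ennreal (norm x powr \<alpha> * (norm (gradient u x))\<^sup>2) + ennreal b * ennreal (norm x powr (\<alpha> - 2) * (u x)\<^sup>2) \<partial>lborel)"
      using ab by (intro nn_integral_mono) (auto simp flip: ennreal_mult ennreal_plus intro!: ennreal_leI pw)
    also have "\<dots> = ennreal a * energy \<alpha> u + ennreal b * (\<integral>\<^sup>+x. ennreal (norm x powr (\<alpha> - 2) * (u x)\<^sup>2) \<partial>lborel)"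
      unfolding energy_def by (simp add: nn_integral_add nn_integral_cmult)
    also have "\<dots> \<le> ennreal a * energy \<alpha> u + ennreal b * (4 * energy \<alpha> u)"
      by (intro add_left_mono mult_left_mono hardy_origin u \<alpha> N) auto
    also have "\<dots> = ennreal (a + 4 * b) * energy \<alpha> u"
      using ab by (simp add: ennreal_plus ennreal_mult' distrib_right distrib_left mult_ac)
    also have "\<dots> \<le> ennreal (a + 4 * b + 1) * energy \<alpha> u"
      using ab by (intro mult_right_mono ennreal_leI) auto
    finally show "(\<integral>\<^sup>+x. ennreal ((norm (gradient (\<lambda>x. \<eta> x * u x) x))\<^sup>2) \<partial>lborel) \<le> ennreal (a + 4 * b + 1) * energy \<alpha> u" .
  qed
qed

text \<open>At y = 0 this is Hardy's inequality itself. For y \<noteq> 0 the inequality centred at y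
  is applied to \<eta>u, with \<eta> supported in B(y, |y|/2) away from the origin: its right-hand
  side carries the weight |x - y|^\<alpha>, which is bounded there, and the unweighted gradient is
  controlled by the energy. Radius and constant depend on y.\<close>

lemma hardy_local:
  fixes y :: "real ^ 'n::finite"
  assumes \<alpha>: "0 < \<alpha>" "\<alpha> < 2" and N: "3 \<le> CARD('n)"
  obtains r C where "r > 0" "C > 0" "\<And>u. u \<in> test_functions \<Longrightarrow>
    (\<integral>\<^sup>+x. ennreal (norm (x - y) powr (\<alpha> - 2) * (u x)\<^sup>2) * indicator (ball y r) x \<partial>lborel) \<le> ennreal C * energy \<alpha> u"
proof (cases "y = 0")
  case True
  show ?thesis
  proof (rule that[of 1 4])
    fix u :: "real ^ 'n \<Rightarrow> real" assume u: "u \<in> test_functions"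
    have "(\<integral>\<^sup>+x. ennreal (norm (x - y) powr (\<alpha> - 2) * (u x)\<^sup>2) * indicator (ball y 1) x \<partial>lborel) \<le>
       (\<integral>\<^sup>+x. ennreal (norm x powr (\<alpha> - 2) * (u x)\<^sup>2) \<partial>lborel)"
      unfolding True by (intro nn_integral_mono) (auto split: split_indicator)
    also have "\<dots> \<le> 4 * energy \<alpha> u" by (rule hardy_origin[OF u \<alpha> N])
    finally show "(\<integral>\<^sup>+x. ennreal (norm (x - y) powr (\<alpha> - 2) * (u x)\<^sup>2) * indicator (ball y 1) x \<partial>lborel) \<le> ennreal 4 * energy \<alpha> u"
      by simp
  qed auto
next
  case False
  define \<rho> where "\<rho> = norm y / 2"
  have \<rho>: "\<rho> > 0" using False by (simp add: \<rho>_def)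
  define \<eta> where "\<eta> = bump y \<rho> 1"
  have \<eta>: "\<eta> \<in> test_functions" using \<rho> by (simp add: \<eta>_def bump_test)
  have s: "\<eta> x = 0" if "norm x < \<rho>" for x
  proof -
    have "norm y \<le> norm x + dist y x" by (metis dist_norm norm_triangle_sub add.commute)
    then have "x \<notin> ball y \<rho>" using that by (auto simp: \<rho>_def)
    then show ?thesis using \<rho> by (simp add: \<eta>_def bump_eq_0)
  qed
  obtain C where C: "C > 0" "\<And>u. u \<in> test_functions \<Longrightarrow>
    (\<integral>\<^sup>+x. ennreal ((norm (gradient (\<lambda>x. \<eta> x * u x) x))\<^sup>2) \<partial>lborel) \<le> ennreal C * energy \<alpha> u"
    using cutoff_gradient[OF \<alpha> N \<eta> \<rho> s] by blast
  \<comment> \<open>The minimum of the cut-off on the ball of half the radius, as \<rho>^2 -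
    (\<rho>/2)^2 = 3\<rho>^2/4.\<close>
  define \<kappa> where "\<kappa> = flat_exp (3 / 4 * \<rho>\<^sup>2)"
  have \<kappa>: "\<kappa> > 0" using \<rho> by (simp add: \<kappa>_def flat_exp_pos)
  have \<eta>\<kappa>: "\<kappa> \<le> \<eta> x" if "x \<in> ball y (\<rho> / 2)" for x
  proof -
    have "(norm (x - y))\<^sup>2 \<le> (\<rho> / 2)\<^sup>2"
      using that by (intro power_mono) (auto simp: dist_norm norm_minus_commute)
    then show ?thesis unfolding \<kappa>_def \<eta>_def bump_def
      by (intro flat_exp_mono) (simp add: power_divide)
  qed
  show ?thesis
  proof (rule that[of "\<rho> / 2" "4 * \<rho> powr \<alpha> * C / \<kappa>\<^sup>2"])
    show "\<rho> / 2 > 0" "4 * \<rho> powr \<alpha> * C / \<kappa>\<^sup>2 > 0" using \<rho> C \<kappa> by auto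
    fix u :: "real ^ 'n \<Rightarrow> real" assume u: "u \<in> test_functions"
    let ?w = "\<lambda>x. \<eta> x * u x"
    have w: "?w \<in> test_functions" by (rule test_mult[OF \<eta> test_smooth[OF u]])
    have [measurable]: "?w \<in> borel_measurable borel" "gradient ?w \<in> borel_measurable borel"
      using w test_smooth smooth_measurable gradient_measurable by blast+
    have gw: "gradient ?w x = 0" if x: "x \<notin> cball y \<rho>" for x
    proof (rule gradient_eqI)
      have "((\<lambda>_. 0) has_derivative (\<lambda>h. 0 \<bullet> h)) (at x)" by simp
      then show "(?w has_derivative (\<lambda>h. 0 \<bullet> h)) (at x)"
      proof (rule has_derivative_transform_within_open)
        show "open (- cball y \<rho>)" by auto
      qed (use x \<rho> in \<open>auto simp: \<eta>_def bump_eq_0\<close>)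
    qed
    have "(\<integral>\<^sup>+x. ennreal (norm (x - y) powr (\<alpha> - 2) * (u x)\<^sup>2) * indicator (ball y (\<rho> / 2)) x \<partial>lborel) \<le>
      (\<integral>\<^sup>+x. ennreal (1 / \<kappa>\<^sup>2) * ennreal (norm (x - y) powr (\<alpha> - 2) * (?w x)\<^sup>2) \<partial>lborel)"
    proof (rule nn_integral_mono)
      fix x
      show "ennreal (norm (x - y) powr (\<alpha> - 2) * (u x)\<^sup>2) * indicator (ball y (\<rho> / 2)) x \<le>
        ennreal (1 / \<kappa>\<^sup>2) * ennreal (norm (x - y) powr (\<alpha> - 2) * (?w x)\<^sup>2)"
      proof (cases "x \<in> ball y (\<rho> / 2)")
        case True
        have "\<kappa>\<^sup>2 \<le> (\<eta> x)\<^sup>2" using \<eta>\<kappa>[OF True] \<kappa> by (intro power_mono) auto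
        then have "1 * (norm (x - y) powr (\<alpha> - 2) * (u x)\<^sup>2) \<le> ((\<eta> x)\<^sup>2 / \<kappa>\<^sup>2) * (norm (x - y) powr (\<alpha> - 2) * (u x)\<^sup>2)"
          using \<kappa> by (intro mult_right_mono) auto
        then show ?thesis using True
          by (simp add: ennreal_leI power_mult_distrib mult_ac flip: ennreal_mult)
      qed simp
    qed
    also have "\<dots> = ennreal (1 / \<kappa>\<^sup>2) * (\<integral>\<^sup>+x. ennreal (norm (x - y) powr (\<alpha> - 2) * (?w x)\<^sup>2) \<partial>lborel)"
      by (rule nn_integral_cmult) measurable
    also have "\<dots> \<le> ennreal (1 / \<kappa>\<^sup>2) * (4 * (\<integral>\<^sup>+x. ennreal (norm (x - y) powr \<alpha> * (norm (gradient ?w x))\<^sup>2) \<partial>lborel))"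
      by (intro mult_left_mono hardy[OF w \<alpha> N]) auto
    also have "(\<integral>\<^sup>+x. ennreal (norm (x - y) powr \<alpha> * (norm (gradient ?w x))\<^sup>2) \<partial>lborel) \<le>
       (\<integral>\<^sup>+x. ennreal (\<rho> powr \<alpha>) * ennreal ((norm (gradient ?w x))\<^sup>2) \<partial>lborel)"
    proof (rule nn_integral_mono)
      fix x
      show "ennreal (norm (x - y) powr \<alpha> * (norm (gradient ?w x))\<^sup>2) \<le> ennreal (\<rho> powr \<alpha>) * ennreal ((norm (gradient ?w x))\<^sup>2)"
      proof (cases "x \<in> cball y \<rho>")
        case True
        then have "norm (x - y) powr \<alpha> \<le> \<rho> powr \<alpha>"
          using \<alpha> by (intro powr_mono2) (auto simp: dist_norm norm_minus_commute)
        then show ?thesis by (simp add: ennreal_leI mult_right_mono flip: ennreal_mult)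
      qed (simp add: gw)
    qed
    also have "\<dots> = ennreal (\<rho> powr \<alpha>) * (\<integral>\<^sup>+x. ennreal ((norm (gradient ?w x))\<^sup>2) \<partial>lborel)"
      by (rule nn_integral_cmult) measurable
    also have "\<dots> \<le> ennreal (\<rho> powr \<alpha>) * (ennreal C * energy \<alpha> u)"
      by (intro mult_left_mono C(2) u) auto
    finally have "(\<integral>\<^sup>+x. ennreal (norm (x - y) powr (\<alpha> - 2) * (u x)\<^sup>2) * indicator (ball y (\<rho> / 2)) x \<partial>lborel) \<le>
        ennreal (1 / \<kappa>\<^sup>2) * (ennreal 4 * (ennreal (\<rho> powr \<alpha>) * (ennreal C * energy \<alpha> u)))"
      by (simp add: mult_left_mono)
    also have "\<dots> = ennreal (4 * \<rho> powr \<alpha> * C / \<kappa>\<^sup>2) * energy \<alpha> u"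
      using C(1) by (simp only: ennreal_mult_mult mult_nonneg_nonneg powr_ge_zero zero_le_divide_1_iff
          zero_le_power2 zero_le_numeral less_imp_le) (simp add: mult_ac)
    finally show "(\<integral>\<^sup>+x. ennreal (norm (x - y) powr (\<alpha> - 2) * (u x)\<^sup>2) * indicator (ball y (\<rho> / 2)) x \<partial>lborel) \<le>
       ennreal (4 * \<rho> powr \<alpha> * C / \<kappa>\<^sup>2) * energy \<alpha> u" .
  qed
qed

text \<open>With b the volume of the ball, b w(x) is the integral over the ball of w(x) - w(y) plus
  that of w. Cauchy-Schwarz handles the first; since x and y lie in one ball of radius h, the
  displacement z = y - x has length below 2h, which removes the centre c from the error
  term.\<close>

lemma average_bound:
  fixes w :: "real ^ 'n::finite \<Rightarrow> real"
  assumes w: "smooth w" and h: "h > 0" and x: "x \<in> ball c h"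
  defines "b \<equiv> measure lborel (ball c h)"
  shows "ennreal (b\<^sup>2 * (w x)\<^sup>2) \<le> ennreal (2 * b) * (\<integral>\<^sup>+z. ennreal ((w (x + z) - w x)\<^sup>2) * indicator (ball 0 (2 * h)) z \<partial>lborel)
     + ennreal (2 * (LBINT y. indicator (ball c h) y * w y)\<^sup>2)"
proof -
  let ?i = "indicator (ball c h) :: real ^ 'n \<Rightarrow> real"
  have [measurable]: "w \<in> borel_measurable borel" using w smooth_measurable by blast
  have fin: "emeasure lborel (ball c h) < \<infinity>" by (intro emeasure_bounded_finite bounded_ball)
  have b: "emeasure lborel (ball c h) = ennreal b" "b \<ge> 0"
    using fin by (auto simp: b_def emeasure_eq_ennreal_measure)
  define l where "l = (LBINT y. ?i y * w y)"
  define D where "D = (LBINT y. ?i y * (w x - w y))"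
  have "integrable lborel (\<lambda>y. indicator (cball c h) y *\<^sub>R w y)"
    by (rule borel_integrable_compact) (auto intro: smooth_continuous w)
  then have "integrable lborel (\<lambda>y. ?i y *\<^sub>R (indicator (cball c h) y *\<^sub>R w y))"
    by (rule integrable_mult_indicator[rotated]) simp
  also have "(\<lambda>y. ?i y *\<^sub>R (indicator (cball c h) y *\<^sub>R w y)) = (\<lambda>y. ?i y * w y)"
    by (auto simp: indicator_def fun_eq_iff)
  finally have i1: "integrable lborel (\<lambda>y. ?i y * w y)" .
  have i2: "integrable lborel (\<lambda>y. ?i y * w x)"
    using fin by (intro integrable_mult_left integrable_real_indicator) auto
  have "D = (LBINT y. ?i y * w x - ?i y * w y)" by (simp add: D_def right_diff_distrib)
  also have "\<dots> = b * w x - l" using i1 i2 by (simp add: l_def b_def)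
  finally have "b * w x = D + l" by simp
  then have "b\<^sup>2 * (w x)\<^sup>2 \<le> 2 * D\<^sup>2 + 2 * l\<^sup>2"
    using sum_squares_bound[of D l] by (simp add: power_mult_distrib[symmetric] power2_sum)
  then have 1: "ennreal (b\<^sup>2 * (w x)\<^sup>2) \<le> 2 * ennreal (D\<^sup>2) + ennreal (2 * l\<^sup>2)"
  proof -
    have "ennreal (b\<^sup>2 * (w x)\<^sup>2) \<le> ennreal (2 * D\<^sup>2 + 2 * l\<^sup>2)"
      using \<open>b\<^sup>2 * (w x)\<^sup>2 \<le> 2 * D\<^sup>2 + 2 * l\<^sup>2\<close> by (rule ennreal_leI)
    also have "\<dots> = ennreal (2 * D\<^sup>2) + ennreal (2 * l\<^sup>2)" by (rule ennreal_plus) auto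
    also have "ennreal (2 * D\<^sup>2) = 2 * ennreal (D\<^sup>2)" by (simp add: ennreal_mult')
    finally show ?thesis .
  qed
  have iD: "integrable lborel (\<lambda>y. ?i y * (w x - w y))" using i1 i2 by (simp add: right_diff_distrib)
  have "ennreal (D\<^sup>2) = (ennreal \<bar>D\<bar>)\<^sup>2" by (subst ennreal_power) auto
  also have "\<dots> \<le> (\<integral>\<^sup>+y. ennreal \<bar>?i y * (w x - w y)\<bar> \<partial>lborel)\<^sup>2"
    unfolding D_def using integral_norm_bound_ennreal[OF iD] by (intro power_mono) auto
  also have "\<dots> = (\<integral>\<^sup>+y. (ennreal \<bar>w x - w y\<bar> * indicator (ball c h) y) * indicator (ball c h) y \<partial>lborel)\<^sup>2"
    by (intro arg_cong[where f = "\<lambda>x. x\<^sup>2"] nn_integral_cong) (auto split: split_indicator)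
  also have "\<dots> \<le> (\<integral>\<^sup>+y. (ennreal \<bar>w x - w y\<bar> * indicator (ball c h) y)\<^sup>2 \<partial>lborel) * (\<integral>\<^sup>+y. (indicator (ball c h) y)\<^sup>2 \<partial>lborel)"
    by (rule Cauchy_Schwarz_nn_integral) measurable
  also have "(\<integral>\<^sup>+y. (indicator (ball c h) y)\<^sup>2 \<partial>lborel) = (\<integral>\<^sup>+y. indicator (ball c h) y \<partial>lborel)"
    by (intro nn_integral_cong) (auto split: split_indicator)
  also have "\<dots> = ennreal b" by (simp add: b)
  also have "(\<integral>\<^sup>+y. (ennreal \<bar>w x - w y\<bar> * indicator (ball c h) y)\<^sup>2 \<partial>lborel) = (\<integral>\<^sup>+z. (ennreal \<bar>w x - w (x + z)\<bar> * indicator (ball c h) (x + z))\<^sup>2 \<partial>lborel)"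
    by (rule nn_integral_lborel_shift[symmetric]) measurable
  also have "\<dots> \<le> (\<integral>\<^sup>+z. ennreal ((w (x + z) - w x)\<^sup>2) * indicator (ball 0 (2 * h)) z \<partial>lborel)"
  proof (rule nn_integral_mono)
    fix z
    have "z \<in> ball 0 (2 * h)" if "x + z \<in> ball c h"
    proof -
      have "norm z = dist (x + z) x" by (simp add: dist_norm)
      also have "\<dots> \<le> dist (x + z) c + dist x c" by (rule dist_triangle2)
      also have "\<dots> < 2 * h" using that x by (simp add: dist_commute)
      finally show ?thesis by simp
    qed
    then show "(ennreal \<bar>w x - w (x + z)\<bar> * indicator (ball c h) (x + z))\<^sup>2 \<le> ennreal ((w (x + z) - w x)\<^sup>2) * indicator (ball 0 (2 * h)) z"
      by (auto split: split_indicator simp: ennreal_power power2_commute)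
  qed
  finally have "ennreal (D\<^sup>2) \<le> (\<integral>\<^sup>+z. ennreal ((w (x + z) - w x)\<^sup>2) * indicator (ball 0 (2 * h)) z \<partial>lborel) * ennreal b"
    by (simp add: mult_right_mono)
  then have "2 * ennreal (D\<^sup>2) \<le> 2 * ((\<integral>\<^sup>+z. ennreal ((w (x + z) - w x)\<^sup>2) * indicator (ball 0 (2 * h)) z \<partial>lborel) * ennreal b)"
    by (rule mult_left_mono) simp
  also have "\<dots> = ennreal (2 * b) * (\<integral>\<^sup>+z. ennreal ((w (x + z) - w x)\<^sup>2) * indicator (ball 0 (2 * h)) z \<partial>lborel)"
    using b(2) by (simp add: ennreal_mult mult_ac)
  finally show ?thesis using 1 add_right_mono order_trans unfolding l_def by blast
qed

lemma ennreal_mult3: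
  assumes "0 \<le> a" "0 \<le> b" "0 \<le> c"
  shows "ennreal a * (ennreal b * (ennreal c * X)) = ennreal (a * (b * c)) * X"
  using assms by (simp add: ennreal_mult mult.assoc)

lemma ennreal_mult4:
  assumes "0 \<le> a" "0 \<le> b" "0 \<le> c" "0 \<le> d"
  shows "ennreal a * (ennreal b * (ennreal c * (ennreal d * X))) = ennreal (a * (b * (c * d))) * X"
  using assms by (simp add: ennreal_mult mult.assoc)

lemma cball_borel [measurable]: "cball c r \<in> sets (borel :: 'a::metric_space measure)"
  by (intro borel_closed closed_cball)

text \<open>A quantitative Rellich theorem: finitely many balls of radius h cover the region, each
  point is compared with the average over a ball containing it, and the error is of order h^2 times
  the Dirichlet integral. The cut-off is absorbed into the averaging functions, so that the averages
  are linear in u itself.\<close>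

lemma finite_rank_ball:
  fixes \<eta> :: "real ^ 'n::finite \<Rightarrow> real"
  assumes h: "h > 0" and R: "R > 0" and \<eta>: "\<eta> \<in> test_functions" "\<And>x. \<bar>\<eta> x\<bar> \<le> 1"
  obtains \<Psi> C where "finite \<Psi>" "C \<ge> 0"
    "\<And>\<psi>. \<psi> \<in> \<Psi> \<Longrightarrow> \<exists>c. \<psi> = (\<lambda>x. indicator (ball c h) x * \<eta> x)"
    "\<And>u. u \<in> test_functions \<Longrightarrow> (\<integral>\<^sup>+x. ennreal ((\<eta> x * u x)\<^sup>2) * indicator (cball 0 R) x \<partial>lborel) \<le>
      ennreal (2 ^ (CARD('n) + 3) * h\<^sup>2) * (\<integral>\<^sup>+x. ennreal ((norm (gradient (\<lambda>x. \<eta> x * u x) x))\<^sup>2) \<partial>lborel)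
      + ennreal C * (\<Sum>\<psi>\<in>\<Psi>. ennreal ((LBINT x. \<psi> x * u x)\<^sup>2))"
proof -
  have "compact (cball (0::real^'n) R)" by simp
  then obtain S where S: "S \<subseteq> cball (0::real^'n) R" "finite S" "cball 0 R \<subseteq> (\<Union>c\<in>S. ball c h)"
    by (rule compactE_image[of _ "cball 0 R" "\<lambda>c. ball c h"]) (use h in auto)
  define \<psi> where "\<psi> c = (\<lambda>x. indicator (ball c h) x * \<eta> x)" for c :: "real ^ 'n"
  let ?\<omega> = "unit_ball_vol (real CARD('n))"
  define b where "b = ?\<omega> * h ^ CARD('n)"
  define V where "V = ?\<omega> * R ^ CARD('n)"
  have b: "b > 0" using h by (simp add: b_def)
  have V: "V > 0" using R by (simp add: V_def)
  have bm: "measure lborel (ball c h) = b" for c :: "real ^ 'n"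
    using h by (simp add: b_def content_ball)
  show ?thesis
  proof (rule that[of "\<psi> ` S" "V * 2 / b\<^sup>2"])
    show "finite (\<psi> ` S)" "V * 2 / b\<^sup>2 \<ge> 0" using S V by auto
    show "\<exists>c. \<phi> = (\<lambda>x. indicator (ball c h) x * \<eta> x)" if "\<phi> \<in> \<psi> ` S" for \<phi>
      using that by (auto simp: \<psi>_def)
    fix u :: "real ^ 'n \<Rightarrow> real" assume u: "u \<in> test_functions"
    define w where "w = (\<lambda>x. \<eta> x * u x)"
    have w: "smooth w" unfolding w_def using \<eta> u by (intro smooth_mult test_smooth)
    have [measurable]: "w \<in> borel_measurable borel" "gradient w \<in> borel_measurable borel"
      using w smooth_measurable gradient_measurable by blast+
    define \<Sigma> where "\<Sigma> = (\<Sum>\<psi>\<in>\<psi>`S. ennreal ((LBINT x. \<psi> x * u x)\<^sup>2))"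
    define G where "G = (\<integral>\<^sup>+x. ennreal ((norm (gradient w x))\<^sup>2) \<partial>lborel)"
    let ?Z = "\<lambda>x z. ennreal ((w (x + z) - w x)\<^sup>2) * indicator (ball 0 (2 * h)) z"
    have pw: "ennreal (b\<^sup>2) * (ennreal ((w x)\<^sup>2) * indicator (cball 0 R) x) \<le>
        ennreal (2 * b) * (\<integral>\<^sup>+z. ?Z x z \<partial>lborel) + 2 * \<Sigma> * indicator (cball 0 R) x" for x
    proof (cases "x \<in> cball 0 R")
      case True
      then obtain c where c: "c \<in> S" "x \<in> ball c h" using S(3) by blast
      have "ennreal (b\<^sup>2 * (w x)\<^sup>2) \<le> ennreal (2 * b) * (\<integral>\<^sup>+z. ?Z x z \<partial>lborel)
         + ennreal (2 * (LBINT y. indicator (ball c h) y * w y)\<^sup>2)"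
        using average_bound[OF w h c(2)] unfolding bm .
      also have "ennreal (2 * (LBINT y. indicator (ball c h) y * w y)\<^sup>2) = 2 * ennreal ((LBINT x. \<psi> c x * u x)\<^sup>2)"
        by (simp add: w_def \<psi>_def ennreal_mult' mult.assoc)
      also have "ennreal ((LBINT x. \<psi> c x * u x)\<^sup>2) \<le> \<Sigma>"
        unfolding \<Sigma>_def by (rule member_le_sum) (use c S in auto)
      finally show ?thesis using True by (simp add: ennreal_mult' add_left_mono mult_left_mono)
    qed simp
    have "ennreal (b\<^sup>2) * (\<integral>\<^sup>+x. ennreal ((w x)\<^sup>2) * indicator (cball 0 R) x \<partial>lborel)
        = (\<integral>\<^sup>+x. ennreal (b\<^sup>2) * (ennreal ((w x)\<^sup>2) * indicator (cball 0 R) x) \<partial>lborel)"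
      by (rule nn_integral_cmult[symmetric]) measurable
    also have "\<dots> \<le> (\<integral>\<^sup>+x. ennreal (2 * b) * (\<integral>\<^sup>+z. ?Z x z \<partial>lborel) + 2 * \<Sigma> * indicator (cball 0 R) x \<partial>lborel)"
      by (intro nn_integral_mono pw)
    also have "\<dots> = ennreal (2 * b) * (\<integral>\<^sup>+x. \<integral>\<^sup>+z. ?Z x z \<partial>lborel \<partial>lborel) + 2 * \<Sigma> * ennreal V"
      using R by (simp add: nn_integral_add nn_integral_cmult emeasure_cball V_def)
    also have "(\<integral>\<^sup>+x. \<integral>\<^sup>+z. ?Z x z \<partial>lborel \<partial>lborel) = (\<integral>\<^sup>+z. \<integral>\<^sup>+x. ?Z x z \<partial>lborel \<partial>lborel)"
      by (rule lborel_pair.Fubini'[symmetric]) measurable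
    also have "\<dots> \<le> (\<integral>\<^sup>+z. ennreal ((2 * h)\<^sup>2) * G * indicator (ball (0::real^'n) (2 * h)) z \<partial>lborel)"
    proof (rule nn_integral_mono)
      fix z :: "real ^ 'n"
      show "(\<integral>\<^sup>+x. ?Z x z \<partial>lborel) \<le> ennreal ((2 * h)\<^sup>2) * G * indicator (ball 0 (2 * h)) z"
      proof (cases "z \<in> ball 0 (2 * h)")
        case True
        then have "(norm z)\<^sup>2 \<le> (2 * h)\<^sup>2" by (intro power_mono) auto
        then have "ennreal ((norm z)\<^sup>2) * G \<le> ennreal ((2 * h)\<^sup>2) * G" by (intro mult_right_mono ennreal_leI) auto
        moreover have "(\<integral>\<^sup>+x. ennreal ((w (x + z) - w x)\<^sup>2) \<partial>lborel) \<le> ennreal ((norm z)\<^sup>2) * G"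
          unfolding G_def by (rule translation_estimate[OF w])
        ultimately show ?thesis using True by simp
      qed simp
    qed
    also have "\<dots> = ennreal ((2 * h)\<^sup>2) * G * ennreal (?\<omega> * (2 * h) ^ CARD('n))"
      using h by (simp add: nn_integral_cmult_indicator emeasure_ball)
    finally have "ennreal (b\<^sup>2) * (\<integral>\<^sup>+x. ennreal ((w x)\<^sup>2) * indicator (cball 0 R) x \<partial>lborel) \<le>
       ennreal (2 * b) * (ennreal ((2 * h)\<^sup>2) * G * ennreal (?\<omega> * (2 * h) ^ CARD('n))) + 2 * \<Sigma> * ennreal V"
      by (simp add: mult_left_mono add_right_mono)
    then have "ennreal (1 / b\<^sup>2) * (ennreal (b\<^sup>2) * (\<integral>\<^sup>+x. ennreal ((w x)\<^sup>2) * indicator (cball 0 R) x \<partial>lborel)) \<le>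
       ennreal (1 / b\<^sup>2) * (ennreal (2 * b) * (ennreal ((2 * h)\<^sup>2) * G * ennreal (?\<omega> * (2 * h) ^ CARD('n))) + 2 * \<Sigma> * ennreal V)"
      by (rule mult_left_mono) simp
    also have "ennreal (1 / b\<^sup>2) * (ennreal (b\<^sup>2) * (\<integral>\<^sup>+x. ennreal ((w x)\<^sup>2) * indicator (cball 0 R) x \<partial>lborel)) =
        (\<integral>\<^sup>+x. ennreal ((w x)\<^sup>2) * indicator (cball 0 R) x \<partial>lborel)"
      using b by (simp add: ennreal_mult_mult)
    also have "ennreal (1 / b\<^sup>2) * (ennreal (2 * b) * (ennreal ((2 * h)\<^sup>2) * G * ennreal (?\<omega> * (2 * h) ^ CARD('n))) + 2 * \<Sigma> * ennreal V)
      = ennreal (1 / b\<^sup>2) * (ennreal (2 * b) * (ennreal ((2 * h)\<^sup>2) * (ennreal (?\<omega> * (2 * h) ^ CARD('n)) * G))) + ennreal (1 / b\<^sup>2) * (ennreal V * (ennreal 2 * \<Sigma>))"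
      by (simp add: distrib_left mult_ac)
    also have "\<dots> = ennreal (1 / b\<^sup>2 * (2 * b * ((2 * h)\<^sup>2 * (?\<omega> * (2 * h) ^ CARD('n))))) * G + ennreal (1 / b\<^sup>2 * (V * 2)) * \<Sigma>"
      by (intro arg_cong2[where f = "(+)"] ennreal_mult3 ennreal_mult4) (use b V h in auto)
    \<comment> \<open>The power 2^(N+3) is made of 2 from the squared sum, 4 from (2h)^2 and 2^N
      from the volume of the ball of radius 2h.\<close>
    also have "1 / b\<^sup>2 * (2 * b * ((2 * h)\<^sup>2 * (?\<omega> * (2 * h) ^ CARD('n)))) = 2 ^ (CARD('n) + 3) * h\<^sup>2"
    proof -
      have "?\<omega> * (2 * h) ^ CARD('n) = 2 ^ CARD('n) * b" by (simp add: b_def power_mult_distrib)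
      then show ?thesis using b by (simp only:) (simp add: power2_eq_square power_add)
    qed
    finally show "(\<integral>\<^sup>+x. ennreal ((\<eta> x * u x)\<^sup>2) * indicator (cball 0 R) x \<partial>lborel) \<le>
      ennreal (2 ^ (CARD('n) + 3) * h\<^sup>2) * (\<integral>\<^sup>+x. ennreal ((norm (gradient (\<lambda>x. \<eta> x * u x) x))\<^sup>2) \<partial>lborel)
      + ennreal (V * 2 / b\<^sup>2) * (\<Sum>\<psi>\<in>\<psi>`S. ennreal ((LBINT x. \<psi> x * u x)\<^sup>2))"
      by (simp add: w_def G_def \<Sigma>_def)
  qed
qed

text \<open>The annulus avoids the origin, so the cut-off lemma bounds the Dirichlet integral of
  \<eta>u by the energy, and h can be taken so small that the error of the finite-rank estimate is
  at most \<epsilon> times the energy.\<close>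

lemma finite_rank_annulus:
  assumes \<alpha>: "0 < \<alpha>" "\<alpha> < 2" and N: "3 \<le> CARD('n::finite)"
    and s: "0 < s" "s \<le> R" and \<epsilon>: "\<epsilon> > 0"
  obtains \<Psi> C where "finite \<Psi>" "C \<ge> 0"
    "\<And>\<psi>. \<psi> \<in> \<Psi> \<Longrightarrow> \<psi> \<in> borel_measurable borel \<and> (\<forall>x. \<bar>\<psi> x\<bar> \<le> 1) \<and> (\<forall>x. norm x \<ge> 2 * R \<longrightarrow> \<psi> x = 0)"
    "\<And>u :: real ^ 'n \<Rightarrow> real. u \<in> test_functions \<Longrightarrow>
      (\<integral>\<^sup>+x. ennreal ((u x)\<^sup>2) * indicator {x. s \<le> norm x \<and> norm x \<le> R} x \<partial>lborel) \<le>
      ennreal \<epsilon> * energy \<alpha> u + ennreal C * (\<Sum>\<psi>\<in>\<Psi>. ennreal ((LBINT x. \<psi> x * u x)\<^sup>2))"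
proof -
  \<comment> \<open>The product of the two quadratic factors is positive exactly for s/2 < |x| < 2R,
    so one flat exponential cuts off on both sides.\<close>
  define \<eta> where "\<eta> = (\<lambda>x::real^'n. flat_exp (((norm (x - 0))\<^sup>2 - (s / 2)\<^sup>2) * ((2 * R)\<^sup>2 - (norm (x - 0))\<^sup>2)))"
  have smooth: "smooth \<eta>"
    unfolding \<eta>_def by (intro smooth_flat_exp smooth_mult smooth_diff smooth_norm_sq smooth_const)
  have z1: "\<eta> x = 0" if "norm x < s / 2" for x
  proof -
    have "(norm x)\<^sup>2 \<le> (s / 2)\<^sup>2" "(norm x)\<^sup>2 \<le> (2 * R)\<^sup>2" using that s by (intro power_mono; simp)+
    then show ?thesis by (simp add: \<eta>_def flat_exp_eq_0 mult_nonpos_nonneg)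
  qed
  have z2: "\<eta> x = 0" if "norm x \<ge> 2 * R" for x
  proof -
    have "(s / 2)\<^sup>2 \<le> (norm x)\<^sup>2" "(2 * R)\<^sup>2 \<le> (norm x)\<^sup>2" using that s by (intro power_mono; simp)+
    then show ?thesis by (simp add: \<eta>_def flat_exp_eq_0 mult_nonneg_nonpos)
  qed
  have \<eta>: "\<eta> \<in> test_functions"
  proof (rule test_functionsI[OF smooth, where B = "ball 0 (2 * R)"])
    show "x \<in> ball 0 (2 * R)" if "\<eta> x \<noteq> 0" for x
      using z2[of x] that by (simp add: not_le[symmetric]) blast
  qed simp
  have \<eta>1: "\<bar>\<eta> x\<bar> \<le> 1" for x by (simp add: \<eta>_def flat_exp_nonneg flat_exp_le_1)
  obtain C0 where C0: "C0 > 0" "\<And>u. u \<in> test_functions \<Longrightarrow>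
    (\<integral>\<^sup>+x. ennreal ((norm (gradient (\<lambda>x. \<eta> x * u x) x))\<^sup>2) \<partial>lborel) \<le> ennreal C0 * energy \<alpha> u"
    using cutoff_gradient[OF \<alpha> N \<eta> half_gt_zero[OF s(1)] z1] by blast
  define \<kappa> where "\<kappa> = flat_exp ((s\<^sup>2 - (s / 2)\<^sup>2) * ((2 * R)\<^sup>2 - R\<^sup>2))"
  have "s\<^sup>2 - (s / 2)\<^sup>2 > 0" "(2 * R)\<^sup>2 - R\<^sup>2 > 0" using s by (auto simp: power_mult_distrib power_divide)
  then have \<kappa>: "\<kappa> > 0" unfolding \<kappa>_def by (intro flat_exp_pos mult_pos_pos)
  have \<eta>\<kappa>: "\<kappa> \<le> \<eta> x" if "s \<le> norm x" "norm x \<le> R" for x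
  proof -
    have "s\<^sup>2 \<le> (norm x)\<^sup>2" "(norm x)\<^sup>2 \<le> R\<^sup>2" "R\<^sup>2 \<le> (2 * R)\<^sup>2" "(s / 2)\<^sup>2 \<le> s\<^sup>2" using that s by (intro power_mono; simp)+
    then show ?thesis unfolding \<kappa>_def \<eta>_def by (intro flat_exp_mono mult_mono) auto
  qed
  \<comment> \<open>Solves 2^(N+3) h^2 C0 / \<kappa>^2 = \<epsilon>.\<close>
  define h where "h = sqrt (\<epsilon> * \<kappa>\<^sup>2 / (2 ^ (CARD('n) + 3) * C0))"
  have h: "h > 0" "2 ^ (CARD('n) + 3) * h\<^sup>2 * C0 / \<kappa>\<^sup>2 = \<epsilon>"
    using \<epsilon> \<kappa> C0(1) by (simp_all add: h_def)
  obtain \<Psi> C where \<Psi>: "finite \<Psi>" "C \<ge> 0"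
    "\<And>\<psi>. \<psi> \<in> \<Psi> \<Longrightarrow> \<exists>c. \<psi> = (\<lambda>x. indicator (ball c h) x * \<eta> x)"
    "\<And>u. u \<in> test_functions \<Longrightarrow> (\<integral>\<^sup>+x. ennreal ((\<eta> x * u x)\<^sup>2) * indicator (cball 0 R) x \<partial>lborel) \<le>
      ennreal (2 ^ (CARD('n) + 3) * h\<^sup>2) * (\<integral>\<^sup>+x. ennreal ((norm (gradient (\<lambda>x. \<eta> x * u x) x))\<^sup>2) \<partial>lborel)
      + ennreal C * (\<Sum>\<psi>\<in>\<Psi>. ennreal ((LBINT x. \<psi> x * u x)\<^sup>2))"
    using finite_rank_ball[OF h(1) less_le_trans[OF s] \<eta> \<eta>1] by blast
  have [measurable]: "\<eta> \<in> borel_measurable borel" using smooth smooth_measurable by blast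
  show ?thesis
  proof (rule that[of \<Psi> "C / \<kappa>\<^sup>2"])
    show "finite \<Psi>" "C / \<kappa>\<^sup>2 \<ge> 0" using \<Psi> by auto
    show "\<psi> \<in> borel_measurable borel \<and> (\<forall>x. \<bar>\<psi> x\<bar> \<le> 1) \<and> (\<forall>x. norm x \<ge> 2 * R \<longrightarrow> \<psi> x = 0)"
      if mem: "\<psi> \<in> \<Psi>" for \<psi>
    proof -
      obtain c where c: "\<psi> = (\<lambda>x. indicator (ball c h) x * \<eta> x)" using \<Psi>(3)[OF mem] by blast
      show ?thesis unfolding c using \<eta>1 z2 by (auto split: split_indicator)
    qed
    fix u :: "real ^ 'n \<Rightarrow> real" assume u: "u \<in> test_functions"
    have [measurable]: "u \<in> borel_measurable borel" using u test_smooth smooth_measurable by blast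
    define \<Sigma> where "\<Sigma> = (\<Sum>\<psi>\<in>\<Psi>. ennreal ((LBINT x. \<psi> x * u x)\<^sup>2))"
    have "(\<integral>\<^sup>+x. ennreal ((u x)\<^sup>2) * indicator {x. s \<le> norm x \<and> norm x \<le> R} x \<partial>lborel) \<le>
       (\<integral>\<^sup>+x. ennreal (1 / \<kappa>\<^sup>2) * (ennreal ((\<eta> x * u x)\<^sup>2) * indicator (cball 0 R) x) \<partial>lborel)"
    proof (rule nn_integral_mono)
      fix x
      show "ennreal ((u x)\<^sup>2) * indicator {x. s \<le> norm x \<and> norm x \<le> R} x \<le>
        ennreal (1 / \<kappa>\<^sup>2) * (ennreal ((\<eta> x * u x)\<^sup>2) * indicator (cball 0 R) x)"
      proof (cases "s \<le> norm x \<and> norm x \<le> R")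
        case True
        have "\<kappa>\<^sup>2 \<le> (\<eta> x)\<^sup>2" using \<eta>\<kappa> True \<kappa> by (intro power_mono) auto
        then have "1 * (u x)\<^sup>2 \<le> ((\<eta> x)\<^sup>2 / \<kappa>\<^sup>2) * (u x)\<^sup>2" using \<kappa> by (intro mult_right_mono) auto
        then show ?thesis using True by (simp add: ennreal_leI power_mult_distrib flip: ennreal_mult)
      qed simp
    qed
    also have "\<dots> = ennreal (1 / \<kappa>\<^sup>2) * (\<integral>\<^sup>+x. ennreal ((\<eta> x * u x)\<^sup>2) * indicator (cball 0 R) x \<partial>lborel)"
      by (rule nn_integral_cmult) measurable
    also have "\<dots> \<le> ennreal (1 / \<kappa>\<^sup>2) * (ennreal (2 ^ (CARD('n) + 3) * h\<^sup>2) * (ennreal C0 * energy \<alpha> u) + ennreal C * \<Sigma>)"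
      unfolding \<Sigma>_def
      by (intro mult_left_mono order_trans[OF \<Psi>(4)[OF u]] add_right_mono C0(2)[OF u]) auto
    also have "\<dots> = ennreal (1 / \<kappa>\<^sup>2) * (ennreal (2 ^ (CARD('n) + 3) * h\<^sup>2) * (ennreal C0 * energy \<alpha> u)) + ennreal (1 / \<kappa>\<^sup>2) * (ennreal C * \<Sigma>)"
      by (rule distrib_left)
    also have "\<dots> = ennreal (1 / \<kappa>\<^sup>2 * (2 ^ (CARD('n) + 3) * h\<^sup>2 * C0)) * energy \<alpha> u + ennreal (1 / \<kappa>\<^sup>2 * C) * \<Sigma>"
      by (intro arg_cong2[where f = "(+)"] ennreal_mult3 ennreal_mult_mult) (use C0(1) \<Psi>(2) in auto)
    finally show "(\<integral>\<^sup>+x. ennreal ((u x)\<^sup>2) * indicator {x. s \<le> norm x \<and> norm x \<le> R} x \<partial>lborel) \<le>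
      ennreal \<epsilon> * energy \<alpha> u + ennreal (C / \<kappa>\<^sup>2) * (\<Sum>\<psi>\<in>\<Psi>. ennreal ((LBINT x. \<psi> x * u x)\<^sup>2))"
      using h(2) by (simp add: \<Sigma>_def)
  qed
qed

section \<open>Convergence in the mean and test functions\<close>

text \<open>The integral of the sum over k is finite, so the series converges almost everywhere and
  its terms tend to 0.\<close>

lemma AE_tendsto_zero_fast:
  fixes f :: "nat \<Rightarrow> 'a \<Rightarrow> real"
  assumes [measurable]: "\<And>k. f k \<in> borel_measurable M" and nonneg: "\<And>k x. 0 \<le> f k x"
    and le: "\<And>k. (\<integral>\<^sup>+x. ennreal (f k x) \<partial>M) \<le> ennreal ((1/2) ^ k)"
  shows "AE x in M. (\<lambda>k. f k x) \<longlonglongrightarrow> 0"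
proof -
  have "(\<integral>\<^sup>+x. (\<Sum>k. ennreal (f k x)) \<partial>M) = (\<Sum>k. \<integral>\<^sup>+x. ennreal (f k x) \<partial>M)"
    by (rule nn_integral_suminf) measurable
  also have "\<dots> \<le> (\<Sum>k. ennreal ((1/2) ^ k))" by (intro suminf_le le) auto
  also have "\<dots> < \<infinity>"
    unfolding infinity_ennreal_def less_top[symmetric]
    by (rule ennreal_suminf_neq_top) (auto intro: summable_geometric)
  finally have "AE x in M. (\<Sum>k. ennreal (f k x)) \<noteq> \<infinity>"
    by (intro nn_integral_PInf_AE) auto
  then show ?thesis
  proof eventually_elim
    case (elim x)
    then have "summable (\<lambda>k. f k x)" using nonneg by (intro summable_suminf_not_top) auto
    then show ?case by (rule summable_LIMSEQ_zero)
  qed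
qed

lemma powr_tendsto_zeroD:
  fixes a :: "nat \<Rightarrow> real"
  assumes "(\<lambda>k. a k powr p) \<longlonglongrightarrow> 0" "p > 0" "\<And>k. a k \<ge> 0"
  shows "a \<longlonglongrightarrow> 0"
proof -
  have "(\<lambda>k. (a k powr p) powr (1 / p)) \<longlonglongrightarrow> 0 powr (1 / p)"
    using assms by (intro tendsto_powr') auto
  then show ?thesis using assms by (simp add: powr_powr)
qed

lemma mean_convergence_AE_subseq:
  fixes f :: "nat \<Rightarrow> 'a \<Rightarrow> 'b::{real_normed_vector, second_countable_topology}"
  assumes [measurable]: "\<And>n. f n \<in> borel_measurable M" "g \<in> borel_measurable M" and p: "p > 0"
    and lim: "(\<lambda>n. \<integral>\<^sup>+x. ennreal (norm (f n x - g x) powr p) \<partial>M) \<longlonglongrightarrow> 0"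
  obtains r :: "nat \<Rightarrow> nat" where "strict_mono r" "AE x in M. (\<lambda>n. f (r n) x) \<longlonglongrightarrow> g x"
proof -
  have "\<exists>K. \<forall>n\<ge>K. (\<integral>\<^sup>+x. ennreal (norm (f n x - g x) powr p) \<partial>M) \<le> ennreal ((1/2) ^ k)" for k
    using order_tendstoD(2)[OF lim, of "ennreal ((1/2) ^ k)"]
    by (auto simp: eventually_sequentially intro: less_imp_le)
  then obtain K where K: "\<And>k n. n \<ge> K k \<Longrightarrow> (\<integral>\<^sup>+x. ennreal (norm (f n x - g x) powr p) \<partial>M) \<le> ennreal ((1/2) ^ k)"
    by metis
  \<comment> \<open>Summing the thresholds and adding k makes \<open>r\<close> strictly increasing
    while keeping r k \<ge> K k.\<close>
  define r where "r k = (\<Sum>j\<le>k. K j) + k" for k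
  have r: "strict_mono r" "K k \<le> r k" for k
    by (auto simp: r_def strict_mono_Suc_iff intro: trans_le_add1 member_le_sum)
  have "AE x in M. (\<lambda>k. norm (f (r k) x - g x) powr p) \<longlonglongrightarrow> 0"
    by (rule AE_tendsto_zero_fast) (auto intro!: K r)
  then have "AE x in M. (\<lambda>k. f (r k) x) \<longlonglongrightarrow> g x"
  proof eventually_elim
    case (elim x)
    from powr_tendsto_zeroD[OF this p] show ?case
      by (auto simp: tendsto_norm_zero_iff LIM_zero_iff)
  qed
  with r(1) show ?thesis by (rule that)
qed

text \<open>Completeness of L^p, phrased with integrals of p-th powers, so that it needs no triangle
  inequality for the norm and applies to scalar and vector valued functions alike.\<close>

lemma mean_Cauchy_convergent:
  fixes f :: "nat \<Rightarrow> 'a \<Rightarrow> 'b::{banach, second_countable_topology}"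
  assumes [measurable]: "\<And>n. f n \<in> borel_measurable M" and p: "p > 0"
    and Cauchy: "\<And>e. e > 0 \<Longrightarrow> \<exists>K. \<forall>m\<ge>K. \<forall>n\<ge>K. (\<integral>\<^sup>+x. ennreal (norm (f m x - f n x) powr p) \<partial>M) \<le> ennreal e"
  obtains g where "g \<in> borel_measurable M" "(\<lambda>n. \<integral>\<^sup>+x. ennreal (norm (f n x - g x) powr p) \<partial>M) \<longlonglongrightarrow> 0"
proof -
  \<comment> \<open>The factor 2^(-kp) forces the k-th increment of the subsequence to be below
    2^(-k) eventually, at almost every point; the factor 2^(-k) is the one that the almost
    everywhere lemma asks for.\<close>
  define e where "e k = 2 powr (- (real k * p)) * (1/2) ^ k" for k
  have e: "e k > 0" for k by (simp add: e_def)
  obtain K where K: "\<And>k m n. m \<ge> K k \<Longrightarrow> n \<ge> K k \<Longrightarrow> (\<integral>\<^sup>+x. ennreal (norm (f m x - f n x) powr p) \<partial>M) \<le> ennreal (e k)"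
    using Cauchy[OF e] by metis
  define r where "r k = (\<Sum>j\<le>k. K j) + k" for k
  have r: "strict_mono r" "K k \<le> r k" for k
    by (auto simp: r_def strict_mono_Suc_iff intro: trans_le_add1 member_le_sum)
  have r': "K k \<le> r (Suc k)" for k
    using r(2)[of k] strict_monoD[OF r(1), of k "Suc k"] by simp
  have "AE x in M. (\<lambda>k. 2 powr (real k * p) * norm (f (r (Suc k)) x - f (r k) x) powr p) \<longlonglongrightarrow> 0"
  proof (rule AE_tendsto_zero_fast)
    fix k
    have "(\<integral>\<^sup>+x. ennreal (2 powr (real k * p) * norm (f (r (Suc k)) x - f (r k) x) powr p) \<partial>M)
       = ennreal (2 powr (real k * p)) * (\<integral>\<^sup>+x. ennreal (norm (f (r (Suc k)) x - f (r k) x) powr p) \<partial>M)"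
      by (simp add: ennreal_mult nn_integral_cmult)
    also have "\<dots> \<le> ennreal (2 powr (real k * p)) * ennreal (e k)"
      by (intro mult_left_mono K r r') auto
    also have "\<dots> = ennreal ((1/2) ^ k)"
      by (simp add: e_def powr_minus flip: ennreal_mult mult.assoc)
    finally show "(\<integral>\<^sup>+x. ennreal (2 powr (real k * p) * norm (f (r (Suc k)) x - f (r k) x) powr p) \<partial>M) \<le> ennreal ((1/2) ^ k)" .
  qed auto
  then have conv: "AE x in M. convergent (\<lambda>k. f (r k) x)"
  proof eventually_elim
    case (elim x)
    have eq: "2 powr (real k * p) * norm (f (r (Suc k)) x - f (r k) x) powr p = (2 ^ k * norm (f (r (Suc k)) x - f (r k) x)) powr p" for k
      by (simp add: powr_mult powr_powr flip: powr_realpow)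
    have "(\<lambda>k. 2 ^ k * norm (f (r (Suc k)) x - f (r k) x)) \<longlonglongrightarrow> 0"
      using elim unfolding eq by (rule powr_tendsto_zeroD) (use p in auto)
    then have "\<forall>\<^sub>F k in sequentially. 2 ^ k * norm (f (r (Suc k)) x - f (r k) x) < 1"
      by (rule order_tendstoD) simp
    then have "\<forall>\<^sub>F k in sequentially. norm (f (r (Suc k)) x - f (r k) x) \<le> (1/2) ^ k"
      by eventually_elim (simp add: power_divide field_simps)
    then have "summable (\<lambda>k. f (r (Suc k)) x - f (r k) x)"
      by (rule summable_comparison_test_ev) (simp add: summable_geometric)
    then have "(\<lambda>n. f (r 0) x + (\<Sum>k<n. f (r (Suc k)) x - f (r k) x)) \<longlonglongrightarrow>
        f (r 0) x + (\<Sum>k. f (r (Suc k)) x - f (r k) x)"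
      by (intro tendsto_intros summable_LIMSEQ)
    then show ?case by (auto simp: sum_lessThan_telescope[of "\<lambda>k. f (r k) x"] convergent_def)
  qed
  define g where "g x = lim (\<lambda>k. f (r k) x)" for x
  have g [measurable]: "g \<in> borel_measurable M" unfolding g_def by measurable
  have conv': "AE x in M. (\<lambda>k. f (r k) x) \<longlonglongrightarrow> g x"
    using conv by eventually_elim (simp add: g_def convergent_LIMSEQ_iff)
  \<comment> \<open>Fatou's lemma along the subsequence transfers the Cauchy bound to the limit, and
    so yields convergence of the full sequence.\<close>
  have le: "(\<integral>\<^sup>+x. ennreal (norm (f n x - g x) powr p) \<partial>M) \<le> ennreal d"
    if n: "\<And>m. m \<ge> L \<Longrightarrow> (\<integral>\<^sup>+x. ennreal (norm (f n x - f m x) powr p) \<partial>M) \<le> ennreal d" for n L d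
  proof -
    have "(\<integral>\<^sup>+x. ennreal (norm (f n x - g x) powr p) \<partial>M) \<le> (\<integral>\<^sup>+x. liminf (\<lambda>k. ennreal (norm (f n x - f (r k) x) powr p)) \<partial>M)"
    proof (rule nn_integral_mono_AE, use conv' in eventually_elim)
      case (elim x)
      then have "(\<lambda>k. ennreal (norm (f n x - f (r k) x) powr p)) \<longlonglongrightarrow> ennreal (norm (f n x - g x) powr p)"
        using p by (intro tendsto_ennrealI tendsto_powr' tendsto_intros) auto
      from lim_imp_Liminf[OF trivial_limit_sequentially this] show ?case by simp
    qed
    also have "\<dots> \<le> liminf (\<lambda>k. \<integral>\<^sup>+x. ennreal (norm (f n x - f (r k) x) powr p) \<partial>M)"
      by (rule nn_integral_liminf) measurable
    also have "\<dots> \<le> ennreal d"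
    proof (rule Liminf_le)
      show "\<forall>\<^sub>F k in sequentially. (\<integral>\<^sup>+x. ennreal (norm (f n x - f (r k) x) powr p) \<partial>M) \<le> ennreal d"
        using eventually_ge_at_top[of L]
        by eventually_elim (use n strict_mono_imp_increasing[OF r(1)] in \<open>blast intro: order_trans\<close>)
    qed auto
    finally show ?thesis .
  qed
  have "(\<lambda>n. \<integral>\<^sup>+x. ennreal (norm (f n x - g x) powr p) \<partial>M) \<longlonglongrightarrow> 0"
  proof (rule order_tendstoI)
    fix a :: ennreal assume "0 < a"
    then obtain b where b: "0 < b" "b < a" using dense by blast
    then have "b < top" using top_greatest by (rule_tac less_le_trans)
    then obtain d where d: "b = ennreal d" using less_top_ennreal by blast
    then have d: "d > 0" "ennreal d < a" using b by (auto simp: ennreal_less_zero_iff)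
    obtain K where "\<forall>m\<ge>K. \<forall>n\<ge>K. (\<integral>\<^sup>+x. ennreal (norm (f m x - f n x) powr p) \<partial>M) \<le> ennreal d"
      using Cauchy[OF d(1)] by blast
    then have "(\<integral>\<^sup>+x. ennreal (norm (f n x - g x) powr p) \<partial>M) \<le> ennreal d" if "n \<ge> K" for n
      using le[of K n d] that by blast
    then show "\<forall>\<^sub>F n in sequentially. (\<integral>\<^sup>+x. ennreal (norm (f n x - g x) powr p) \<partial>M) < a"
      using d(2) unfolding eventually_sequentially by (meson le_less_trans)
  qed simp
  with g show ?thesis by (rule that)
qed

text \<open>An open set is a countable union of balls; 1 minus the product of 1 - bump over the
  first m balls, each with sharpness m, is smooth, stays in [0, 1] and tends to 1 as soon as one
  factor tends to 0.\<close>

lemma smooth_indicator_approx: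
  fixes V :: "(real ^ 'n::finite) set"
  assumes V: "open V" "bounded V"
  obtains \<psi> where "\<And>m. \<psi> m \<in> test_functions" "\<And>m x. 0 \<le> \<psi> m x" "\<And>m x. \<psi> m x \<le> 1"
    "\<And>m x. x \<notin> V \<Longrightarrow> \<psi> m x = 0" "\<And>x. (\<lambda>m. \<psi> m x) \<longlonglongrightarrow> indicator V x"
proof -
  define \<F> where "\<F> = {ball c r | c r. 0 < r \<and> ball c r \<subseteq> V}"
  have un: "\<Union>\<F> = V"
  proof
    show "V \<subseteq> \<Union>\<F>"
    proof
      fix x assume "x \<in> V"
      then obtain r where "r > 0" "ball x r \<subseteq> V" using V(1) openE by blast
      then have "ball x r \<in> \<F>" "x \<in> ball x r" by (auto simp: \<F>_def)
      then show "x \<in> \<Union>\<F>" by blast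
    qed
  qed (auto simp: \<F>_def)
  obtain \<F>' where F': "\<F>' \<subseteq> \<F>" "countable \<F>'" "\<Union>\<F>' = \<Union>\<F>"
    by (rule Lindelof_openin[of \<F> UNIV]) (auto simp: \<F>_def)
  \<comment> \<open>The empty set is added to make the enumerated family non-empty; it is
    represented by a ball of radius 0.\<close>
  have "\<exists>c r. 0 \<le> r \<and> ball c r = from_nat_into (insert {} \<F>') j \<and> ball c r \<subseteq> V" for j
  proof -
    have "from_nat_into (insert {} \<F>') j \<in> insert {} \<F>'" by (rule from_nat_into) simp
    then consider "from_nat_into (insert {} \<F>') j = {}" | "from_nat_into (insert {} \<F>') j \<in> \<F>" using F' by blast
    then show ?thesis
    proof cases
      case 1
      then show ?thesis by (intro exI[of _ 0]) auto
    next
      case 2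
      then obtain c r where "from_nat_into (insert {} \<F>') j = ball c r" "0 < r" "ball c r \<subseteq> V"
        unfolding \<F>_def by blast
      then show ?thesis by (intro exI[of _ c] exI[of _ r]) simp
    qed
  qed
  then obtain c r where cr: "\<And>j. 0 \<le> r j" "\<And>j. ball (c j) (r j) = from_nat_into (insert {} \<F>') j" "\<And>j. ball (c j) (r j) \<subseteq> V"
    by metis
  have cover: "(\<Union>j. ball (c j) (r j)) = V"
  proof -
    have "(\<Union>j. ball (c j) (r j)) = \<Union>(range (from_nat_into (insert {} \<F>')))" by (simp add: cr(2))
    also have "\<dots> = \<Union>(insert {} \<F>')" using F'(2) by (subst range_from_nat_into) auto
    finally show ?thesis using F'(3) un by simp
  qed
  define \<psi> where "\<psi> m x = 1 - (\<Prod>j<m. 1 - bump (c j) (r j) (real m) x)" for m x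
  have prod01: "0 \<le> (\<Prod>j<m. 1 - bump (c j) (r j) (real m) x)" "(\<Prod>j<m. 1 - bump (c j) (r j) (real m) x) \<le> 1" for m x
    by (auto intro!: prod_nonneg prod_le_1 simp: bump_le_1 bump_nonneg)
  have zero: "\<psi> m x = 0" if "x \<notin> V" for m x
  proof -
    have "bump (c j) (r j) (real m) x = 0" for j
    proof (rule bump_eq_0)
      show "x \<notin> ball (c j) (r j)" using that cr(3)[of j] by blast
    qed (use cr(1) in auto)
    then show ?thesis by (simp add: \<psi>_def)
  qed
  show ?thesis
  proof (rule that[of \<psi>])
    show "\<psi> m \<in> test_functions" for m
    proof (rule test_functionsI[where B = V])
      show "smooth (\<psi> m)" unfolding \<psi>_def[abs_def]
        by (intro smooth_diff smooth_prod smooth_const smooth_bump)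
    qed (use zero V in auto)
    show "0 \<le> \<psi> m x" "\<psi> m x \<le> 1" for m x using prod01[of m x] by (auto simp: \<psi>_def)
    show "\<psi> m x = 0" if "x \<notin> V" for m x by (rule zero[OF that])
    show "(\<lambda>m. \<psi> m x) \<longlonglongrightarrow> indicator V x" for x
    proof (cases "x \<in> V")
      case True
      then obtain i where i: "x \<in> ball (c i) (r i)" using cover by blast
      have "(\<lambda>m. 1 - bump (c i) (r i) (real m) x) \<longlonglongrightarrow> 1 - indicator (ball (c i) (r i)) x"
        by (intro tendsto_intros bump_tendsto cr)
      then have lim: "(\<lambda>m. 1 - bump (c i) (r i) (real m) x) \<longlonglongrightarrow> 0" using i by simp
      have "(\<lambda>m. \<Prod>j<m. 1 - bump (c j) (r j) (real m) x) \<longlonglongrightarrow> 0"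
      proof (rule tendsto_sandwich[OF _ _ tendsto_const lim])
        show "\<forall>\<^sub>F m in sequentially. (\<Prod>j<m. 1 - bump (c j) (r j) (real m) x) \<le> 1 - bump (c i) (r i) (real m) x"
          using eventually_gt_at_top[of i]
        proof eventually_elim
          case (elim m)
          have "(\<Prod>j<m. 1 - bump (c j) (r j) (real m) x) = (1 - bump (c i) (r i) (real m) x) * (\<Prod>j\<in>{..<m} - {i}. 1 - bump (c j) (r j) (real m) x)"
            using elim by (intro prod.remove) auto
          also have "\<dots> \<le> (1 - bump (c i) (r i) (real m) x) * 1"
            by (intro mult_left_mono prod_le_1) (auto simp: bump_le_1 bump_nonneg)
          finally show ?case by simp
        qed
      qed (use prod01 in auto)
      then have "(\<lambda>m. \<psi> m x) \<longlonglongrightarrow> 1 - 0" unfolding \<psi>_def by (intro tendsto_intros)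
      then show ?thesis using True by simp
    qed (simp add: zero)
  qed
qed

text \<open>A quadratic form sees only squares of test functions. These approximate indicators of
  open sets, and open sets approximate the set S where h > 0 from outside; so the integral of h over
  S is at most 0, and S is null.\<close>

lemma AE_nonpos_if_test_nonpos:
  fixes h :: "real ^ 'n::finite \<Rightarrow> real"
  assumes A: "open A" "bounded A" and int: "set_integrable lebesgue A h"
    and le: "\<And>\<psi>. \<psi> \<in> test_functions \<Longrightarrow> (\<And>x. x \<notin> A \<Longrightarrow> \<psi> x = 0) \<Longrightarrow> (\<integral>x. h x * (\<psi> x)\<^sup>2 \<partial>lebesgue) \<le> 0"
  shows "AE x in lebesgue. x \<in> A \<longrightarrow> h x \<le> 0"
proof -
  have iA: "integrable lebesgue (\<lambda>x. indicator A x * h x)"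
    using int by (simp add: set_integrable_def)
  then have [measurable]: "(\<lambda>x. indicator A x * h x) \<in> borel_measurable lebesgue" by blast
  have open_le: "(\<integral>x. indicator V x * (indicator A x * h x) \<partial>lebesgue) \<le> 0" if V: "open V" "V \<subseteq> A" for V
  proof -
    obtain \<psi> where \<psi>: "\<And>m. \<psi> m \<in> test_functions" "\<And>m x. 0 \<le> \<psi> m x" "\<And>m x. \<psi> m x \<le> 1"
      "\<And>m x. x \<notin> V \<Longrightarrow> \<psi> m x = 0" "\<And>x. (\<lambda>m. \<psi> m x) \<longlonglongrightarrow> indicator V x"
      using smooth_indicator_approx[OF V(1) bounded_subset[OF A(2) V(2)]] by blast
    have [measurable]: "\<psi> m \<in> borel_measurable lebesgue" for m
      using \<psi>(1) test_smooth smooth_measurable measurable_completion by (metis measurable_lborel2)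
    have [measurable]: "V \<in> sets lebesgue" using V by auto
    have "(\<lambda>m. \<integral>x. (\<psi> m x)\<^sup>2 * (indicator A x * h x) \<partial>lebesgue) \<longlonglongrightarrow> (\<integral>x. indicator V x * (indicator A x * h x) \<partial>lebesgue)"
    proof (rule integral_dominated_convergence[where w = "\<lambda>x. \<bar>indicator A x * h x\<bar>"])
      show "integrable lebesgue (\<lambda>x. \<bar>indicator A x * h x\<bar>)" using iA by simp
      have "(\<lambda>m. (\<psi> m x)\<^sup>2 * (indicator A x * h x)) \<longlonglongrightarrow> (indicator V x)\<^sup>2 * (indicator A x * h x)" for x
        by (intro tendsto_intros \<psi>)
      moreover have "(indicator V x)\<^sup>2 = (indicator V x :: real)" for x by (simp add: indicator_def)
      ultimately show "AE x in lebesgue. (\<lambda>m. (\<psi> m x)\<^sup>2 * (indicator A x * h x)) \<longlonglongrightarrow> indicator V x * (indicator A x * h x)"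
        by simp
      show "AE x in lebesgue. norm ((\<psi> m x)\<^sup>2 * (indicator A x * h x)) \<le> \<bar>indicator A x * h x\<bar>" for m
        using \<psi>(2,3)[of m] by (auto simp: abs_mult power_le_one intro!: mult_left_le_one_le)
    qed measurable
    moreover have "(\<integral>x. (\<psi> m x)\<^sup>2 * (indicator A x * h x) \<partial>lebesgue) \<le> 0" for m
    proof -
      have "(\<lambda>x. (\<psi> m x)\<^sup>2 * (indicator A x * h x)) = (\<lambda>x. h x * (\<psi> m x)\<^sup>2)"
        using \<psi>(4) V(2) by (auto simp: indicator_def fun_eq_iff)
      then show ?thesis using le[OF \<psi>(1)[of m]] \<psi>(4)[of _ m] V(2) by auto
    qed
    ultimately show ?thesis using LIMSEQ_le_const2 by blast
  qed
  define S where "S = {x. indicator A x * h x > 0}"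
  have S [measurable]: "S \<in> sets lebesgue" 
  proof -
    have "{x \<in> space lebesgue. 0 < indicator A x * h x} \<in> sets lebesgue" by measurable
    then show ?thesis by (simp add: S_def)
  qed
  have SA: "S \<subseteq> A" by (auto simp: S_def indicator_def)
  \<comment> \<open>Excess measure below 2^(-n) makes the sum finite, so by Borel-Cantelli almost
    every point outside S lies in only finitely many of the open sets, and their indicators converge
    to that of S.\<close>
  define P where "P n T \<longleftrightarrow> open T \<and> S \<subseteq> T \<and> (T - S) \<in> lmeasurable \<and> emeasure lebesgue (T - S) < ennreal ((1/2) ^ n)"
    for n :: nat and T
  have "\<exists>T. P n T" for n unfolding P_def
    by (rule sets_lebesgue_outer_open[OF S, of "(1/2) ^ n"]) auto
  then obtain T where "\<And>n. P n (T n)" by metis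
  then have T: "\<And>n. open (T n)" "\<And>n. S \<subseteq> T n" "\<And>n. T n - S \<in> lmeasurable"
      "\<And>n. emeasure lebesgue (T n - S) < ennreal ((1/2) ^ n)" by (simp_all add: P_def)
  have [measurable]: "T n \<in> sets lebesgue" for n using T(1) by auto
  have "AE x in lebesgue. eventually (\<lambda>n. x \<in> space lebesgue - (T n - S)) sequentially"
  proof (rule borel_cantelli_AE1)
    show "summable (\<lambda>n. measure lebesgue (T n - S))"
    proof (rule summable_comparison_test')
      show "summable (\<lambda>n. (1/2::real) ^ n)" by (simp add: summable_geometric)
      show "norm (measure lebesgue (T n - S)) \<le> (1/2) ^ n" for n
        using T(4)[of n] by (simp add: measure_def enn2real_leI)
    qed
    show "T n - S \<in> sets lebesgue" for n using T(3) by (rule fmeasurableD)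
    show "emeasure lebesgue (T n - S) < \<infinity>" for n by (rule less_trans[OF T(4)]) simp
  qed
  then have ev: "AE x in lebesgue. (\<lambda>n. indicator (T n \<inter> A) x * (indicator A x * h x)) \<longlonglongrightarrow> indicator S x * (indicator A x * h x)"
  proof eventually_elim
    case (elim x)
    then have "\<forall>\<^sub>F n in sequentially. indicator (T n \<inter> A) x * (indicator A x * h x) = indicator S x * (indicator A x * h x)"
      by eventually_elim (use T(2) SA in \<open>auto simp: indicator_def\<close>)
    then show ?case by (rule tendsto_eventually)
  qed
  have "(\<lambda>n. \<integral>x. indicator (T n \<inter> A) x * (indicator A x * h x) \<partial>lebesgue) \<longlonglongrightarrow> (\<integral>x. indicator S x * (indicator A x * h x) \<partial>lebesgue)"
  proof (rule integral_dominated_convergence[where w = "\<lambda>x. \<bar>indicator A x * h x\<bar>", OF _ _ _ ev])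
    show "(\<lambda>x. indicator (T n \<inter> A) x * (indicator A x * h x)) \<in> borel_measurable lebesgue" for n
    proof -
      have [measurable]: "T n \<inter> A \<in> sets lebesgue" using A T by auto
      show ?thesis by measurable
    qed
  qed (use iA in \<open>auto split: split_indicator\<close>)
  moreover have "(\<integral>x. indicator (T n \<inter> A) x * (indicator A x * h x) \<partial>lebesgue) \<le> 0" for n
    by (rule open_le) (use T A in auto)
  ultimately have "(\<integral>x. indicator S x * (indicator A x * h x) \<partial>lebesgue) \<le> 0" using LIMSEQ_le_const2 by blast
  moreover have nn: "0 \<le> indicator S x * (indicator A x * h x)" for x by (auto simp: S_def indicator_def)
  ultimately have "(\<integral>x. indicator S x * (indicator A x * h x) \<partial>lebesgue) = 0"
    by (intro antisym Bochner_Integration.integral_nonneg) auto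
  moreover have "integrable lebesgue (\<lambda>x. indicator S x * (indicator A x * h x))"
    using integrable_mult_indicator[OF S iA] by simp
  ultimately have "AE x in lebesgue. indicator S x * (indicator A x * h x) = 0"
    using nn by (subst (asm) integral_nonneg_eq_0_iff_AE) auto
  then show ?thesis by eventually_elim (auto simp: S_def indicator_def split: if_splits)
qed

section \<open>The completion as a space of functions\<close>

lemma lebesgue_ident_measurable [measurable]: "(\<lambda>x. x) \<in> borel_measurable lebesgue"
  by (rule measurable_completion) simp

lemma ennreal_lincomb:
  assumes "0 \<le> a" "0 \<le> b" "0 \<le> x" "0 \<le> y"
  shows "ennreal (a * x + b * y) = ennreal a * ennreal x + ennreal b * ennreal y"
  using assms by (simp add: ennreal_mult)

text \<open>The parameter \<open>dim\<close> pins down the type \<open>'n\<close>, which the real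
  number \<alpha> does not determine.\<close>

locale weighted_space =
  fixes \<alpha> :: real and dim :: "'n::finite itself"
  assumes \<alpha>: "0 < \<alpha>" "\<alpha> < 2" and N: "3 \<le> CARD('n)"
begin

definition q :: real where "q = critical_exponent CARD('n) \<alpha>"

definition wen :: "(real ^ 'n \<Rightarrow> real ^ 'n) \<Rightarrow> ennreal" where
  "wen G = (\<integral>\<^sup>+x. ennreal (norm x powr \<alpha> * (norm (G x))\<^sup>2) \<partial>lebesgue)"

definition qint :: "(real ^ 'n \<Rightarrow> real) \<Rightarrow> ennreal" where
  "qint u = (\<integral>\<^sup>+x. ennreal (\<bar>u x\<bar> powr q) \<partial>lebesgue)"

definition approx :: "(nat \<Rightarrow> real ^ 'n \<Rightarrow> real) \<Rightarrow> (real ^ 'n \<Rightarrow> real) \<Rightarrow> (real ^ 'n \<Rightarrow> real ^ 'n) \<Rightarrow> bool" where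
  "approx \<phi> u G \<longleftrightarrow> (\<forall>n. \<phi> n \<in> test_functions) \<and>
     (\<lambda>n. wen (\<lambda>x. gradient (\<phi> n) x - G x)) \<longlonglongrightarrow> 0 \<and> (\<lambda>n. qint (\<lambda>x. \<phi> n x - u x)) \<longlonglongrightarrow> 0"

abbreviation hwg :: "(real ^ 'n \<Rightarrow> real) \<Rightarrow> (real ^ 'n \<Rightarrow> real ^ 'n) \<Rightarrow> bool" where
  "hwg \<equiv> has_weighted_gradient \<alpha>"

lemma hwg_iff: "hwg u G \<longleftrightarrow> u \<in> borel_measurable lebesgue \<and> G \<in> borel_measurable lebesgue \<and> (\<exists>\<phi>. approx \<phi> u G)"
  by (simp add: has_weighted_gradient_def approx_def wen_def qint_def q_def)

lemma hwgD: "hwg u G \<Longrightarrow> u \<in> borel_measurable lebesgue" "hwg u G \<Longrightarrow> G \<in> borel_measurable lebesgue"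
  by (auto simp: hwg_iff)

lemma q_gt_2: "q > 2" unfolding q_def by (rule critical_exponent_props[OF \<alpha> N])

lemma test_measurable: "\<phi> \<in> test_functions \<Longrightarrow> \<phi> \<in> borel_measurable lebesgue"
  by (intro measurable_completion) (simp add: smooth_measurable test_smooth)

lemma test_gradient_measurable: "\<phi> \<in> test_functions \<Longrightarrow> gradient \<phi> \<in> borel_measurable lebesgue"
  by (intro measurable_completion) (simp add: gradient_measurable test_smooth)

lemma wen_gradient: "wen (gradient \<phi>) = energy \<alpha> \<phi>"
  by (simp add: wen_def energy_def nn_integral_completion)

lemma energy_finite: assumes "\<phi> \<in> test_functions" shows "energy \<alpha> \<phi> < \<infinity>"
proof -
  obtain R where R: "\<And>x. norm x \<ge> R \<Longrightarrow> gradient \<phi> x = 0" using test_support[OF assms] by metis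
  have "integrable lborel (\<lambda>x. norm x powr \<alpha> * (norm (gradient \<phi> x))\<^sup>2)"
    by (rule integrable_bounded_support[of _ R])
      (use R \<alpha> assms in \<open>auto intro!: continuous_intros continuous_on_powr' continuous_gradient test_smooth\<close>)
  then show ?thesis unfolding energy_def by (simp add: nn_integral_eq_integral)
qed

lemma wen_add_le:
  assumes [measurable]: "G \<in> borel_measurable lebesgue" "H \<in> borel_measurable lebesgue" and \<delta>: "\<delta> > 0"
  shows "wen (\<lambda>x. G x + H x) \<le> ennreal (1 + \<delta>) * wen G + ennreal (1 + 1 / \<delta>) * wen H"
proof -
  have pw: "(norm (a + b))\<^sup>2 \<le> (1 + \<delta>) * (norm a)\<^sup>2 + (1 + 1 / \<delta>) * (norm b)\<^sup>2" for a b :: "real ^ 'n"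
  proof -
    have "(norm (a + b))\<^sup>2 \<le> (norm a + norm b)\<^sup>2" by (intro power_mono norm_triangle_ineq) auto
    moreover have "0 \<le> (sqrt \<delta> * norm a - norm b / sqrt \<delta>)\<^sup>2" by simp
    then have "2 * norm a * norm b \<le> \<delta> * (norm a)\<^sup>2 + (norm b)\<^sup>2 / \<delta>"
      using \<delta> by (simp add: power2_diff power_mult_distrib power_divide)
    ultimately show ?thesis by (simp add: power2_sum algebra_simps)
  qed
  have "wen (\<lambda>x. G x + H x) \<le> (\<integral>\<^sup>+x. ennreal (1 + \<delta>) * ennreal (norm x powr \<alpha> * (norm (G x))\<^sup>2) +
      ennreal (1 + 1 / \<delta>) * ennreal (norm x powr \<alpha> * (norm (H x))\<^sup>2) \<partial>lebesgue)"
    unfolding wen_def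
  proof (rule nn_integral_mono)
    fix x
    have "norm x powr \<alpha> * (norm (G x + H x))\<^sup>2 \<le> norm x powr \<alpha> * ((1 + \<delta>) * (norm (G x))\<^sup>2 + (1 + 1 / \<delta>) * (norm (H x))\<^sup>2)"
      by (intro mult_left_mono pw) auto
    also have "\<dots> = (1 + \<delta>) * (norm x powr \<alpha> * (norm (G x))\<^sup>2) + (1 + 1 / \<delta>) * (norm x powr \<alpha> * (norm (H x))\<^sup>2)"
      by (simp add: distrib_left mult_ac)
    finally have "ennreal (norm x powr \<alpha> * (norm (G x + H x))\<^sup>2) \<le>
      ennreal ((1 + \<delta>) * (norm x powr \<alpha> * (norm (G x))\<^sup>2) + (1 + 1 / \<delta>) * (norm x powr \<alpha> * (norm (H x))\<^sup>2))"
      by (rule ennreal_leI)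
    also have "\<dots> = ennreal (1 + \<delta>) * ennreal (norm x powr \<alpha> * (norm (G x))\<^sup>2) +
      ennreal (1 + 1 / \<delta>) * ennreal (norm x powr \<alpha> * (norm (H x))\<^sup>2)"
      by (rule ennreal_lincomb) (use \<delta> in auto)
    finally show "ennreal (norm x powr \<alpha> * (norm (G x + H x))\<^sup>2) \<le> \<dots>" .
  qed
  also have "\<dots> = ennreal (1 + \<delta>) * wen G + ennreal (1 + 1 / \<delta>) * wen H"
    unfolding wen_def by (simp add: nn_integral_add nn_integral_cmult)
  finally show ?thesis .
qed

lemma wen_add_le2:
  assumes "G \<in> borel_measurable lebesgue" "H \<in> borel_measurable lebesgue"
  shows "wen (\<lambda>x. G x + H x) \<le> ennreal 2 * wen G + ennreal 2 * wen H"
  using wen_add_le[OF assms, of 1] by simp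

lemma wen_scale:
  assumes [measurable]: "G \<in> borel_measurable lebesgue"
  shows "wen (\<lambda>x. c *\<^sub>R G x) = ennreal (c\<^sup>2) * wen G"
  unfolding wen_def by (subst nn_integral_cmult[symmetric])
    (auto simp: power_mult_distrib mult_ac simp flip: ennreal_mult intro!: nn_integral_cong)

lemma wen_minus: "wen (\<lambda>x. - G x) = wen G"
  by (simp add: wen_def)

lemma qint_add_le:
  assumes [measurable]: "u \<in> borel_measurable lebesgue" "v \<in> borel_measurable lebesgue"
  shows "qint (\<lambda>x. u x + v x) \<le> ennreal (2 powr q) * qint u + ennreal (2 powr q) * qint v"
proof -
  have pw: "\<bar>a + b\<bar> powr q \<le> 2 powr q * \<bar>a\<bar> powr q + 2 powr q * \<bar>b\<bar> powr q" for a b :: real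
  proof -
    have "\<bar>a + b\<bar> powr q \<le> (2 * max \<bar>a\<bar> \<bar>b\<bar>) powr q"
      using q_gt_2 by (intro powr_mono2) auto
    also have "\<dots> = 2 powr q * (max \<bar>a\<bar> \<bar>b\<bar>) powr q" by (simp add: powr_mult)
    also have "\<dots> \<le> 2 powr q * (\<bar>a\<bar> powr q + \<bar>b\<bar> powr q)" by (intro mult_left_mono) (auto simp: max_def)
    finally show ?thesis by (simp add: distrib_left)
  qed
  have "qint (\<lambda>x. u x + v x) \<le> (\<integral>\<^sup>+x. ennreal (2 powr q) * ennreal (\<bar>u x\<bar> powr q) + ennreal (2 powr q) * ennreal (\<bar>v x\<bar> powr q) \<partial>lebesgue)"
    unfolding qint_def
    by (intro nn_integral_mono) (auto simp flip: ennreal_mult ennreal_plus intro!: ennreal_leI pw)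
  also have "\<dots> = ennreal (2 powr q) * qint u + ennreal (2 powr q) * qint v"
    unfolding qint_def by (simp add: nn_integral_add nn_integral_cmult)
  finally show ?thesis .
qed

lemma qint_scale:
  assumes [measurable]: "u \<in> borel_measurable lebesgue"
  shows "qint (\<lambda>x. c * u x) = ennreal (\<bar>c\<bar> powr q) * qint u"
  unfolding qint_def by (subst nn_integral_cmult[symmetric])
    (auto simp: abs_mult powr_mult simp flip: ennreal_mult intro!: nn_integral_cong)

end

lemma ennreal_tendsto_zero_bound:
  fixes f g h :: "nat \<Rightarrow> ennreal"
  assumes "\<And>n. f n \<le> ennreal c * g n + ennreal d * h n" "g \<longlonglongrightarrow> 0" "h \<longlonglongrightarrow> 0"
  shows "f \<longlonglongrightarrow> 0"
proof -
  have "(\<lambda>n. ennreal c * g n + ennreal d * h n) \<longlonglongrightarrow> ennreal c * 0 + ennreal d * 0"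
    by (intro tendsto_add ennreal_tendsto_cmult assms) auto
  then have "(\<lambda>n. ennreal c * g n + ennreal d * h n) \<longlonglongrightarrow> 0" by simp
  then show ?thesis
    by (rule tendsto_sandwich[OF _ _ tendsto_const, rotated 2]) (use assms in auto)
qed

section \<open>Linear structure and almost everywhere approximation\<close>

context weighted_space
begin

lemma approx_linear:
  assumes "approx \<phi> u G" "approx \<psi> v H"
    and [measurable]: "u \<in> borel_measurable lebesgue" "v \<in> borel_measurable lebesgue"
      "G \<in> borel_measurable lebesgue" "H \<in> borel_measurable lebesgue"
  shows "approx (\<lambda>n x. a * \<phi> n x + b * \<psi> n x) (\<lambda>x. a * u x + b * v x) (\<lambda>x. a *\<^sub>R G x + b *\<^sub>R H x)"
  unfolding approx_def
proof (intro conjI allI)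
  have t: "\<phi> n \<in> test_functions" "\<psi> n \<in> test_functions" for n using assms by (auto simp: approx_def)
  note [measurable] = t[THEN test_measurable] t[THEN test_gradient_measurable]
  show "(\<lambda>x. a * \<phi> n x + b * \<psi> n x) \<in> test_functions" for n by (intro test_linear t)
  show "(\<lambda>n. wen (\<lambda>x. gradient (\<lambda>x. a * \<phi> n x + b * \<psi> n x) x - (a *\<^sub>R G x + b *\<^sub>R H x))) \<longlonglongrightarrow> 0"
  proof (rule ennreal_tendsto_zero_bound)
    fix n
    have "(\<lambda>x. gradient (\<lambda>x. a * \<phi> n x + b * \<psi> n x) x - (a *\<^sub>R G x + b *\<^sub>R H x)) =
      (\<lambda>x. a *\<^sub>R (gradient (\<phi> n) x - G x) + b *\<^sub>R (gradient (\<psi> n) x - H x))"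
      by (simp add: gradient_linear t test_smooth fun_eq_iff algebra_simps)
    then have "wen (\<lambda>x. gradient (\<lambda>x. a * \<phi> n x + b * \<psi> n x) x - (a *\<^sub>R G x + b *\<^sub>R H x)) \<le>
      ennreal 2 * wen (\<lambda>x. a *\<^sub>R (gradient (\<phi> n) x - G x)) + ennreal 2 * wen (\<lambda>x. b *\<^sub>R (gradient (\<psi> n) x - H x))"
      by (simp only:) (intro wen_add_le2; measurable)
    also have "\<dots> = ennreal (2 * a\<^sup>2) * wen (\<lambda>x. gradient (\<phi> n) x - G x) + ennreal (2 * b\<^sup>2) * wen (\<lambda>x. gradient (\<psi> n) x - H x)"
      by (simp add: wen_scale ennreal_mult mult.assoc)
    finally show "wen (\<lambda>x. gradient (\<lambda>x. a * \<phi> n x + b * \<psi> n x) x - (a *\<^sub>R G x + b *\<^sub>R H x)) \<le> \<dots>" .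
  qed (use assms in \<open>auto simp: approx_def\<close>)
  show "(\<lambda>n. qint (\<lambda>x. a * \<phi> n x + b * \<psi> n x - (a * u x + b * v x))) \<longlonglongrightarrow> 0"
  proof (rule ennreal_tendsto_zero_bound)
    fix n
    have "(\<lambda>x. a * \<phi> n x + b * \<psi> n x - (a * u x + b * v x)) = (\<lambda>x. a * (\<phi> n x - u x) + b * (\<psi> n x - v x))"
      by (simp add: fun_eq_iff algebra_simps)
    then have "qint (\<lambda>x. a * \<phi> n x + b * \<psi> n x - (a * u x + b * v x)) \<le>
      ennreal (2 powr q) * qint (\<lambda>x. a * (\<phi> n x - u x)) + ennreal (2 powr q) * qint (\<lambda>x. b * (\<psi> n x - v x))"
      by (simp only:) (intro qint_add_le; measurable)
    also have "\<dots> = ennreal (2 powr q * \<bar>a\<bar> powr q) * qint (\<lambda>x. \<phi> n x - u x) + ennreal (2 powr q * \<bar>b\<bar> powr q) * qint (\<lambda>x. \<psi> n x - v x)"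
      by (simp add: qint_scale ennreal_mult mult.assoc)
    finally show "qint (\<lambda>x. a * \<phi> n x + b * \<psi> n x - (a * u x + b * v x)) \<le> \<dots>" .
  qed (use assms in \<open>auto simp: approx_def\<close>)
qed

lemma hwg_linear:
  assumes "hwg u G" "hwg v H"
  shows "hwg (\<lambda>x. a * u x + b * v x) (\<lambda>x. a *\<^sub>R G x + b *\<^sub>R H x)"
proof -
  obtain \<phi> \<psi> where "approx \<phi> u G" "approx \<psi> v H" using assms by (auto simp: hwg_iff)
  moreover have [measurable]: "u \<in> borel_measurable lebesgue" "v \<in> borel_measurable lebesgue"
      "G \<in> borel_measurable lebesgue" "H \<in> borel_measurable lebesgue" using assms by (auto simp: hwg_iff)
  ultimately have "approx (\<lambda>n x. a * \<phi> n x + b * \<psi> n x) (\<lambda>x. a * u x + b * v x) (\<lambda>x. a *\<^sub>R G x + b *\<^sub>R H x)"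
    by (intro approx_linear)
  then show ?thesis unfolding hwg_iff by (intro conjI exI) measurable
qed

lemma hwg_diff:
  assumes "hwg u G" "hwg v H" shows "hwg (\<lambda>x. u x - v x) (\<lambda>x. G x - H x)"
  using hwg_linear[OF assms, of 1 "-1"] by simp

lemma hwg_test: "\<phi> \<in> test_functions \<Longrightarrow> hwg \<phi> (gradient \<phi>)"
  unfolding hwg_iff
  by (auto simp: approx_def wen_def qint_def test_measurable test_gradient_measurable intro!: exI[of _ "\<lambda>_. \<phi>"])

lemma approx_subseq: "approx \<phi> u G \<Longrightarrow> strict_mono r \<Longrightarrow> approx (\<lambda>n. \<phi> (r n)) u G"
  unfolding approx_def
  using LIMSEQ_subseq_LIMSEQ[of "\<lambda>n. wen (\<lambda>x. gradient (\<phi> n) x - G x)" 0 r]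
    LIMSEQ_subseq_LIMSEQ[of "\<lambda>n. qint (\<lambda>x. \<phi> n x - u x)" 0 r] by (auto simp: o_def)

lemma hwg_approx_AE:
  assumes "hwg u G"
  obtains \<phi> where "approx \<phi> u G" "AE x in lebesgue. (\<lambda>n. \<phi> n x) \<longlonglongrightarrow> u x"
proof -
  obtain \<phi> where \<phi>: "approx \<phi> u G" using assms by (auto simp: hwg_iff)
  have [measurable]: "u \<in> borel_measurable lebesgue" using assms by (auto simp: hwg_iff)
  have t: "\<phi> n \<in> test_functions" for n using \<phi> by (auto simp: approx_def)
  note [measurable] = t[THEN test_measurable]
  have "(\<lambda>n. \<integral>\<^sup>+x. ennreal (norm (\<phi> n x - u x) powr q) \<partial>lebesgue) \<longlonglongrightarrow> 0"
    using \<phi> by (auto simp: approx_def qint_def)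
  then obtain r where r: "strict_mono r" "AE x in lebesgue. (\<lambda>n. \<phi> (r n) x) \<longlonglongrightarrow> u x"
    by (rule mean_convergence_AE_subseq[rotated 3]) (use q_gt_2 in auto)
  show ?thesis by (rule that[OF approx_subseq[OF \<phi> r(1)] r(2)])
qed

lemma wen_finite: assumes "hwg u G" shows "wen G < \<infinity>"
proof -
  obtain \<phi> where \<phi>: "approx \<phi> u G" using assms by (auto simp: hwg_iff)
  have [measurable]: "G \<in> borel_measurable lebesgue" using assms by (auto simp: hwg_iff)
  have t: "\<phi> n \<in> test_functions" for n using \<phi> by (auto simp: approx_def)
  note [measurable] = t[THEN test_gradient_measurable]
  have "(\<lambda>n. wen (\<lambda>x. gradient (\<phi> n) x - G x)) \<longlonglongrightarrow> 0" using \<phi> by (simp add: approx_def)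
  then have "\<forall>\<^sub>F n in sequentially. wen (\<lambda>x. gradient (\<phi> n) x - G x) < 1"
    by (rule order_tendstoD) simp
  then obtain n where n: "wen (\<lambda>x. gradient (\<phi> n) x - G x) < 1" by (auto simp: eventually_sequentially)
  have "wen (\<lambda>x. gradient (\<phi> n) x + - (gradient (\<phi> n) x - G x)) \<le>
     ennreal 2 * wen (gradient (\<phi> n)) + ennreal 2 * wen (\<lambda>x. - (gradient (\<phi> n) x - G x))"
    by (rule wen_add_le2) measurable
  then have "wen G \<le> 2 * wen (gradient (\<phi> n)) + 2 * wen (\<lambda>x. gradient (\<phi> n) x - G x)"
    by (simp only: wen_minus) simp
  also have "\<dots> < \<infinity>"
    using energy_finite[OF t[of n]] n by (auto simp: wen_gradient ennreal_mult_less_top less_top intro: less_trans)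
  finally show ?thesis .
qed

end

text \<open>Continuity of a squared norm from a bound with a free parameter: \<delta> is fixed first
  to make \<delta>w small, and only then is n taken large to beat the factor 1 + 1/\<delta>.\<close>

lemma tendsto_if_near:
  fixes e d :: "nat \<Rightarrow> real"
  assumes near: "\<And>\<delta> n. \<delta> > 0 \<Longrightarrow> \<bar>e n - w\<bar> \<le> \<delta> * w + (1 + 1 / \<delta>) * d n" and d: "d \<longlonglongrightarrow> 0" and w: "0 \<le> w"
  shows "e \<longlonglongrightarrow> w"
proof (rule LIMSEQ_I)
  fix r :: real assume r: "r > 0"
  define \<delta> where "\<delta> = r / (2 * (w + 1))"
  have \<delta>: "\<delta> > 0" using r w by (simp add: \<delta>_def)
  have "\<delta> * w < r / 2"
    using r w by (simp add: \<delta>_def divide_less_eq)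
  have "(\<lambda>n. (1 + 1 / \<delta>) * d n) \<longlonglongrightarrow> (1 + 1 / \<delta>) * 0" by (intro tendsto_intros d)
  then have "\<forall>\<^sub>F n in sequentially. (1 + 1 / \<delta>) * d n < r / 2"
    by (rule order_tendstoD) (use r in simp)
  then obtain K where "\<And>n. n \<ge> K \<Longrightarrow> (1 + 1 / \<delta>) * d n < r / 2" by (auto simp: eventually_sequentially)
  then have "norm (e n - w) < r" if "n \<ge> K" for n
    using near[OF \<delta>, of n] \<open>\<delta> * w < r / 2\<close> that by (smt (verit) real_norm_def field_sum_of_halves)
  then show "\<exists>K. \<forall>n\<ge>K. norm (e n - w) < r" by blast
qed

section \<open>Continuity of the weighted energy and transfer of inequalities\<close>

context weighted_space
begin

text \<open>Expanding |G + D|^2 with D = H - G leaves a cross term 2 G . D, which Young's inequality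
  splits with the weight \<delta>.\<close>

lemma wen_near:
  assumes [measurable]: "G \<in> borel_measurable lebesgue" "H \<in> borel_measurable lebesgue"
    and fin: "wen G < \<infinity>" "wen H < \<infinity>" and \<delta>: "\<delta> > 0"
  shows "\<bar>enn2real (wen H) - enn2real (wen G)\<bar> \<le> \<delta> * enn2real (wen G) + (1 + 1 / \<delta>) * enn2real (wen (\<lambda>x. H x - G x))"
proof -
  define D where "D = (\<lambda>x. H x - G x)"
  have [measurable]: "D \<in> borel_measurable lebesgue" unfolding D_def by measurable
  have int: "integrable lebesgue (\<lambda>x. norm x powr \<alpha> * (norm (K x))\<^sup>2)" "enn2real (wen K) = (\<integral>x. norm x powr \<alpha> * (norm (K x))\<^sup>2 \<partial>lebesgue)"
    if [measurable]: "K \<in> borel_measurable lebesgue" and "wen K < \<infinity>" for K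
  proof -
    show i: "integrable lebesgue (\<lambda>x. norm x powr \<alpha> * (norm (K x))\<^sup>2)"
      using that unfolding wen_def by (intro integrableI_bounded) auto
    show "enn2real (wen K) = (\<integral>x. norm x powr \<alpha> * (norm (K x))\<^sup>2 \<partial>lebesgue)"
      unfolding wen_def by (rule integral_eq_nn_integral[symmetric]) auto
  qed
  have "wen (\<lambda>x. H x + - G x) \<le> ennreal 2 * wen H + ennreal 2 * wen (\<lambda>x. - G x)"
    by (rule wen_add_le2) measurable
  then have "wen D \<le> 2 * wen H + 2 * wen G" by (simp add: wen_minus D_def)
  then have D: "wen D < \<infinity>" using fin by (auto simp: ennreal_mult_less_top less_top intro: le_less_trans)
  have pw: "\<bar>(norm (H x))\<^sup>2 - (norm (G x))\<^sup>2\<bar> \<le> \<delta> * (norm (G x))\<^sup>2 + (1 + 1 / \<delta>) * (norm (D x))\<^sup>2" for x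
  proof -
    have "H x = G x + D x" by (simp add: D_def)
    then have "(norm (H x))\<^sup>2 - (norm (G x))\<^sup>2 = 2 * (G x \<bullet> D x) + (norm (D x))\<^sup>2"
      by (simp add: power2_norm_eq_inner inner_simps inner_commute)
    moreover have "\<bar>G x \<bullet> D x\<bar> \<le> norm (G x) * norm (D x)" by (rule Cauchy_Schwarz_ineq2)
    moreover have "0 \<le> (sqrt \<delta> * norm (G x) - norm (D x) / sqrt \<delta>)\<^sup>2" by simp
    then have "2 * norm (G x) * norm (D x) \<le> \<delta> * (norm (G x))\<^sup>2 + (norm (D x))\<^sup>2 / \<delta>"
      using \<delta> by (simp add: power2_diff power_mult_distrib power_divide)
    moreover have "0 \<le> (norm (D x))\<^sup>2" by simp
    ultimately have "\<bar>(norm (H x))\<^sup>2 - (norm (G x))\<^sup>2\<bar> \<le> \<delta> * (norm (G x))\<^sup>2 + (norm (D x))\<^sup>2 / \<delta> + (norm (D x))\<^sup>2"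
      by linarith
    then show ?thesis by (simp add: distrib_right)
  qed
  have "\<bar>enn2real (wen H) - enn2real (wen G)\<bar> = \<bar>\<integral>x. norm x powr \<alpha> * (norm (H x))\<^sup>2 - norm x powr \<alpha> * (norm (G x))\<^sup>2 \<partial>lebesgue\<bar>"
    using int fin by simp
  also have "\<dots> \<le> (\<integral>x. \<bar>norm x powr \<alpha> * (norm (H x))\<^sup>2 - norm x powr \<alpha> * (norm (G x))\<^sup>2\<bar> \<partial>lebesgue)"
    by (rule integral_abs_bound)
  also have "\<dots> \<le> (\<integral>x. \<delta> * (norm x powr \<alpha> * (norm (G x))\<^sup>2) + (1 + 1 / \<delta>) * (norm x powr \<alpha> * (norm (D x))\<^sup>2) \<partial>lebesgue)"
  proof (rule integral_mono)
    fix x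
    have "norm x powr \<alpha> * \<bar>(norm (H x))\<^sup>2 - (norm (G x))\<^sup>2\<bar> \<le> norm x powr \<alpha> * (\<delta> * (norm (G x))\<^sup>2 + (1 + 1 / \<delta>) * (norm (D x))\<^sup>2)"
      by (intro mult_left_mono pw) auto
    then show "\<bar>norm x powr \<alpha> * (norm (H x))\<^sup>2 - norm x powr \<alpha> * (norm (G x))\<^sup>2\<bar> \<le>
      \<delta> * (norm x powr \<alpha> * (norm (G x))\<^sup>2) + (1 + 1 / \<delta>) * (norm x powr \<alpha> * (norm (D x))\<^sup>2)"
      by (simp add: abs_mult distrib_left mult_ac flip: right_diff_distrib)
  qed (use int fin D in auto)
  also have "\<dots> = \<delta> * enn2real (wen G) + (1 + 1 / \<delta>) * enn2real (wen D)"
    using int fin D by simp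
  finally show ?thesis by (simp add: D_def)
qed

lemma wen_tendsto:
  assumes G: "G \<in> borel_measurable lebesgue" and H: "\<And>n. H n \<in> borel_measurable lebesgue"
    and fin: "wen G < \<infinity>" "\<And>n. wen (H n) < \<infinity>" and lim: "(\<lambda>n. wen (\<lambda>x. H n x - G x)) \<longlonglongrightarrow> 0"
  shows "(\<lambda>n. wen (H n)) \<longlonglongrightarrow> wen G"
proof -
  have "(\<lambda>n. enn2real (wen (H n))) \<longlonglongrightarrow> enn2real (wen G)"
  proof (rule tendsto_if_near[OF wen_near[OF G H fin]])
    show "(\<lambda>n. enn2real (wen (\<lambda>x. H n x - G x))) \<longlonglongrightarrow> 0"
      using tendsto_enn2real[OF lim[folded ennreal_0]] by simp
  qed auto
  then have "(\<lambda>n. ennreal (enn2real (wen (H n)))) \<longlonglongrightarrow> ennreal (enn2real (wen G))" by (rule tendsto_ennrealI)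
  then show ?thesis using fin by (simp only: ennreal_enn2real infinity_ennreal_def)
qed

lemma approx_energy_tendsto:
  assumes "hwg u G" "approx \<phi> u G" shows "(\<lambda>n. energy \<alpha> (\<phi> n)) \<longlonglongrightarrow> wen G"
proof -
  have t: "\<phi> n \<in> test_functions" for n using assms by (auto simp: approx_def)
  have "(\<lambda>n. wen (gradient (\<phi> n))) \<longlonglongrightarrow> wen G"
    by (rule wen_tendsto)
      (use assms wen_finite[OF assms(1)] energy_finite[OF t] test_gradient_measurable[OF t] in \<open>auto simp: hwg_iff approx_def wen_gradient\<close>)
  then show ?thesis by (simp add: wen_gradient)
qed

text \<open>Fatou's lemma on the left, convergence of the energies on the right. The extra sequence
  \<open>T\<close> makes room for the finitely many averages, which converge along the approximation
  on their own.\<close>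

lemma transfer_square_bound:
  assumes hwg: "hwg u G" and \<phi>: "approx \<phi> u G" "AE x in lebesgue. (\<lambda>n. \<phi> n x) \<longlonglongrightarrow> u x"
    and [measurable]: "V \<in> borel_measurable lebesgue" and V: "\<And>x. 0 \<le> V x"
    and le: "\<And>n. (\<integral>\<^sup>+x. ennreal (V x * (\<phi> n x)\<^sup>2) \<partial>lebesgue) \<le> ennreal A * energy \<alpha> (\<phi> n) + T n"
    and T: "T \<longlonglongrightarrow> \<tau>"
  shows "(\<integral>\<^sup>+x. ennreal (V x * (u x)\<^sup>2) \<partial>lebesgue) \<le> ennreal A * wen G + \<tau>"
proof -
  have t: "\<phi> n \<in> test_functions" for n using \<phi> by (auto simp: approx_def)
  note [measurable] = t[THEN test_measurable]
  have "(\<integral>\<^sup>+x. ennreal (V x * (u x)\<^sup>2) \<partial>lebesgue) \<le> (\<integral>\<^sup>+x. liminf (\<lambda>n. ennreal (V x * (\<phi> n x)\<^sup>2)) \<partial>lebesgue)"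
  proof (rule nn_integral_mono_AE, use \<phi>(2) in eventually_elim)
    case (elim x)
    then have "(\<lambda>n. ennreal (V x * (\<phi> n x)\<^sup>2)) \<longlonglongrightarrow> ennreal (V x * (u x)\<^sup>2)" by (intro tendsto_intros)
    from lim_imp_Liminf[OF trivial_limit_sequentially this] show ?case by simp
  qed
  also have "\<dots> \<le> liminf (\<lambda>n. \<integral>\<^sup>+x. ennreal (V x * (\<phi> n x)\<^sup>2) \<partial>lebesgue)"
    by (rule nn_integral_liminf) measurable
  also have "\<dots> \<le> liminf (\<lambda>n. ennreal A * energy \<alpha> (\<phi> n) + T n)"
    by (rule Liminf_mono) (simp add: le)
  also have "\<dots> = ennreal A * wen G + \<tau>"
    by (rule lim_imp_Liminf) (auto intro!: tendsto_add ennreal_tendsto_cmult approx_energy_tendsto[OF hwg \<phi>(1)] T)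
  finally show ?thesis .
qed

lemma hwg_square_bound:
  assumes hwg: "hwg u G" and V[measurable]: "V \<in> borel_measurable borel" "\<And>x. 0 \<le> V x"
    and le: "\<And>\<phi>. \<phi> \<in> test_functions \<Longrightarrow> (\<integral>\<^sup>+x. ennreal (V x * (\<phi> x)\<^sup>2) \<partial>lborel) \<le> ennreal A * energy \<alpha> \<phi>"
  shows "(\<integral>\<^sup>+x. ennreal (V x * (u x)\<^sup>2) \<partial>lebesgue) \<le> ennreal A * wen G"
proof -
  obtain \<phi> where \<phi>: "approx \<phi> u G" "AE x in lebesgue. (\<lambda>n. \<phi> n x) \<longlonglongrightarrow> u x"
    using hwg_approx_AE[OF hwg] by blast
  have [measurable]: "V \<in> borel_measurable lebesgue" by (rule measurable_completion) simp
  have "(\<integral>\<^sup>+x. ennreal (V x * (u x)\<^sup>2) \<partial>lebesgue) \<le> ennreal A * wen G + 0"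
    by (rule transfer_square_bound[OF hwg \<phi> _ V(2) _ tendsto_const])
      (use \<phi> le in \<open>auto simp: approx_def nn_integral_completion\<close>)
  then show ?thesis by simp
qed

lemma hwg_hardy:
  assumes "hwg u G"
  shows "(\<integral>\<^sup>+x. ennreal (norm x powr (\<alpha> - 2) * (u x)\<^sup>2) \<partial>lebesgue) \<le> ennreal 4 * wen G"
  by (rule hwg_square_bound[OF assms]) (use hardy_origin[OF _ \<alpha> N] in auto)

end

section \<open>Uniqueness of the weighted gradient\<close>

lemma measurable_vec_nth_raw [measurable (raw)]:
  fixes H :: "'a \<Rightarrow> real ^ 'n::finite"
  assumes "H \<in> borel_measurable M"
  shows "(\<lambda>x. H x $ i) \<in> borel_measurable M"
  using assms by (rule borel_measurable_continuous_on[rotated]) (rule continuous_on_component[OF continuous_on_id])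

text \<open>On a set of finite measure Hoelder's inequality is replaced by the pointwise bound a
  \<le> \<delta> + \<delta>^(1-p) a^p, in which \<delta> is chosen before n.\<close>

lemma mean_imp_L1:
  fixes v :: "nat \<Rightarrow> 'a \<Rightarrow> real"
  assumes [measurable]: "\<And>n. v n \<in> borel_measurable M" "B \<in> sets M" and p: "p > 1"
    and B: "emeasure M B < \<infinity>" and v: "\<And>n x. 0 \<le> v n x"
    and lim: "(\<lambda>n. \<integral>\<^sup>+x. ennreal (v n x powr p) \<partial>M) \<longlonglongrightarrow> 0"
  shows "(\<lambda>n. \<integral>\<^sup>+x. ennreal (v n x) * indicator B x \<partial>M) \<longlonglongrightarrow> 0"
proof -
  obtain b where b: "emeasure M B = ennreal b" "b \<ge> 0"
    using B by (cases "emeasure M B") auto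
  have le: "(\<integral>\<^sup>+x. ennreal (v n x) * indicator B x \<partial>M) \<le> ennreal (\<delta> * b) + ennreal (\<delta> powr (1 - p)) * (\<integral>\<^sup>+x. ennreal (v n x powr p) \<partial>M)"
    if \<delta>: "\<delta> > 0" for \<delta> n
  proof -
    have "a \<le> \<delta> + \<delta> powr (1 - p) * a powr p" if "a \<ge> 0" for a :: real
    proof (cases "a \<le> \<delta>")
      case True
      then show ?thesis by (simp add: add_increasing2)
    next
      case False
      then have "a = a powr (1 - p) * a powr p" using \<delta> by (simp flip: powr_add)
      also have "\<dots> \<le> \<delta> powr (1 - p) * a powr p"
        using False \<delta> p by (intro mult_right_mono powr_mono2') auto
      finally show ?thesis using \<delta> by simp
    qed
    then have "(\<integral>\<^sup>+x. ennreal (v n x) * indicator B x \<partial>M) \<le>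
        (\<integral>\<^sup>+x. ennreal \<delta> * indicator B x + ennreal (\<delta> powr (1 - p)) * ennreal (v n x powr p) \<partial>M)"
      using \<delta> v by (intro nn_integral_mono)
        (auto split: split_indicator simp flip: ennreal_mult ennreal_plus intro!: ennreal_leI)
    also have "\<dots> = ennreal \<delta> * emeasure M B + ennreal (\<delta> powr (1 - p)) * (\<integral>\<^sup>+x. ennreal (v n x powr p) \<partial>M)"
      by (simp add: nn_integral_add nn_integral_cmult)
    also have "ennreal \<delta> * emeasure M B = ennreal (\<delta> * b)" using b \<delta> by (simp add: ennreal_mult)
    finally show ?thesis .
  qed
  show ?thesis
  proof (rule order_tendstoI)
    fix a :: ennreal assume "0 < a"
    then obtain a0 where a0: "0 < a0" "a0 < a" using dense by blast
    then have "a0 < top" using top_greatest by (rule_tac less_le_trans)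
    then obtain c where "a0 = ennreal c" using less_top_ennreal by blast
    then have c: "c > 0" "ennreal c < a" using a0 by (auto simp: ennreal_less_zero_iff)
    define \<delta> where "\<delta> = c / (2 * (b + 1))"
    have \<delta>: "\<delta> > 0" using c b by (simp add: \<delta>_def)
    have \<delta>b: "\<delta> * b \<le> c / 2" using c b by (simp add: \<delta>_def divide_le_eq)
    have "(\<lambda>n. ennreal (\<delta> powr (1 - p)) * (\<integral>\<^sup>+x. ennreal (v n x powr p) \<partial>M)) \<longlonglongrightarrow> ennreal (\<delta> powr (1 - p)) * 0"
      by (intro ennreal_tendsto_cmult lim) simp
    then have "\<forall>\<^sub>F n in sequentially. ennreal (\<delta> powr (1 - p)) * (\<integral>\<^sup>+x. ennreal (v n x powr p) \<partial>M) < ennreal (c / 2)"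
      by (rule order_tendstoD) (use c in simp)
    then show "\<forall>\<^sub>F n in sequentially. (\<integral>\<^sup>+x. ennreal (v n x) * indicator B x \<partial>M) < a"
    proof eventually_elim
      case (elim n)
      have "(\<integral>\<^sup>+x. ennreal (v n x) * indicator B x \<partial>M) \<le> ennreal (c / 2) + ennreal (c / 2)"
        using le[OF \<delta>, of n] elim \<delta>b
        by (meson add_mono ennreal_leI less_imp_le order_trans)
      also have "\<dots> = ennreal c" using c by (simp flip: ennreal_plus)
      finally show ?case using c(2) by (rule le_less_trans)
    qed
  qed simp
qed

lemma test_ibp:
  assumes "\<phi> \<in> test_functions" "\<psi> \<in> test_functions"
  shows "(LBINT x. \<phi> x * gradient \<psi> x $ i) = - (LBINT x. \<psi> x * gradient \<phi> x $ i)"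
proof -
  note s = assms[THEN test_smooth]
  obtain R where R: "\<And>x. norm x \<ge> R \<Longrightarrow> \<phi> x = 0" "\<And>x. norm x \<ge> R \<Longrightarrow> gradient \<phi> x = 0"
    using test_support[OF assms(1)] by metis
  have c: "continuous_on UNIV \<phi>" "continuous_on UNIV \<psi>" "continuous_on UNIV (gradient \<phi>)" "continuous_on UNIV (gradient \<psi>)"
    using s smooth_continuous continuous_gradient by blast+
  have "(LBINT x. \<phi> x * gradient \<psi> x $ i + \<psi> x * gradient \<phi> x $ i) = 0"
  proof (rule integral_directional_derivative_zero[where F = "\<lambda>x. \<phi> x * \<psi> x" and e = "axis i 1" and R = R])
    fix x
    have "((\<lambda>t. \<phi> (x + t *\<^sub>R axis i 1) * \<psi> (x + t *\<^sub>R axis i 1)) has_real_derivative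
       gradient (\<lambda>x. \<phi> x * \<psi> x) (x + 0 *\<^sub>R axis i 1) \<bullet> axis i 1) (at 0)"
      by (rule smooth_line[OF smooth_mult[OF s]])
    then show "((\<lambda>t. \<phi> (x + t *\<^sub>R axis i 1) * \<psi> (x + t *\<^sub>R axis i 1)) has_real_derivative
      \<phi> x * gradient \<psi> x $ i + \<psi> x * gradient \<phi> x $ i) (at 0)"
      by (simp add: gradient_mult[OF s] inner_axis)
  qed (use R c in \<open>auto intro!: continuous_intros\<close>)
  moreover have "integrable lborel (\<lambda>x. \<phi> x * gradient \<psi> x $ i)" "integrable lborel (\<lambda>x. \<psi> x * gradient \<phi> x $ i)"
    by (rule integrable_bounded_support[of _ R], use R c in \<open>auto intro!: continuous_intros\<close>)+
  ultimately show ?thesis by simp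
qed

context weighted_space
begin

lemma emeasure_cball_finite: "emeasure lebesgue (cball (0::real^'n) R) < \<infinity>"
  using emeasure_bounded_finite[of "cball (0::real^'n) R"] by simp

lemma qint_tendsto_L1:
  assumes [measurable]: "\<And>n. v n \<in> borel_measurable lebesgue" and lim: "(\<lambda>n. qint (v n)) \<longlonglongrightarrow> 0"
  shows "(\<lambda>n. \<integral>\<^sup>+x. ennreal \<bar>v n x\<bar> * indicator (cball 0 R) x \<partial>lebesgue) \<longlonglongrightarrow> 0"
  by (rule mean_imp_L1[where p = q]) (use q_gt_2 emeasure_cball_finite lim in \<open>auto simp: qint_def\<close>)

lemma weighted_norm_le:
  fixes a :: "real ^ 'n"
  assumes "norm x \<le> R"
  shows "(norm x)\<^sup>2 * norm a \<le> R powr (2 - \<alpha> / 2) * (norm x powr (\<alpha> / 2) * norm a)"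
proof -
  have "(norm x)\<^sup>2 = norm x powr (2 - \<alpha> / 2) * norm x powr (\<alpha> / 2)"
    by (cases "x = 0") (auto simp flip: powr_add)
  also have "\<dots> \<le> R powr (2 - \<alpha> / 2) * norm x powr (\<alpha> / 2)"
    using assms \<alpha> by (intro mult_right_mono powr_mono2) auto
  finally show ?thesis by (simp add: mult_right_mono mult.assoc[symmetric])
qed

text \<open>The factor $|x|^2$ keeps the test function admissible for the degenerate weight at the origin.\<close>

lemma gradient_unique_aux:
  assumes \<phi>: "approx \<phi> (\<lambda>_. 0) H" and [measurable]: "H \<in> borel_measurable lebesgue" and fin: "wen H < \<infinity>"
    and \<psi>: "\<psi> \<in> test_functions"
  shows "(\<integral>x. (norm x)\<^sup>2 * H x $ i * (\<psi> x)\<^sup>2 \<partial>lebesgue) = 0"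
proof -
  define \<Psi> where "\<Psi> = (\<lambda>x. \<psi> x * (\<psi> x * (norm (x - 0))\<^sup>2))"
  have \<Psi>: "\<Psi> \<in> test_functions" unfolding \<Psi>_def
    by (intro test_mult \<psi> smooth_mult smooth_norm_sq test_smooth)
  have t: "\<phi> n \<in> test_functions" for n using \<phi> by (auto simp: approx_def)
  note [measurable] = t[THEN test_measurable] t[THEN test_gradient_measurable] \<psi>[THEN test_measurable] \<Psi>[THEN test_measurable] \<Psi>[THEN test_gradient_measurable]
  obtain R where R: "R > 0" "\<And>x. norm x \<ge> R \<Longrightarrow> \<psi> x = 0" using test_support[OF \<psi>] by metis
  obtain R' where R': "R' > 0" "\<And>x. norm x \<ge> R' \<Longrightarrow> gradient \<Psi> x = 0" using test_support[OF \<Psi>] by metis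
  obtain M where M: "\<And>x. \<bar>\<psi> x\<bar> \<le> M" using test_bounded[OF \<psi>] by metis
  obtain M' where M': "\<And>x. norm (gradient \<Psi> x) \<le> M'" using test_bounded[OF \<Psi>] by metis
  have M0: "M \<ge> 0" "M' \<ge> 0" using M[of 0] M'[of 0] norm_ge_zero order_trans abs_ge_zero by blast+
  let ?c = "M\<^sup>2 * R powr (2 - \<alpha> / 2)"
  let ?v = "\<lambda>n x. norm x powr (\<alpha> / 2) * norm (gradient (\<phi> n) x - H x)"
  have \<Psi>_le: "\<bar>\<Psi> x * a $ i\<bar> \<le> ?c * (norm x powr (\<alpha> / 2) * norm a) * indicator (cball 0 R) x" for x and a :: "real ^ 'n"
  proof (cases "norm x \<le> R")
    case True
    have "(\<psi> x)\<^sup>2 \<le> M\<^sup>2" using M[of x] M0 by (metis abs_ge_zero power2_abs power_mono)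
    have "\<bar>\<Psi> x * a $ i\<bar> = (\<psi> x)\<^sup>2 * ((norm x)\<^sup>2 * \<bar>a $ i\<bar>)" by (simp add: \<Psi>_def abs_mult power2_eq_square mult_ac)
    also have "\<dots> \<le> M\<^sup>2 * ((norm x)\<^sup>2 * norm a)"
      using \<open>(\<psi> x)\<^sup>2 \<le> M\<^sup>2\<close> component_le_norm_cart[of a i] by (intro mult_mono) auto
    also have "\<dots> \<le> M\<^sup>2 * (R powr (2 - \<alpha> / 2) * (norm x powr (\<alpha> / 2) * norm a))"
      by (intro mult_left_mono weighted_norm_le True) auto
    finally show ?thesis using True by (simp add: mult_ac)
  next
    case False
    then show ?thesis using R by (simp add: \<Psi>_def)
  qed
  \<comment> \<open>H is written as grad \<phi>_n minus the error grad \<phi>_n - H. The first part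
    is integrated by parts and becomes an integral of \<phi>_n, which tends to 0 because the
    approximated function is 0; the error tends to 0 in the weighted L^2 sense.\<close>
  have le: "ennreal \<bar>\<integral>x. \<Psi> x * H x $ i \<partial>lebesgue\<bar> \<le>
      ennreal ?c * (\<integral>\<^sup>+x. ennreal (?v n x) * indicator (cball 0 R) x \<partial>lebesgue) +
      ennreal M' * (\<integral>\<^sup>+x. ennreal \<bar>\<phi> n x - 0\<bar> * indicator (cball 0 R') x \<partial>lebesgue)" for n
  proof -
    have Hle: "ennreal \<bar>\<Psi> x * H x $ i\<bar> \<le> ennreal ?c * (indicator (cball 0 R) x + ennreal (norm x powr \<alpha> * (norm (H x))\<^sup>2))" for x
    proof -
      have "norm x powr (\<alpha> / 2) * norm (H x) \<le> 1 + (norm x powr (\<alpha> / 2) * norm (H x))\<^sup>2"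
        using zero_le_power2[of "norm x powr (\<alpha> / 2) * norm (H x) - 1"] by (simp add: power2_diff) (smt (verit) zero_le_mult_iff norm_ge_zero powr_ge_zero)
      also have "(norm x powr (\<alpha> / 2) * norm (H x))\<^sup>2 = norm x powr \<alpha> * (norm (H x))\<^sup>2"
        by (simp add: power_mult_distrib) (simp add: power2_eq_square flip: powr_add)
      finally have "?c * (norm x powr (\<alpha> / 2) * norm (H x)) * indicator (cball 0 R) x \<le> ?c * (indicator (cball 0 R) x + norm x powr \<alpha> * (norm (H x))\<^sup>2)"
        by (auto split: split_indicator intro!: mult_left_mono)
      then have "\<bar>\<Psi> x * H x $ i\<bar> \<le> ?c * (indicator (cball 0 R) x + norm x powr \<alpha> * (norm (H x))\<^sup>2)"
        using \<Psi>_le[of x "H x"] by linarith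
      then have "ennreal \<bar>\<Psi> x * H x $ i\<bar> \<le> ennreal (?c * (indicator (cball 0 R) x + norm x powr \<alpha> * (norm (H x))\<^sup>2))"
        by (rule ennreal_leI)
      also have "\<dots> = ennreal ?c * (indicator (cball 0 R) x + ennreal (norm x powr \<alpha> * (norm (H x))\<^sup>2))"
        by (auto simp: ennreal_mult split: split_indicator)
      finally show ?thesis .
    qed
    have "(\<integral>\<^sup>+x. ennreal \<bar>\<Psi> x * H x $ i\<bar> \<partial>lebesgue) \<le> (\<integral>\<^sup>+x. ennreal ?c * (indicator (cball 0 R) x + ennreal (norm x powr \<alpha> * (norm (H x))\<^sup>2)) \<partial>lebesgue)"
      by (intro nn_integral_mono Hle)
    also have "\<dots> = ennreal ?c * (emeasure lebesgue (cball (0::real^'n) R) + wen H)"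
      unfolding wen_def by (simp add: nn_integral_cmult nn_integral_add)
    also have "\<dots> < \<infinity>" using emeasure_cball_finite[of R] fin by (simp add: ennreal_mult_less_top)
    finally have iH: "integrable lebesgue (\<lambda>x. \<Psi> x * H x $ i)"
      by (intro integrableI_bounded) auto
    have cont: "continuous_on UNIV \<Psi>" "continuous_on UNIV (gradient \<Psi>)" "continuous_on UNIV (\<phi> n)" "continuous_on UNIV (gradient (\<phi> n))"
      using \<Psi> t[of n] by (auto dest: test_smooth intro: smooth_continuous continuous_gradient)
    have ig: "integrable lebesgue (\<lambda>x. \<Psi> x * gradient (\<phi> n) x $ i)" "integrable lebesgue (\<lambda>x. \<phi> n x * gradient \<Psi> x $ i)"
    proof -
      obtain r where r: "\<And>x. norm x \<ge> r \<Longrightarrow> \<phi> n x = 0" "\<And>x. norm x \<ge> r \<Longrightarrow> gradient (\<phi> n) x = 0" using test_support[OF t] by metis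
      have "integrable lborel (\<lambda>x. \<Psi> x * gradient (\<phi> n) x $ i)" "integrable lborel (\<lambda>x. \<phi> n x * gradient \<Psi> x $ i)"
        by (rule integrable_bounded_support[of _ r], use r in \<open>auto intro!: continuous_intros cont\<close>)+
      then show "integrable lebesgue (\<lambda>x. \<Psi> x * gradient (\<phi> n) x $ i)" "integrable lebesgue (\<lambda>x. \<phi> n x * gradient \<Psi> x $ i)"
        by (auto simp: integrable_completion)
    qed
    have e1: "(\<integral>x. \<Psi> x * gradient (\<phi> n) x $ i \<partial>lebesgue) = - (\<integral>x. \<phi> n x * gradient \<Psi> x $ i \<partial>lebesgue)"
    proof -
      have "(\<lambda>x. \<Psi> x * gradient (\<phi> n) x $ i) \<in> borel_measurable borel" "(\<lambda>x. \<phi> n x * gradient \<Psi> x $ i) \<in> borel_measurable borel"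
        by (intro borel_measurable_continuous_onI continuous_intros cont)+
      then show ?thesis using test_ibp[OF \<Psi> t[of n], of i] by (simp add: integral_completion)
    qed
    have "(\<integral>x. \<Psi> x * H x $ i \<partial>lebesgue) = (\<integral>x. \<Psi> x * gradient (\<phi> n) x $ i \<partial>lebesgue) - (\<integral>x. \<Psi> x * (gradient (\<phi> n) x - H x) $ i \<partial>lebesgue)"
      using ig iH by (simp add: right_diff_distrib)
    then have "\<bar>\<integral>x. \<Psi> x * H x $ i \<partial>lebesgue\<bar> \<le> \<bar>\<integral>x. \<Psi> x * (gradient (\<phi> n) x - H x) $ i \<partial>lebesgue\<bar> + \<bar>\<integral>x. \<phi> n x * gradient \<Psi> x $ i \<partial>lebesgue\<bar>"
      unfolding e1 by linarith
    then have "ennreal \<bar>\<integral>x. \<Psi> x * H x $ i \<partial>lebesgue\<bar> \<le> ennreal \<bar>\<integral>x. \<Psi> x * (gradient (\<phi> n) x - H x) $ i \<partial>lebesgue\<bar> + ennreal \<bar>\<integral>x. \<phi> n x * gradient \<Psi> x $ i \<partial>lebesgue\<bar>"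
      by (simp add: ennreal_leI flip: ennreal_plus)
    also have "\<dots> \<le> (\<integral>\<^sup>+x. ennreal \<bar>\<Psi> x * (gradient (\<phi> n) x - H x) $ i\<bar> \<partial>lebesgue) + (\<integral>\<^sup>+x. ennreal \<bar>\<phi> n x * gradient \<Psi> x $ i\<bar> \<partial>lebesgue)"
    proof (rule add_mono)
      have "integrable lebesgue (\<lambda>x. \<Psi> x * (gradient (\<phi> n) x - H x) $ i)" using ig iH by (simp add: right_diff_distrib)
      from integral_norm_bound_ennreal[OF this]
      show "ennreal \<bar>\<integral>x. \<Psi> x * (gradient (\<phi> n) x - H x) $ i \<partial>lebesgue\<bar> \<le> (\<integral>\<^sup>+x. ennreal \<bar>\<Psi> x * (gradient (\<phi> n) x - H x) $ i\<bar> \<partial>lebesgue)"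
        by simp
      from integral_norm_bound_ennreal[OF ig(2)]
      show "ennreal \<bar>\<integral>x. \<phi> n x * gradient \<Psi> x $ i \<partial>lebesgue\<bar> \<le> (\<integral>\<^sup>+x. ennreal \<bar>\<phi> n x * gradient \<Psi> x $ i\<bar> \<partial>lebesgue)"
        by simp
    qed
    also have "\<dots> \<le> (\<integral>\<^sup>+x. ennreal ?c * (ennreal (?v n x) * indicator (cball 0 R) x) \<partial>lebesgue) + (\<integral>\<^sup>+x. ennreal M' * (ennreal \<bar>\<phi> n x - 0\<bar> * indicator (cball 0 R') x) \<partial>lebesgue)"
    proof (intro add_mono nn_integral_mono)
      fix x
      have "ennreal \<bar>\<Psi> x * (gradient (\<phi> n) x - H x) $ i\<bar> \<le> ennreal (?c * ?v n x * indicator (cball 0 R) x)"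
        by (intro ennreal_leI \<Psi>_le)
      also have "\<dots> = ennreal ?c * (ennreal (?v n x) * indicator (cball 0 R) x)"
        by (auto simp: ennreal_mult split: split_indicator)
      finally show "ennreal \<bar>\<Psi> x * (gradient (\<phi> n) x - H x) $ i\<bar> \<le> ennreal ?c * (ennreal (?v n x) * indicator (cball 0 R) x)" .
      have "\<bar>gradient \<Psi> x $ i\<bar> \<le> M' * indicator (cball 0 R') x"
        using R'(2)[of x] M'[of x] component_le_norm_cart[of "gradient \<Psi> x" i] by (auto split: split_indicator)
      then have "\<bar>\<phi> n x * gradient \<Psi> x $ i\<bar> \<le> \<bar>\<phi> n x\<bar> * (M' * indicator (cball 0 R') x)"
        by (simp add: abs_mult mult_left_mono)
      then have "ennreal \<bar>\<phi> n x * gradient \<Psi> x $ i\<bar> \<le> ennreal (\<bar>\<phi> n x\<bar> * (M' * indicator (cball 0 R') x))" by (rule ennreal_leI)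
      also have "\<dots> = ennreal M' * (ennreal \<bar>\<phi> n x - 0\<bar> * indicator (cball 0 R') x)"
        using M0 by (auto simp: ennreal_mult mult.commute split: split_indicator)
      finally show "ennreal \<bar>\<phi> n x * gradient \<Psi> x $ i\<bar> \<le> ennreal M' * (ennreal \<bar>\<phi> n x - 0\<bar> * indicator (cball 0 R') x)" .
    qed
    also have "\<dots> = ennreal ?c * (\<integral>\<^sup>+x. ennreal (?v n x) * indicator (cball 0 R) x \<partial>lebesgue) +
      ennreal M' * (\<integral>\<^sup>+x. ennreal \<bar>\<phi> n x - 0\<bar> * indicator (cball 0 R') x \<partial>lebesgue)"
      by (intro arg_cong2[where f = "(+)"] nn_integral_cmult) measurable
    finally show ?thesis .
  qed
  have l2: "(\<lambda>n. \<integral>\<^sup>+x. ennreal \<bar>\<phi> n x - 0\<bar> * indicator (cball 0 R') x \<partial>lebesgue) \<longlonglongrightarrow> 0"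
    by (rule qint_tendsto_L1) (use \<phi> in \<open>auto simp: approx_def\<close>)
  have l1: "(\<lambda>n. \<integral>\<^sup>+x. ennreal (?v n x) * indicator (cball 0 R) x \<partial>lebesgue) \<longlonglongrightarrow> 0"
  proof (rule mean_imp_L1[where p = 2])
    have "ennreal (?v n x powr 2) = ennreal (norm x powr \<alpha> * (norm (gradient (\<phi> n) x - H x))\<^sup>2)" for n x
      by (simp add: power_mult_distrib) (simp add: power2_eq_square flip: powr_add)
    then show "(\<lambda>n. \<integral>\<^sup>+x. ennreal (?v n x powr 2) \<partial>lebesgue) \<longlonglongrightarrow> 0"
      using \<phi> by (simp add: approx_def wen_def)
  qed (use emeasure_cball_finite in auto)
  have "(\<lambda>n::nat. ennreal \<bar>\<integral>x. \<Psi> x * H x $ i \<partial>lebesgue\<bar>) \<longlonglongrightarrow> 0"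
    by (rule ennreal_tendsto_zero_bound[OF le l1 l2])
  then have "(\<integral>x. \<Psi> x * H x $ i \<partial>lebesgue) = 0" by (simp add: LIMSEQ_const_iff)
  then show ?thesis by (simp add: \<Psi>_def power2_eq_square mult_ac)
qed

text \<open>Both signs of |x|^2 H_i are tested on each ball about the origin, so the component
  vanishes there almost everywhere; the factor |x|^2 is removed outside the null set {0}. This makes
  the choice in \<open>weighted_gradient\<close> harmless.\<close>

lemma gradient_zero_unique:
  assumes "hwg u H" "AE x in lebesgue. u x = 0"
  shows "AE x in lebesgue. H x = 0"
proof -
  have [measurable]: "H \<in> borel_measurable lebesgue" "u \<in> borel_measurable lebesgue" using assms by (auto simp: hwg_iff)
  obtain \<phi> where \<phi>: "approx \<phi> u H" using assms by (auto simp: hwg_iff)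
  have fin: "wen H < \<infinity>" by (rule wen_finite[OF assms(1)])
  have "qint (\<lambda>x. \<phi> n x - u x) = qint (\<lambda>x. \<phi> n x - 0)" for n
    unfolding qint_def using assms(2) by (intro nn_integral_cong_AE) auto
  then have \<phi>0: "approx \<phi> (\<lambda>_. 0) H" using \<phi> by (simp add: approx_def)
  have int: "set_integrable lebesgue (ball 0 R) (\<lambda>x. (norm x)\<^sup>2 * H x $ i)" for R i
    unfolding set_integrable_def
  proof (rule integrableI_bounded)
    let ?c = "R powr (2 - \<alpha> / 2)"
    have "ennreal (norm (indicator (ball 0 R) x *\<^sub>R ((norm x)\<^sup>2 * H x $ i))) \<le> ennreal ?c * (indicator (cball 0 R) x + ennreal (norm x powr \<alpha> * (norm (H x))\<^sup>2))" for x
    proof (cases "norm x < R")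
      case True
      have "norm ((norm x)\<^sup>2 * H x $ i) \<le> (norm x)\<^sup>2 * norm (H x)"
        using component_le_norm_cart[of "H x" i] by (simp add: abs_mult mult_left_mono)
      also have "\<dots> \<le> ?c * (norm x powr (\<alpha> / 2) * norm (H x))" using True by (intro weighted_norm_le) auto
      also have "norm x powr (\<alpha> / 2) * norm (H x) \<le> 1 + (norm x powr (\<alpha> / 2) * norm (H x))\<^sup>2"
        using zero_le_power2[of "norm x powr (\<alpha> / 2) * norm (H x) - 1"] by (simp add: power2_diff) (smt (verit) zero_le_mult_iff norm_ge_zero powr_ge_zero)
      also have "(norm x powr (\<alpha> / 2) * norm (H x))\<^sup>2 = norm x powr \<alpha> * (norm (H x))\<^sup>2"
        by (simp add: power_mult_distrib) (simp add: power2_eq_square flip: powr_add)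
      finally have "ennreal (norm ((norm x)\<^sup>2 * H x $ i)) \<le> ennreal (?c * (1 + norm x powr \<alpha> * (norm (H x))\<^sup>2))"
        by (intro ennreal_leI) (simp add: mult_left_mono)
      also have "\<dots> = ennreal ?c * (1 + ennreal (norm x powr \<alpha> * (norm (H x))\<^sup>2))"
        by (simp add: ennreal_mult)
      finally show ?thesis using True by simp
    qed simp
    then have "(\<integral>\<^sup>+x. ennreal (norm (indicator (ball 0 R) x *\<^sub>R ((norm x)\<^sup>2 * H x $ i))) \<partial>lebesgue) \<le>
       (\<integral>\<^sup>+x. ennreal ?c * (indicator (cball 0 R) x + ennreal (norm x powr \<alpha> * (norm (H x))\<^sup>2)) \<partial>lebesgue)"
      by (intro nn_integral_mono)
    also have "\<dots> = ennreal ?c * (emeasure lebesgue (cball (0::real^'n) R) + wen H)"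
      unfolding wen_def by (simp add: nn_integral_cmult nn_integral_add)
    also have "\<dots> < \<infinity>" using emeasure_cball_finite[of R] fin by (simp add: ennreal_mult_less_top)
    finally show "(\<integral>\<^sup>+x. ennreal (norm (indicator (ball 0 R) x *\<^sub>R ((norm x)\<^sup>2 * H x $ i))) \<partial>lebesgue) < \<infinity>" .
  qed measurable
  have "AE x in lebesgue. x \<in> ball 0 (real k) \<longrightarrow> H x $ i = 0" for k i
  proof -
    have 1: "AE x in lebesgue. x \<in> ball 0 (real k) \<longrightarrow> (norm x)\<^sup>2 * H x $ i \<le> 0"
      by (rule AE_nonpos_if_test_nonpos) (use int gradient_unique_aux[OF \<phi>0 _ fin, of _ i] in auto)
    have 2: "AE x in lebesgue. x \<in> ball 0 (real k) \<longrightarrow> - ((norm x)\<^sup>2 * H x $ i) \<le> 0"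
      by (rule AE_nonpos_if_test_nonpos) (use int[unfolded set_integrable_def, THEN integrable_minus] gradient_unique_aux[OF \<phi>0 _ fin, of _ i] in \<open>auto simp: set_integrable_def\<close>)
    have 3: "AE x in lebesgue. x \<noteq> (0::real^'n)" by (rule AE_completion[OF AE_lborel_nonzero])
    from 1 2 3 show ?thesis
      by eventually_elim (auto simp: mult_le_0_iff zero_le_mult_iff)
  qed
  then have "AE x in lebesgue. \<forall>k i. x \<in> ball 0 (real k) \<longrightarrow> H x $ i = 0"
    unfolding AE_all_countable by (auto intro!: AE_finite_allI)
  then show ?thesis
  proof eventually_elim
    case (elim x)
    obtain k :: nat where "norm x < real k" using reals_Archimedean2 by blast
    then show ?case using elim by (auto simp: vec_eq_iff)
  qed
qed

lemma gradient_unique: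
  assumes "hwg u G" "hwg v H" "AE x in lebesgue. u x = v x"
  shows "AE x in lebesgue. G x = H x"
proof -
  have "AE x in lebesgue. G x - H x = 0"
    by (rule gradient_zero_unique[OF hwg_diff[OF assms(1,2)]]) (use assms(3) in auto)
  then show ?thesis by simp
qed

end

section \<open>Inner product, Hardy and Sobolev inequalities, completeness\<close>

context weighted_space
begin

abbreviation W :: "(real ^ 'n \<Rightarrow> real) set" where "W \<equiv> weighted_sobolev \<alpha>"

abbreviation ip :: "(real ^ 'n \<Rightarrow> real) \<Rightarrow> (real ^ 'n \<Rightarrow> real) \<Rightarrow> real" where "ip \<equiv> weighted_inner \<alpha>"

lemma WI: "hwg u G \<Longrightarrow> u \<in> W" by (auto simp: weighted_sobolev_def)

lemma hwg_weighted_gradient: "u \<in> W \<Longrightarrow> hwg u (weighted_gradient \<alpha> u)"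
  unfolding weighted_sobolev_def weighted_gradient_def by (simp add: someI_ex[of "hwg u"])

lemma W_measurable: "u \<in> W \<Longrightarrow> u \<in> borel_measurable lebesgue"
  using hwg_weighted_gradient hwgD by blast

lemma W_linear: "u \<in> W \<Longrightarrow> v \<in> W \<Longrightarrow> (\<lambda>x. a * u x + b * v x) \<in> W"
  using hwg_linear[OF hwg_weighted_gradient hwg_weighted_gradient] WI by blast

lemma W_diff: "u \<in> W \<Longrightarrow> v \<in> W \<Longrightarrow> (\<lambda>x. u x - v x) \<in> W"
  using W_linear[of u v 1 "-1"] by simp

lemma test_in_W: "\<phi> \<in> test_functions \<Longrightarrow> \<phi> \<in> W"
  by (rule WI[OF hwg_test])

lemma integrable_inner:
  assumes "hwg u G" "hwg v H"
  shows "integrable lebesgue (\<lambda>x. norm x powr \<alpha> * (G x \<bullet> H x))"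
proof (rule integrableI_bounded)
  have [measurable]: "G \<in> borel_measurable lebesgue" "H \<in> borel_measurable lebesgue" using assms by (auto simp: hwg_iff)
  show "(\<lambda>x. norm x powr \<alpha> * (G x \<bullet> H x)) \<in> borel_measurable lebesgue" by measurable
  have "ennreal (norm (norm x powr \<alpha> * (G x \<bullet> H x))) \<le> ennreal (norm x powr \<alpha> * (norm (G x))\<^sup>2) + ennreal (norm x powr \<alpha> * (norm (H x))\<^sup>2)" for x
  proof -
    have "\<bar>G x \<bullet> H x\<bar> \<le> norm (G x) * norm (H x)" by (rule Cauchy_Schwarz_ineq2)
    also have "\<dots> \<le> (norm (G x))\<^sup>2 + (norm (H x))\<^sup>2"
      using sum_squares_bound[of "norm (G x)" "norm (H x)"] mult_nonneg_nonneg[OF norm_ge_zero norm_ge_zero, of "G x" "H x"] by linarith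
    finally have "norm x powr \<alpha> * \<bar>G x \<bullet> H x\<bar> \<le> norm x powr \<alpha> * ((norm (G x))\<^sup>2 + (norm (H x))\<^sup>2)"
      by (rule mult_left_mono) simp
    then have "ennreal (norm x powr \<alpha> * \<bar>G x \<bullet> H x\<bar>) \<le> ennreal (norm x powr \<alpha> * (norm (G x))\<^sup>2 + norm x powr \<alpha> * (norm (H x))\<^sup>2)"
      by (intro ennreal_leI) (simp add: distrib_left)
    also have "\<dots> = ennreal (norm x powr \<alpha> * (norm (G x))\<^sup>2) + ennreal (norm x powr \<alpha> * (norm (H x))\<^sup>2)"
      by (rule ennreal_plus) auto
    finally show ?thesis by (simp add: abs_mult)
  qed
  then have "(\<integral>\<^sup>+x. ennreal (norm (norm x powr \<alpha> * (G x \<bullet> H x))) \<partial>lebesgue) \<le>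
     (\<integral>\<^sup>+x. ennreal (norm x powr \<alpha> * (norm (G x))\<^sup>2) + ennreal (norm x powr \<alpha> * (norm (H x))\<^sup>2) \<partial>lebesgue)"
    by (intro nn_integral_mono)
  also have "\<dots> = wen G + wen H" unfolding wen_def by (simp add: nn_integral_add)
  also have "\<dots> < \<infinity>" using wen_finite assms by (simp add: wen_finite)
  finally show "(\<integral>\<^sup>+x. ennreal (norm (norm x powr \<alpha> * (G x \<bullet> H x))) \<partial>lebesgue) < \<infinity>" .
qed

text \<open>By uniqueness the inner product may be computed with any admissible gradients in place
  of the chosen ones; all rules of bilinearity rest on this.\<close>

lemma ip_eq:
  assumes "hwg u G" "hwg v H"
  shows "ip u v = (\<integral>x. norm x powr \<alpha> * (G x \<bullet> H x) \<partial>lebesgue)"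
proof -
  have [measurable]: "G \<in> borel_measurable lebesgue" "H \<in> borel_measurable lebesgue" using assms by (auto simp: hwg_iff)
  have [measurable]: "weighted_gradient \<alpha> u \<in> borel_measurable lebesgue" "weighted_gradient \<alpha> v \<in> borel_measurable lebesgue"
    using assms[THEN WI, THEN hwg_weighted_gradient, THEN hwgD(2)] by auto
  have "AE x in lebesgue. weighted_gradient \<alpha> u x = G x" "AE x in lebesgue. weighted_gradient \<alpha> v x = H x"
    by (rule gradient_unique[OF hwg_weighted_gradient[OF WI]], fact, fact, simp)+
  then show ?thesis
    unfolding weighted_inner_def by (intro integral_cong_AE) (measurable, auto)
qed

lemma ip_sym: "ip u v = ip v u"
  by (simp add: weighted_inner_def inner_commute)

lemma ip_linear:
  assumes "u \<in> W" "v \<in> W" "w \<in> W"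
  shows "ip (\<lambda>x. a * u x + b * v x) w = a * ip u w + b * ip v w"
proof -
  note h = assms[THEN hwg_weighted_gradient]
  let ?G = "weighted_gradient \<alpha>"
  have "ip (\<lambda>x. a * u x + b * v x) w = (\<integral>x. norm x powr \<alpha> * ((a *\<^sub>R ?G u x + b *\<^sub>R ?G v x) \<bullet> ?G w x) \<partial>lebesgue)"
    by (rule ip_eq[OF hwg_linear[OF h(1,2)] h(3)])
  also have "\<dots> = (\<integral>x. a * (norm x powr \<alpha> * (?G u x \<bullet> ?G w x)) + b * (norm x powr \<alpha> * (?G v x \<bullet> ?G w x)) \<partial>lebesgue)"
    by (intro Bochner_Integration.integral_cong) (auto simp: inner_add_left algebra_simps)
  also have "\<dots> = a * ip u w + b * ip v w"
    using integrable_inner[OF h(1,3)] integrable_inner[OF h(2,3)] by (simp add: weighted_inner_def)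
  finally show ?thesis .
qed

lemma wen_eq_ip: assumes "hwg u G" shows "wen G = ennreal (ip u u)" "0 \<le> ip u u"
proof -
  have e: "norm x powr \<alpha> * (G x \<bullet> G x) = norm x powr \<alpha> * (norm (G x))\<^sup>2" for x by (simp add: power2_norm_eq_inner)
  have "integrable lebesgue (\<lambda>x. norm x powr \<alpha> * (norm (G x))\<^sup>2)"
    using integrable_inner[OF assms assms] by (simp add: e)
  then show "wen G = ennreal (ip u u)"
    unfolding wen_def ip_eq[OF assms assms] by (simp add: nn_integral_eq_integral e)
  show "0 \<le> ip u u" unfolding ip_eq[OF assms assms] by (intro Bochner_Integration.integral_nonneg) auto
qed

lemma ip_nonneg: "u \<in> W \<Longrightarrow> 0 \<le> ip u u"
  using wen_eq_ip(2)[OF hwg_weighted_gradient] .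

lemma W_hardy:
  assumes "u \<in> W"
  shows "(\<integral>\<^sup>+x. ennreal (norm x powr (\<alpha> - 2) * (u x)\<^sup>2) \<partial>lebesgue) \<le> ennreal (4 * ip u u)"
  using hwg_hardy[OF hwg_weighted_gradient[OF assms]] ip_nonneg[OF assms]
  by (simp add: wen_eq_ip(1)[OF hwg_weighted_gradient[OF assms]] ennreal_mult)

lemma ip_zero_imp:
  assumes "u \<in> W" "ip u u = 0" shows "AE x in lebesgue. u x = 0"
proof -
  have [measurable]: "u \<in> borel_measurable lebesgue" by (rule W_measurable[OF assms(1)])
  have "(\<integral>\<^sup>+x. ennreal (norm x powr (\<alpha> - 2) * (u x)\<^sup>2) \<partial>lebesgue) = 0"
    using W_hardy[OF assms(1)] assms(2) by simp
  then have "AE x in lebesgue. ennreal (norm x powr (\<alpha> - 2) * (u x)\<^sup>2) = 0"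
    by (subst (asm) nn_integral_0_iff_AE) auto
  moreover have "AE x in lebesgue. x \<noteq> (0::real^'n)" by (rule AE_completion[OF AE_lborel_nonzero])
  ultimately show ?thesis by eventually_elim (auto simp: ennreal_eq_0_iff mult_le_0_iff)
qed

lemma W_hardy_local:
  obtains r C where "r > 0" "C > 0" "\<And>u. u \<in> W \<Longrightarrow>
    (\<integral>\<^sup>+x. ennreal (norm (x - y) powr (\<alpha> - 2) * (u x)\<^sup>2) * indicator (ball y r) x \<partial>lebesgue) \<le> ennreal (C * ip u u)"
proof -
  obtain r C where rC: "r > 0" "C > 0" "\<And>u. u \<in> test_functions \<Longrightarrow>
    (\<integral>\<^sup>+x. ennreal (norm (x - y) powr (\<alpha> - 2) * (u x)\<^sup>2) * indicator (ball y r) x \<partial>lborel) \<le> ennreal C * energy \<alpha> u"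
    using hardy_local[OF \<alpha> N, of y] by blast
  show ?thesis
  proof (rule that[OF rC(1,2)])
    fix u assume u: "u \<in> W"
    have e: "ennreal (norm (x - y) powr (\<alpha> - 2) * indicator (ball y r) x * (v x)\<^sup>2) = ennreal (norm (x - y) powr (\<alpha> - 2) * (v x)\<^sup>2) * indicator (ball y r) x" for x v
      by (auto split: split_indicator)
    have "(\<integral>\<^sup>+x. ennreal (norm (x - y) powr (\<alpha> - 2) * indicator (ball y r) x * (u x)\<^sup>2) \<partial>lebesgue) \<le> ennreal C * wen (weighted_gradient \<alpha> u)"
      by (rule hwg_square_bound[OF hwg_weighted_gradient[OF u]]) (use rC in \<open>auto simp: e\<close>)
    then show "(\<integral>\<^sup>+x. ennreal (norm (x - y) powr (\<alpha> - 2) * (u x)\<^sup>2) * indicator (ball y r) x \<partial>lebesgue) \<le> ennreal (C * ip u u)"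
      using rC(2) ip_nonneg[OF u] by (simp add: e wen_eq_ip(1)[OF hwg_weighted_gradient[OF u]] ennreal_mult)
  qed
qed

text \<open>Scaling by 1/sqrt t reduces to energy at most 1. A positive upper bound t is used in
  place of the energy, so that vanishing energy needs no separate treatment.\<close>

lemma test_sobolev:
  obtains C where "C > 0" "\<And>\<phi> t. \<phi> \<in> test_functions \<Longrightarrow> t > 0 \<Longrightarrow> energy \<alpha> \<phi> \<le> ennreal t \<Longrightarrow> qint \<phi> \<le> ennreal (C * t powr (q / 2))"
proof -
  obtain C where C: "C > 0" "\<And>u :: real ^ 'n \<Rightarrow> real. u \<in> test_functions \<Longrightarrow>
    (\<integral>\<^sup>+x. ennreal (norm x powr \<alpha> * (norm (gradient u x))\<^sup>2) \<partial>lborel) \<le> 1 \<Longrightarrow>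
    (\<integral>\<^sup>+x. ennreal (\<bar>u x\<bar> powr critical_exponent CARD('n) \<alpha>) \<partial>lborel) \<le> ennreal C"
    using sobolev[OF \<alpha> N] by blast
  show ?thesis
  proof (rule that[OF C(1)])
    fix \<phi> :: "real ^ 'n \<Rightarrow> real" and t :: real assume \<phi>: "\<phi> \<in> test_functions" and t: "t > 0" and E: "energy \<alpha> \<phi> \<le> ennreal t"
    define \<psi> where "\<psi> = (\<lambda>x. inverse (sqrt t) * \<phi> x)"
    have \<psi>: "\<psi> \<in> test_functions" using test_linear[OF \<phi> \<phi>, of "inverse (sqrt t)" 0] by (simp add: \<psi>_def)
    have "gradient \<psi> = (\<lambda>x. inverse (sqrt t) *\<^sub>R gradient \<phi> x)"
      using gradient_linear[OF test_smooth[OF \<phi>] test_smooth[OF \<phi>], of "inverse (sqrt t)" 0] by (simp add: \<psi>_def fun_eq_iff)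
    then have "energy \<alpha> \<psi> = ennreal (inverse t) * energy \<alpha> \<phi>"
      using wen_scale[OF test_gradient_measurable[OF \<phi>], of "inverse (sqrt t)"] t
      by (simp add: wen_gradient[symmetric] power_inverse)
    also have "\<dots> \<le> ennreal (inverse t) * ennreal t" by (intro mult_left_mono E) simp
    also have "\<dots> = 1" using t by (simp flip: ennreal_mult)
    finally have "qint \<psi> \<le> ennreal C"
      using C(2)[OF \<psi>] by (simp add: energy_def qint_def q_def nn_integral_completion)
    have "\<phi> = (\<lambda>x. sqrt t * \<psi> x)" using t by (simp add: \<psi>_def fun_eq_iff flip: mult.assoc)
    then have "qint \<phi> = ennreal (\<bar>sqrt t\<bar> powr q) * qint \<psi>"
      using qint_scale[OF test_measurable[OF \<psi>], of "sqrt t"] by simp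
    also have "\<dots> \<le> ennreal (\<bar>sqrt t\<bar> powr q) * ennreal C" by (intro mult_left_mono \<open>qint \<psi> \<le> ennreal C\<close>) simp
    also have "\<dots> = ennreal (C * t powr (q / 2))"
      using t C(1) by (simp add: powr_half_sqrt[symmetric] powr_powr mult.commute flip: ennreal_mult)
    finally show "qint \<phi> \<le> ennreal (C * t powr (q / 2))" .
  qed
qed

lemma W_sobolev:
  obtains C where "C > 0" "\<And>u t. u \<in> W \<Longrightarrow> t > 0 \<Longrightarrow> ip u u \<le> t \<Longrightarrow> qint u \<le> ennreal (C * t powr (q / 2))"
proof -
  obtain C where C: "C > 0" "\<And>\<phi> t. \<phi> \<in> test_functions \<Longrightarrow> t > 0 \<Longrightarrow> energy \<alpha> \<phi> \<le> ennreal t \<Longrightarrow> qint \<phi> \<le> ennreal (C * t powr (q / 2))"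
    using test_sobolev by blast
  show ?thesis
  proof (rule that[of "C * 2 powr (q / 2)"])
    show "C * 2 powr (q / 2) > 0" using C by simp
    fix u t assume u: "u \<in> W" and t: "t > 0" "ip u u \<le> t"
    note h = hwg_weighted_gradient[OF u]
    obtain \<phi> where \<phi>: "approx \<phi> u (weighted_gradient \<alpha> u)" "AE x in lebesgue. (\<lambda>n. \<phi> n x) \<longlonglongrightarrow> u x"
      using hwg_approx_AE[OF h] by blast
    have tst: "\<phi> n \<in> test_functions" for n using \<phi> by (auto simp: approx_def)
    note [measurable] = tst[THEN test_measurable]
    have "(\<lambda>n. energy \<alpha> (\<phi> n)) \<longlonglongrightarrow> ennreal (ip u u)"
      using approx_energy_tendsto[OF h \<phi>(1)] by (simp add: wen_eq_ip(1)[OF h])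
    \<comment> \<open>The energies converge to a value that may equal t, so an eventual bound needs
      the slack 2, which reappears in the constant.\<close>
    then have "\<forall>\<^sub>F n in sequentially. energy \<alpha> (\<phi> n) < ennreal (2 * t)"
      by (rule order_tendstoD) (use t in \<open>auto simp: ennreal_less_iff ip_nonneg[OF u]\<close>)
    then have ev: "\<forall>\<^sub>F n in sequentially. qint (\<phi> n) \<le> ennreal (C * (2 * t) powr (q / 2))"
      by eventually_elim (use C(2)[OF tst] t in auto)
    have "qint u \<le> (\<integral>\<^sup>+x. liminf (\<lambda>n. ennreal (\<bar>\<phi> n x\<bar> powr q)) \<partial>lebesgue)"
      unfolding qint_def
    proof (rule nn_integral_mono_AE, use \<phi>(2) in eventually_elim)
      case (elim x)
      then have "(\<lambda>n. ennreal (\<bar>\<phi> n x\<bar> powr q)) \<longlonglongrightarrow> ennreal (\<bar>u x\<bar> powr q)"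
        using q_gt_2 by (intro tendsto_ennrealI tendsto_powr' tendsto_intros) auto
      from lim_imp_Liminf[OF trivial_limit_sequentially this] show ?case by simp
    qed
    also have "\<dots> \<le> liminf (\<lambda>n. qint (\<phi> n))"
      unfolding qint_def by (rule nn_integral_liminf) measurable
    also have "\<dots> \<le> ennreal (C * (2 * t) powr (q / 2))"
      using ev by (intro Liminf_le) auto
    finally show "qint u \<le> ennreal (C * 2 powr (q / 2) * t powr (q / 2))"
      by (simp add: powr_mult mult.assoc)
  qed
qed

lemma W_qint_tendsto:
  assumes v: "\<And>n. v n \<in> W" and lim: "(\<lambda>n. ip (v n) (v n)) \<longlonglongrightarrow> 0"
  shows "(\<lambda>n. qint (v n)) \<longlonglongrightarrow> 0"
proof -
  obtain C where C: "C > 0" "\<And>u t. u \<in> W \<Longrightarrow> t > 0 \<Longrightarrow> ip u u \<le> t \<Longrightarrow> qint u \<le> ennreal (C * t powr (q / 2))"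
    using W_sobolev by metis
  \<comment> \<open>The added 1/(n+1) keeps the bound positive, as the Sobolev inequality above
    demands.\<close>
  let ?t = "\<lambda>n. ip (v n) (v n) + inverse (real (Suc n))"
  have pos: "?t n > 0" for n using ip_nonneg[OF v[of n]] by (simp add: add_nonneg_pos)
  have "?t \<longlonglongrightarrow> 0 + 0" by (intro tendsto_add lim LIMSEQ_inverse_real_of_nat)
  then have "(\<lambda>n. ?t n powr (q / 2)) \<longlonglongrightarrow> 0 powr (q / 2)"
    using q_gt_2 pos by (intro tendsto_powr') (auto simp: less_imp_le)
  then have "(\<lambda>n. C * ?t n powr (q / 2)) \<longlonglongrightarrow> C * 0"
    using q_gt_2 by (intro tendsto_mult tendsto_const) simp
  then have "(\<lambda>n. ennreal (C * ?t n powr (q / 2))) \<longlonglongrightarrow> ennreal 0" by (intro tendsto_ennrealI) simp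
  then have "(\<lambda>n. ennreal (C * ?t n powr (q / 2))) \<longlonglongrightarrow> 0" by simp
  then show ?thesis
    by (rule tendsto_sandwich[OF _ _ tendsto_const, rotated 2]) (use C(2)[OF v pos] in auto)
qed

lemma W_AE_subseq:
  assumes v: "\<And>n. v n \<in> W" "w \<in> W" and lim: "(\<lambda>n. ip (\<lambda>x. v n x - w x) (\<lambda>x. v n x - w x)) \<longlonglongrightarrow> 0"
  obtains r :: "nat \<Rightarrow> nat" where "strict_mono r" "AE x in lebesgue. (\<lambda>n. v (r n) x) \<longlonglongrightarrow> w x"
proof -
  have "(\<lambda>n. qint (\<lambda>x. v n x - w x)) \<longlonglongrightarrow> 0"
    by (rule W_qint_tendsto[OF W_diff[OF v] lim])
  then have "(\<lambda>n. \<integral>\<^sup>+x. ennreal (norm (v n x - w x) powr q) \<partial>lebesgue) \<longlonglongrightarrow> 0"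
    by (simp add: qint_def)
  then show ?thesis
    by (rule mean_convergence_AE_subseq[rotated 3]) (use q_gt_2 W_measurable v that in auto)
qed

lemma W_approx:
  assumes u: "u \<in> W"
  obtains \<phi> where "\<And>n. \<phi> n \<in> test_functions" "(\<lambda>n. ip (\<lambda>x. \<phi> n x - u x) (\<lambda>x. \<phi> n x - u x)) \<longlonglongrightarrow> 0"
    "AE x in lebesgue. (\<lambda>n. \<phi> n x) \<longlonglongrightarrow> u x"
proof -
  note h = hwg_weighted_gradient[OF u]
  obtain \<phi> where \<phi>: "approx \<phi> u (weighted_gradient \<alpha> u)" "AE x in lebesgue. (\<lambda>n. \<phi> n x) \<longlonglongrightarrow> u x"
    using hwg_approx_AE[OF h] by blast
  have t: "\<phi> n \<in> test_functions" for n using \<phi> by (auto simp: approx_def)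
  have "(\<lambda>n. ennreal (ip (\<lambda>x. \<phi> n x - u x) (\<lambda>x. \<phi> n x - u x))) \<longlonglongrightarrow> ennreal 0"
    using \<phi>(1) wen_eq_ip(1)[OF hwg_diff[OF hwg_test[OF t] h]] by (simp add: approx_def)
  then have "(\<lambda>n. ip (\<lambda>x. \<phi> n x - u x) (\<lambda>x. \<phi> n x - u x)) \<longlonglongrightarrow> 0"
    by (subst (asm) tendsto_ennreal_iff) (auto intro!: always_eventually ip_nonneg W_diff[OF test_in_W[OF t] u])
  with t \<phi> that show ?thesis by blast
qed

text \<open>Each v_n is replaced by a test function within 1/(n+1) in energy. These are Cauchy in
  energy, hence in L^q by Sobolev's inequality; the limit of the functions and the limit of the
  gradients together form an element of the completion.\<close>

lemma W_complete:
  assumes v: "\<And>n. v n \<in> W"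
    and Cauchy: "\<And>e. e > 0 \<Longrightarrow> \<exists>K. \<forall>m\<ge>K. \<forall>n\<ge>K. ip (\<lambda>x. v m x - v n x) (\<lambda>x. v m x - v n x) \<le> e"
  obtains w where "w \<in> W" "(\<lambda>n. ip (\<lambda>x. v n x - w x) (\<lambda>x. v n x - w x)) \<longlonglongrightarrow> 0"
proof -
  let ?G = "\<lambda>n. weighted_gradient \<alpha> (v n)"
  note h = hwg_weighted_gradient[OF v]
  have mG [measurable]: "?G n \<in> borel_measurable lebesgue" for n using h by (simp add: hwg_iff)
  have "\<exists>\<phi>. \<phi> \<in> test_functions \<and> wen (\<lambda>x. gradient \<phi> x - ?G n x) < ennreal (inverse (real (Suc n)))" for n
  proof -
    obtain \<phi> where \<phi>: "approx \<phi> (v n) (?G n)" using h by (auto simp: hwg_iff)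
    then have "(\<lambda>k. wen (\<lambda>x. gradient (\<phi> k) x - ?G n x)) \<longlonglongrightarrow> 0" by (simp add: approx_def)
    then have "\<forall>\<^sub>F k in sequentially. wen (\<lambda>x. gradient (\<phi> k) x - ?G n x) < ennreal (inverse (real (Suc n)))"
      by (rule order_tendstoD) simp
    then show ?thesis using \<phi> by (auto simp: eventually_sequentially approx_def)
  qed
  then obtain \<phi> where \<phi>: "\<And>n. \<phi> n \<in> test_functions" "\<And>n. wen (\<lambda>x. gradient (\<phi> n) x - ?G n x) < ennreal (inverse (real (Suc n)))"
    by metis
  note [measurable] = \<phi>(1)[THEN test_measurable] \<phi>(1)[THEN test_gradient_measurable]
  have \<phi>C: "\<exists>K. \<forall>m\<ge>K. \<forall>n\<ge>K. energy \<alpha> (\<lambda>x. \<phi> m x - \<phi> n x) \<le> ennreal e" if e: "e > 0" for e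
  proof -
    \<comment> \<open>With the factors 2 from each splitting the parts add up to 2(e/8) + 8(e/12) =
      11e/12.\<close>
    obtain K where K: "\<And>m n. m \<ge> K \<Longrightarrow> n \<ge> K \<Longrightarrow> ip (\<lambda>x. v m x - v n x) (\<lambda>x. v m x - v n x) \<le> e / 8"
      using Cauchy[of "e / 8"] e by auto
    obtain L where L: "inverse (real (Suc L)) < e / 12" using reals_Archimedean[of "e / 12"] e by auto
    show ?thesis
    proof (intro exI allI impI)
      fix m n assume mn: "m \<ge> max K L" "n \<ge> max K L"
      let ?D = "\<lambda>n x. gradient (\<phi> n) x - ?G n x"
      have small: "wen (?D k) \<le> ennreal (e / 12)" if "k \<ge> L" for k
      proof -
        have "inverse (real (Suc k)) \<le> inverse (real (Suc L))" using that by (simp add: inverse_eq_divide frac_le)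
        then show ?thesis using \<phi>(2)[of k] L by (meson ennreal_leI less_imp_le order_trans)
      qed
      have g: "gradient (\<lambda>x. \<phi> m x - \<phi> n x) x = (?G m x - ?G n x) + (?D m x + - ?D n x)" for x
        using gradient_linear[of "\<phi> m" "\<phi> n" 1 "-1" x] \<phi>(1) by (simp add: test_smooth)
      have "energy \<alpha> (\<lambda>x. \<phi> m x - \<phi> n x) = wen (\<lambda>x. (?G m x - ?G n x) + (?D m x + - ?D n x))"
        by (simp add: wen_gradient[symmetric] g[abs_def])
      also have "\<dots> \<le> ennreal 2 * wen (\<lambda>x. ?G m x - ?G n x) + ennreal 2 * wen (\<lambda>x. ?D m x + - ?D n x)"
        by (rule wen_add_le2) measurable
      also have "\<dots> \<le> ennreal 2 * ennreal (e / 8) + ennreal 2 * (ennreal 2 * ennreal (e / 12) + ennreal 2 * ennreal (e / 12))"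
      proof (intro add_mono mult_left_mono)
        show "wen (\<lambda>x. ?G m x - ?G n x) \<le> ennreal (e / 8)"
          using K[of m n] mn wen_eq_ip(1)[OF hwg_diff[OF h h], of m n] by (simp add: ennreal_leI)
        have "wen (\<lambda>x. ?D m x + - ?D n x) \<le> ennreal 2 * wen (?D m) + ennreal 2 * wen (\<lambda>x. - ?D n x)"
          by (rule wen_add_le2) measurable
        also have "\<dots> \<le> ennreal 2 * ennreal (e / 12) + ennreal 2 * ennreal (e / 12)"
          unfolding wen_minus using small mn by (intro add_mono mult_left_mono) auto
        finally show "wen (\<lambda>x. ?D m x + - ?D n x) \<le> ennreal 2 * ennreal (e / 12) + ennreal 2 * ennreal (e / 12)" .
      qed auto
      also have "\<dots> = ennreal (2 * (e / 8) + 2 * (2 * (e / 12) + 2 * (e / 12)))"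
        using e by (simp only: ennreal_mult ennreal_plus add_nonneg_nonneg mult_nonneg_nonneg divide_nonneg_nonneg less_imp_le zero_le_numeral)
      also have "\<dots> \<le> ennreal e" using e by (intro ennreal_leI) simp
      finally show "energy \<alpha> (\<lambda>x. \<phi> m x - \<phi> n x) \<le> ennreal e" .
    qed
  qed
  have td: "(\<lambda>x. \<phi> m x - \<phi> n x) \<in> test_functions" for m n using test_linear[OF \<phi>(1) \<phi>(1), of 1 m "-1" n] by simp
  obtain C where C: "C > 0" "\<And>\<phi> t. \<phi> \<in> test_functions \<Longrightarrow> t > 0 \<Longrightarrow> energy \<alpha> \<phi> \<le> ennreal t \<Longrightarrow> qint \<phi> \<le> ennreal (C * t powr (q / 2))"
    using test_sobolev by blast
  obtain w where w: "w \<in> borel_measurable lebesgue" "(\<lambda>n. \<integral>\<^sup>+x. ennreal (norm (\<phi> n x - w x) powr q) \<partial>lebesgue) \<longlonglongrightarrow> 0"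
  proof (rule mean_Cauchy_convergent[of \<phi> lebesgue q])
    fix e :: real assume e: "e > 0"
    define t where "t = (e / C) powr (2 / q)"
    have t: "t > 0" using e C by (simp add: t_def)
    have "C * t powr (q / 2) = e" using e C q_gt_2 by (simp add: t_def powr_powr)
    then have "qint \<phi> \<le> ennreal e" if "\<phi> \<in> test_functions" "energy \<alpha> \<phi> \<le> ennreal t" for \<phi>
      using C(2)[OF that(1) t that(2)] by simp
    then show "\<exists>K. \<forall>m\<ge>K. \<forall>n\<ge>K. (\<integral>\<^sup>+x. ennreal (norm (\<phi> m x - \<phi> n x) powr q) \<partial>lebesgue) \<le> ennreal e"
      using \<phi>C[OF t] td by (simp add: qint_def) blast
  qed (use q_gt_2 in auto)
  \<comment> \<open>Multiplying by |x|^(\<alpha>/2) turns the weighted L^2 space into the unweighted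
    one, where completeness is available; \<open>G\<close> divides the factor out again, which is
    legitimate away from the origin.\<close>
  define F where "F n x = norm x powr (\<alpha> / 2) *\<^sub>R gradient (\<phi> n) x" for n x
  have sq: "ennreal (norm (norm x powr (\<alpha> / 2) *\<^sub>R a) powr 2) = ennreal (norm x powr \<alpha> * (norm a)\<^sup>2)" for x a :: "real ^ 'n"
    by (simp add: power_mult_distrib) (simp add: power2_eq_square flip: powr_add)
  obtain G' where G': "G' \<in> borel_measurable lebesgue" "(\<lambda>n. \<integral>\<^sup>+x. ennreal (norm (F n x - G' x) powr 2) \<partial>lebesgue) \<longlonglongrightarrow> 0"
  proof (rule mean_Cauchy_convergent[of F lebesgue 2])
    show "F n \<in> borel_measurable lebesgue" for n unfolding F_def by measurable
    fix e :: real assume e: "e > 0"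
    have "gradient (\<lambda>x. \<phi> m x - \<phi> n x) x = gradient (\<phi> m) x - gradient (\<phi> n) x" for m n x
      using gradient_linear[of "\<phi> m" "\<phi> n" 1 "-1" x] \<phi>(1) by (simp add: test_smooth)
    then have "(\<integral>\<^sup>+x. ennreal (norm (F m x - F n x) powr 2) \<partial>lebesgue) = energy \<alpha> (\<lambda>x. \<phi> m x - \<phi> n x)" for m n
      by (simp only: F_def scaleR_diff_right[symmetric] sq wen_gradient[symmetric] wen_def)
    then show "\<exists>K. \<forall>m\<ge>K. \<forall>n\<ge>K. (\<integral>\<^sup>+x. ennreal (norm (F m x - F n x) powr 2) \<partial>lebesgue) \<le> ennreal e"
      using \<phi>C[OF e] by simp
  qed auto
  define G where "G x = norm x powr (- \<alpha> / 2) *\<^sub>R G' x" for x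
  have [measurable]: "G \<in> borel_measurable lebesgue" using G' unfolding G_def by measurable
  have "(\<integral>\<^sup>+x. ennreal (norm (F n x - G' x) powr 2) \<partial>lebesgue) = wen (\<lambda>x. gradient (\<phi> n) x - G x)" for n
    unfolding wen_def
  proof (rule nn_integral_cong_AE)
    have "AE x in lebesgue. x \<noteq> (0::real^'n)" by (rule AE_completion[OF AE_lborel_nonzero])
    then show "AE x in lebesgue. ennreal (norm (F n x - G' x) powr 2) = ennreal (norm x powr \<alpha> * (norm (gradient (\<phi> n) x - G x))\<^sup>2)"
    proof eventually_elim
      case (elim x)
      have "norm x powr (\<alpha> / 2) * norm x powr (- \<alpha> / 2) = 1" using elim by (simp flip: powr_add)
      then have "F n x - G' x = norm x powr (\<alpha> / 2) *\<^sub>R (gradient (\<phi> n) x - G x)"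
        by (simp add: F_def G_def scaleR_diff_right)
      then show ?case by (simp only: sq)
    qed
  qed
  then have "approx \<phi> w G" using \<phi>(1) w(2) G'(2) by (simp add: approx_def qint_def)
  then have hw: "hwg w G" using w(1) \<open>G \<in> borel_measurable lebesgue\<close> unfolding hwg_iff by blast
  have "(\<lambda>n. wen (\<lambda>x. ?G n x - G x)) \<longlonglongrightarrow> 0"
  proof (rule ennreal_tendsto_zero_bound)
    fix n
    have "wen (\<lambda>x. - (gradient (\<phi> n) x - ?G n x) + (gradient (\<phi> n) x - G x)) \<le>
      ennreal 2 * wen (\<lambda>x. - (gradient (\<phi> n) x - ?G n x)) + ennreal 2 * wen (\<lambda>x. gradient (\<phi> n) x - G x)"
      by (rule wen_add_le2) measurable
    moreover have "wen (\<lambda>x. - (gradient (\<phi> n) x - ?G n x)) \<le> ennreal (inverse (real (Suc n)))"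
      unfolding wen_minus using \<phi>(2)[of n] by simp
    ultimately show "wen (\<lambda>x. ?G n x - G x) \<le> ennreal 2 * ennreal (inverse (real (Suc n))) + ennreal 2 * wen (\<lambda>x. gradient (\<phi> n) x - G x)"
      by simp (meson add_right_mono mult_left_mono order_trans zero_le)
    show "(\<lambda>n. ennreal (inverse (real (Suc n)))) \<longlonglongrightarrow> 0"
      using tendsto_ennrealI[OF LIMSEQ_inverse_real_of_nat] by simp
    show "(\<lambda>n. wen (\<lambda>x. gradient (\<phi> n) x - G x)) \<longlonglongrightarrow> 0" using \<open>approx \<phi> w G\<close> by (simp add: approx_def)
  qed
  then have "(\<lambda>n. ennreal (ip (\<lambda>x. v n x - w x) (\<lambda>x. v n x - w x))) \<longlonglongrightarrow> ennreal 0"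
    using wen_eq_ip(1)[OF hwg_diff[OF h hw]] by simp
  then have "(\<lambda>n. ip (\<lambda>x. v n x - w x) (\<lambda>x. v n x - w x)) \<longlonglongrightarrow> 0"
    by (subst (asm) tendsto_ennreal_iff) (auto intro!: always_eventually ip_nonneg W_diff[OF v WI[OF hw]])
  with WI[OF hw] show ?thesis by (rule that)
qed

end

section \<open>An abstract indefinite eigenvalue problem\<close>

text \<open>A symmetric bilinear form on a linear space of functions, only semidefinite: functions
  are not identified when they agree almost everywhere, and the forms of g^+ and g^- may vanish on
  large subspaces.\<close>

definition psd_form :: "('a \<Rightarrow> real) set \<Rightarrow> (('a \<Rightarrow> real) \<Rightarrow> ('a \<Rightarrow> real) \<Rightarrow> real) \<Rightarrow> bool" where
  "psd_form X B \<longleftrightarrow>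
     (\<forall>u\<in>X. \<forall>v\<in>X. \<forall>a b. (\<lambda>x. a * u x + b * v x) \<in> X) \<and>
     (\<forall>u\<in>X. \<forall>v\<in>X. B u v = B v u) \<and>
     (\<forall>u\<in>X. \<forall>v\<in>X. \<forall>w\<in>X. \<forall>a b. B (\<lambda>x. a * u x + b * v x) w = a * B u w + b * B v w) \<and>
     (\<forall>u\<in>X. 0 \<le> B u u)"

lemma psd_formD:
  assumes "psd_form X B" "u \<in> X" "v \<in> X"
  shows "(\<lambda>x. a * u x + b * v x) \<in> X" "B u v = B v u" "0 \<le> B u u"
    "w \<in> X \<Longrightarrow> B (\<lambda>x. a * u x + b * v x) w = a * B u w + b * B v w"
    "w \<in> X \<Longrightarrow> B w (\<lambda>x. a * u x + b * v x) = a * B w u + b * B w v"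
proof -
  show X: "(\<lambda>x. a * u x + b * v x) \<in> X" for a b using assms unfolding psd_form_def by blast
  have s: "B y z = B z y" if "y \<in> X" "z \<in> X" for y z using assms(1) that unfolding psd_form_def by blast
  show "B u v = B v u" "0 \<le> B u u" using assms unfolding psd_form_def by blast+
  show l: "B (\<lambda>x. a * u x + b * v x) w = a * B u w + b * B v w" if "w \<in> X" for w a b
    using assms that unfolding psd_form_def by blast
  show "B w (\<lambda>x. a * u x + b * v x) = a * B w u + b * B w v" if "w \<in> X"
    using l[OF that] s[OF X that] s[OF assms(2) that] s[OF assms(3) that] by simp
qed

lemma psd_form_quadratic:
  assumes "psd_form X B" "u \<in> X" "v \<in> X"
  shows "B (\<lambda>x. a * u x + b * v x) (\<lambda>x. a * u x + b * v x) = a\<^sup>2 * B u u + 2 * a * b * B u v + b\<^sup>2 * B v v"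
proof -
  let ?z = "\<lambda>x. a * u x + b * v x"
  have "B ?z ?z = a * B u ?z + b * B v ?z"
    by (rule psd_formD(4)[OF assms psd_formD(1)[OF assms]])
  also have "B u ?z = a * B u u + b * B u v" by (rule psd_formD(5)[OF assms assms(2)])
  also have "B v ?z = a * B u v + b * B v v"
    using psd_formD(5)[OF assms assms(3)] psd_formD(2)[OF assms] by simp
  finally show ?thesis by (simp add: power2_eq_square algebra_simps)
qed

lemma psd_form_diff:
  assumes "psd_form X B" "u \<in> X" "v \<in> X"
  shows "(\<lambda>x. u x - v x) \<in> X"
    "B (\<lambda>x. u x - v x) (\<lambda>x. u x - v x) = B u u - 2 * B u v + B v v"
    "w \<in> X \<Longrightarrow> B w (\<lambda>x. u x - v x) = B w u - B w v"
  using psd_formD(1)[OF assms, of 1 "-1"] psd_form_quadratic[OF assms, of 1 "-1"]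
    psd_formD(5)[OF assms, of w 1 "-1"] by auto

lemma psd_form_Cauchy_Schwarz:
  assumes "psd_form X B" "u \<in> X" "v \<in> X"
  shows "(B u v)\<^sup>2 \<le> B u u * B v v"
proof -
  have q: "0 \<le> a\<^sup>2 * B u u + 2 * a * b * B u v + b\<^sup>2 * B v v" for a b
    using psd_formD(3)[OF assms(1) psd_formD(1)[OF assms, of a b] assms(2)] psd_form_quadratic[OF assms, of a b]
    by simp
  have nn: "0 \<le> B u u" "0 \<le> B v v" using psd_formD(3)[OF assms] psd_formD(3)[OF assms(1,3,2)] by auto
  show ?thesis
  proof (cases "B v v = 0")
    case True
    have "B u v = 0"
    proof (rule ccontr)
      assume "B u v \<noteq> 0"
      \<comment> \<open>With this second coefficient the quadratic expression equals -1.\<close>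
      then show False using q[of 1 "- (B u u + 1) / (2 * B u v)"] True by (simp add: field_simps)
    qed
    then show ?thesis using True by simp
  next
    case False
    then have pos: "B v v > 0" using nn by simp
    have "0 \<le> (B v v)\<^sup>2 * B u u - 2 * B v v * B u v * B u v + (B u v)\<^sup>2 * B v v"
      using q[of "B v v" "- B u v"] by simp
    also have "\<dots> = B v v * (B u u * B v v - (B u v)\<^sup>2)" by (simp add: power2_eq_square algebra_simps)
    finally show ?thesis using pos by (simp add: zero_le_mult_iff)
  qed
qed

lemma psd_form_tendsto:
  assumes B: "psd_form X B" and v: "\<And>n. v n \<in> X" and w: "w \<in> X"
    and lim: "(\<lambda>n. B (\<lambda>x. v n x - w x) (\<lambda>x. v n x - w x)) \<longlonglongrightarrow> 0"
  shows "z \<in> X \<Longrightarrow> (\<lambda>n. B z (v n)) \<longlonglongrightarrow> B z w" "(\<lambda>n. B (v n) (v n)) \<longlonglongrightarrow> B w w"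
proof -
  note d = psd_form_diff[OF B v w]
  show 1: "(\<lambda>n. B z (v n)) \<longlonglongrightarrow> B z w" if z: "z \<in> X" for z
  proof -
    have "(\<lambda>n. sqrt (B z z * B (\<lambda>x. v n x - w x) (\<lambda>x. v n x - w x))) \<longlonglongrightarrow> sqrt (B z z * 0)"
      by (intro tendsto_intros lim)
    then have l: "(\<lambda>n. sqrt (B z z * B (\<lambda>x. v n x - w x) (\<lambda>x. v n x - w x))) \<longlonglongrightarrow> 0" by simp
    have "\<bar>B z (\<lambda>x. v n x - w x)\<bar> \<le> sqrt (B z z * B (\<lambda>x. v n x - w x) (\<lambda>x. v n x - w x))" for n
      using psd_form_Cauchy_Schwarz[OF B z d(1)] by (metis real_sqrt_abs real_sqrt_le_mono)
    then have "(\<lambda>n. B z (\<lambda>x. v n x - w x)) \<longlonglongrightarrow> 0"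
      by (intro Lim_null_comparison[OF _ l]) simp
    then have "(\<lambda>n. B z (v n) - B z w) \<longlonglongrightarrow> 0" by (simp add: d(3)[OF z])
    then show ?thesis by (simp add: LIM_zero_iff)
  qed
  have "(\<lambda>n. B (\<lambda>x. v n x - w x) (\<lambda>x. v n x - w x) + 2 * B w (v n) - B w w) \<longlonglongrightarrow> 0 + 2 * B w w - B w w"
    by (intro tendsto_intros lim 1[OF w])
  then show "(\<lambda>n. B (v n) (v n)) \<longlonglongrightarrow> B w w" by (simp add: d(2) psd_formD(2)[OF B v w])
qed

text \<open>In the application A is the energy, and P and M are the forms of g^+ and g^-. The space
  is complete for A + M only. \<open>compact\<close> asks merely for a subsequence that is Cauchy in
  P; its limit is identified through \<open>bound\<close> once convergence in A is known.\<close>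

locale form_space =
  fixes X :: "('a \<Rightarrow> real) set" and A P M :: "('a \<Rightarrow> real) \<Rightarrow> ('a \<Rightarrow> real) \<Rightarrow> real" and C :: real
  assumes A: "psd_form X A" and P: "psd_form X P" and M: "psd_form X M"
    and bound: "\<And>u. u \<in> X \<Longrightarrow> P u u \<le> C * A u u"
    and compact: "\<And>v. (\<And>n::nat. v n \<in> X) \<Longrightarrow> (\<And>n. A (v n) (v n) \<le> 1) \<Longrightarrow>
      \<exists>r::nat\<Rightarrow>nat. strict_mono r \<and> (\<forall>e>0. \<exists>K. \<forall>m\<ge>K. \<forall>n\<ge>K. P (\<lambda>x. v (r m) x - v (r n) x) (\<lambda>x. v (r m) x - v (r n) x) \<le> e)"
    and complete: "\<And>v. (\<And>n::nat. v n \<in> X) \<Longrightarrow>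
      (\<And>e. e > 0 \<Longrightarrow> \<exists>K. \<forall>m\<ge>K. \<forall>n\<ge>K. A (\<lambda>x. v m x - v n x) (\<lambda>x. v m x - v n x) + M (\<lambda>x. v m x - v n x) (\<lambda>x. v m x - v n x) \<le> e) \<Longrightarrow>
      \<exists>w\<in>X. (\<lambda>n. A (\<lambda>x. v n x - w x) (\<lambda>x. v n x - w x)) \<longlonglongrightarrow> 0 \<and> (\<lambda>n. M (\<lambda>x. v n x - w x) (\<lambda>x. v n x - w x)) \<longlonglongrightarrow> 0"
    and positive: "\<And>U. finite U \<Longrightarrow> U \<subseteq> X \<Longrightarrow> \<exists>v\<in>X. (\<forall>u\<in>U. A u v = 0) \<and> M v v < P v v"
begin

text \<open>The multiplier stands on the side of A, so \<mu> is the reciprocal of an eigenvalue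
  \<lambda>.\<close>

definition eig :: "real \<Rightarrow> ('a \<Rightarrow> real) \<Rightarrow> bool" where
  "eig \<mu> u \<longleftrightarrow> u \<in> X \<and> A u u = 1 \<and> (\<forall>\<phi>\<in>X. P u \<phi> - M u \<phi> = \<mu> * A u \<phi>)"

definition good :: "('a \<Rightarrow> real) set \<Rightarrow> bool" where
  "good U \<longleftrightarrow> finite U \<and> (\<forall>u\<in>U. \<exists>\<mu>. eig \<mu> u) \<and> (\<forall>u\<in>U. \<forall>v\<in>U. u \<noteq> v \<longrightarrow> A u v = 0)"

text \<open>Orthogonal projection away from an orthonormal family, one vector at a time. A linear
  functional that vanishes on the family does not notice the projection; this extends an equation
  from the orthogonal complement to the whole space.\<close>

lemma remove_components:
  assumes "finite U" "\<And>u. u \<in> U \<Longrightarrow> u \<in> X \<and> A u u = 1 \<and> E u = 0" "\<And>u v. u \<in> U \<Longrightarrow> v \<in> U \<Longrightarrow> u \<noteq> v \<Longrightarrow> A u v = 0"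
    and E: "\<And>u v c. u \<in> X \<Longrightarrow> v \<in> X \<Longrightarrow> E (\<lambda>x. 1 * u x + c * v x) = E u + c * E v" and "\<phi> \<in> X"
  shows "\<exists>\<psi>\<in>X. (\<forall>u\<in>U. A u \<psi> = 0) \<and> E \<psi> = E \<phi>"
  using assms(1-3)
proof (induction U)
  case empty
  then show ?case using \<open>\<phi> \<in> X\<close> by auto
next
  case (insert u U)
  have u: "u \<in> X" "A u u = 1" "E u = 0" using insert.prems(1)[of u] by auto
  have "\<exists>\<psi>\<in>X. (\<forall>u\<in>U. A u \<psi> = 0) \<and> E \<psi> = E \<phi>"
    by (rule insert.IH) (use insert.prems in auto)
  then obtain \<psi> where \<psi>: "\<psi> \<in> X" "\<And>v. v \<in> U \<Longrightarrow> A v \<psi> = 0" "E \<psi> = E \<phi>" by blast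
  let ?\<psi> = "\<lambda>x. 1 * \<psi> x + (- A u \<psi>) * u x"
  have "A v ?\<psi> = A v \<psi> + (- A u \<psi>) * A v u" if "v \<in> X" for v
    using psd_formD(5)[OF A \<psi>(1) u(1) that, of 1 "- A u \<psi>"] by simp
  then have "A v ?\<psi> = 0" if "v \<in> insert u U" for v
    using that u \<psi> insert.prems insert.hyps by (cases "v = u") auto
  moreover have "E ?\<psi> = E \<phi>" using E[OF \<psi>(1) u(1), of "- A u \<psi>"] u \<psi>(3) by simp
  ultimately show ?case using psd_formD(1)[OF A \<psi>(1) u(1), of 1 "- A u \<psi>"] by blast
qed

text \<open>With S the supremum of P - M on the unit sphere of the complement, the defect form S A -
  (P - M) is positive semidefinite there and tends to 0 along a maximising sequence. The
  parallelogram law makes it small on differences; P is small on differences by compactness; so S A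
  + M is small too, and the sequence converges in the norm A + M.\<close>

lemma next_eigenvector:
  assumes U: "good U"
  shows "\<exists>S v. S > 0 \<and> eig S v \<and> (\<forall>u\<in>U. A u v = 0)"
proof -
  have UX: "U \<subseteq> X" "finite U" using U by (auto simp: good_def eig_def)
  define V where "V = {v\<in>X. \<forall>u\<in>U. A u v = 0}"
  have VX: "v \<in> X" if "v \<in> V" for v using that by (simp add: V_def)
  have Vlin: "(\<lambda>x. a * v x + b * w x) \<in> V" if "v \<in> V" "w \<in> V" for v w a b
    using that UX psd_formD(1,5)[OF A, of v w] by (auto simp: V_def)
  define Q where "Q v = P v v - M v v" for v
  define R where "R = {Q v | v. v \<in> V \<and> A v v = 1}"
  have scale: "(\<lambda>x. c * v x) \<in> V" "A (\<lambda>x. c * v x) (\<lambda>x. c * v x) = c\<^sup>2 * A v v" "Q (\<lambda>x. c * v x) = c\<^sup>2 * Q v" if "v \<in> V" for v c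
    using Vlin[OF that that, of c 0] psd_form_quadratic[OF A VX[OF that] VX[OF that], of c 0]
      psd_form_quadratic[OF P VX[OF that] VX[OF that], of c 0] psd_form_quadratic[OF M VX[OF that] VX[OF that], of c 0]
    by (auto simp: Q_def algebra_simps)
  have QP: "Q v \<le> P v v" if "v \<in> V" for v
    using psd_formD(3)[OF M VX VX, OF that that] by (simp add: Q_def)
  have normalize: "\<exists>w\<in>V. A w w = 1 \<and> Q w = Q v / A v v" if "v \<in> V" "A v v > 0" for v
  proof -
    let ?c = "1 / sqrt (A v v)"
    have "?c\<^sup>2 = 1 / A v v" using that by (simp add: power_divide)
    then show ?thesis using scale[OF that(1), of ?c] that(2) by (intro bexI[of _ "\<lambda>x. ?c * v x"]) auto
  qed
  have bdd: "bdd_above R"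
  proof (rule bdd_aboveI)
    fix r assume "r \<in> R"
    then obtain v where v: "r = Q v" "v \<in> V" "A v v = 1" by (auto simp: R_def)
    then show "r \<le> C" using QP[OF v(2)] bound[OF VX[OF v(2)]] by simp
  qed
  obtain v0 where v0: "v0 \<in> V" "Q v0 > 0"
    using positive[OF UX(2,1)] by (auto simp: V_def Q_def)
  \<comment> \<open>A is only semidefinite, but \<open>bound\<close> forces P, and with it the
    positive quantity Q, to be at most 0 where A vanishes.\<close>
  have "A v0 v0 > 0"
  proof (rule ccontr)
    assume "\<not> A v0 v0 > 0"
    then have "A v0 v0 = 0" using psd_formD(3)[OF A VX VX, OF v0(1) v0(1)] by simp
    then show False using bound[OF VX[OF v0(1)]] QP[OF v0(1)] v0(2) by simp
  qed
  then obtain v1 where v1: "v1 \<in> V" "A v1 v1 = 1" "Q v1 > 0" using normalize[OF v0(1)] v0(2) by auto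
  define S where "S = Sup R"
  have "Q v1 \<le> S" unfolding S_def using v1 by (intro cSup_upper bdd) (auto simp: R_def)
  then have S: "S > 0" using v1 by simp
  have le: "Q v \<le> S * A v v" if v: "v \<in> V" for v
  proof (cases "A v v = 0")
    case True
    then show ?thesis using bound[OF VX[OF v]] QP[OF v] by simp
  next
    case False
    then have pos: "A v v > 0" using psd_formD(3)[OF A VX VX, OF v v] by simp
    then obtain w where w: "w \<in> V" "A w w = 1" "Q w = Q v / A v v" using normalize[OF v] by blast
    have "Q w \<in> R" using w(1,2) unfolding R_def by blast
    then have "Q w \<le> S" unfolding S_def by (intro cSup_upper bdd)
    then have "Q v / A v v \<le> S" using w by simp
    then show ?thesis using pos by (simp add: divide_le_eq)
  qed
  define E where "E u v = S * A u v - (P u v - M u v)" for u v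
  have E: "psd_form V E"
    unfolding psd_form_def
  proof (intro conjI ballI allI)
    fix u v w a b assume uvw: "u \<in> V" "v \<in> V" "w \<in> V"
    show "E (\<lambda>x. a * u x + b * v x) w = a * E u w + b * E v w"
      using uvw[THEN VX] by (simp add: E_def psd_formD(4)[OF A] psd_formD(4)[OF P] psd_formD(4)[OF M] algebra_simps)
  next
    fix u v assume "u \<in> V" "v \<in> V"
    then show "E u v = E v u" using psd_formD(2)[OF A, of u v] psd_formD(2)[OF P, of u v] psd_formD(2)[OF M, of u v] VX
      by (simp add: E_def)
  next
    fix u assume "u \<in> V" then show "0 \<le> E u u" using le[of u] by (simp add: E_def Q_def)
  qed (use Vlin in auto)
  have "\<exists>v. v \<in> V \<and> A v v = 1 \<and> E v v < inverse (real (Suc n))" for n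
  proof -
    have "S - inverse (real (Suc n)) < Sup R" by (simp add: S_def)
    then obtain r where "r \<in> R" "S - inverse (real (Suc n)) < r"
      using less_cSup_iff[OF _ bdd] v1 by (auto simp: R_def)
    then show ?thesis by (auto simp: R_def E_def Q_def)
  qed
  then obtain v where v: "\<And>n. v n \<in> V" "\<And>n. A (v n) (v n) = 1" "\<And>n. E (v n) (v n) < inverse (real (Suc n))" by metis
  from compact[of v, OF VX[OF v(1)] eq_refl[OF v(2)]]
  obtain r :: "nat \<Rightarrow> nat" where r1: "strict_mono r" and
    r2: "\<forall>e>0. \<exists>K. \<forall>m\<ge>K. \<forall>n\<ge>K. P (\<lambda>x. v (r m) x - v (r n) x) (\<lambda>x. v (r m) x - v (r n) x) \<le> e"
    by (elim exE conjE)
  note r = r1 r2[rule_format]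
  define w where "w n = v (r n)" for n
  have wV: "w n \<in> V" "A (w n) (w n) = 1" for n by (auto simp: w_def v)
  have Ew: "(\<lambda>n. E (w n) (w n)) \<longlonglongrightarrow> 0"
  proof (rule tendsto_sandwich[OF _ _ tendsto_const LIMSEQ_inverse_real_of_nat])
    have "E (w n) (w n) \<le> inverse (real (Suc n))" for n
    proof -
      have "inverse (real (Suc (r n))) \<le> inverse (real (Suc n))"
        using strict_mono_imp_increasing[OF r(1), of n] by (simp add: inverse_eq_divide frac_le)
      then show ?thesis using v(3)[of "r n"] unfolding w_def by linarith
    qed
    then show "\<forall>\<^sub>F n in sequentially. E (w n) (w n) \<le> inverse (real (Suc n))" by simp
    show "\<forall>\<^sub>F n in sequentially. 0 \<le> E (w n) (w n)" using psd_formD(3)[OF E wV(1) wV(1)] by simp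
  qed
  have "\<exists>z\<in>X. (\<lambda>n. A (\<lambda>x. w n x - z x) (\<lambda>x. w n x - z x)) \<longlonglongrightarrow> 0 \<and> (\<lambda>n. M (\<lambda>x. w n x - z x) (\<lambda>x. w n x - z x)) \<longlonglongrightarrow> 0"
  proof (rule complete)
    show "w n \<in> X" for n using VX wV by blast
    fix e :: real assume e: "e > 0"
    \<comment> \<open>The smallness is obtained for S A + M; k is a factor with A + M \<le> k (S A +
      M).\<close>
    define k where "k = 1 / S + 1"
    have k: "k > 0" using S by (simp add: k_def add_pos_pos)
    obtain K1 where K1: "\<And>m n. m \<ge> K1 \<Longrightarrow> n \<ge> K1 \<Longrightarrow> P (\<lambda>x. w m x - w n x) (\<lambda>x. w m x - w n x) \<le> e / (2 * k)"
      using r(2)[of "e / (2 * k)"] e k by (auto simp: w_def)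
    obtain K2 where K2: "\<And>n. n \<ge> K2 \<Longrightarrow> E (w n) (w n) < e / (8 * k)"
      using order_tendstoD(2)[OF Ew, of "e / (8 * k)"] e k by (auto simp: eventually_sequentially)
    show "\<exists>K. \<forall>m\<ge>K. \<forall>n\<ge>K. A (\<lambda>x. w m x - w n x) (\<lambda>x. w m x - w n x) + M (\<lambda>x. w m x - w n x) (\<lambda>x. w m x - w n x) \<le> e"
    proof (intro exI allI impI)
      fix m n assume mn: "m \<ge> max K1 K2" "n \<ge> max K1 K2"
      define d where "d = (\<lambda>x. w m x - w n x)"
      have dV: "d \<in> V" using psd_form_diff(1)[OF E wV(1) wV(1)] by (simp add: d_def)
      \<comment> \<open>The parallelogram law for the defect form; the sum lies in the complement,
        so its defect is non-negative and may be dropped.\<close>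
      have "E d d + E (\<lambda>x. 1 * w m x + 1 * w n x) (\<lambda>x. 1 * w m x + 1 * w n x) = 2 * E (w m) (w m) + 2 * E (w n) (w n)"
        unfolding d_def psd_form_diff(2)[OF E wV(1) wV(1)] psd_form_quadratic[OF E wV(1) wV(1)] by simp
      moreover have "0 \<le> E (\<lambda>x. 1 * w m x + 1 * w n x) (\<lambda>x. 1 * w m x + 1 * w n x)"
        using psd_formD(3)[OF E] Vlin[OF wV(1) wV(1)] by blast
      ultimately have "E d d \<le> 2 * E (w m) (w m) + 2 * E (w n) (w n)" by linarith
      also have "\<dots> \<le> e / (2 * k)" using K2[of m] K2[of n] mn by (simp add: field_simps)
      finally have "E d d + P d d \<le> e / k" using K1[of m n] mn k by (simp add: d_def)
      then have sm: "S * A d d + M d d \<le> e / k" by (simp add: E_def)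
      have nn: "0 \<le> A d d" "0 \<le> M d d" using psd_formD(3)[OF A VX VX, OF dV dV] psd_formD(3)[OF M VX VX, OF dV dV] by auto
      have "A d d + M d d \<le> k * (S * A d d + M d d)"
      proof -
        have "k * (S * A d d + M d d) = A d d + M d d + S * A d d + M d d / S"
          using S by (simp add: k_def field_simps)
        then show ?thesis using nn S by simp
      qed
      also have "\<dots> \<le> k * (e / k)" using sm k by (intro mult_left_mono) auto
      finally show "A (\<lambda>x. w m x - w n x) (\<lambda>x. w m x - w n x) + M (\<lambda>x. w m x - w n x) (\<lambda>x. w m x - w n x) \<le> e"
        using k by (simp add: d_def)
    qed
  qed
  then obtain z where z: "z \<in> X" and zA: "(\<lambda>n. A (\<lambda>x. w n x - z x) (\<lambda>x. w n x - z x)) \<longlonglongrightarrow> 0"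
    and zM: "(\<lambda>n. M (\<lambda>x. w n x - z x) (\<lambda>x. w n x - z x)) \<longlonglongrightarrow> 0" by blast
  have wX: "w n \<in> X" for n using VX wV by blast
  have zP: "(\<lambda>n. P (\<lambda>x. w n x - z x) (\<lambda>x. w n x - z x)) \<longlonglongrightarrow> 0"
  proof (rule tendsto_sandwich[OF _ _ tendsto_const])
    have "(\<lambda>n. C * A (\<lambda>x. w n x - z x) (\<lambda>x. w n x - z x)) \<longlonglongrightarrow> C * 0" by (intro tendsto_intros zA)
    then show "(\<lambda>n. C * A (\<lambda>x. w n x - z x) (\<lambda>x. w n x - z x)) \<longlonglongrightarrow> 0" by simp
  next
    have d: "(\<lambda>x. w n x - z x) \<in> X" for n by (rule psd_form_diff(1)[OF A wX z])
    show "\<forall>\<^sub>F n in sequentially. 0 \<le> P (\<lambda>x. w n x - z x) (\<lambda>x. w n x - z x)"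
      using psd_formD(3)[OF P d d] by simp
    show "\<forall>\<^sub>F n in sequentially. P (\<lambda>x. w n x - z x) (\<lambda>x. w n x - z x) \<le> C * A (\<lambda>x. w n x - z x) (\<lambda>x. w n x - z x)"
      using bound[OF d] by simp
  qed
  have zV: "z \<in> V"
  proof -
    have "A u z = 0" if u: "u \<in> U" for u
    proof -
      have "(\<lambda>n. A u (w n)) \<longlonglongrightarrow> A u z" using psd_form_tendsto(1)[OF A wX z zA] u UX by blast
      moreover have "A u (w n) = 0" for n using wV(1)[of n] u by (simp add: V_def)
      ultimately show ?thesis by (simp add: LIMSEQ_const_iff)
    qed
    then show ?thesis using z by (simp add: V_def)
  qed
  have "(\<lambda>n. A (w n) (w n)) \<longlonglongrightarrow> A z z" by (rule psd_form_tendsto(2)[OF A wX z zA])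
  then have Az: "A z z = 1" by (simp add: wV LIMSEQ_const_iff)
  have "(\<lambda>n. E (w n) (w n)) \<longlonglongrightarrow> E z z"
    unfolding E_def by (intro tendsto_intros psd_form_tendsto(2)[OF A wX z zA] psd_form_tendsto(2)[OF P wX z zP] psd_form_tendsto(2)[OF M wX z zM])
  then have "E z z = 0" using Ew LIMSEQ_unique by blast
  \<comment> \<open>The Euler-Lagrange equation without differentiation: by Cauchy-Schwarz a null
    vector of a semidefinite form is orthogonal to everything.\<close>
  then have EzV: "E z \<phi> = 0" if "\<phi> \<in> V" for \<phi>
    using psd_form_Cauchy_Schwarz[OF E zV that] by simp
  have "E z \<phi> = 0" if \<phi>: "\<phi> \<in> X" for \<phi>
  proof -
    \<comment> \<open>The earlier eigenvectors are orthogonal to z for A, and by their own equation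
      also for P - M, so the functional E z vanishes on them.\<close>
    have "\<exists>\<psi>\<in>X. (\<forall>u\<in>U. A u \<psi> = 0) \<and> E z \<psi> = E z \<phi>"
    proof (rule remove_components[OF UX(2) _ _ _ \<phi>])
      fix u assume u: "u \<in> U"
      then obtain \<mu> where \<mu>: "eig \<mu> u" using U by (auto simp: good_def)
      have uX: "u \<in> X" using u UX by blast
      have "A u z = 0" using zV u by (simp add: V_def)
      moreover have "P u z - M u z = \<mu> * A u z" using \<mu> z by (simp add: eig_def)
      ultimately have "E z u = 0"
        using psd_formD(2)[OF A z uX] psd_formD(2)[OF P z uX] psd_formD(2)[OF M z uX] by (simp add: E_def)
      then show "u \<in> X \<and> A u u = 1 \<and> E z u = 0" using \<mu> by (simp add: eig_def)
    next
      fix u v c assume "u \<in> X" "v \<in> X"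
      then show "E z (\<lambda>x. 1 * u x + c * v x) = E z u + c * E z v"
        using psd_formD(5)[OF A _ _ z, of u v 1 c] psd_formD(5)[OF P _ _ z, of u v 1 c] psd_formD(5)[OF M _ _ z, of u v 1 c]
        by (simp add: E_def algebra_simps)
    qed (use U in \<open>auto simp: good_def\<close>)
    then obtain \<psi> where \<psi>: "\<psi> \<in> X" "\<forall>u\<in>U. A u \<psi> = 0" "E z \<psi> = E z \<phi>" by blast
    then show ?thesis using EzV[of \<psi>] by (simp add: V_def)
  qed
  then have "eig S z" using z Az by (auto simp: eig_def E_def)
  then show ?thesis using S zV by (auto simp: V_def)
qed

text \<open>If all values stayed above \<epsilon>, the construction would yield an infinite
  orthonormal sequence of eigenvectors. Two of them have P-distance squared at least \<mu>_m +
  \<mu>_n \<ge> 2\<epsilon>, which contradicts the Cauchy subsequence.\<close>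

theorem small_eigenvalue:
  assumes \<epsilon>: "\<epsilon> > 0"
  shows "\<exists>\<mu> u. 0 < \<mu> \<and> \<mu> < \<epsilon> \<and> eig \<mu> u"
proof (rule ccontr)
  assume "\<not> ?thesis"
  then have ge: "\<mu> \<ge> \<epsilon>" if "0 < \<mu>" "eig \<mu> u" for \<mu> u using that by (meson not_less)
  define succ where "succ U v \<longleftrightarrow> (\<exists>S. S > 0 \<and> eig S v \<and> (\<forall>u\<in>U. A u v = 0))" for U v
  define nxt where "nxt U = (SOME v. succ U v)" for U
  have nxt: "\<exists>S. S > 0 \<and> eig S (nxt U) \<and> (\<forall>u\<in>U. A u (nxt U) = 0)" if "good U" for U
  proof -
    from next_eigenvector[OF that] obtain S v where "S > 0 \<and> eig S v \<and> (\<forall>u\<in>U. A u v = 0)"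
      by (elim exE)
    then have "succ U v" unfolding succ_def by (rule exI)
    then have "succ U (nxt U)" unfolding nxt_def by (rule someI[of "succ U"])
    then show ?thesis unfolding succ_def .
  qed
  define US where "US = rec_nat ({} :: ('a \<Rightarrow> real) set) (\<lambda>_ U. insert (nxt U) U)"
  have US: "US 0 = {}" "US (Suc n) = insert (nxt (US n)) (US n)" for n by (simp_all add: US_def)
  have good: "good (US n)" for n
  proof (induction n)
    case 0
    then show ?case by (simp add: US good_def)
  next
    case (Suc n)
    obtain S where S: "eig S (nxt (US n))" "\<And>u. u \<in> US n \<Longrightarrow> A u (nxt (US n)) = 0" using nxt[OF Suc] by blast
    have "A (nxt (US n)) u = 0" if "u \<in> US n" for u
    proof -
      have "u \<in> X" using Suc that by (auto simp: good_def eig_def)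
      then show ?thesis using S that psd_formD(2)[OF A, of "nxt (US n)" u] by (simp add: eig_def)
    qed
    then show ?case using Suc S by (auto simp: US good_def)
  qed
  define u where "u n = nxt (US n)" for n
  have "\<exists>S>0. eig S (u n)" for n using nxt[OF good] by (auto simp: u_def)
  then obtain \<mu> where \<mu>: "\<And>n. \<mu> n > 0" "\<And>n. eig (\<mu> n) (u n)" by metis
  have uX: "u n \<in> X" for n using \<mu>(2)[of n] by (simp add: eig_def)
  have uA: "A (u n) (u n) = 1" for n using \<mu>(2)[of n] by (simp add: eig_def)
  have sub: "u m \<in> US (m + Suc k)" for m k by (induction k) (auto simp: US u_def)
  have orth: "A (u m) (u n) = 0" if "m < n" for m n
  proof -
    have "n = m + Suc (n - Suc m)" using that by simp
    then have "u m \<in> US n" using sub by metis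
    then show ?thesis using nxt[OF good[of n]] by (auto simp: u_def)
  qed
  from compact[of u, OF uX eq_refl[OF uA]]
  obtain r :: "nat \<Rightarrow> nat" where r1: "strict_mono r" and
    r2: "\<forall>e>0. \<exists>K. \<forall>m\<ge>K. \<forall>n\<ge>K. P (\<lambda>x. u (r m) x - u (r n) x) (\<lambda>x. u (r m) x - u (r n) x) \<le> e"
    by (elim exE conjE)
  note r = r1 r2[rule_format]
  obtain K where K: "\<And>m n. m \<ge> K \<Longrightarrow> n \<ge> K \<Longrightarrow> P (\<lambda>x. u (r m) x - u (r n) x) (\<lambda>x. u (r m) x - u (r n) x) \<le> \<epsilon>"
    using r(2)[OF \<epsilon>] by blast
  let ?m = "r K" and ?n = "r (Suc K)"
  have lt: "?m < ?n" using r(1) by (simp add: strict_mono_Suc_iff)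
  have B: "P (u i) (u j) - M (u i) (u j) = \<mu> i * A (u i) (u j)" for i j
    using \<mu>(2)[of i] uX by (simp add: eig_def)
  \<comment> \<open>Orthogonality in A makes the cross terms of P - M vanish by the eigenvalue
    equation.\<close>
  have "P (\<lambda>x. u ?m x - u ?n x) (\<lambda>x. u ?m x - u ?n x) - M (\<lambda>x. u ?m x - u ?n x) (\<lambda>x. u ?m x - u ?n x) = \<mu> ?m + \<mu> ?n"
    using B[of ?m ?m] B[of ?m ?n] B[of ?n ?n] orth[OF lt] uA
    by (simp add: psd_form_diff(2)[OF P uX uX] psd_form_diff(2)[OF M uX uX])
  moreover have "0 \<le> M (\<lambda>x. u ?m x - u ?n x) (\<lambda>x. u ?m x - u ?n x)"
    using psd_formD(3)[OF M] psd_form_diff(1)[OF M uX uX] by blast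
  moreover have "\<mu> ?m \<ge> \<epsilon>" "\<mu> ?n \<ge> \<epsilon>" using ge \<mu> by blast+
  ultimately show False using K[of K "Suc K"] \<epsilon> by simp
qed

end

section \<open>Compactness of the positive part\<close>

text \<open>Whichever of b and a^(p-1) is larger decides which of the two powers alone dominates the
  product; the sharp constants do not matter below.\<close>

lemma Young_crude:
  fixes a b p :: real
  assumes "0 \<le> a" "0 \<le> b" "1 < p"
  shows "a * b \<le> a powr p + b powr (p / (p - 1))"
proof (cases "b \<le> a powr (p - 1)")
  case True
  then have "a * b \<le> a * a powr (p - 1)" using assms by (intro mult_left_mono) auto
  also have "\<dots> = a powr p" using assms by (cases "a = 0") (auto simp: powr_mult_base)
  finally show ?thesis by (simp add: add_increasing2)
next
  case False
  then have "b > 0" using powr_ge_zero[of a "p - 1"] by linarith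
  have "a = (a powr (p - 1)) powr (1 / (p - 1))" using assms by (simp add: powr_powr)
  also have "\<dots> \<le> b powr (1 / (p - 1))" using False assms by (intro powr_mono2) auto
  finally have "a * b \<le> b powr (1 / (p - 1)) * b" using \<open>b > 0\<close> by (intro mult_right_mono) auto
  also have "\<dots> = b powr (p / (p - 1))"
    using assms \<open>b > 0\<close> by (simp add: powr_mult_base mult.commute) (simp add: field_simps)
  finally show ?thesis by (simp add: add_increasing)
qed

lemma le_from_product:
  fixes a b c d :: real
  assumes "b * a < d" "c * b = 1" "0 \<le> c"
  shows "a \<le> d * c"
proof -
  have "a = c * (b * a)" using assms(2) by (simp flip: mult.assoc)
  also have "\<dots> \<le> c * d" using assms by (intro mult_left_mono) auto
  finally show ?thesis by (simp only: mult.commute[of d c])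
qed

section \<open>Splitting a weight into a small part and a local part\<close>

context weighted_space
begin

text \<open>A relative form bound with arbitrarily small constant: what remains is an L^2 norm over
  a ball, the part that a Rellich argument can handle. Both admissible kinds of weight have this
  property, and it is stable under sums.\<close>

definition small_plus_local :: "(real ^ 'n \<Rightarrow> real) \<Rightarrow> bool" where
  "small_plus_local V \<longleftrightarrow> (\<forall>\<epsilon>>0. \<exists>M\<ge>0. \<exists>R>0. \<forall>u\<in>W. (\<integral>\<^sup>+x. ennreal (V x * (u x)\<^sup>2) \<partial>lebesgue) \<le>
     ennreal (\<epsilon> * ip u u) + ennreal M * (\<integral>\<^sup>+x. ennreal ((u x)\<^sup>2) * indicator (cball 0 R) x \<partial>lebesgue))"

lemma W_scale: "u \<in> W \<Longrightarrow> (\<lambda>x. c * u x) \<in> W" "u \<in> W \<Longrightarrow> ip (\<lambda>x. c * u x) (\<lambda>x. c * u x) = c\<^sup>2 * ip u u"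
proof -
  assume u: "u \<in> W"
  show w: "(\<lambda>x. c * u x) \<in> W" using W_linear[OF u u, of c 0] by simp
  show "ip (\<lambda>x. c * u x) (\<lambda>x. c * u x) = c\<^sup>2 * ip u u"
    using ip_linear[OF u u w, of c 0] ip_linear[OF u u u, of c 0] ip_sym[of u "\<lambda>x. c * u x"]
    by (simp add: power2_eq_square)
qed

lemma homogeneous_square_bound:
  assumes V [measurable]: "V \<in> borel_measurable lebesgue" and V0: "\<And>x. 0 \<le> V x" and "c \<ge> 0"
    and unit: "\<And>u. u \<in> W \<Longrightarrow> ip u u = 1 \<Longrightarrow> (\<integral>\<^sup>+x. ennreal (V x * (u x)\<^sup>2) \<partial>lebesgue) \<le> ennreal c"
    and u: "u \<in> W"
  shows "(\<integral>\<^sup>+x. ennreal (V x * (u x)\<^sup>2) \<partial>lebesgue) \<le> ennreal (c * ip u u)"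
proof (cases "ip u u = 0")
  case True
  have "(\<integral>\<^sup>+x. ennreal (V x * (u x)\<^sup>2) \<partial>lebesgue) = integral\<^sup>N lebesgue (\<lambda>x::real^'n. 0)"
    by (rule nn_integral_cong_AE) (use ip_zero_imp[OF u True] in auto)
  then show ?thesis by simp
next
  case False
  then have t: "ip u u > 0" using ip_nonneg[OF u] by simp
  have [measurable]: "u \<in> borel_measurable lebesgue" by (rule W_measurable[OF u])
  let ?c = "1 / sqrt (ip u u)"
  have sq: "?c\<^sup>2 = 1 / ip u u" using t by (simp add: power_divide)
  have "(\<integral>\<^sup>+x. ennreal (V x * (?c * u x)\<^sup>2) \<partial>lebesgue) \<le> ennreal c"
    by (rule unit[OF W_scale(1)[OF u]]) (use W_scale(2)[OF u, of ?c] sq t in simp)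
  then have "ennreal (ip u u) * (\<integral>\<^sup>+x. ennreal (V x * (?c * u x)\<^sup>2) \<partial>lebesgue) \<le> ennreal (ip u u) * ennreal c"
    by (rule mult_left_mono) simp
  also have "ennreal (ip u u) * (\<integral>\<^sup>+x. ennreal (V x * (?c * u x)\<^sup>2) \<partial>lebesgue) = (\<integral>\<^sup>+x. ennreal (V x * (u x)\<^sup>2) \<partial>lebesgue)"
  proof -
    have "ennreal (V x * (u x)\<^sup>2) = ennreal (ip u u) * ennreal (V x * (?c * u x)\<^sup>2)" for x
      using t V0 by (simp add: power_divide flip: ennreal_mult)
    then show ?thesis by (simp add: nn_integral_cmult)
  qed
  finally show ?thesis using t \<open>c \<ge> 0\<close> by (simp add: ennreal_mult mult.commute)
qed

text \<open>Where |h| \<le> k and |x| \<le> k the weight is bounded on a ball. The remaining set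
  carries little of the p-th power of |h| when k is large, and there Young's inequality with
  Sobolev's gives a small multiple of the energy. The inhomogeneous Young inequality is used at unit
  energy and the result is scaled.\<close>

lemma small_plus_local_Lp:
  assumes h: "in_Lp (real CARD('n) / (2 - \<alpha>)) h"
  shows "small_plus_local (\<lambda>x. \<bar>h x\<bar>)"
  unfolding small_plus_local_def
proof (intro allI impI)
  fix \<epsilon> :: real assume \<epsilon>: "\<epsilon> > 0"
  define p where "p = real CARD('n) / (2 - \<alpha>)"
  have h_meas [measurable]: "h \<in> borel_measurable lebesgue" and h_int: "integrable lebesgue (\<lambda>x. \<bar>h x\<bar> powr p)"
    using h by (auto simp: in_Lp_def p_def)
  have p: "p > 1" using N \<alpha> by (simp add: p_def less_divide_eq)
  \<comment> \<open>The integrability exponent N/(2-\<alpha>) is dual to q/2, so that u^2 pairs with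
    h in exactly the Sobolev space.\<close>
  have pq: "p / (p - 1) = q / 2"
  proof -
    have "2 - \<alpha> \<noteq> 0" "real CARD('n) - 2 + \<alpha> \<noteq> 0" using N \<alpha> by auto
    then show ?thesis by (simp add: p_def q_def critical_exponent_def divide_simps)
  qed
  obtain C where C: "C > 0" "\<And>u t. u \<in> W \<Longrightarrow> t > 0 \<Longrightarrow> ip u u \<le> t \<Longrightarrow> qint u \<le> ennreal (C * t powr (q / 2))"
    using W_sobolev by metis
  \<comment> \<open>The scale l is chosen so that the Sobolev term of Young's inequality costs
    \<epsilon>/2; afterwards k is chosen so that the term with |h|^p costs at most the other
    \<epsilon>/2.\<close>
  define l where "l = (2 * C / \<epsilon>) powr (2 / q)"
  have l: "l > 0" using C \<epsilon> by (simp add: l_def)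
  have lC: "l powr (- (q / 2)) * C = \<epsilon> / 2"
    using C \<epsilon> q_gt_2 by (simp add: l_def powr_powr powr_minus field_simps)
  define E where "E k = {x. \<bar>h x\<bar> > real k \<or> norm x > real k}" for k :: nat
  have [measurable]: "E k \<in> sets lebesgue" for k
  proof -
    have "{x \<in> space lebesgue. \<bar>h x\<bar> > real k \<or> norm x > real k} \<in> sets lebesgue" by measurable
    then show ?thesis by (simp add: E_def)
  qed
  have "(\<lambda>k. \<integral>x. indicator (E k) x * \<bar>h x\<bar> powr p \<partial>lebesgue) \<longlonglongrightarrow> integral\<^sup>L lebesgue (\<lambda>x::real^'n. 0)"
  proof (rule integral_dominated_convergence[OF _ _ h_int])
    have "(\<lambda>k. indicator (E k) x * \<bar>h x\<bar> powr p) \<longlonglongrightarrow> 0" for x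
    proof (rule tendsto_eventually)
      obtain k0 :: nat where "max \<bar>h x\<bar> (norm x) < real k0" using reals_Archimedean2 by blast
      then have "x \<notin> E k" if "k \<ge> k0" for k using that by (auto simp: E_def)
      then show "\<forall>\<^sub>F k in sequentially. indicator (E k) x * \<bar>h x\<bar> powr p = 0"
        unfolding eventually_sequentially by (intro exI[of _ k0]) auto
    qed
    then show "AE x in lebesgue. (\<lambda>k. indicator (E k) x * \<bar>h x\<bar> powr p) \<longlonglongrightarrow> 0" by simp
  qed (auto split: split_indicator)
  then have "\<forall>\<^sub>F k in sequentially. (\<integral>x. indicator (E k) x * \<bar>h x\<bar> powr p \<partial>lebesgue) < \<epsilon> / (2 * l powr p)"
    by (rule order_tendstoD) (use \<epsilon> l in simp)
  then have "\<forall>\<^sub>F k in sequentially. k > 0 \<and> (\<integral>x. indicator (E k) x * \<bar>h x\<bar> powr p \<partial>lebesgue) < \<epsilon> / (2 * l powr p)"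
    by (intro eventually_conj eventually_gt_at_top)
  then obtain k where k: "k > 0" "(\<integral>x. indicator (E k) x * \<bar>h x\<bar> powr p \<partial>lebesgue) < \<epsilon> / (2 * l powr p)"
    using eventually_happens'[OF sequentially_bot] by blast
  have hE: "(\<integral>\<^sup>+x. ennreal (indicator (E k) x * \<bar>h x\<bar> powr p) \<partial>lebesgue) \<le> ennreal (\<epsilon> / (2 * l powr p))"
  proof -
    have "integrable lebesgue (\<lambda>x. indicator (E k) x * \<bar>h x\<bar> powr p)"
      using integrable_mult_indicator[OF \<open>E k \<in> sets lebesgue\<close> h_int] by simp
    then show ?thesis using k(2) by (subst nn_integral_eq_integral) (auto intro: ennreal_leI)
  qed
  have unit: "(\<integral>\<^sup>+x. ennreal (indicator (E k) x * \<bar>h x\<bar> * (u x)\<^sup>2) \<partial>lebesgue) \<le> ennreal \<epsilon>"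
    if u: "u \<in> W" "ip u u = 1" for u
  proof -
    have [measurable]: "u \<in> borel_measurable lebesgue" by (rule W_measurable[OF u(1)])
    have pw: "indicator (E k) x * \<bar>h x\<bar> * (u x)\<^sup>2 \<le> l powr p * (indicator (E k) x * \<bar>h x\<bar> powr p) + l powr (- (q / 2)) * \<bar>u x\<bar> powr q" for x
    proof (cases "x \<in> E k")
      case True
      have "\<bar>h x\<bar> * (u x)\<^sup>2 = (l * \<bar>h x\<bar>) * ((u x)\<^sup>2 / l)" using l by simp
      also have "\<dots> \<le> (l * \<bar>h x\<bar>) powr p + ((u x)\<^sup>2 / l) powr (q / 2)"
        using Young_crude[OF _ _ p, of "l * \<bar>h x\<bar>" "(u x)\<^sup>2 / l"] l by (simp add: pq)
      also have "(l * \<bar>h x\<bar>) powr p = l powr p * \<bar>h x\<bar> powr p" by (simp add: powr_mult)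
      also have "((u x)\<^sup>2 / l) powr (q / 2) = l powr (- (q / 2)) * \<bar>u x\<bar> powr q"
      proof (cases "u x = 0")
        case False
        have "((u x)\<^sup>2 / l) powr (q / 2) = (\<bar>u x\<bar>\<^sup>2) powr (q / 2) / l powr (q / 2)" by (simp add: powr_divide)
        also have "(\<bar>u x\<bar>\<^sup>2) powr (q / 2) = \<bar>u x\<bar> powr q" using False by (intro powr_half_sq) simp
        finally show ?thesis by (simp add: powr_minus_divide)
      qed simp
      finally show ?thesis using True by simp
    qed simp
    have "(\<integral>\<^sup>+x. ennreal (indicator (E k) x * \<bar>h x\<bar> * (u x)\<^sup>2) \<partial>lebesgue) \<le>
      (\<integral>\<^sup>+x. ennreal (l powr p) * ennreal (indicator (E k) x * \<bar>h x\<bar> powr p) + ennreal (l powr (- (q / 2))) * ennreal (\<bar>u x\<bar> powr q) \<partial>lebesgue)"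
    proof (rule nn_integral_mono)
      fix x
      have "ennreal (indicator (E k) x * \<bar>h x\<bar> * (u x)\<^sup>2) \<le> ennreal (l powr p * (indicator (E k) x * \<bar>h x\<bar> powr p) + l powr (- (q / 2)) * \<bar>u x\<bar> powr q)"
        by (rule ennreal_leI[OF pw])
      also have "\<dots> = ennreal (l powr p) * ennreal (indicator (E k) x * \<bar>h x\<bar> powr p) + ennreal (l powr (- (q / 2))) * ennreal (\<bar>u x\<bar> powr q)"
        by (rule ennreal_lincomb) auto
      finally show "ennreal (indicator (E k) x * \<bar>h x\<bar> * (u x)\<^sup>2) \<le> \<dots>" .
    qed
    also have "\<dots> = ennreal (l powr p) * (\<integral>\<^sup>+x. ennreal (indicator (E k) x * \<bar>h x\<bar> powr p) \<partial>lebesgue) + ennreal (l powr (- (q / 2))) * qint u"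
      unfolding qint_def by (simp add: nn_integral_add nn_integral_cmult)
    also have "\<dots> \<le> ennreal (l powr p) * ennreal (\<epsilon> / (2 * l powr p)) + ennreal (l powr (- (q / 2))) * ennreal C"
      using hE C(2)[OF u(1), of 1] u(2) by (intro add_mono mult_left_mono) auto
    also have "\<dots> = ennreal (\<epsilon> / 2) + ennreal (\<epsilon> / 2)"
      using l lC C \<epsilon> by (simp flip: ennreal_mult)
    also have "\<dots> = ennreal \<epsilon>" using \<epsilon> by (simp flip: ennreal_plus)
    finally show ?thesis .
  qed
  show "\<exists>M\<ge>0. \<exists>R>0. \<forall>u\<in>W. (\<integral>\<^sup>+x. ennreal (\<bar>h x\<bar> * (u x)\<^sup>2) \<partial>lebesgue) \<le>
     ennreal (\<epsilon> * ip u u) + ennreal M * (\<integral>\<^sup>+x. ennreal ((u x)\<^sup>2) * indicator (cball 0 R) x \<partial>lebesgue)"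
  proof (intro exI conjI ballI)
    show "real k \<ge> 0" "real k > 0" using k by auto
    fix u assume u: "u \<in> W"
    have [measurable]: "u \<in> borel_measurable lebesgue" by (rule W_measurable[OF u])
    have "(\<integral>\<^sup>+x. ennreal (\<bar>h x\<bar> * (u x)\<^sup>2) \<partial>lebesgue) \<le>
       (\<integral>\<^sup>+x. ennreal (indicator (E k) x * \<bar>h x\<bar> * (u x)\<^sup>2) + ennreal (real k) * (ennreal ((u x)\<^sup>2) * indicator (cball 0 (real k)) x) \<partial>lebesgue)"
    proof (rule nn_integral_mono)
      fix x
      show "ennreal (\<bar>h x\<bar> * (u x)\<^sup>2) \<le> ennreal (indicator (E k) x * \<bar>h x\<bar> * (u x)\<^sup>2) + ennreal (real k) * (ennreal ((u x)\<^sup>2) * indicator (cball 0 (real k)) x)"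
      proof (cases "x \<in> E k")
        case False
        then have "\<bar>h x\<bar> \<le> real k" "x \<in> cball 0 (real k)" by (auto simp: E_def)
        then show ?thesis using False by (simp add: ennreal_leI mult_right_mono flip: ennreal_mult)
      qed simp
    qed
    also have "\<dots> = (\<integral>\<^sup>+x. ennreal (indicator (E k) x * \<bar>h x\<bar> * (u x)\<^sup>2) \<partial>lebesgue) + ennreal (real k) * (\<integral>\<^sup>+x. ennreal ((u x)\<^sup>2) * indicator (cball 0 (real k)) x \<partial>lebesgue)"
      by (simp add: nn_integral_add nn_integral_cmult)
    also have "(\<integral>\<^sup>+x. ennreal (indicator (E k) x * \<bar>h x\<bar> * (u x)\<^sup>2) \<partial>lebesgue) \<le> ennreal (\<epsilon> * ip u u)"
      by (rule homogeneous_square_bound[OF _ _ _ unit u]) (use \<epsilon> in auto)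
    finally show "(\<integral>\<^sup>+x. ennreal (\<bar>h x\<bar> * (u x)\<^sup>2) \<partial>lebesgue) \<le>
     ennreal (\<epsilon> * ip u u) + ennreal (real k) * (\<integral>\<^sup>+x. ennreal ((u x)\<^sup>2) * indicator (cball 0 (real k)) x \<partial>lebesgue)"
      by (simp add: add_right_mono)
  qed
qed

lemma tendsto_weight_bound:
  fixes h :: "real ^ 'n \<Rightarrow> real"
  assumes "((\<lambda>x. norm (x - y) powr (2 - \<alpha>) * h x) \<longlongrightarrow> 0) (at y)" "\<delta> > 0"
  obtains s where "s > 0" "\<And>x. x \<in> ball y s \<Longrightarrow> x \<noteq> y \<Longrightarrow> \<bar>h x\<bar> \<le> \<delta> * norm (x - y) powr (\<alpha> - 2)"
proof -
  have "\<forall>\<^sub>F x in at y. dist (norm (x - y) powr (2 - \<alpha>) * h x) 0 < \<delta>"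
    using assms by (auto simp: tendsto_iff)
  then obtain s where s: "s > 0" "\<And>x. x \<noteq> y \<Longrightarrow> dist x y < s \<Longrightarrow> \<bar>norm (x - y) powr (2 - \<alpha>) * h x\<bar> < \<delta>"
    by (auto simp: eventually_at)
  show ?thesis
  proof (rule that[OF s(1)])
    fix x assume x: "x \<in> ball y s" "x \<noteq> y"
    have "norm (x - y) powr (2 - \<alpha>) * \<bar>h x\<bar> < \<delta>" using s(2)[of x] x by (simp add: abs_mult dist_commute)
    moreover have "norm (x - y) powr (\<alpha> - 2) * norm (x - y) powr (2 - \<alpha>) = 1" using x by (simp flip: powr_add)
    ultimately show "\<bar>h x\<bar> \<le> \<delta> * norm (x - y) powr (\<alpha> - 2)"
      by (rule_tac le_from_product) auto
  qed
qed

text \<open>A finite subcover by balls on which $|h|\le|x-y|^{\alpha-2}$ is fixed first; only then are the balls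
  around the finitely many centres shrunk, so that the number of centres does not depend on the gain.\<close>

lemma small_plus_local_singular:
  assumes h_meas [measurable]: "h \<in> borel_measurable lebesgue"
    and loc: "\<And>y. ((\<lambda>x. norm (x - y) powr (2 - \<alpha>) * h x) \<longlongrightarrow> 0) (at y)"
    and inf: "((\<lambda>x. norm x powr (2 - \<alpha>) * h x) \<longlongrightarrow> 0) at_infinity"
  shows "small_plus_local (\<lambda>x. \<bar>h x\<bar>)"
  unfolding small_plus_local_def
proof (intro allI impI)
  fix \<epsilon> :: real assume \<epsilon>: "\<epsilon> > 0"
  \<comment> \<open>Hardy's constant 4 turns \<epsilon>/8 into \<epsilon>/2; the other half of
    \<epsilon> is shared among the finitely many centres.\<close>
  have "\<forall>\<^sub>F x in at_infinity. dist (norm x powr (2 - \<alpha>) * h x) 0 < \<epsilon> / 8"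
    by (rule tendstoD[OF inf]) (use \<epsilon> in simp)
  then obtain R0 where R0: "\<And>x. norm x \<ge> R0 \<Longrightarrow> \<bar>norm x powr (2 - \<alpha>) * h x\<bar> < \<epsilon> / 8"
    by (auto simp: eventually_at_infinity)
  define R where "R = max R0 1"
  have R: "R > 0" by (simp add: R_def)
  have hR: "\<bar>h x\<bar> \<le> \<epsilon> / 8 * norm x powr (\<alpha> - 2)" if "norm x \<ge> R" for x
  proof -
    have x: "norm x > 0" using that R by linarith
    have "norm x powr (2 - \<alpha>) * \<bar>h x\<bar> < \<epsilon> / 8" using R0[of x] that by (simp add: abs_mult R_def)
    moreover have "norm x powr (\<alpha> - 2) * norm x powr (2 - \<alpha>) = 1" using x by (simp flip: powr_add)
    ultimately show ?thesis
      by (rule_tac le_from_product) auto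
  qed
  have "\<exists>\<rho>>0. \<forall>x\<in>ball y \<rho>. x \<noteq> y \<longrightarrow> \<bar>h x\<bar> \<le> norm (x - y) powr (\<alpha> - 2)" for y
    using tendsto_weight_bound[OF loc[of y] zero_less_one] by (metis mult_1)
  then obtain \<rho> where \<rho>: "\<And>y. \<rho> y > 0" "\<And>y x. x \<in> ball y (\<rho> y) \<Longrightarrow> x \<noteq> y \<Longrightarrow> \<bar>h x\<bar> \<le> norm (x - y) powr (\<alpha> - 2)"
    by metis
  have "compact (cball (0::real^'n) R)" by simp
  then obtain Y where Y: "Y \<subseteq> cball (0::real^'n) R" "finite Y" "cball 0 R \<subseteq> (\<Union>y\<in>Y. ball y (\<rho> y))"
    by (rule compactE_image[of _ "cball 0 R" "\<lambda>y. ball y (\<rho> y)"]) (use \<rho>(1) in auto)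
  define m where "m = real (card Y) + 1"
  have m: "m > 0" by (simp add: m_def)
  \<comment> \<open>A radius and a gain for each centre are bundled in one predicate, so that both
    can be chosen simultaneously as functions of the centre.\<close>
  define T where "T y s \<delta> \<longleftrightarrow> s > 0 \<and> \<delta> \<ge> 0 \<and> (\<forall>x\<in>ball y s. x \<noteq> y \<longrightarrow> \<bar>h x\<bar> \<le> \<delta> * norm (x - y) powr (\<alpha> - 2)) \<and>
     (\<forall>u\<in>W. ennreal \<delta> * (\<integral>\<^sup>+x. ennreal (norm (x - y) powr (\<alpha> - 2) * (u x)\<^sup>2) * indicator (ball y s) x \<partial>lebesgue) \<le> ennreal (\<epsilon> / (2 * m) * ip u u))"
    for y s \<delta>
  have "\<exists>s \<delta>. T y s \<delta>" for y
  proof -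
    obtain r C where rC: "r > 0" "C > 0" "\<And>u. u \<in> W \<Longrightarrow>
      (\<integral>\<^sup>+x. ennreal (norm (x - y) powr (\<alpha> - 2) * (u x)\<^sup>2) * indicator (ball y r) x \<partial>lebesgue) \<le> ennreal (C * ip u u)"
      by (rule W_hardy_local[of y]) (rule that)
    define \<delta> where "\<delta> = \<epsilon> / (2 * m * C)"
    have \<delta>: "\<delta> > 0" using \<epsilon> m rC by (simp add: \<delta>_def)
    obtain s where s: "s > 0" "\<And>x. x \<in> ball y s \<Longrightarrow> x \<noteq> y \<Longrightarrow> \<bar>h x\<bar> \<le> \<delta> * norm (x - y) powr (\<alpha> - 2)"
      using tendsto_weight_bound[OF loc[of y] \<delta>] by metis
 have "T y (min s r) \<delta>"
      unfolding T_def
    proof (intro conjI ballI impI)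
      show "min s r > 0" "\<delta> \<ge> 0" using s rC \<delta> by auto
      show "\<bar>h x\<bar> \<le> \<delta> * norm (x - y) powr (\<alpha> - 2)" if "x \<in> ball y (min s r)" "x \<noteq> y" for x
        using s(2)[of x] that by simp
      fix u assume u: "u \<in> W"
      have "(\<integral>\<^sup>+x. ennreal (norm (x - y) powr (\<alpha> - 2) * (u x)\<^sup>2) * indicator (ball y (min s r)) x \<partial>lebesgue) \<le>
        (\<integral>\<^sup>+x. ennreal (norm (x - y) powr (\<alpha> - 2) * (u x)\<^sup>2) * indicator (ball y r) x \<partial>lebesgue)"
        by (intro nn_integral_mono) (auto split: split_indicator)
      also have "\<dots> \<le> ennreal (C * ip u u)" by (rule rC(3)[OF u])
      finally have "ennreal \<delta> * (\<integral>\<^sup>+x. ennreal (norm (x - y) powr (\<alpha> - 2) * (u x)\<^sup>2) * indicator (ball y (min s r)) x \<partial>lebesgue) \<le> ennreal \<delta> * ennreal (C * ip u u)"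
        by (rule mult_left_mono) simp
      also have "\<dots> = ennreal (\<delta> * (C * ip u u))" using \<delta> by (simp add: ennreal_mult')
      also have "\<delta> * (C * ip u u) = \<epsilon> / (2 * m) * ip u u" using rC by (simp add: \<delta>_def)
      finally show "ennreal \<delta> * (\<integral>\<^sup>+x. ennreal (norm (x - y) powr (\<alpha> - 2) * (u x)\<^sup>2) * indicator (ball y (min s r)) x \<partial>lebesgue) \<le> ennreal (\<epsilon> / (2 * m) * ip u u)" .
    qed
    then show ?thesis by blast
  qed
  then obtain s \<delta> where "\<And>y. T y (s y) (\<delta> y)" by metis
  then have s: "\<And>y. s y > 0" "\<And>y. \<delta> y \<ge> 0"
    "\<And>y x. x \<in> ball y (s y) \<Longrightarrow> x \<noteq> y \<Longrightarrow> \<bar>h x\<bar> \<le> \<delta> y * norm (x - y) powr (\<alpha> - 2)"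
    "\<And>y u. u \<in> W \<Longrightarrow> ennreal (\<delta> y) * (\<integral>\<^sup>+x. ennreal (norm (x - y) powr (\<alpha> - 2) * (u x)\<^sup>2) * indicator (ball y (s y)) x \<partial>lebesgue) \<le> ennreal (\<epsilon> / (2 * m) * ip u u)"
    unfolding T_def by auto
  define M where "M = (\<Sum>y\<in>Y. s y powr (\<alpha> - 2))"
  have M: "M \<ge> 0" unfolding M_def by (intro sum_nonneg) auto
  show "\<exists>M\<ge>0. \<exists>R>0. \<forall>u\<in>W. (\<integral>\<^sup>+x. ennreal (\<bar>h x\<bar> * (u x)\<^sup>2) \<partial>lebesgue) \<le>
     ennreal (\<epsilon> * ip u u) + ennreal M * (\<integral>\<^sup>+x. ennreal ((u x)\<^sup>2) * indicator (cball 0 R) x \<partial>lebesgue)"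
  proof (intro exI conjI ballI)
    show "M \<ge> 0" "R > 0" by fact+
    fix u assume u: "u \<in> W"
    have [measurable]: "u \<in> borel_measurable lebesgue" by (rule W_measurable[OF u])
    let ?A = "\<lambda>x. ennreal (norm x powr (\<alpha> - 2) * (u x)\<^sup>2)"
    let ?B = "\<lambda>y x. ennreal (norm (x - y) powr (\<alpha> - 2) * (u x)\<^sup>2) * indicator (ball y (s y)) x"
    let ?D = "\<lambda>x. ennreal ((u x)\<^sup>2) * indicator (cball 0 R) x"
    \<comment> \<open>The centres themselves are excluded: there the singular weight has the value 0
      by the convention for \<open>powr\<close>, and the limit hypothesis does not constrain h. They
      form a null set.\<close>
    have pw: "ennreal (\<bar>h x\<bar> * (u x)\<^sup>2) \<le> ennreal (\<epsilon> / 8) * ?A x + ((\<Sum>y\<in>Y. ennreal (\<delta> y) * ?B y x) + ennreal M * ?D x)"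
      if xY: "x \<notin> Y" for x
    proof -
      have mono: "ennreal (\<bar>h x\<bar> * (u x)\<^sup>2) \<le> ennreal c * ennreal (d * (u x)\<^sup>2)" if "\<bar>h x\<bar> \<le> c * d" "0 \<le> c" "0 \<le> d" for c d
        using that by (simp add: ennreal_leI mult_right_mono mult.assoc[symmetric] flip: ennreal_mult)
      \<comment> \<open>Far away the decay at infinity applies; near a centre the small gain; in the
        rest of the cover |x - y| \<ge> s(y), so the fixed bound |x - y|^(\<alpha>-2) is at most
        s(y)^(\<alpha>-2).\<close>
      consider "norm x \<ge> R" | y where "y \<in> Y" "x \<in> ball y (s y)" | y where "norm x < R" "y \<in> Y" "x \<in> ball y (\<rho> y)" "x \<notin> ball y (s y)"
      proof (cases "norm x \<ge> R")
        case False
        then have "x \<in> (\<Union>y\<in>Y. ball y (\<rho> y))" using subsetD[OF Y(3), of x] by simp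
        then obtain y where "y \<in> Y" "x \<in> ball y (\<rho> y)" by blast
        then show ?thesis using False that(2)[of y] that(3)[of y] by linarith
      qed (rule that(1))
      then show ?thesis
      proof cases
        case 1
        then have "ennreal (\<bar>h x\<bar> * (u x)\<^sup>2) \<le> ennreal (\<epsilon> / 8) * ?A x" using hR[OF 1] \<epsilon> by (intro mono) auto
        then show ?thesis by (rule order_trans) simp
      next
        case (2 y)
        have "ennreal (\<bar>h x\<bar> * (u x)\<^sup>2) \<le> ennreal (\<delta> y) * ?B y x"
          using mono[of "\<delta> y" "norm (x - y) powr (\<alpha> - 2)"] s(2)[of y] s(3)[of x y] 2 xY by auto
        also have "\<dots> \<le> (\<Sum>y\<in>Y. ennreal (\<delta> y) * ?B y x)"
          by (rule member_le_sum[of y Y "\<lambda>y. ennreal (\<delta> y) * ?B y x"]) (use 2 Y in auto)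
        also have "\<dots> \<le> ennreal (\<epsilon> / 8) * ?A x + ((\<Sum>y\<in>Y. ennreal (\<delta> y) * ?B y x) + ennreal M * ?D x)"
          by (simp add: add_increasing add_increasing2)
        finally show ?thesis .
      next
        case (3 y)
        have "\<bar>h x\<bar> \<le> norm (x - y) powr (\<alpha> - 2)" using \<rho>(2)[of x y] 3 xY by auto
        also have "\<dots> \<le> s y powr (\<alpha> - 2)"
          using 3 s(1)[of y] \<alpha> by (intro powr_mono2') (auto simp: dist_norm norm_minus_commute)
        also have "\<dots> \<le> M" unfolding M_def by (rule member_le_sum) (use 3 Y in auto)
        finally have "ennreal (\<bar>h x\<bar> * (u x)\<^sup>2) \<le> ennreal M * ?D x"
          using mono[of M 1] M 3 by simp
        also have "\<dots> \<le> ennreal (\<epsilon> / 8) * ?A x + ((\<Sum>y\<in>Y. ennreal (\<delta> y) * ?B y x) + ennreal M * ?D x)"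
          by (simp add: add_increasing)
        finally show ?thesis .
      qed
    qed
    have "AE x in lebesgue. x \<notin> Y"
    proof -
      have "Y \<in> null_sets lebesgue" using Y(2) by (simp add: finite_imp_null_set_lborel null_sets_completionI)
      then show ?thesis by (rule AE_not_in)
    qed
    then have "(\<integral>\<^sup>+x. ennreal (\<bar>h x\<bar> * (u x)\<^sup>2) \<partial>lebesgue) \<le>
      (\<integral>\<^sup>+x. ennreal (\<epsilon> / 8) * ?A x + ((\<Sum>y\<in>Y. ennreal (\<delta> y) * ?B y x) + ennreal M * ?D x) \<partial>lebesgue)"
      by (intro nn_integral_mono_AE) (auto elim: eventually_mono intro: pw)
    also have "\<dots> = ennreal (\<epsilon> / 8) * (\<integral>\<^sup>+x. ?A x \<partial>lebesgue) + ((\<Sum>y\<in>Y. ennreal (\<delta> y) * (\<integral>\<^sup>+x. ?B y x \<partial>lebesgue)) + ennreal M * (\<integral>\<^sup>+x. ?D x \<partial>lebesgue))"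
      by (simp add: nn_integral_add nn_integral_cmult nn_integral_sum)
    also have "\<dots> \<le> ennreal (\<epsilon> / 8) * ennreal (4 * ip u u) + ((\<Sum>y\<in>Y. ennreal (\<epsilon> / (2 * m) * ip u u)) + ennreal M * (\<integral>\<^sup>+x. ?D x \<partial>lebesgue))"
      by (intro add_mono mult_left_mono W_hardy[OF u] sum_mono s(4)[OF u]) auto
    also have "\<dots> = ennreal (\<epsilon> / 2 * ip u u) + (ennreal (real (card Y) * (\<epsilon> / (2 * m) * ip u u)) + ennreal M * (\<integral>\<^sup>+x. ?D x \<partial>lebesgue))"
    proof -
      have "ennreal (\<epsilon> / 8) * ennreal (4 * ip u u) = ennreal (\<epsilon> / 2 * ip u u)" using \<epsilon> ip_nonneg[OF u] by (simp flip: ennreal_mult)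
      moreover have "(\<Sum>y\<in>Y. ennreal (\<epsilon> / (2 * m) * ip u u)) = ennreal (\<Sum>y\<in>Y. \<epsilon> / (2 * m) * ip u u)"
        using \<epsilon> m ip_nonneg[OF u] by (intro sum_ennreal) auto
      ultimately show ?thesis by simp
    qed
    also have "\<dots> = ennreal (\<epsilon> / 2 * ip u u + real (card Y) * (\<epsilon> / (2 * m) * ip u u)) + ennreal M * (\<integral>\<^sup>+x. ?D x \<partial>lebesgue)"
      using \<epsilon> m ip_nonneg[OF u] by (simp add: add.assoc)
    also have "\<dots> \<le> ennreal (\<epsilon> * ip u u) + ennreal M * (\<integral>\<^sup>+x. ?D x \<partial>lebesgue)"
    proof (intro add_right_mono ennreal_leI)
      have "real (card Y) * (\<epsilon> / (2 * m)) \<le> \<epsilon> / 2" using m \<epsilon> by (simp add: m_def field_simps)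
      then have "real (card Y) * (\<epsilon> / (2 * m)) * ip u u \<le> \<epsilon> / 2 * ip u u" using ip_nonneg[OF u] by (rule mult_right_mono)
      then show "\<epsilon> / 2 * ip u u + real (card Y) * (\<epsilon> / (2 * m) * ip u u) \<le> \<epsilon> * ip u u"
        unfolding mult.assoc by linarith
    qed
    finally show "(\<integral>\<^sup>+x. ennreal (\<bar>h x\<bar> * (u x)\<^sup>2) \<partial>lebesgue) \<le> ennreal (\<epsilon> * ip u u) + ennreal M * (\<integral>\<^sup>+x. ?D x \<partial>lebesgue)" .
  qed
qed

lemma small_plus_local_add:
  assumes V [measurable]: "V1 \<in> borel_measurable lebesgue" "V2 \<in> borel_measurable lebesgue"
    and nn: "\<And>x. 0 \<le> V1 x" "\<And>x. 0 \<le> V2 x"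
    and s: "small_plus_local V1" "small_plus_local V2" and le: "AE x in lebesgue. V x \<le> V1 x + V2 x"
  shows "small_plus_local V"
  unfolding small_plus_local_def
proof (intro allI impI)
  fix \<epsilon> :: real assume "\<epsilon> > 0"
  then have \<epsilon>: "\<epsilon> / 2 > 0" by simp
  let ?D = "\<lambda>u R. \<integral>\<^sup>+x. ennreal ((u x)\<^sup>2) * indicator (cball 0 R) x \<partial>lebesgue"
  from s(1)[unfolded small_plus_local_def, rule_format, OF \<epsilon>]
  obtain M1 R1 where M1: "M1 \<ge> 0" "R1 > 0"
    and b1: "\<forall>u\<in>W. (\<integral>\<^sup>+x. ennreal (V1 x * (u x)\<^sup>2) \<partial>lebesgue) \<le> ennreal (\<epsilon> / 2 * ip u u) + ennreal M1 * ?D u R1"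
    by (elim exE conjE)
  note 1 = M1 b1[rule_format]
  from s(2)[unfolded small_plus_local_def, rule_format, OF \<epsilon>]
  obtain M2 R2 where M2: "M2 \<ge> 0" "R2 > 0"
    and b2: "\<forall>u\<in>W. (\<integral>\<^sup>+x. ennreal (V2 x * (u x)\<^sup>2) \<partial>lebesgue) \<le> ennreal (\<epsilon> / 2 * ip u u) + ennreal M2 * ?D u R2"
    by (elim exE conjE)
  note 2 = M2 b2[rule_format]
  show "\<exists>M\<ge>0. \<exists>R>0. \<forall>u\<in>W. (\<integral>\<^sup>+x. ennreal (V x * (u x)\<^sup>2) \<partial>lebesgue) \<le> ennreal (\<epsilon> * ip u u) + ennreal M * ?D u R"
  proof (intro exI conjI ballI)
    show "M1 + M2 \<ge> 0" "max R1 R2 > 0" using 1 2 by auto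
    fix u assume u: "u \<in> W"
    have [measurable]: "u \<in> borel_measurable lebesgue" by (rule W_measurable[OF u])
    have D: "?D u R \<le> ?D u (max R1 R2)" if "R = R1 \<or> R = R2" for R
      using that by (intro nn_integral_mono) (auto split: split_indicator)
    have "(\<integral>\<^sup>+x. ennreal (V x * (u x)\<^sup>2) \<partial>lebesgue) \<le> (\<integral>\<^sup>+x. ennreal (V1 x * (u x)\<^sup>2) + ennreal (V2 x * (u x)\<^sup>2) \<partial>lebesgue)"
    proof (rule nn_integral_mono_AE, use le in eventually_elim)
      case (elim x)
      then have "ennreal (V x * (u x)\<^sup>2) \<le> ennreal (V1 x * (u x)\<^sup>2 + V2 x * (u x)\<^sup>2)"
        by (intro ennreal_leI) (metis distrib_right mult_right_mono zero_le_power2)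
      then show ?case using nn by simp
    qed
    also have "\<dots> = (\<integral>\<^sup>+x. ennreal (V1 x * (u x)\<^sup>2) \<partial>lebesgue) + (\<integral>\<^sup>+x. ennreal (V2 x * (u x)\<^sup>2) \<partial>lebesgue)"
      by (rule nn_integral_add) measurable
    also have "\<dots> \<le> (ennreal (\<epsilon> / 2 * ip u u) + ennreal M1 * ?D u (max R1 R2)) + (ennreal (\<epsilon> / 2 * ip u u) + ennreal M2 * ?D u (max R1 R2))"
      by (intro add_mono order_trans[OF 1(3)[OF u] add_left_mono] order_trans[OF 2(3)[OF u] add_left_mono] mult_left_mono D) auto
    also have "\<dots> = (ennreal (\<epsilon> / 2 * ip u u) + ennreal (\<epsilon> / 2 * ip u u)) + (ennreal M1 + ennreal M2) * ?D u (max R1 R2)"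
      by (simp add: distrib_right add_ac)
    also have "ennreal (\<epsilon> / 2 * ip u u) + ennreal (\<epsilon> / 2 * ip u u) = ennreal (\<epsilon> * ip u u)"
      using \<epsilon> ip_nonneg[OF u] by (simp flip: ennreal_plus)
    also have "ennreal M1 + ennreal M2 = ennreal (M1 + M2)" using 1 2 by simp
    finally show "(\<integral>\<^sup>+x. ennreal (V x * (u x)\<^sup>2) \<partial>lebesgue) \<le> ennreal (\<epsilon> * ip u u) + ennreal (M1 + M2) * ?D u (max R1 R2)" .
  qed
qed

end

section \<open>Control by finitely many averages\<close>

context weighted_space
begin

definition adm :: "(real ^ 'n \<Rightarrow> real) \<Rightarrow> bool" where
  "adm \<psi> \<longleftrightarrow> \<psi> \<in> borel_measurable borel \<and> (\<forall>x. \<bar>\<psi> x\<bar> \<le> 1) \<and> (\<exists>R>0. \<forall>x. norm x \<ge> R \<longrightarrow> \<psi> x = 0)"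

definition L :: "(real ^ 'n \<Rightarrow> real) \<Rightarrow> (real ^ 'n \<Rightarrow> real) \<Rightarrow> real" where
  "L \<psi> u = (\<integral>x. \<psi> x * u x \<partial>lebesgue)"

lemma local_square_bound:
  assumes u: "u \<in> W" and R: "R > 0"
  shows "(\<integral>\<^sup>+x. ennreal ((u x)\<^sup>2) * indicator (cball 0 R) x \<partial>lebesgue) \<le> ennreal (R powr (2 - \<alpha>) * 4 * ip u u)"
proof -
  have [measurable]: "u \<in> borel_measurable lebesgue" by (rule W_measurable[OF u])
  have "AE x in lebesgue. x \<noteq> (0::real^'n)" by (rule AE_completion[OF AE_lborel_nonzero])
  then have "AE x in lebesgue. ennreal ((u x)\<^sup>2) * indicator (cball 0 R) x \<le> ennreal (R powr (2 - \<alpha>)) * ennreal (norm x powr (\<alpha> - 2) * (u x)\<^sup>2)"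
  proof eventually_elim
    case (elim x)
    show ?case
    proof (cases "norm x \<le> R")
      case True
      have "1 = norm x powr (2 - \<alpha>) * norm x powr (\<alpha> - 2)" using elim by (simp flip: powr_add)
      also have "\<dots> \<le> R powr (2 - \<alpha>) * norm x powr (\<alpha> - 2)"
        using True \<alpha> by (intro mult_right_mono powr_mono2) auto
      finally have "1 * (u x)\<^sup>2 \<le> R powr (2 - \<alpha>) * norm x powr (\<alpha> - 2) * (u x)\<^sup>2" by (rule mult_right_mono) simp
      then show ?thesis using True by (simp add: ennreal_leI mult.assoc flip: ennreal_mult)
    qed simp
  qed
  then have "(\<integral>\<^sup>+x. ennreal ((u x)\<^sup>2) * indicator (cball 0 R) x \<partial>lebesgue) \<le>
     (\<integral>\<^sup>+x. ennreal (R powr (2 - \<alpha>)) * ennreal (norm x powr (\<alpha> - 2) * (u x)\<^sup>2) \<partial>lebesgue)"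
    by (rule nn_integral_mono_AE)
  also have "\<dots> = ennreal (R powr (2 - \<alpha>)) * (\<integral>\<^sup>+x. ennreal (norm x powr (\<alpha> - 2) * (u x)\<^sup>2) \<partial>lebesgue)"
    by (rule nn_integral_cmult) measurable
  also have "\<dots> \<le> ennreal (R powr (2 - \<alpha>)) * ennreal (4 * ip u u)"
    by (intro mult_left_mono W_hardy[OF u]) auto
  finally show ?thesis using ip_nonneg[OF u] by (simp add: mult.assoc flip: ennreal_mult)
qed

text \<open>Cauchy-Schwarz on the ball that contains the support, followed by the local L^2 bound
  from Hardy's inequality: averages are continuous linear functionals on the completion.\<close>

lemma adm_bound:
  assumes \<psi>: "adm \<psi>"
  obtains K where "K \<ge> 0" "\<And>u. u \<in> W \<Longrightarrow> integrable lebesgue (\<lambda>x. \<psi> x * u x) \<and> (L \<psi> u)\<^sup>2 \<le> K * ip u u"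
proof -
  obtain R where R: "R > 0" "\<And>x. norm x \<ge> R \<Longrightarrow> \<psi> x = 0" using \<psi> by (auto simp: adm_def)
  have [measurable]: "\<psi> \<in> borel_measurable lebesgue" using \<psi> by (intro measurable_completion) (simp add: adm_def)
  define b where "b = measure lebesgue (cball (0::real^'n) R)"
  have b: "emeasure lebesgue (cball (0::real^'n) R) = ennreal b" "b \<ge> 0"
    using emeasure_cball_finite[of R] by (auto simp: b_def emeasure_eq_ennreal_measure)
  define K where "K = R powr (2 - \<alpha>) * 4 * b"
  have K: "K \<ge> 0" using b by (simp add: K_def)
  have sq: "(\<integral>\<^sup>+x. ennreal \<bar>\<psi> x * u x\<bar> \<partial>lebesgue)\<^sup>2 \<le> ennreal (K * ip u u)" if u: "u \<in> W" for u
  proof -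
    have [measurable]: "u \<in> borel_measurable lebesgue" by (rule W_measurable[OF u])
    have "\<bar>\<psi> x * u x\<bar> \<le> \<bar>u x\<bar> * indicator (cball 0 R) x" for x
      using \<psi> R(2)[of x] by (cases "norm x \<le> R") (auto simp: adm_def abs_mult mult_left_le_one_le)
    then have "(\<integral>\<^sup>+x. ennreal \<bar>\<psi> x * u x\<bar> \<partial>lebesgue) \<le> (\<integral>\<^sup>+x. ennreal (\<bar>u x\<bar> * indicator (cball 0 R) x) \<partial>lebesgue)"
      by (intro nn_integral_mono ennreal_leI)
    also have "\<dots> = (\<integral>\<^sup>+x. (ennreal \<bar>u x\<bar> * indicator (cball 0 R) x) * indicator (cball 0 R) x \<partial>lebesgue)"
      by (intro nn_integral_cong) (auto split: split_indicator)
    finally have "(\<integral>\<^sup>+x. ennreal \<bar>\<psi> x * u x\<bar> \<partial>lebesgue)\<^sup>2 \<le> (\<integral>\<^sup>+x. (ennreal \<bar>u x\<bar> * indicator (cball 0 R) x) * indicator (cball 0 R) x \<partial>lebesgue)\<^sup>2"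
      by (intro power_mono) auto
    also have "\<dots> \<le> (\<integral>\<^sup>+x. (ennreal \<bar>u x\<bar> * indicator (cball 0 R) x)\<^sup>2 \<partial>lebesgue) * (\<integral>\<^sup>+x. (indicator (cball (0::real^'n) R) x)\<^sup>2 \<partial>lebesgue)"
      by (rule Cauchy_Schwarz_nn_integral) measurable
    also have "(\<integral>\<^sup>+x. (indicator (cball (0::real^'n) R) x)\<^sup>2 \<partial>lebesgue) = (\<integral>\<^sup>+x. indicator (cball (0::real^'n) R) x \<partial>lebesgue)"
      by (intro nn_integral_cong) (auto split: split_indicator)
    also have "\<dots> = ennreal b" using b by simp
    also have "(\<integral>\<^sup>+x. (ennreal \<bar>u x\<bar> * indicator (cball 0 R) x)\<^sup>2 \<partial>lebesgue) = (\<integral>\<^sup>+x. ennreal ((u x)\<^sup>2) * indicator (cball 0 R) x \<partial>lebesgue)"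
      by (intro nn_integral_cong) (auto split: split_indicator simp: ennreal_power)
    also have "\<dots> * ennreal b \<le> ennreal (R powr (2 - \<alpha>) * 4 * ip u u) * ennreal b"
      by (intro mult_right_mono local_square_bound u R) auto
    also have "\<dots> = ennreal (K * ip u u)" using b ip_nonneg[OF u] by (simp add: K_def mult_ac flip: ennreal_mult)
    finally show ?thesis .
  qed
  show ?thesis
  proof (rule that[OF K], rule conjI)
    fix u assume u: "u \<in> W"
    have [measurable]: "u \<in> borel_measurable lebesgue" by (rule W_measurable[OF u])
    have "(\<integral>\<^sup>+x. ennreal \<bar>\<psi> x * u x\<bar> \<partial>lebesgue)\<^sup>2 < \<infinity>" using sq[OF u] by (rule le_less_trans) simp
    then have "(\<integral>\<^sup>+x. ennreal \<bar>\<psi> x * u x\<bar> \<partial>lebesgue) < \<infinity>"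
      by (auto simp: power2_eq_square ennreal_mult_less_top less_top top_unique)
    then show i: "integrable lebesgue (\<lambda>x. \<psi> x * u x)" by (intro integrableI_bounded) auto
    have "ennreal ((L \<psi> u)\<^sup>2) = (ennreal \<bar>L \<psi> u\<bar>)\<^sup>2" by (subst ennreal_power) auto
    also have "\<dots> \<le> (\<integral>\<^sup>+x. ennreal \<bar>\<psi> x * u x\<bar> \<partial>lebesgue)\<^sup>2"
      unfolding L_def using integral_norm_bound_ennreal[OF i] by (intro power_mono) auto
    also have "\<dots> \<le> ennreal (K * ip u u)" by (rule sq[OF u])
    finally show "(L \<psi> u)\<^sup>2 \<le> K * ip u u" using K ip_nonneg[OF u] by (subst (asm) ennreal_le_iff) auto
  qed
qed

lemma L_diff:
  assumes "adm \<psi>" "u \<in> W" "v \<in> W" shows "L \<psi> (\<lambda>x. u x - v x) = L \<psi> u - L \<psi> v"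
proof -
  obtain K where "\<And>u. u \<in> W \<Longrightarrow> integrable lebesgue (\<lambda>x. \<psi> x * u x) \<and> (L \<psi> u)\<^sup>2 \<le> K * ip u u"
    using adm_bound[OF assms(1)] by metis
  then have "integrable lebesgue (\<lambda>x. \<psi> x * u x)" "integrable lebesgue (\<lambda>x. \<psi> x * v x)" using assms by auto
  then show ?thesis by (simp add: L_def right_diff_distrib)
qed

lemma L_tendsto:
  assumes \<psi>: "adm \<psi>" and v: "\<And>n. v n \<in> W" and w: "w \<in> W" and lim: "(\<lambda>n. ip (\<lambda>x. v n x - w x) (\<lambda>x. v n x - w x)) \<longlonglongrightarrow> 0"
  shows "(\<lambda>n. L \<psi> (v n)) \<longlonglongrightarrow> L \<psi> w"
proof -
  obtain K where K: "K \<ge> 0" "\<And>u. u \<in> W \<Longrightarrow> integrable lebesgue (\<lambda>x. \<psi> x * u x) \<and> (L \<psi> u)\<^sup>2 \<le> K * ip u u"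
    using adm_bound[OF \<psi>] by metis
  have "(\<lambda>n. sqrt (K * ip (\<lambda>x. v n x - w x) (\<lambda>x. v n x - w x))) \<longlonglongrightarrow> sqrt (K * 0)" by (intro tendsto_intros lim)
  then have l: "(\<lambda>n. sqrt (K * ip (\<lambda>x. v n x - w x) (\<lambda>x. v n x - w x))) \<longlonglongrightarrow> 0" by simp
  have "\<bar>L \<psi> (v n) - L \<psi> w\<bar> \<le> sqrt (K * ip (\<lambda>x. v n x - w x) (\<lambda>x. v n x - w x))" for n
  proof -
    have "(L \<psi> (v n) - L \<psi> w)\<^sup>2 \<le> K * ip (\<lambda>x. v n x - w x) (\<lambda>x. v n x - w x)"
      using K(2)[OF W_diff[OF v w], of n] by (simp add: L_diff[OF \<psi> v w])
    then show ?thesis by (metis real_sqrt_abs real_sqrt_le_mono)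
  qed
  then have "(\<lambda>n. L \<psi> (v n) - L \<psi> w) \<longlonglongrightarrow> 0"
    by (intro Lim_null_comparison[OF _ l]) simp
  then show ?thesis by (simp add: LIM_zero_iff)
qed

text \<open>Compactness of the embedding into L^2 with weight \<open>V\<close>, expressed as an
  inequality: up to an arbitrarily small part of the energy, the weighted norm is seen by finitely
  many linear functionals.\<close>

definition finite_rank :: "(real ^ 'n \<Rightarrow> real) \<Rightarrow> bool" where
  "finite_rank V \<longleftrightarrow> (\<forall>\<epsilon>>0. \<exists>\<Psi> C. finite \<Psi> \<and> C \<ge> 0 \<and> (\<forall>\<psi>\<in>\<Psi>. adm \<psi>) \<and>
     (\<forall>u\<in>W. (\<integral>\<^sup>+x. ennreal (V x * (u x)\<^sup>2) \<partial>lebesgue) \<le> ennreal (\<epsilon> * ip u u + C * (\<Sum>\<psi>\<in>\<Psi>. (L \<psi> u)\<^sup>2))))"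

text \<open>The averages of the approximating test functions converge to those of u, so the estimate
  passes to the completion with the averages as the convergent extra term.\<close>

lemma W_finite_rank_annulus:
  assumes s: "0 < s" "s \<le> R" and \<epsilon>: "\<epsilon> > 0"
  shows "\<exists>\<Psi> C. finite \<Psi> \<and> C \<ge> 0 \<and> (\<forall>\<psi>\<in>\<Psi>. adm \<psi>) \<and> (\<forall>u\<in>W.
      (\<integral>\<^sup>+x. ennreal ((u x)\<^sup>2) * indicator {x. s \<le> norm x \<and> norm x \<le> R} x \<partial>lebesgue) \<le> ennreal (\<epsilon> * ip u u + C * (\<Sum>\<psi>\<in>\<Psi>. (L \<psi> u)\<^sup>2)))"
proof -
  obtain \<Psi> C where \<Psi>: "finite \<Psi>" "C \<ge> 0"
    "\<And>\<psi>. \<psi> \<in> \<Psi> \<Longrightarrow> \<psi> \<in> borel_measurable borel \<and> (\<forall>x. \<bar>\<psi> x\<bar> \<le> 1) \<and> (\<forall>x. norm x \<ge> 2 * R \<longrightarrow> \<psi> x = 0)"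
    "\<And>u :: real ^ 'n \<Rightarrow> real. u \<in> test_functions \<Longrightarrow>
      (\<integral>\<^sup>+x. ennreal ((u x)\<^sup>2) * indicator {x. s \<le> norm x \<and> norm x \<le> R} x \<partial>lborel) \<le>
      ennreal \<epsilon> * energy \<alpha> u + ennreal C * (\<Sum>\<psi>\<in>\<Psi>. ennreal ((LBINT x. \<psi> x * u x)\<^sup>2))"
    by (rule finite_rank_annulus[OF \<alpha> N s \<epsilon>]) (rule that)
  have adm: "adm \<psi>" if "\<psi> \<in> \<Psi>" for \<psi>
    unfolding adm_def using \<Psi>(3)[OF that] s by (intro conjI exI[of _ "2 * R"]) auto
  have "(\<integral>\<^sup>+x. ennreal ((u x)\<^sup>2) * indicator {x. s \<le> norm x \<and> norm x \<le> R} x \<partial>lebesgue) \<le> ennreal (\<epsilon> * ip u u + C * (\<Sum>\<psi>\<in>\<Psi>. (L \<psi> u)\<^sup>2))"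
    if u: "u \<in> W" for u
  proof -
    note h = hwg_weighted_gradient[OF u]
    let ?V = "indicator {x. s \<le> norm x \<and> norm x \<le> R} :: real ^ 'n \<Rightarrow> real"
    obtain \<phi> where \<phi>: "approx \<phi> u (weighted_gradient \<alpha> u)" "AE x in lebesgue. (\<lambda>n. \<phi> n x) \<longlonglongrightarrow> u x"
      using hwg_approx_AE[OF h] by blast
    have t: "\<phi> n \<in> test_functions" for n using \<phi> by (auto simp: approx_def)
    have lim: "(\<lambda>n. ip (\<lambda>x. \<phi> n x - u x) (\<lambda>x. \<phi> n x - u x)) \<longlonglongrightarrow> 0"
    proof -
      have "(\<lambda>n. ennreal (ip (\<lambda>x. \<phi> n x - u x) (\<lambda>x. \<phi> n x - u x))) \<longlonglongrightarrow> ennreal 0"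
        using \<phi>(1) wen_eq_ip(1)[OF hwg_diff[OF hwg_test[OF t] h]] by (simp add: approx_def)
      then show ?thesis
        by (subst (asm) tendsto_ennreal_iff) (auto intro!: always_eventually ip_nonneg W_diff[OF test_in_W[OF t] u])
    qed
    have set: "{x :: real ^ 'n. s \<le> norm x \<and> norm x \<le> R} \<in> sets borel"
      by (intro borel_closed closed_Collect_conj closed_Collect_le continuous_intros)
    have "(\<integral>\<^sup>+x. ennreal (?V x * (u x)\<^sup>2) \<partial>lebesgue) \<le> ennreal \<epsilon> * wen (weighted_gradient \<alpha> u) + ennreal (C * (\<Sum>\<psi>\<in>\<Psi>. (L \<psi> u)\<^sup>2))"
    proof (rule transfer_square_bound[OF h \<phi>])
      show "?V \<in> borel_measurable lebesgue" by (rule measurable_completion) (use set in simp)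
      show "(\<lambda>n. ennreal (C * (\<Sum>\<psi>\<in>\<Psi>. (L \<psi> (\<phi> n))\<^sup>2))) \<longlonglongrightarrow> ennreal (C * (\<Sum>\<psi>\<in>\<Psi>. (L \<psi> u)\<^sup>2))"
        by (intro tendsto_ennrealI tendsto_intros L_tendsto[OF adm test_in_W[OF t] u lim])
      fix n
      have Leq: "L \<psi> (\<phi> n) = (LBINT x. \<psi> x * \<phi> n x)" if "\<psi> \<in> \<Psi>" for \<psi>
      proof -
        have [measurable]: "\<psi> \<in> borel_measurable borel" "\<phi> n \<in> borel_measurable borel"
          using \<Psi>(3)[OF that] smooth_measurable[OF test_smooth[OF t]] by auto
        have "(\<lambda>x. \<psi> x * \<phi> n x) \<in> borel_measurable borel" by measurable
        then show ?thesis unfolding L_def by (simp add: integral_completion)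
      qed
      have "(\<integral>\<^sup>+x. ennreal (?V x * (\<phi> n x)\<^sup>2) \<partial>lebesgue) = (\<integral>\<^sup>+x. ennreal ((\<phi> n x)\<^sup>2) * indicator {x. s \<le> norm x \<and> norm x \<le> R} x \<partial>lborel)"
        unfolding nn_integral_completion by (intro nn_integral_cong) (auto split: split_indicator)
      also have "\<dots> \<le> ennreal \<epsilon> * energy \<alpha> (\<phi> n) + ennreal C * (\<Sum>\<psi>\<in>\<Psi>. ennreal ((LBINT x. \<psi> x * \<phi> n x)\<^sup>2))"
        by (rule \<Psi>(4)[OF t])
      also have "(\<Sum>\<psi>\<in>\<Psi>. ennreal ((LBINT x. \<psi> x * \<phi> n x)\<^sup>2)) = ennreal (\<Sum>\<psi>\<in>\<Psi>. (L \<psi> (\<phi> n))\<^sup>2)"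
        by (subst sum_ennreal[symmetric]) (auto simp: Leq)
      also have "ennreal C * ennreal (\<Sum>\<psi>\<in>\<Psi>. (L \<psi> (\<phi> n))\<^sup>2) = ennreal (C * (\<Sum>\<psi>\<in>\<Psi>. (L \<psi> (\<phi> n))\<^sup>2))"
        using \<Psi>(2) by (simp add: ennreal_mult sum_nonneg)
      finally show "(\<integral>\<^sup>+x. ennreal (?V x * (\<phi> n x)\<^sup>2) \<partial>lebesgue) \<le> ennreal \<epsilon> * energy \<alpha> (\<phi> n) + ennreal (C * (\<Sum>\<psi>\<in>\<Psi>. (L \<psi> (\<phi> n))\<^sup>2))" .
    qed simp
    also have "\<dots> = ennreal (\<epsilon> * ip u u + C * (\<Sum>\<psi>\<in>\<Psi>. (L \<psi> u)\<^sup>2))"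
      using \<epsilon> ip_nonneg[OF u] \<Psi>(2) by (simp add: wen_eq_ip(1)[OF h] ennreal_mult ennreal_plus sum_nonneg)
    finally have b: "(\<integral>\<^sup>+x. ennreal (?V x * (u x)\<^sup>2) \<partial>lebesgue) \<le> ennreal (\<epsilon> * ip u u + C * (\<Sum>\<psi>\<in>\<Psi>. (L \<psi> u)\<^sup>2))" .
    have "(\<integral>\<^sup>+x. ennreal (?V x * (u x)\<^sup>2) \<partial>lebesgue) = (\<integral>\<^sup>+x. ennreal ((u x)\<^sup>2) * indicator {x. s \<le> norm x \<and> norm x \<le> R} x \<partial>lebesgue)"
      by (intro nn_integral_cong) (auto split: split_indicator)
    with b show ?thesis by simp
  qed
  then show ?thesis using \<Psi>(1,2) adm by blast
qed

text \<open>The ball is divided into a small ball about the origin and an annulus. On the small ball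
  Hardy's inequality gives the factor 4 s^(2-\<alpha>), on the annulus the finite-rank estimate
  applies; the origin, where the weight degenerates, costs only energy.\<close>

lemma finite_rank_if_small_plus_local:
  assumes V [measurable]: "V \<in> borel_measurable lebesgue" and small: "small_plus_local V"
  shows "finite_rank V"
  unfolding finite_rank_def
proof (intro allI impI)
  fix \<epsilon> :: real assume \<epsilon>: "\<epsilon> > 0"
  let ?D = "\<lambda>u R. \<integral>\<^sup>+x. ennreal ((u x)\<^sup>2) * indicator (cball 0 R) x \<partial>lebesgue"
  from small[unfolded small_plus_local_def, rule_format, OF half_gt_zero[OF \<epsilon>]]
  obtain M R where M: "M \<ge> 0" "R > 0"
    and b: "\<forall>u\<in>W. (\<integral>\<^sup>+x. ennreal (V x * (u x)\<^sup>2) \<partial>lebesgue) \<le> ennreal (\<epsilon> / 2 * ip u u) + ennreal M * ?D u R"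
    by (elim exE conjE)
  \<comment> \<open>Small ball and annulus each contribute e times the energy; multiplied by M this
    is 2 e M \<le> \<epsilon>/2. The radius s below solves 4 s^(2-\<alpha>) \<le> e.\<close>
  define e where "e = \<epsilon> / (4 * (M + 1))"
  have e: "e > 0" using \<epsilon> M by (simp add: e_def)
  define s where "s = min R ((e / 4) powr (1 / (2 - \<alpha>)))"
  have s: "s > 0" "s \<le> R" using M e by (auto simp: s_def)
  have "s powr (2 - \<alpha>) \<le> ((e / 4) powr (1 / (2 - \<alpha>))) powr (2 - \<alpha>)"
    using s \<alpha> by (intro powr_mono2) (auto simp: s_def)
  also have "\<dots> = e / 4" using e \<alpha> by (simp add: powr_powr)
  finally have se: "s powr (2 - \<alpha>) * 4 \<le> e" by simp
  from W_finite_rank_annulus[OF s e]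
  obtain \<Psi> C where \<Psi>: "finite \<Psi>" "C \<ge> 0" "\<forall>\<psi>\<in>\<Psi>. adm \<psi>" and c: "\<forall>u\<in>W.
      (\<integral>\<^sup>+x. ennreal ((u x)\<^sup>2) * indicator {x. s \<le> norm x \<and> norm x \<le> R} x \<partial>lebesgue) \<le> ennreal (e * ip u u + C * (\<Sum>\<psi>\<in>\<Psi>. (L \<psi> u)\<^sup>2))"
    by (elim exE conjE)
  have "(\<integral>\<^sup>+x. ennreal (V x * (u x)\<^sup>2) \<partial>lebesgue) \<le> ennreal (\<epsilon> * ip u u + (M * C) * (\<Sum>\<psi>\<in>\<Psi>. (L \<psi> u)\<^sup>2))" if u: "u \<in> W" for u
  proof -
    have [measurable]: "u \<in> borel_measurable lebesgue" by (rule W_measurable[OF u])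
    define S where "S = (\<Sum>\<psi>\<in>\<Psi>. (L \<psi> u)\<^sup>2)"
    have S: "S \<ge> 0" unfolding S_def by (intro sum_nonneg) auto
    have I: "ip u u \<ge> 0" by (rule ip_nonneg[OF u])
    have set [measurable]: "{x :: real ^ 'n. s \<le> norm x \<and> norm x \<le> R} \<in> sets lebesgue"
      using borel_closed[of "{x :: real ^ 'n. s \<le> norm x \<and> norm x \<le> R}"]
      by (auto intro!: closed_Collect_conj closed_Collect_le continuous_intros)
    have "?D u R \<le> (\<integral>\<^sup>+x. ennreal ((u x)\<^sup>2) * indicator (cball 0 s) x + ennreal ((u x)\<^sup>2) * indicator {x. s \<le> norm x \<and> norm x \<le> R} x \<partial>lebesgue)"
      by (intro nn_integral_mono) (auto split: split_indicator)
    also have "\<dots> = ?D u s + (\<integral>\<^sup>+x. ennreal ((u x)\<^sup>2) * indicator {x. s \<le> norm x \<and> norm x \<le> R} x \<partial>lebesgue)"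
      by (rule nn_integral_add) measurable
    also have "\<dots> \<le> ennreal (s powr (2 - \<alpha>) * 4 * ip u u) + ennreal (e * ip u u + C * S)"
      unfolding S_def using c u by (intro add_mono local_square_bound u s) auto
    also have "\<dots> \<le> ennreal (e * ip u u) + ennreal (e * ip u u + C * S)"
      by (intro add_right_mono ennreal_leI mult_right_mono se I)
    also have "\<dots> = ennreal (2 * e * ip u u + C * S)"
      using e I S \<Psi>(2) by (subst ennreal_plus[symmetric]) (auto simp: algebra_simps)
    finally have D: "?D u R \<le> ennreal (2 * e * ip u u + C * S)" .
    have "(\<integral>\<^sup>+x. ennreal (V x * (u x)\<^sup>2) \<partial>lebesgue) \<le> ennreal (\<epsilon> / 2 * ip u u) + ennreal M * ?D u R" using b u by blast
    also have "\<dots> \<le> ennreal (\<epsilon> / 2 * ip u u) + ennreal M * ennreal (2 * e * ip u u + C * S)"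
      by (intro add_left_mono mult_left_mono D) auto
    also have "\<dots> = ennreal (\<epsilon> / 2 * ip u u + M * (2 * e * ip u u + C * S))"
      using \<epsilon> e I S M \<Psi>(2) by (simp add: ennreal_plus ennreal_mult)
    also have "\<dots> \<le> ennreal (\<epsilon> * ip u u + (M * C) * S)"
    proof (rule ennreal_leI)
      have "M * (2 * e) \<le> \<epsilon> / 2" using M \<epsilon> by (simp add: e_def field_simps)
      then have "M * (2 * e) * ip u u \<le> \<epsilon> / 2 * ip u u" using I by (rule mult_right_mono)
      then show "\<epsilon> / 2 * ip u u + M * (2 * e * ip u u + C * S) \<le> \<epsilon> * ip u u + (M * C) * S"
        by (simp add: distrib_left mult.assoc)
    qed
    finally show ?thesis by (simp add: S_def)
  qed
  then show "\<exists>\<Psi> C. finite \<Psi> \<and> C \<ge> 0 \<and> (\<forall>\<psi>\<in>\<Psi>. adm \<psi>) \<and>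
     (\<forall>u\<in>W. (\<integral>\<^sup>+x. ennreal (V x * (u x)\<^sup>2) \<partial>lebesgue) \<le> ennreal (\<epsilon> * ip u u + C * (\<Sum>\<psi>\<in>\<Psi>. (L \<psi> u)\<^sup>2)))"
    using \<Psi> M by (intro exI[of _ \<Psi>] exI[of _ "M * C"]) auto
qed

lemma finite_rank_bounded:
  assumes "finite_rank V"
  obtains K where "K \<ge> 0" "\<And>u. u \<in> W \<Longrightarrow> (\<integral>\<^sup>+x. ennreal (V x * (u x)\<^sup>2) \<partial>lebesgue) \<le> ennreal (K * ip u u)"
proof -
  from assms[unfolded finite_rank_def, rule_format, OF zero_less_one]
  obtain \<Psi> C where \<Psi>: "finite \<Psi>" "C \<ge> 0" "\<forall>\<psi>\<in>\<Psi>. adm \<psi>"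
    and b: "\<forall>u\<in>W. (\<integral>\<^sup>+x. ennreal (V x * (u x)\<^sup>2) \<partial>lebesgue) \<le> ennreal (1 * ip u u + C * (\<Sum>\<psi>\<in>\<Psi>. (L \<psi> u)\<^sup>2))"
    by (elim exE conjE)
  have "\<exists>K. K \<ge> 0 \<and> (adm \<psi> \<longrightarrow> (\<forall>u\<in>W. (L \<psi> u)\<^sup>2 \<le> K * ip u u))" for \<psi>
  proof (cases "adm \<psi>")
    case True
    show ?thesis by (rule adm_bound[OF True]) blast
  qed auto
  then obtain k where k: "\<And>\<psi>. k \<psi> \<ge> 0" "\<And>\<psi> u. adm \<psi> \<Longrightarrow> u \<in> W \<Longrightarrow> (L \<psi> u)\<^sup>2 \<le> k \<psi> * ip u u"
    by metis
  show ?thesis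
  proof (rule that[of "1 + C * (\<Sum>\<psi>\<in>\<Psi>. k \<psi>)"])
    show "1 + C * (\<Sum>\<psi>\<in>\<Psi>. k \<psi>) \<ge> 0" using k \<Psi> by (simp add: sum_nonneg)
    fix u assume u: "u \<in> W"
    have "(\<Sum>\<psi>\<in>\<Psi>. (L \<psi> u)\<^sup>2) \<le> (\<Sum>\<psi>\<in>\<Psi>. k \<psi> * ip u u)" using \<Psi> k u by (intro sum_mono) auto
    then have "1 * ip u u + C * (\<Sum>\<psi>\<in>\<Psi>. (L \<psi> u)\<^sup>2) \<le> 1 * ip u u + C * (\<Sum>\<psi>\<in>\<Psi>. k \<psi> * ip u u)"
      using \<Psi> by (intro add_left_mono mult_left_mono) auto
    also have "\<dots> = (1 + C * (\<Sum>\<psi>\<in>\<Psi>. k \<psi>)) * ip u u" by (simp add: sum_distrib_right algebra_simps)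
    finally show "(\<integral>\<^sup>+x. ennreal (V x * (u x)\<^sup>2) \<partial>lebesgue) \<le> ennreal ((1 + C * (\<Sum>\<psi>\<in>\<Psi>. k \<psi>)) * ip u u)"
      using b u by (meson ennreal_leI order_trans)
  qed
qed

section \<open>Compactness by a diagonal subsequence\<close>

lemma finite_family_convergent_subseq:
  fixes f :: "'b \<Rightarrow> nat \<Rightarrow> real"
  assumes "finite I" "\<And>i. i \<in> I \<Longrightarrow> Bseq (f i)"
  shows "\<exists>r::nat\<Rightarrow>nat. strict_mono r \<and> (\<forall>i\<in>I. convergent (f i \<circ> r))"
  using assms
proof (induction I)
  case empty
  then show ?case by (intro exI[of _ id]) (simp add: strict_mono_def)
next
  case (insert i I)
  have "\<exists>r::nat\<Rightarrow>nat. strict_mono r \<and> (\<forall>i\<in>I. convergent (f i \<circ> r))"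
    by (rule insert.IH) (use insert.prems in auto)
  then obtain r :: "nat \<Rightarrow> nat" where r: "strict_mono r" "\<forall>j\<in>I. convergent (f j \<circ> r)" by blast
  have "bounded (range (f i \<circ> r))"
  proof (rule bounded_subset)
    show "bounded (range (f i))" using insert.prems[of i] by (simp add: Bseq_eq_bounded)
  qed auto
  then obtain l r' where r': "strict_mono r'" "((f i \<circ> r) \<circ> r') \<longlonglongrightarrow> l"
    using bounded_imp_convergent_subsequence by metis
  have "convergent (f j \<circ> (r \<circ> r'))" if "j \<in> insert i I" for j
  proof (cases "j = i")
    case True
    then show ?thesis using r'(2) by (auto simp: convergent_def o_assoc)
  next
    case False
    then have "convergent (f j \<circ> r)" using that r by auto
    then show ?thesis using convergent_subseq_convergent[OF _ r'(1), of "f j \<circ> r"] by (simp add: o_assoc)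
  qed
  then show ?case using strict_mono_o[OF r(1) r'(1)] by blast
qed

text \<open>For each accuracy only finitely many bounded real sequences of averages have to
  converge, which a subsequence achieves; a diagonal sequence serves all accuracies 1/(k+1) at
  once.\<close>

lemma finite_rank_compact:
  assumes V: "finite_rank V" and v: "\<And>n::nat. v n \<in> W" "\<And>n. ip (v n) (v n) \<le> 1"
  shows "\<exists>r::nat\<Rightarrow>nat. strict_mono r \<and> (\<forall>e>0. \<exists>K. \<forall>m\<ge>K. \<forall>n\<ge>K.
     (\<integral>\<^sup>+x. ennreal (V x * (v (r m) x - v (r n) x)\<^sup>2) \<partial>lebesgue) \<le> ennreal e)"
proof -
  define Q where "Q m n = (\<integral>\<^sup>+x. ennreal (V x * (v m x - v n x)\<^sup>2) \<partial>lebesgue)" for m n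
  define P where "P k s \<longleftrightarrow> (\<exists>K. \<forall>m\<ge>K. \<forall>n\<ge>K. Q (s m) (s n) \<le> ennreal (inverse (real (Suc k))))" for k and s :: "nat \<Rightarrow> nat"
  \<comment> \<open>By the parallelogram law differences of vectors in the unit ball have energy at
    most 4, so the accuracy e/8 spends e/2 on the energy and leaves e/2 for the averages.\<close>
  have ipd: "ip (\<lambda>x. v m x - v n x) (\<lambda>x. v m x - v n x) \<le> 4" for m n
  proof -
    have "ip (\<lambda>x. v m x - v n x) (\<lambda>x. v m x - v n x) + ip (\<lambda>x. v m x + v n x) (\<lambda>x. v m x + v n x) = 2 * ip (v m) (v m) + 2 * ip (v n) (v n)"
    proof -
      have d: "(\<lambda>x. 1 * v m x + c * v n x) \<in> W" for c by (intro W_linear v)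
      have "ip (\<lambda>x. 1 * v m x + c * v n x) (\<lambda>x. 1 * v m x + c * v n x) = ip (v m) (v m) + 2 * c * ip (v m) (v n) + c\<^sup>2 * ip (v n) (v n)" for c
        unfolding ip_linear[OF v(1) v(1) d] ip_sym[of "v m" "\<lambda>x. 1 * v m x + c * v n x"] ip_sym[of "v n" "\<lambda>x. 1 * v m x + c * v n x"]
          ip_linear[OF v(1) v(1) v(1)] ip_sym[of "v n" "v m"] by (simp add: power2_eq_square algebra_simps)
      from this[of 1] this[of "-1"] show ?thesis by simp
    qed
    moreover have "0 \<le> ip (\<lambda>x. v m x + v n x) (\<lambda>x. v m x + v n x)"
      using ip_nonneg[OF W_linear[OF v(1) v(1), of 1 m 1 n]] by simp
    ultimately show ?thesis using v(2)[of m] v(2)[of n] by linarith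
  qed
  interpret subseqs P
  proof
    fix k and s :: "nat \<Rightarrow> nat" assume s: "strict_mono s"
    define e where "e = inverse (real (Suc k))"
    have e: "e > 0" "e / 8 > 0" by (auto simp: e_def)
    from V[unfolded finite_rank_def, rule_format, OF e(2)]
    obtain \<Psi> C where \<Psi>: "finite \<Psi>" "C \<ge> 0" "\<forall>\<psi>\<in>\<Psi>. adm \<psi>"
      and b: "\<forall>u\<in>W. (\<integral>\<^sup>+x. ennreal (V x * (u x)\<^sup>2) \<partial>lebesgue) \<le> ennreal (e / 8 * ip u u + C * (\<Sum>\<psi>\<in>\<Psi>. (L \<psi> u)\<^sup>2))"
      by (elim exE conjE)
    have "Bseq (\<lambda>n. L \<psi> (v (s n)))" if mem: "\<psi> \<in> \<Psi>" for \<psi>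
    proof -
      obtain K where K: "K \<ge> 0" "\<And>u. u \<in> W \<Longrightarrow> integrable lebesgue (\<lambda>x. \<psi> x * u x) \<and> (L \<psi> u)\<^sup>2 \<le> K * ip u u"
        by (rule adm_bound[OF \<Psi>(3)[rule_format, OF mem]]) (rule that)
      have "norm (L \<psi> (v (s n))) \<le> sqrt K" for n
      proof -
        have "(L \<psi> (v (s n)))\<^sup>2 \<le> K * ip (v (s n)) (v (s n))" using K(2)[OF v(1)] by blast
        also have "\<dots> \<le> K * 1" using K(1) v(2) by (intro mult_left_mono) auto
        finally show ?thesis by (metis mult.right_neutral real_norm_def real_sqrt_abs real_sqrt_le_mono)
      qed
      then show ?thesis by (rule BseqI')
    qed
    from finite_family_convergent_subseq[OF \<Psi>(1), of "\<lambda>\<psi> n. L \<psi> (v (s n))", OF this]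
    obtain r :: "nat \<Rightarrow> nat" where r: "strict_mono r" "\<forall>\<psi>\<in>\<Psi>. convergent ((\<lambda>n. L \<psi> (v (s n))) \<circ> r)" by blast
    have CS: "\<exists>K. \<forall>m\<ge>K. \<forall>n\<ge>K. C * (\<Sum>\<psi>\<in>\<Psi>. (L \<psi> (v (s (r m))) - L \<psi> (v (s (r n))))\<^sup>2) \<le> e / 2"
    proof -
      \<comment> \<open>The tolerance for a single average; the summands 1 avoid division by zero
        when C or the family of averages is trivial.\<close>
      define c where "c = e / (2 * (C + 1) * (real (card \<Psi>) + 1))"
      have c: "c > 0" using e \<Psi> by (simp add: c_def)
      have "\<exists>K. \<forall>m\<ge>K. \<forall>n\<ge>K. (L \<psi> (v (s (r m))) - L \<psi> (v (s (r n))))\<^sup>2 \<le> c" if "\<psi> \<in> \<Psi>" for \<psi>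
      proof -
        have "Cauchy (\<lambda>n. L \<psi> (v (s (r n))))" using r(2) that by (auto simp: Cauchy_convergent_iff o_def)
        then obtain K where K: "\<And>m n. m \<ge> K \<Longrightarrow> n \<ge> K \<Longrightarrow> norm (L \<psi> (v (s (r m))) - L \<psi> (v (s (r n)))) < sqrt c"
          using CauchyD[of _ "sqrt c"] c by (metis real_sqrt_gt_zero)
        have "(L \<psi> (v (s (r m))) - L \<psi> (v (s (r n))))\<^sup>2 \<le> c" if "m \<ge> K" "n \<ge> K" for m n
          using K[OF that] c by (metis less_imp_le real_norm_def real_sqrt_abs real_sqrt_le_iff)
        then show ?thesis by blast
      qed
      then obtain k where k: "\<And>\<psi> m n. \<psi> \<in> \<Psi> \<Longrightarrow> m \<ge> k \<psi> \<Longrightarrow> n \<ge> k \<psi> \<Longrightarrow> (L \<psi> (v (s (r m))) - L \<psi> (v (s (r n))))\<^sup>2 \<le> c"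
        by metis
      have "C * (\<Sum>\<psi>\<in>\<Psi>. (L \<psi> (v (s (r m))) - L \<psi> (v (s (r n))))\<^sup>2) \<le> e / 2" if "m \<ge> sum k \<Psi>" "n \<ge> sum k \<Psi>" for m n
      proof -
        have "k \<psi> \<le> sum k \<Psi>" if "\<psi> \<in> \<Psi>" for \<psi> using that \<Psi>(1) by (intro member_le_sum) auto
        then have "(\<Sum>\<psi>\<in>\<Psi>. (L \<psi> (v (s (r m))) - L \<psi> (v (s (r n))))\<^sup>2) \<le> (\<Sum>\<psi>\<in>\<Psi>. c)"
          using that k by (intro sum_mono) (meson order_trans)
        then have "C * (\<Sum>\<psi>\<in>\<Psi>. (L \<psi> (v (s (r m))) - L \<psi> (v (s (r n))))\<^sup>2) \<le> C * (real (card \<Psi>) * c)"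
          using \<Psi>(2) by (intro mult_left_mono) auto
        also have "\<dots> \<le> (C + 1) * ((real (card \<Psi>) + 1) * c)" using \<Psi>(2) c by (intro mult_mono) auto
        also have "\<dots> = e / 2"
        proof -
          have "a * (b * (e / (2 * a * b))) = e / 2" if "a \<noteq> 0" "b \<noteq> 0" for a b :: real using that by simp
          from this[of "C + 1" "real (card \<Psi>) + 1"] show ?thesis using \<Psi>(2) by (simp add: c_def add_nonneg_eq_0_iff)
        qed
        finally show ?thesis .
      qed
      then show ?thesis by blast
    qed
    then obtain K where K: "\<And>m n. m \<ge> K \<Longrightarrow> n \<ge> K \<Longrightarrow> C * (\<Sum>\<psi>\<in>\<Psi>. (L \<psi> (v (s (r m))) - L \<psi> (v (s (r n))))\<^sup>2) \<le> e / 2" by blast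
    have "Q ((s \<circ> r) m) ((s \<circ> r) n) \<le> ennreal e" if mn: "m \<ge> K" "n \<ge> K" for m n
    proof -
      let ?d = "\<lambda>x. v (s (r m)) x - v (s (r n)) x"
      have "(\<Sum>\<psi>\<in>\<Psi>. (L \<psi> ?d)\<^sup>2) = (\<Sum>\<psi>\<in>\<Psi>. (L \<psi> (v (s (r m))) - L \<psi> (v (s (r n))))\<^sup>2)"
        using \<Psi>(3) by (intro sum.cong) (auto simp: L_diff[OF _ v(1) v(1)])
      then have "e / 8 * ip ?d ?d + C * (\<Sum>\<psi>\<in>\<Psi>. (L \<psi> ?d)\<^sup>2) \<le> e / 8 * 4 + e / 2"
        using K[OF mn] ipd e by (intro add_mono mult_left_mono) auto
      then have "ennreal (e / 8 * ip ?d ?d + C * (\<Sum>\<psi>\<in>\<Psi>. (L \<psi> ?d)\<^sup>2)) \<le> ennreal e" by (intro ennreal_leI) simp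
      then show ?thesis using b W_diff[OF v(1) v(1), of "s (r m)" "s (r n)"] unfolding Q_def o_def by (meson order_trans)
    qed
    then have "P k (s \<circ> r)" unfolding P_def e_def[symmetric] by blast
    with r(1) show "\<exists>r'. strict_mono r' \<and> P k (s \<circ> r')" by blast
  qed
  \<comment> \<open>The diagonal sequence is a subsequence of the k-th stage only from index k + 1
    on, hence the property must be inherited by subsequences and the shift by \<open>Suc k\<close>
    appears below.\<close>
  have stable: "P k (s \<circ> r)" if "strict_mono r" and Ps: "P k s" for r s k
  proof -
    obtain K where "\<forall>m\<ge>K. \<forall>n\<ge>K. Q (s m) (s n) \<le> ennreal (inverse (real (Suc k)))" using Ps by (auto simp: P_def)
    moreover have "r m \<ge> K" if "m \<ge> K" for m using strict_mono_imp_increasing[OF \<open>strict_mono r\<close>, of m] that by linarith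
    ultimately show ?thesis unfolding P_def o_def by blast
  qed
  have "\<exists>K. \<forall>m\<ge>K. \<forall>n\<ge>K. Q (diagseq m) (diagseq n) \<le> ennreal e" if e: "e > 0" for e
  proof -
    obtain k where k: "inverse (real (Suc k)) < e" using reals_Archimedean[OF e] by blast
    obtain K where K: "\<And>m n. m \<ge> K \<Longrightarrow> n \<ge> K \<Longrightarrow> Q (diagseq (Suc k + m)) (diagseq (Suc k + n)) \<le> ennreal (inverse (real (Suc k)))"
      using diagseq_holds[OF stable, of k] by (auto simp: P_def o_def)
    have "Q (diagseq m) (diagseq n) \<le> ennreal e" if "m \<ge> K + Suc k" "n \<ge> K + Suc k" for m n
    proof -
      have "Q (diagseq m) (diagseq n) \<le> ennreal (inverse (real (Suc k)))"
        using K[of "m - Suc k" "n - Suc k"] that by simp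
      also have "\<dots> \<le> ennreal e" using k by (intro ennreal_leI) simp
      finally show ?thesis .
    qed
    then show ?thesis by blast
  qed
  then show ?thesis using subseq_diagseq unfolding Q_def by blast
qed

end

section \<open>The indefinite weight\<close>

text \<open>Gaussian elimination: a homogeneous linear system with fewer equations than unknowns has
  a nonzero solution. Each equation with a nonzero coefficient eliminates one unknown.\<close>

lemma nontrivial_kernel:
  fixes F :: "'u \<Rightarrow> 'i \<Rightarrow> real"
  assumes "finite U"
  shows "finite I \<Longrightarrow> card I > card U \<Longrightarrow> \<exists>c. (\<exists>i\<in>I. c i \<noteq> 0) \<and> (\<forall>u\<in>U. (\<Sum>i\<in>I. c i * F u i) = 0)"
  using assms
proof (induction U arbitrary: I F rule: finite_induct)
  case empty
  then obtain i where "i \<in> I" by (metis card.empty card_gt_0_iff equals0I not_less_zero)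
  then show ?case by (intro exI[of _ "\<lambda>_. 1"]) auto
next
  case (insert u U)
  show ?case
  proof (cases "\<forall>i\<in>I. F u i = 0")
    case True
    have "\<exists>c. (\<exists>i\<in>I. c i \<noteq> 0) \<and> (\<forall>u\<in>U. (\<Sum>i\<in>I. c i * F u i) = 0)"
      by (rule insert.IH) (use insert in auto)
    then show ?thesis using True by auto
  next
    case False
    then obtain k where k: "k \<in> I" "F u k \<noteq> 0" by blast
    \<comment> \<open>The coefficients of the other equations after the unknown k has been
      eliminated with the pivot \<open>F u k\<close>.\<close>
    define G where "G v i = F v i - F v k * F u i / F u k" for v i
    have "\<exists>c. (\<exists>i\<in>I - {k}. c i \<noteq> 0) \<and> (\<forall>v\<in>U. (\<Sum>i\<in>I - {k}. c i * G v i) = 0)"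
      by (rule insert.IH) (use insert k in auto)
    then obtain c where c: "\<exists>i\<in>I - {k}. c i \<noteq> 0" "\<And>v. v \<in> U \<Longrightarrow> (\<Sum>i\<in>I - {k}. c i * G v i) = 0" by blast
    define s where "s = (\<Sum>i\<in>I - {k}. c i * F u i)"
    define d where "d = c(k := - s / F u k)"
    have sum_d: "(\<Sum>i\<in>I. d i * F v i) = - s / F u k * F v k + (\<Sum>i\<in>I - {k}. c i * F v i)" for v
    proof -
      have "(\<Sum>i\<in>I. d i * F v i) = d k * F v k + (\<Sum>i\<in>I - {k}. d i * F v i)"
        using insert k by (intro sum.remove) auto
      also have "(\<Sum>i\<in>I - {k}. d i * F v i) = (\<Sum>i\<in>I - {k}. c i * F v i)"
        by (rule sum.cong) (auto simp: d_def)
      finally show ?thesis by (simp add: d_def)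
    qed
    have "(\<Sum>i\<in>I. d i * F v i) = 0" if "v \<in> insert u U" for v
    proof (cases "v = u")
      case True
      then show ?thesis unfolding sum_d using k by (simp add: s_def)
    next
      case False
      then have "v \<in> U" using that by simp
      have "0 = (\<Sum>i\<in>I - {k}. c i * F v i) - (\<Sum>i\<in>I - {k}. F v k / F u k * (c i * F u i))"
        using c(2)[OF \<open>v \<in> U\<close>] by (simp add: G_def right_diff_distrib sum_subtractf mult_ac)
      also have "\<dots> = (\<Sum>i\<in>I - {k}. c i * F v i) - F v k / F u k * s"
        by (simp add: s_def sum_distrib_left)
      finally show ?thesis unfolding sum_d by (simp add: mult.commute)
    qed
    moreover have "\<exists>i\<in>I. d i \<noteq> 0" using c(1) by (auto simp: d_def)
    ultimately show ?thesis by blast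
  qed
qed

text \<open>The splitting of the positive part enters from here on only through the compactness that
  it implies.\<close>

locale weighted_problem = weighted_space \<alpha> dim for \<alpha> :: real and dim :: "'n::finite itself" +
  fixes g :: "real ^ 'n \<Rightarrow> real"
  assumes locally_integrable: "locally_integrable g"
    and finite_rank: "finite_rank (\<lambda>x. max (g x) 0)"
    and nonzero: "\<not> (AE x in lebesgue. max (g x) 0 = 0)"
begin

definition gp :: "real ^ 'n \<Rightarrow> real" where "gp x = max (g x) 0"
definition gm :: "real ^ 'n \<Rightarrow> real" where "gm x = max (- g x) 0"

lemma g_eq: "g x = gp x - gm x" and gp_nonneg: "0 \<le> gp x" and gm_nonneg: "0 \<le> gm x" and gm_le: "gm x \<le> \<bar>g x\<bar>"
  by (auto simp: gp_def gm_def)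

lemma g_measurable [measurable]: "g \<in> borel_measurable lebesgue"
proof (rule borel_measurable_LIMSEQ_real)
  show "(\<lambda>x. indicator (cball 0 (real n)) x * g x) \<in> borel_measurable lebesgue" for n
    using locally_integrable by (intro borel_measurable_integrable) (auto simp: locally_integrable_def set_integrable_def)
  show "(\<lambda>n. indicator (cball 0 (real n)) x * g x) \<longlonglongrightarrow> g x" for x
  proof (rule tendsto_eventually)
    obtain k :: nat where "norm x \<le> real k" using real_arch_simple by blast
    then show "\<forall>\<^sub>F n in sequentially. indicator (cball 0 (real n)) x * g x = g x"
      unfolding eventually_sequentially by (intro exI[of _ k]) auto
  qed
qed

lemma gp_measurable [measurable]: "gp \<in> borel_measurable lebesgue"
  and gm_measurable [measurable]: "gm \<in> borel_measurable lebesgue"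
  unfolding gp_def gm_def by measurable

definition X :: "(real ^ 'n \<Rightarrow> real) set" where
  "X = {u\<in>W. (\<integral>\<^sup>+x. ennreal (gm x * (u x)\<^sup>2) \<partial>lebesgue) < \<infinity>}"

definition form :: "(real ^ 'n \<Rightarrow> real) \<Rightarrow> (real ^ 'n \<Rightarrow> real) \<Rightarrow> (real ^ 'n \<Rightarrow> real) \<Rightarrow> real" where
  "form V u v = (\<integral>x. V x * (u x * v x) \<partial>lebesgue)"

lemma XW: "u \<in> X \<Longrightarrow> u \<in> W" by (simp add: X_def)

lemma square_add_finite:
  assumes [measurable]: "V \<in> borel_measurable lebesgue" "u \<in> borel_measurable lebesgue" "v \<in> borel_measurable lebesgue"
    and V: "\<And>x. 0 \<le> V x"
    and fin: "(\<integral>\<^sup>+x. ennreal (V x * (u x)\<^sup>2) \<partial>lebesgue) < \<infinity>" "(\<integral>\<^sup>+x. ennreal (V x * (v x)\<^sup>2) \<partial>lebesgue) < \<infinity>"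
  shows "(\<integral>\<^sup>+x. ennreal (V x * (a * u x + b * v x)\<^sup>2) \<partial>lebesgue) < \<infinity>"
    "integrable lebesgue (\<lambda>x. V x * (u x * v x))" "integrable lebesgue (\<lambda>x. V x * \<bar>u x * v x\<bar>)"
proof -
  have "(\<integral>\<^sup>+x. ennreal (V x * (a * u x + b * v x)\<^sup>2) \<partial>lebesgue) \<le>
    (\<integral>\<^sup>+x. ennreal (2 * a\<^sup>2) * ennreal (V x * (u x)\<^sup>2) + ennreal (2 * b\<^sup>2) * ennreal (V x * (v x)\<^sup>2) \<partial>lebesgue)"
  proof (rule nn_integral_mono)
    fix x
    have "(a * u x + b * v x)\<^sup>2 \<le> 2 * (a * u x)\<^sup>2 + 2 * (b * v x)\<^sup>2"
      using sum_squares_bound[of "a * u x" "b * v x"] by (simp add: power2_sum)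
    then have "V x * (a * u x + b * v x)\<^sup>2 \<le> V x * (2 * (a * u x)\<^sup>2 + 2 * (b * v x)\<^sup>2)"
      using V by (intro mult_left_mono) auto
    also have "\<dots> = 2 * a\<^sup>2 * (V x * (u x)\<^sup>2) + 2 * b\<^sup>2 * (V x * (v x)\<^sup>2)"
      by (simp add: power_mult_distrib algebra_simps)
    finally have "ennreal (V x * (a * u x + b * v x)\<^sup>2) \<le> ennreal (2 * a\<^sup>2 * (V x * (u x)\<^sup>2) + 2 * b\<^sup>2 * (V x * (v x)\<^sup>2))"
      by (rule ennreal_leI)
    also have "\<dots> = ennreal (2 * a\<^sup>2) * ennreal (V x * (u x)\<^sup>2) + ennreal (2 * b\<^sup>2) * ennreal (V x * (v x)\<^sup>2)"
      using V by (intro ennreal_lincomb) auto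
    finally show "ennreal (V x * (a * u x + b * v x)\<^sup>2) \<le> \<dots>" .
  qed
  also have "\<dots> = ennreal (2 * a\<^sup>2) * (\<integral>\<^sup>+x. ennreal (V x * (u x)\<^sup>2) \<partial>lebesgue) + ennreal (2 * b\<^sup>2) * (\<integral>\<^sup>+x. ennreal (V x * (v x)\<^sup>2) \<partial>lebesgue)"
    by (simp add: nn_integral_add nn_integral_cmult)
  also have "\<dots> < \<infinity>" using fin by (simp add: ennreal_mult_less_top)
  finally show "(\<integral>\<^sup>+x. ennreal (V x * (a * u x + b * v x)\<^sup>2) \<partial>lebesgue) < \<infinity>" .
  have "(\<integral>\<^sup>+x. ennreal (V x * \<bar>u x * v x\<bar>) \<partial>lebesgue) \<le> (\<integral>\<^sup>+x. ennreal (V x * (u x)\<^sup>2) + ennreal (V x * (v x)\<^sup>2) \<partial>lebesgue)"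
  proof (rule nn_integral_mono)
    fix x
    have "\<bar>u x * v x\<bar> \<le> (u x)\<^sup>2 + (v x)\<^sup>2"
    proof -
      have "2 * \<bar>u x * v x\<bar> \<le> (u x)\<^sup>2 + (v x)\<^sup>2"
        using sum_squares_bound[of "\<bar>u x\<bar>" "\<bar>v x\<bar>"] by (simp add: abs_mult)
      then show ?thesis using abs_ge_zero[of "u x * v x"] by linarith
    qed
    then have "V x * \<bar>u x * v x\<bar> \<le> V x * ((u x)\<^sup>2 + (v x)\<^sup>2)" using V by (intro mult_left_mono) auto
    then have "ennreal (V x * \<bar>u x * v x\<bar>) \<le> ennreal (V x * (u x)\<^sup>2 + V x * (v x)\<^sup>2)"
      by (intro ennreal_leI) (simp add: distrib_left)
    then show "ennreal (V x * \<bar>u x * v x\<bar>) \<le> ennreal (V x * (u x)\<^sup>2) + ennreal (V x * (v x)\<^sup>2)"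
      using V by simp
  qed
  also have "\<dots> < \<infinity>" using fin by (simp add: nn_integral_add)
  finally have f: "(\<integral>\<^sup>+x. ennreal (V x * \<bar>u x * v x\<bar>) \<partial>lebesgue) < \<infinity>" .
  then show "integrable lebesgue (\<lambda>x. V x * (u x * v x))" "integrable lebesgue (\<lambda>x. V x * \<bar>u x * v x\<bar>)"
    using V by (auto intro!: integrableI_bounded simp: abs_mult)
qed

lemma gp_bounded:
  obtains K where "K \<ge> 0" "\<And>u. u \<in> W \<Longrightarrow> (\<integral>\<^sup>+x. ennreal (gp x * (u x)\<^sup>2) \<partial>lebesgue) \<le> ennreal (K * ip u u)"
proof -
  have "finite_rank gp" using finite_rank by (simp add: gp_def[abs_def])
  then show ?thesis by (rule finite_rank_bounded) (rule that)
qed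

lemma gp_finite: "u \<in> W \<Longrightarrow> (\<integral>\<^sup>+x. ennreal (gp x * (u x)\<^sup>2) \<partial>lebesgue) < \<infinity>"
proof (rule gp_bounded)
  fix K assume u: "u \<in> W" and K: "\<And>u. u \<in> W \<Longrightarrow> (\<integral>\<^sup>+x. ennreal (gp x * (u x)\<^sup>2) \<partial>lebesgue) \<le> ennreal (K * ip u u)"
  show "(\<integral>\<^sup>+x. ennreal (gp x * (u x)\<^sup>2) \<partial>lebesgue) < \<infinity>"
    by (rule le_less_trans[OF K[OF u]]) simp
qed

lemma gm_finite: "u \<in> X \<Longrightarrow> (\<integral>\<^sup>+x. ennreal (gm x * (u x)\<^sup>2) \<partial>lebesgue) < \<infinity>"
  by (simp add: X_def)

lemma X_linear: assumes "u \<in> X" "v \<in> X" shows "(\<lambda>x. a * u x + b * v x) \<in> X"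
  using square_add_finite(1)[OF gm_measurable W_measurable W_measurable gm_nonneg gm_finite gm_finite, OF XW XW, OF assms assms, of a b]
    W_linear[OF XW XW, OF assms, of a b] by (simp add: X_def)

lemma psd_form_ip: "psd_form X ip"
  unfolding psd_form_def
  using X_linear ip_sym ip_linear XW ip_nonneg by blast

lemma psd_form_form:
  assumes [measurable]: "V \<in> borel_measurable lebesgue" and V: "\<And>x. 0 \<le> V x"
    and fin: "\<And>u. u \<in> X \<Longrightarrow> (\<integral>\<^sup>+x. ennreal (V x * (u x)\<^sup>2) \<partial>lebesgue) < \<infinity>"
  shows "psd_form X (form V)"
  unfolding psd_form_def
proof (intro conjI ballI allI)
  fix u v w a b assume uvw: "u \<in> X" "v \<in> X" "w \<in> X"
  note m = uvw[THEN XW, THEN W_measurable]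
  have "integrable lebesgue (\<lambda>x. V x * (u x * w x))" "integrable lebesgue (\<lambda>x. V x * (v x * w x))"
    using square_add_finite(2)[OF _ _ _ V fin fin] uvw m by auto
  moreover have "form V (\<lambda>x. a * u x + b * v x) w = (\<integral>x. a * (V x * (u x * w x)) + b * (V x * (v x * w x)) \<partial>lebesgue)"
    unfolding form_def by (intro Bochner_Integration.integral_cong) (auto simp: algebra_simps)
  ultimately show "form V (\<lambda>x. a * u x + b * v x) w = a * form V u w + b * form V v w"
    by (simp add: form_def)
next
  fix u v show "form V u v = form V v u" by (simp add: form_def mult.commute)
next
  fix u show "0 \<le> form V u u" unfolding form_def by (intro Bochner_Integration.integral_nonneg) (simp add: V)
qed (rule X_linear)

lemma form_self:
  assumes [measurable]: "V \<in> borel_measurable lebesgue" "u \<in> borel_measurable lebesgue" and V: "\<And>x. 0 \<le> V x"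
    and fin: "(\<integral>\<^sup>+x. ennreal (V x * (u x)\<^sup>2) \<partial>lebesgue) < \<infinity>"
  shows "ennreal (form V u u) = (\<integral>\<^sup>+x. ennreal (V x * (u x)\<^sup>2) \<partial>lebesgue)"
proof -
  have "integrable lebesgue (\<lambda>x. V x * (u x * u x))" by (rule square_add_finite(2)) (use V fin in auto)
  then show ?thesis unfolding form_def
    by (subst nn_integral_eq_integral[symmetric]) (auto simp: V power2_eq_square)
qed

lemma psd_form_gp: "psd_form X (form gp)"
  by (rule psd_form_form) (auto simp: gp_nonneg intro: gp_finite[OF XW, unfolded infinity_ennreal_def])

lemma psd_form_gm: "psd_form X (form gm)"
  by (rule psd_form_form) (auto simp: gm_nonneg intro: gm_finite[unfolded infinity_ennreal_def])

lemma form_gp_self: "u \<in> W \<Longrightarrow> ennreal (form gp u u) = (\<integral>\<^sup>+x. ennreal (gp x * (u x)\<^sup>2) \<partial>lebesgue)"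
  by (intro form_self gp_nonneg gp_finite W_measurable gp_measurable)

lemma form_gm_self: "u \<in> X \<Longrightarrow> ennreal (form gm u u) = (\<integral>\<^sup>+x. ennreal (gm x * (u x)\<^sup>2) \<partial>lebesgue)"
  by (intro form_self gm_nonneg gm_finite W_measurable gm_measurable XW)

lemma g_integrable_cball: "integrable lebesgue (\<lambda>x. indicator (cball 0 R) x * g x)"
  using locally_integrable by (auto simp: locally_integrable_def set_integrable_def)

lemma test_in_X: assumes \<phi>: "\<phi> \<in> test_functions" shows "\<phi> \<in> X"
proof -
  obtain R where R: "\<And>x. norm x \<ge> R \<Longrightarrow> \<phi> x = 0" using test_support[OF \<phi>] by metis
  obtain M where M: "\<And>x. \<bar>\<phi> x\<bar> \<le> M" using test_bounded[OF \<phi>] by metis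
  have "(\<integral>\<^sup>+x. ennreal (gm x * (\<phi> x)\<^sup>2) \<partial>lebesgue) \<le> (\<integral>\<^sup>+x. ennreal (M\<^sup>2) * ennreal (norm (indicator (cball 0 R) x * g x)) \<partial>lebesgue)"
  proof (rule nn_integral_mono)
    fix x
    show "ennreal (gm x * (\<phi> x)\<^sup>2) \<le> ennreal (M\<^sup>2) * ennreal (norm (indicator (cball 0 R) x * g x))"
    proof (cases "norm x \<le> R")
      case True
      have "(\<phi> x)\<^sup>2 \<le> M\<^sup>2" using M[of x] by (metis abs_ge_zero power2_abs power_mono)
      then have "gm x * (\<phi> x)\<^sup>2 \<le> \<bar>g x\<bar> * M\<^sup>2" using gm_le gm_nonneg by (intro mult_mono) auto
      then show ?thesis using True by (simp add: ennreal_leI mult.commute flip: ennreal_mult)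
    next
      case False
      then show ?thesis using R[of x] by simp
    qed
  qed
  also have "\<dots> = ennreal (M\<^sup>2) * (\<integral>\<^sup>+x. ennreal (norm (indicator (cball 0 R) x * g x)) \<partial>lebesgue)"
    by (rule nn_integral_cmult) (use g_integrable_cball in auto)
  also have "\<dots> < \<infinity>"
    using g_integrable_cball[of R] by (simp add: integrable_iff_bounded ennreal_mult_less_top)
  finally show ?thesis using test_in_W[OF \<phi>] by (simp add: X_def)
qed

lemma form_g: "u \<in> X \<Longrightarrow> v \<in> X \<Longrightarrow> integrable lebesgue (\<lambda>x. g x * (u x * v x))"
  "u \<in> X \<Longrightarrow> v \<in> X \<Longrightarrow> form gp u v - form gm u v = (\<integral>x. g x * (u x * v x) \<partial>lebesgue)"
proof -
  assume uv: "u \<in> X" "v \<in> X"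
  note m = uv[THEN XW, THEN W_measurable]
  have e: "(\<lambda>x. g x * (u x * v x)) = (\<lambda>x. gp x * (u x * v x) - gm x * (u x * v x))"
    by (rule ext) (simp only: g_eq left_diff_distrib)
  have "integrable lebesgue (\<lambda>x. gp x * (u x * v x))" "integrable lebesgue (\<lambda>x. gm x * (u x * v x))"
    using square_add_finite(2)[OF gp_measurable m gp_nonneg] square_add_finite(2)[OF gm_measurable m gm_nonneg]
      gp_finite[OF XW] gm_finite uv by blast+
  then show "integrable lebesgue (\<lambda>x. g x * (u x * v x))" "form gp u v - form gm u v = (\<integral>x. g x * (u x * v x) \<partial>lebesgue)"
    unfolding e form_def by simp_all
qed

text \<open>The essential support of the positive part of g.\<close>

definition positive_points :: "(real ^ 'n) set" where
  "positive_points = {x. \<forall>r>0. \<not> (AE y in lebesgue. y \<in> ball x r \<longrightarrow> g y \<le> 0)}"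

text \<open>The complement is covered by balls on which g \<le> 0 almost everywhere, and by Lindelof
  countably many of them suffice. A finite set is null, so if this one were finite the positive part
  of g would vanish almost everywhere.\<close>

lemma infinite_positive_points: "infinite positive_points"
proof
  assume fin: "finite positive_points"
  define \<F> where "\<F> = {ball x r | x r. r > 0 \<and> (AE y in lebesgue. y \<in> ball x r \<longrightarrow> g y \<le> 0)}"
  obtain \<F>' where F': "\<F>' \<subseteq> \<F>" "countable \<F>'" "\<Union>\<F>' = \<Union>\<F>"
    by (rule Lindelof_openin[of \<F> UNIV]) (auto simp: \<F>_def)
  have "AE y in lebesgue. \<forall>B\<in>\<F>'. y \<in> B \<longrightarrow> g y \<le> 0"
  proof (subst AE_ball_countable[OF F'(2)], rule ballI)
    fix B assume "B \<in> \<F>'"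
    then have "B \<in> \<F>" using F'(1) by blast
    then show "AE y in lebesgue. y \<in> B \<longrightarrow> g y \<le> 0" unfolding \<F>_def by blast
  qed
  moreover have "AE y in lebesgue. y \<notin> positive_points"
  proof -
    have "positive_points \<in> null_sets lebesgue" using fin by (simp add: finite_imp_null_set_lborel null_sets_completionI)
    then show ?thesis by (rule AE_not_in)
  qed
  ultimately have "AE y in lebesgue. max (g y) 0 = 0"
  proof eventually_elim
    case (elim y)
    then obtain r where "r > 0" "AE z in lebesgue. z \<in> ball y r \<longrightarrow> g z \<le> 0" by (auto simp: positive_points_def)
    then have "ball y r \<in> \<F>" "y \<in> ball y r" by (auto simp: \<F>_def)
    then have "y \<in> \<Union>\<F>'" using F'(3) by blast
    then show ?case using elim by auto
  qed
  then show False using nonzero by simp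
qed

lemma positive_test:
  assumes "x \<in> positive_points" "r > 0"
  obtains \<phi> where "\<phi> \<in> test_functions" "\<And>y. y \<notin> ball x r \<Longrightarrow> \<phi> y = 0" "(\<integral>y. g y * (\<phi> y)\<^sup>2 \<partial>lebesgue) > 0"
proof (rule ccontr)
  assume none: "\<not> thesis"
  have "set_integrable lebesgue (cball x r) g" using locally_integrable by (auto simp: locally_integrable_def)
  then have "set_integrable lebesgue (ball x r) g"
    by (rule set_integrable_subset) auto
  then have "AE y in lebesgue. y \<in> ball x r \<longrightarrow> g y \<le> 0"
  proof (rule AE_nonpos_if_test_nonpos[rotated 2])
    fix \<psi> :: "real ^ 'n \<Rightarrow> real" assume "\<psi> \<in> test_functions" "\<And>y. y \<notin> ball x r \<Longrightarrow> \<psi> y = 0"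
    then show "(\<integral>y. g y * (\<psi> y)\<^sup>2 \<partial>lebesgue) \<le> 0" using none that[of \<psi>] by force
  qed auto
  then show False using assms by (auto simp: positive_points_def)
qed

lemma exists_positive:
  assumes U: "finite U" "U \<subseteq> X"
  shows "\<exists>v\<in>X. (\<forall>u\<in>U. ip u v = 0) \<and> form gm v v < form gp v v"
proof -
  obtain I where I: "I \<subseteq> positive_points" "finite I" "card I = Suc (card U)"
    \<comment> \<open>One point more than there are orthogonality conditions, so that the linear
      system for the coefficients has a nontrivial solution.\<close>
    using infinite_arbitrarily_large[OF infinite_positive_points] by metis
  have "\<exists>r>0. \<forall>x\<in>I. \<forall>y\<in>I. x \<noteq> y \<longrightarrow> ball x r \<inter> ball y r = {}"
  proof -
    have "\<exists>d>0. \<forall>y\<in>I. y \<noteq> x \<longrightarrow> d \<le> dist x y" for x using finite_set_avoid[OF I(2)] by blast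
    then obtain d where d: "\<And>x. d x > 0" "\<And>x y. y \<in> I \<Longrightarrow> y \<noteq> x \<Longrightarrow> d x \<le> dist x y" by metis
    \<comment> \<open>Half the least distance between the points makes the balls, and with them the
      supports, disjoint.\<close>
    define r where "r = Min (d ` I) / 2"
    have ne: "I \<noteq> {}" using I by auto
    have "r > 0" using d I ne by (simp add: r_def)
    moreover have "ball x r \<inter> ball y r = {}" if "x \<in> I" "y \<in> I" "x \<noteq> y" for x y
    proof -
      have "2 * r \<le> d x" using I that by (simp add: r_def)
      also have "\<dots> \<le> dist x y" using d that by auto
      finally have far: "2 * r \<le> dist x y" .
      have "\<not> (dist x z < r \<and> dist y z < r)" for z
        using dist_triangle2[of x y z] far by linarith
      then show ?thesis by auto
    qed
    ultimately show ?thesis by blast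
  qed
  then obtain r where r: "r > 0" "\<And>x y. x \<in> I \<Longrightarrow> y \<in> I \<Longrightarrow> x \<noteq> y \<Longrightarrow> ball x r \<inter> ball y r = {}" by metis
  define T where "T x \<phi> \<longleftrightarrow> \<phi> \<in> test_functions \<and> (\<forall>y. y \<notin> ball x r \<longrightarrow> \<phi> y = 0) \<and> (\<integral>y. g y * (\<phi> y)\<^sup>2 \<partial>lebesgue) > 0"
    for x and \<phi> :: "real ^ 'n \<Rightarrow> real"
  have "\<exists>\<phi>. x \<in> I \<longrightarrow> T x \<phi>" for x
  proof (cases "x \<in> I")
    case True
    then have "x \<in> positive_points" using I by blast
    then show ?thesis by (rule positive_test[OF _ r(1)]) (auto simp: T_def)
  qed auto
  then obtain \<phi> where "\<And>x. x \<in> I \<Longrightarrow> T x (\<phi> x)" by metis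
  then have \<phi>: "\<And>x. x \<in> I \<Longrightarrow> \<phi> x \<in> test_functions" "\<And>x y. x \<in> I \<Longrightarrow> y \<notin> ball x r \<Longrightarrow> \<phi> x y = 0"
    "\<And>x. x \<in> I \<Longrightarrow> (\<integral>y. g y * (\<phi> x y)\<^sup>2 \<partial>lebesgue) > 0"
    unfolding T_def by auto
  obtain c where c: "\<exists>x\<in>I. c x \<noteq> 0" "\<And>u. u \<in> U \<Longrightarrow> (\<Sum>x\<in>I. c x * ip u (\<phi> x)) = 0"
    using nontrivial_kernel[OF U(1) I(2), of "\<lambda>u x. ip u (\<phi> x)"] I(3) by auto
  have span: "(\<lambda>y. \<Sum>x\<in>J. c x * \<phi> x y) \<in> test_functions \<and> (\<forall>u\<in>U. ip u (\<lambda>y. \<Sum>x\<in>J. c x * \<phi> x y) = (\<Sum>x\<in>J. c x * ip u (\<phi> x)))"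
    if "J \<subseteq> I" for J
    using finite_subset[OF that I(2)] that
  proof (induction J rule: finite_induct)
    case empty
    have z: "(\<lambda>_. 0) \<in> (test_functions :: (real ^ 'n \<Rightarrow> real) set)"
      by (rule test_functionsI[where B = "{}"]) auto
    have "ip u (\<lambda>_. 0) = 0" if "u \<in> U" for u
      using psd_form_diff(3)[OF psd_form_ip test_in_X[OF z] test_in_X[OF z], of u] U(2) that by auto
    then show ?case using z by simp
  next
    case (insert z J)
    let ?s = "\<lambda>y. \<Sum>x\<in>J. c x * \<phi> x y"
    have s: "?s \<in> test_functions" "\<And>u. u \<in> U \<Longrightarrow> ip u ?s = (\<Sum>x\<in>J. c x * ip u (\<phi> x))" using insert by auto
    have z: "\<phi> z \<in> test_functions" using \<phi> insert by auto
    have e: "(\<lambda>y. \<Sum>x\<in>insert z J. c x * \<phi> x y) = (\<lambda>y. c z * \<phi> z y + 1 * ?s y)" using insert by auto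
    have "ip u (\<lambda>y. c z * \<phi> z y + 1 * ?s y) = c z * ip u (\<phi> z) + 1 * ip u ?s" if "u \<in> U" for u
      by (rule psd_formD(5)[OF psd_form_ip test_in_X[OF z] test_in_X[OF s(1)]]) (use U that in auto)
    then show ?case unfolding e using test_linear[OF z s(1), of "c z" 1] s(2) insert by simp
  qed
  define v where "v = (\<lambda>y. \<Sum>x\<in>I. c x * \<phi> x y)"
  have v: "v \<in> test_functions" "\<And>u. u \<in> U \<Longrightarrow> ip u v = 0" using span[of I] c(2) by (auto simp: v_def)
  \<comment> \<open>Disjoint supports kill the mixed products, so the indefinite form is diagonal on
    the span, with positive diagonal entries.\<close>
  have sq: "v y * v y = (\<Sum>x\<in>I. (c x)\<^sup>2 * (\<phi> x y)\<^sup>2)" for y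
  proof -
    have "v y * v y = (\<Sum>x\<in>I. \<Sum>z\<in>I. (c x * \<phi> x y) * (c z * \<phi> z y))"
      by (simp add: v_def sum_product)
    also have "\<dots> = (\<Sum>x\<in>I. \<Sum>z\<in>I. if z = x then (c x)\<^sup>2 * (\<phi> x y)\<^sup>2 else 0)"
    proof (intro sum.cong refl)
      fix x z assume xz: "x \<in> I" "z \<in> I"
      show "(c x * \<phi> x y) * (c z * \<phi> z y) = (if z = x then (c x)\<^sup>2 * (\<phi> x y)\<^sup>2 else 0)"
      proof (cases "z = x")
        case False
        then have "y \<notin> ball x r \<or> y \<notin> ball z r" using r(2)[OF xz] by auto
        then show ?thesis using \<phi>(2) xz False by auto
      qed (simp add: power2_eq_square)
    qed
    also have "\<dots> = (\<Sum>x\<in>I. (c x)\<^sup>2 * (\<phi> x y)\<^sup>2)" using I(2) by simp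
    finally show ?thesis .
  qed
  have int: "integrable lebesgue (\<lambda>y. g y * (\<phi> x y)\<^sup>2)" if "x \<in> I" for x
    using form_g(1)[OF test_in_X test_in_X, OF \<phi>(1) \<phi>(1), OF that that] by (simp add: power2_eq_square)
  have "(\<integral>y. g y * (v y * v y) \<partial>lebesgue) = (\<integral>y. (\<Sum>x\<in>I. (c x)\<^sup>2 * (g y * (\<phi> x y)\<^sup>2)) \<partial>lebesgue)"
    by (intro Bochner_Integration.integral_cong) (auto simp: sq sum_distrib_left mult_ac)
  also have "\<dots> = (\<Sum>x\<in>I. (c x)\<^sup>2 * (\<integral>y. g y * (\<phi> x y)\<^sup>2 \<partial>lebesgue))"
    using int by (subst Bochner_Integration.integral_sum) auto
  also have "\<dots> > 0"
  proof -
    obtain x where x: "x \<in> I" "c x \<noteq> 0" using c by blast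
    then show ?thesis
      using I(2) \<phi>(3) by (intro sum_pos2[of I x]) (auto intro!: mult_nonneg_nonneg dest: less_imp_le)
  qed
  finally have "form gm v v < form gp v v" using form_g(2)[OF test_in_X test_in_X, OF v(1) v(1)] by simp
  then show ?thesis using v test_in_X by blast
qed

text \<open>The limit exists in the larger space by completeness for the energy alone. Along an
  almost everywhere convergent subsequence Fatou's lemma bounds the form of g^- on v_n - w, which
  shows both that w belongs to X and that the convergence holds in the full norm.\<close>

lemma complete_X:
  assumes v: "\<And>n::nat. v n \<in> X"
    and Cauchy: "\<And>e. e > 0 \<Longrightarrow> \<exists>K. \<forall>m\<ge>K. \<forall>n\<ge>K. ip (\<lambda>x. v m x - v n x) (\<lambda>x. v m x - v n x) + form gm (\<lambda>x. v m x - v n x) (\<lambda>x. v m x - v n x) \<le> e"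
  shows "\<exists>w\<in>X. (\<lambda>n. ip (\<lambda>x. v n x - w x) (\<lambda>x. v n x - w x)) \<longlonglongrightarrow> 0 \<and> (\<lambda>n. form gm (\<lambda>x. v n x - w x) (\<lambda>x. v n x - w x)) \<longlonglongrightarrow> 0"
proof -
  have dX: "(\<lambda>x. v m x - v n x) \<in> X" for m n by (rule psd_form_diff(1)[OF psd_form_ip v v])
  note nn = psd_formD(3)[OF psd_form_ip dX dX] psd_formD(3)[OF psd_form_gm dX dX]
  note [measurable] = v[THEN XW, THEN W_measurable]
  obtain w where w: "w \<in> W" "(\<lambda>n. ip (\<lambda>x. v n x - w x) (\<lambda>x. v n x - w x)) \<longlonglongrightarrow> 0"
  proof (rule W_complete[OF XW[OF v]])
    fix e :: real assume "e > 0"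
    then obtain K where "\<forall>m\<ge>K. \<forall>n\<ge>K. ip (\<lambda>x. v m x - v n x) (\<lambda>x. v m x - v n x) + form gm (\<lambda>x. v m x - v n x) (\<lambda>x. v m x - v n x) \<le> e"
      using Cauchy by blast
    then show "\<exists>K. \<forall>m\<ge>K. \<forall>n\<ge>K. ip (\<lambda>x. v m x - v n x) (\<lambda>x. v m x - v n x) \<le> e"
      using nn(2) by (smt (verit))
  qed
  note [measurable] = w(1)[THEN W_measurable]
  obtain r :: "nat \<Rightarrow> nat" where r: "strict_mono r" "AE x in lebesgue. (\<lambda>n. v (r n) x) \<longlonglongrightarrow> w x"
    by (rule W_AE_subseq[OF XW[OF v] w]) (rule that)
  have small: "\<exists>K. \<forall>n\<ge>K. (\<integral>\<^sup>+x. ennreal (gm x * (v n x - w x)\<^sup>2) \<partial>lebesgue) \<le> ennreal e" if e: "e > 0" for e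
  proof -
    obtain K where K: "\<And>m n. m \<ge> K \<Longrightarrow> n \<ge> K \<Longrightarrow> ip (\<lambda>x. v m x - v n x) (\<lambda>x. v m x - v n x) + form gm (\<lambda>x. v m x - v n x) (\<lambda>x. v m x - v n x) \<le> e"
      using Cauchy[OF e] by blast
    have "(\<integral>\<^sup>+x. ennreal (gm x * (v n x - w x)\<^sup>2) \<partial>lebesgue) \<le> ennreal e" if n: "n \<ge> K" for n
    proof -
      have "(\<integral>\<^sup>+x. ennreal (gm x * (v n x - w x)\<^sup>2) \<partial>lebesgue) \<le> (\<integral>\<^sup>+x. liminf (\<lambda>k. ennreal (gm x * (v n x - v (r k) x)\<^sup>2)) \<partial>lebesgue)"
      proof (rule nn_integral_mono_AE, use r(2) in eventually_elim)
        case (elim x)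
        then have "(\<lambda>k. ennreal (gm x * (v n x - v (r k) x)\<^sup>2)) \<longlonglongrightarrow> ennreal (gm x * (v n x - w x)\<^sup>2)" by (intro tendsto_intros)
        from lim_imp_Liminf[OF trivial_limit_sequentially this] show ?case by simp
      qed
      also have "\<dots> \<le> liminf (\<lambda>k. \<integral>\<^sup>+x. ennreal (gm x * (v n x - v (r k) x)\<^sup>2) \<partial>lebesgue)"
        by (rule nn_integral_liminf) measurable
      also have "\<dots> \<le> ennreal e"
      proof (rule Liminf_le)
        have "(\<integral>\<^sup>+x. ennreal (gm x * (v n x - v (r k) x)\<^sup>2) \<partial>lebesgue) \<le> ennreal e" if "k \<ge> K" for k
        proof -
          have "r k \<ge> K" using strict_mono_imp_increasing[OF r(1), of k] that by linarith
          then have "form gm (\<lambda>x. v n x - v (r k) x) (\<lambda>x. v n x - v (r k) x) \<le> e" using K[OF n] nn(1)[of n "r k"] by fastforce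
          then show ?thesis unfolding form_gm_self[OF dX, symmetric] by (rule ennreal_leI)
        qed
        then show "\<forall>\<^sub>F k in sequentially. (\<integral>\<^sup>+x. ennreal (gm x * (v n x - v (r k) x)\<^sup>2) \<partial>lebesgue) \<le> ennreal e"
          unfolding eventually_sequentially by blast
      qed simp
      finally show ?thesis .
    qed
    then show ?thesis by blast
  qed
  have wX: "w \<in> X"
  proof -
    obtain K where "\<forall>n\<ge>K. (\<integral>\<^sup>+x. ennreal (gm x * (v n x - w x)\<^sup>2) \<partial>lebesgue) \<le> ennreal 1" using small[of 1] by auto
    then have "(\<integral>\<^sup>+x. ennreal (gm x * (v K x - w x)\<^sup>2) \<partial>lebesgue) < \<infinity>" by (auto intro: le_less_trans)
    then have "(\<lambda>x. v K x - w x) \<in> X" using W_diff[OF XW[OF v] w(1)] by (simp add: X_def)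
    from psd_form_diff(1)[OF psd_form_ip v[of K] this] show ?thesis by simp
  qed
  have d: "(\<lambda>x. v n x - w x) \<in> X" for n by (rule psd_form_diff(1)[OF psd_form_ip v wX])
  have "(\<lambda>n. form gm (\<lambda>x. v n x - w x) (\<lambda>x. v n x - w x)) \<longlonglongrightarrow> 0"
  proof (rule LIMSEQ_I)
    fix e :: real assume e: "e > 0"
    obtain K where K: "\<And>n. n \<ge> K \<Longrightarrow> (\<integral>\<^sup>+x. ennreal (gm x * (v n x - w x)\<^sup>2) \<partial>lebesgue) \<le> ennreal (e / 2)" using small[of "e / 2"] e by auto
    have "norm (form gm (\<lambda>x. v n x - w x) (\<lambda>x. v n x - w x) - 0) < e" if "n \<ge> K" for n
    proof -
      have "ennreal (form gm (\<lambda>x. v n x - w x) (\<lambda>x. v n x - w x)) \<le> ennreal (e / 2)" using K[OF that] by (simp add: form_gm_self[OF d])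
      then have "form gm (\<lambda>x. v n x - w x) (\<lambda>x. v n x - w x) \<le> e / 2" using e by (subst (asm) ennreal_le_iff) auto
      then show ?thesis using e psd_formD(3)[OF psd_form_gm d d, of n] by simp
    qed
    then show "\<exists>K. \<forall>n\<ge>K. norm (form gm (\<lambda>x. v n x - w x) (\<lambda>x. v n x - w x) - 0) < e" by blast
  qed
  with wX w(2) show ?thesis by blast
qed

lemma small_weak_eigenvalue:
  assumes "\<epsilon> > 0"
  shows "\<exists>\<mu> u. 0 < \<mu> \<and> \<mu> < \<epsilon> \<and> u \<in> X \<and> ip u u = 1 \<and> (\<forall>\<phi>\<in>X. form gp u \<phi> - form gm u \<phi> = \<mu> * ip u \<phi>)"
proof -
  obtain K where K: "K \<ge> 0" "\<And>u. u \<in> W \<Longrightarrow> (\<integral>\<^sup>+x. ennreal (gp x * (u x)\<^sup>2) \<partial>lebesgue) \<le> ennreal (K * ip u u)"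
    using gp_bounded by metis
  have dX: "(\<lambda>x. u x - v x) \<in> X" if "u \<in> X" "v \<in> X" for u v by (rule psd_form_diff(1)[OF psd_form_ip that])
  interpret form_space X ip "form gp" "form gm" K
  proof
    fix u assume u: "u \<in> X"
    have "ennreal (form gp u u) \<le> ennreal (K * ip u u)" using K(2)[OF XW[OF u]] by (simp add: form_gp_self[OF XW[OF u]])
    then show "form gp u u \<le> K * ip u u" using K(1) ip_nonneg[OF XW[OF u]] by (subst (asm) ennreal_le_iff) auto
  next
    fix v :: "nat \<Rightarrow> real ^ 'n \<Rightarrow> real" assume v: "\<And>n. v n \<in> X" "\<And>n. ip (v n) (v n) \<le> 1"
    have fr: "finite_rank gp" using finite_rank by (simp add: gp_def[abs_def])
    from finite_rank_compact[OF fr, of v, OF XW[OF v(1)] v(2)]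
    obtain r :: "nat \<Rightarrow> nat" where r: "strict_mono r" and
      c: "\<forall>e>0. \<exists>K. \<forall>m\<ge>K. \<forall>n\<ge>K. (\<integral>\<^sup>+x. ennreal (gp x * (v (r m) x - v (r n) x)\<^sup>2) \<partial>lebesgue) \<le> ennreal e"
      by (elim exE conjE)
    have "\<exists>K. \<forall>m\<ge>K. \<forall>n\<ge>K. form gp (\<lambda>x. v (r m) x - v (r n) x) (\<lambda>x. v (r m) x - v (r n) x) \<le> e" if e: "e > 0" for e
    proof -
      obtain K where K: "\<And>m n. m \<ge> K \<Longrightarrow> n \<ge> K \<Longrightarrow> (\<integral>\<^sup>+x. ennreal (gp x * (v (r m) x - v (r n) x)\<^sup>2) \<partial>lebesgue) \<le> ennreal e"
        using c e by blast
      have "form gp (\<lambda>x. v (r m) x - v (r n) x) (\<lambda>x. v (r m) x - v (r n) x) \<le> e" if "m \<ge> K" "n \<ge> K" for m n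
        using K[OF that] e unfolding form_gp_self[OF XW[OF dX[OF v(1) v(1)]], symmetric] by (subst (asm) ennreal_le_iff) auto
      then show ?thesis by blast
    qed
    with r show "\<exists>r::nat\<Rightarrow>nat. strict_mono r \<and> (\<forall>e>0. \<exists>K. \<forall>m\<ge>K. \<forall>n\<ge>K. form gp (\<lambda>x. v (r m) x - v (r n) x) (\<lambda>x. v (r m) x - v (r n) x) \<le> e)"
      by blast
  qed (fact psd_form_ip psd_form_gp psd_form_gm complete_X exists_positive)+
  show ?thesis using small_eigenvalue[OF assms] unfolding eig_def by blast
qed

end

section \<open>Testing against the whole space\<close>

lemma arctan_abs_le_2: "\<bar>arctan t\<bar> \<le> 2"
  using arctan_ubound[of t] arctan_lbound[of t] pi_less_4 by auto

lemma abs_div_one_plus_square_le: "\<bar>t / (1 + t\<^sup>2)\<bar> \<le> (1::real)"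
proof -
  have "1 + t\<^sup>2 > 0" using zero_le_power2[of t] by linarith
  moreover have "\<bar>t\<bar> \<le> 1 + t\<^sup>2" using zero_le_power2[of "\<bar>t\<bar> - 1"] by (simp add: power2_diff)
  ultimately show ?thesis by (simp add: abs_divide divide_le_eq)
qed

lemma mult_arctan_tendsto: "(\<lambda>m. t * arctan (real m * t)) \<longlonglongrightarrow> pi / 2 * \<bar>t\<bar>"
proof (cases "t = 0")
  case False
  have e: "t * arctan (real m * t) = \<bar>t\<bar> * arctan (real m * \<bar>t\<bar>)" for m
    by (cases "t \<ge> 0") (simp_all add: arctan_minus)
  have "filterlim (\<lambda>m. real m * \<bar>t\<bar>) at_top sequentially"
    using False by (intro filterlim_at_top_mult_tendsto_pos[OF tendsto_const _ filterlim_real_sequentially]) simp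
  then have "(\<lambda>m. arctan (real m * \<bar>t\<bar>)) \<longlonglongrightarrow> pi / 2"
    by (rule filterlim_compose[OF tendsto_arctan_at_top])
  then have "(\<lambda>m. \<bar>t\<bar> * arctan (real m * \<bar>t\<bar>)) \<longlonglongrightarrow> \<bar>t\<bar> * (pi / 2)" by (intro tendsto_intros)
  then show ?thesis unfolding e by (simp add: mult.commute)
qed simp

lemma young_scaled:
  fixes a b :: real
  assumes "\<delta> > 0" "0 \<le> a" "0 \<le> b"
  shows "a * b \<le> \<delta> * a\<^sup>2 + b\<^sup>2 / \<delta>"
proof -
  have "0 \<le> (sqrt \<delta> * a - b / sqrt \<delta>)\<^sup>2" by simp
  then have "2 * (a * b) \<le> \<delta> * a\<^sup>2 + b\<^sup>2 / \<delta>"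
    using assms by (simp add: power2_diff power_mult_distrib power_divide)
  moreover have "0 \<le> a * b" using assms by simp
  ultimately show ?thesis by linarith
qed

section \<open>Truncated test functions\<close>

context weighted_problem
begin

definition K :: real where
  "K = (SOME K. K \<ge> 0 \<and> (\<forall>u\<in>W. form gp u u \<le> K * ip u u))"

lemma K: "K \<ge> 0" "u \<in> W \<Longrightarrow> form gp u u \<le> K * ip u u"
proof -
  obtain C where C: "C \<ge> 0" "\<And>u. u \<in> W \<Longrightarrow> (\<integral>\<^sup>+x. ennreal (gp x * (u x)\<^sup>2) \<partial>lebesgue) \<le> ennreal (C * ip u u)"
    using gp_bounded by metis
  have "\<forall>u\<in>W. form gp u u \<le> C * ip u u"
  proof
    fix u assume u: "u \<in> W"
    have "ennreal (form gp u u) \<le> ennreal (C * ip u u)" using C(2)[OF u] by (simp add: form_gp_self[OF u])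
    then show "form gp u u \<le> C * ip u u" using C(1) ip_nonneg[OF u] by (subst (asm) ennreal_le_iff) auto
  qed
  then have "\<exists>K. K \<ge> 0 \<and> (\<forall>u\<in>W. form gp u u \<le> K * ip u u)" using C(1) by blast
  from someI_ex[OF this] show "K \<ge> 0" "u \<in> W \<Longrightarrow> form gp u u \<le> K * ip u u" by (auto simp: K_def)
qed

text \<open>The free parameter t lets the bound be used additively with t = 1 and, with t balanced
  against the energy of w, as a bound of Cauchy-Schwarz type.\<close>

lemma gp_abs_integral:
  assumes u: "u \<in> W" and w: "w \<in> W" and t: "t > 0"
  shows "integrable lebesgue (\<lambda>x. gp x * \<bar>u x * w x\<bar>)"
    "(\<integral>x. gp x * \<bar>u x * w x\<bar> \<partial>lebesgue) \<le> K * (t * ip u u + ip w w / t)"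
proof -
  note m = u[THEN W_measurable] w[THEN W_measurable]
  note f = gp_finite[OF u] gp_finite[OF w]
  show i: "integrable lebesgue (\<lambda>x. gp x * \<bar>u x * w x\<bar>)"
    by (rule square_add_finite(3)[OF gp_measurable m gp_nonneg f])
  have i2: "integrable lebesgue (\<lambda>x. gp x * (u x * u x))" "integrable lebesgue (\<lambda>x. gp x * (w x * w x))"
    using square_add_finite(2)[OF gp_measurable m(1) m(1) gp_nonneg f(1) f(1)] square_add_finite(2)[OF gp_measurable m(2) m(2) gp_nonneg f(2) f(2)] by auto
  have "(\<integral>x. gp x * \<bar>u x * w x\<bar> \<partial>lebesgue) \<le> (\<integral>x. t * (gp x * (u x * u x)) + gp x * (w x * w x) / t \<partial>lebesgue)"
  proof (rule integral_mono[OF i])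
    show "integrable lebesgue (\<lambda>x. t * (gp x * (u x * u x)) + gp x * (w x * w x) / t)" using i2 by simp
    fix x
    have "gp x * \<bar>u x * w x\<bar> \<le> gp x * (t * (u x)\<^sup>2 + (w x)\<^sup>2 / t)"
      using young_scaled[OF t, of "\<bar>u x\<bar>" "\<bar>w x\<bar>"] gp_nonneg by (intro mult_left_mono) (auto simp: abs_mult)
    then show "gp x * \<bar>u x * w x\<bar> \<le> t * (gp x * (u x * u x)) + gp x * (w x * w x) / t"
      by (simp add: power2_eq_square algebra_simps)
  qed
  also have "\<dots> = t * form gp u u + form gp w w / t" using i2 by (simp add: form_def)
  also have "\<dots> \<le> t * (K * ip u u) + (K * ip w w) / t"
    using K(2)[OF u] K(2)[OF w] t by (intro add_mono mult_left_mono divide_right_mono) auto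
  finally show "(\<integral>x. gp x * \<bar>u x * w x\<bar> \<partial>lebesgue) \<le> K * (t * ip u u + ip w w / t)"
    by (simp add: algebra_simps)
qed

text \<open>Inside arctan the function u is replaced by a test function v near it, so that \<psi> is
  an admissible test function. Then grad v = G + D with G the gradient of u: the term with G . G has
  a favourable sign and is dropped, and D is small when v is close to u. The constant 3 bounds
  |arctan s + s/(1+s^2)| by 2 + 1.\<close>

lemma ip_truncated_lower_bound:
  assumes u: "u \<in> W" and \<phi>: "\<phi> \<in> test_functions" and v: "v \<in> test_functions" and k: "k \<ge> 0" and \<delta>: "\<delta> > 0"
    and M: "\<And>x. \<bar>\<phi> x\<bar> \<le> M"
  defines "\<psi> \<equiv> \<lambda>x. \<phi> x * arctan (k * (v x * \<phi> x))"
  shows "\<psi> \<in> test_functions"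
    "- ip u \<psi> \<le> 3 * (ip u u + ip \<phi> \<phi>) + k * M\<^sup>2 * (\<delta> * ip u u + ip (\<lambda>x. v x - u x) (\<lambda>x. v x - u x) / \<delta>)"
proof -
  note s\<phi> = test_smooth[OF \<phi>] and sv = test_smooth[OF v]
  have st: "smooth (\<lambda>x. k * (v x * \<phi> x))" by (intro smooth_cmult smooth_mult sv s\<phi>)
  show \<psi>: "\<psi> \<in> test_functions" unfolding \<psi>_def by (rule test_mult[OF \<phi> smooth_arctan[OF st]])
  define t where "t x = k * (v x * \<phi> x)" for x
  define G where "G = weighted_gradient \<alpha> u"
  have hG: "hwg u G" unfolding G_def by (rule hwg_weighted_gradient[OF u])
  define D where "D x = gradient v x - G x" for x
  have hD: "hwg (\<lambda>x. v x - u x) D" unfolding D_def by (rule hwg_diff[OF hwg_test[OF v] hG])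
  have grad: "gradient \<psi> x = (arctan (t x) + t x / (1 + (t x)\<^sup>2)) *\<^sub>R gradient \<phi> x + (k * (\<phi> x)\<^sup>2 / (1 + (t x)\<^sup>2)) *\<^sub>R gradient v x" for x
  proof -
    have gt: "gradient (\<lambda>x. k * (v x * \<phi> x)) x = (k * v x) *\<^sub>R gradient \<phi> x + (k * \<phi> x) *\<^sub>R gradient v x"
      using gradient_linear[OF smooth_mult[OF sv s\<phi>] smooth_mult[OF sv s\<phi>], of k 0 x]
      by (simp add: gradient_mult[OF sv s\<phi>] scaleR_add_right)
    have "gradient (\<lambda>x. arctan (k * (v x * \<phi> x))) x = inverse (1 + (t x)\<^sup>2) *\<^sub>R gradient (\<lambda>x. k * (v x * \<phi> x)) x"
      unfolding t_def by (rule gradient_compose[OF st DERIV_arctan])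
    then have "gradient \<psi> x = \<phi> x *\<^sub>R (inverse (1 + (t x)\<^sup>2) *\<^sub>R ((k * v x) *\<^sub>R gradient \<phi> x + (k * \<phi> x) *\<^sub>R gradient v x)) + arctan (t x) *\<^sub>R gradient \<phi> x"
      unfolding \<psi>_def gradient_mult[OF s\<phi> smooth_arctan[OF st]] gt t_def by simp
    then show ?thesis
      by (simp add: scaleR_add_right scaleR_add_left divide_inverse t_def power2_eq_square mult_ac)
  qed
  have pw: "- (norm x powr \<alpha> * (G x \<bullet> gradient \<psi> x)) \<le>
     3 * (norm x powr \<alpha> * (G x \<bullet> G x) + norm x powr \<alpha> * (gradient \<phi> x \<bullet> gradient \<phi> x)) +
     k * M\<^sup>2 * (\<delta> * (norm x powr \<alpha> * (G x \<bullet> G x)) + norm x powr \<alpha> * (D x \<bullet> D x) / \<delta>)" for x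
  proof -
    define a where "a = arctan (t x) + t x / (1 + (t x)\<^sup>2)"
    define c where "c = k * (\<phi> x)\<^sup>2 / (1 + (t x)\<^sup>2)"
    have "1 + (t x)\<^sup>2 \<ge> 1" by simp
    have c: "0 \<le> c" "c \<le> k * M\<^sup>2"
    proof -
      show "0 \<le> c" using k by (simp add: c_def)
      have "(\<phi> x)\<^sup>2 \<le> M\<^sup>2" using M[of x] by (metis abs_ge_zero power2_abs power_mono)
      then have "k * (\<phi> x)\<^sup>2 \<le> k * M\<^sup>2" using k by (rule mult_left_mono)
      moreover have "c \<le> k * (\<phi> x)\<^sup>2"
        unfolding c_def using k divide_left_mono[OF \<open>1 + (t x)\<^sup>2 \<ge> 1\<close>, of "k * (\<phi> x)\<^sup>2"]
        by (simp add: add_pos_nonneg)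
      ultimately show "c \<le> k * M\<^sup>2" by linarith
    qed
    have "\<bar>a\<bar> \<le> 3" using arctan_abs_le_2[of "t x"] abs_div_one_plus_square_le[of "t x"] unfolding a_def by linarith
    have "\<bar>a * (G x \<bullet> gradient \<phi> x)\<bar> \<le> 3 * (norm (G x) * norm (gradient \<phi> x))"
      unfolding abs_mult using \<open>\<bar>a\<bar> \<le> 3\<close> Cauchy_Schwarz_ineq2 by (intro mult_mono) auto
    also have "\<dots> \<le> 3 * (G x \<bullet> G x + gradient \<phi> x \<bullet> gradient \<phi> x)"
      using young_scaled[of 1 "norm (G x)" "norm (gradient \<phi> x)"] by (simp add: power2_norm_eq_inner)
    finally have 1: "- (a * (G x \<bullet> gradient \<phi> x)) \<le> 3 * (G x \<bullet> G x + gradient \<phi> x \<bullet> gradient \<phi> x)" by linarith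
    have "\<bar>c * (G x \<bullet> D x)\<bar> \<le> (k * M\<^sup>2) * (norm (G x) * norm (D x))"
      unfolding abs_mult using c Cauchy_Schwarz_ineq2[of "G x" "D x"] by (intro mult_mono) auto
    also have "\<dots> \<le> (k * M\<^sup>2) * (\<delta> * (G x \<bullet> G x) + (D x \<bullet> D x) / \<delta>)"
      using young_scaled[OF \<delta>, of "norm (G x)" "norm (D x)"] c by (intro mult_left_mono) (auto simp: power2_norm_eq_inner)
    finally have 2: "- (c * (G x \<bullet> D x)) \<le> (k * M\<^sup>2) * (\<delta> * (G x \<bullet> G x) + (D x \<bullet> D x) / \<delta>)" by linarith
    have 3: "0 \<le> c * (G x \<bullet> G x)" using c by simp
    have "G x \<bullet> gradient \<psi> x = a * (G x \<bullet> gradient \<phi> x) + c * (G x \<bullet> G x) + c * (G x \<bullet> D x)"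
      unfolding grad a_def[symmetric] c_def[symmetric] by (simp add: D_def inner_simps algebra_simps)
    then have "- (G x \<bullet> gradient \<psi> x) \<le> 3 * (G x \<bullet> G x + gradient \<phi> x \<bullet> gradient \<phi> x) + (k * M\<^sup>2) * (\<delta> * (G x \<bullet> G x) + (D x \<bullet> D x) / \<delta>)"
      using 1 2 3 by linarith
    then have "norm x powr \<alpha> * - (G x \<bullet> gradient \<psi> x) \<le> norm x powr \<alpha> * (3 * (G x \<bullet> G x + gradient \<phi> x \<bullet> gradient \<phi> x) + (k * M\<^sup>2) * (\<delta> * (G x \<bullet> G x) + (D x \<bullet> D x) / \<delta>))"
      by (rule mult_left_mono) simp
    then show ?thesis by (simp add: algebra_simps add_divide_distrib)
  qed
  note i = integrable_inner[OF hG hG] integrable_inner[OF hwg_test[OF \<phi>] hwg_test[OF \<phi>]] integrable_inner[OF hD hD] integrable_inner[OF hG hwg_test[OF \<psi>]]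
  have "- ip u \<psi> = (\<integral>x. - (norm x powr \<alpha> * (G x \<bullet> gradient \<psi> x)) \<partial>lebesgue)"
    unfolding ip_eq[OF hG hwg_test[OF \<psi>]] by simp
  also have "\<dots> \<le> (\<integral>x. 3 * (norm x powr \<alpha> * (G x \<bullet> G x) + norm x powr \<alpha> * (gradient \<phi> x \<bullet> gradient \<phi> x)) +
     k * M\<^sup>2 * (\<delta> * (norm x powr \<alpha> * (G x \<bullet> G x)) + norm x powr \<alpha> * (D x \<bullet> D x) / \<delta>) \<partial>lebesgue)"
    by (rule integral_mono[OF _ _ pw]) (use i in auto)
  also have "\<dots> = 3 * (ip u u + ip \<phi> \<phi>) + k * M\<^sup>2 * (\<delta> * ip u u + ip (\<lambda>x. v x - u x) (\<lambda>x. v x - u x) / \<delta>)"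
    unfolding ip_eq[OF hG hG] ip_eq[OF hD hD] ip_eq[OF hwg_test[OF \<phi>] hwg_test[OF \<phi>]] using i by simp
  finally show "- ip u \<psi> \<le> 3 * (ip u u + ip \<phi> \<phi>) + k * M\<^sup>2 * (\<delta> * ip u u + ip (\<lambda>x. v x - u x) (\<lambda>x. v x - u x) / \<delta>)" .
qed

end

locale weak_eigenvector = weighted_problem \<alpha> dim g for \<alpha> :: real and dim :: "'n::finite itself" and g +
  fixes \<mu> :: real and u :: "real ^ 'n \<Rightarrow> real"
  assumes \<mu>: "\<mu> > 0" and u: "u \<in> X" and normalized: "ip u u = 1"
    and equation: "\<And>\<phi>. \<phi> \<in> X \<Longrightarrow> form gp u \<phi> - form gm u \<phi> = \<mu> * ip u \<phi>"
begin

lemmas [measurable] = u[THEN XW, THEN W_measurable]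

text \<open>Kato's inequality in weak form: the test function $\varphi\arctan(k u\varphi)$ approximates
  $\frac{\pi}{2}|\varphi|\,\mathrm{sgn}\,u\varphi$, and the term containing $|\nabla u|^2$ has a sign.\<close>

lemma gm_test_bound:
  assumes \<phi>: "\<phi> \<in> test_functions"
  shows "(\<integral>\<^sup>+x. ennreal (gm x * \<bar>u x * \<phi> x\<bar>) \<partial>lebesgue) \<le> ennreal ((2 * K + 3 * \<mu>) * (1 + ip \<phi> \<phi>))"
proof -
  note uW = XW[OF u]
  have \<phi>X: "\<phi> \<in> X" by (rule test_in_X[OF \<phi>])
  note [measurable] = test_measurable[OF \<phi>]
  obtain M where M: "\<And>x. \<bar>\<phi> x\<bar> \<le> M" using test_bounded[OF \<phi>] by metis
  \<comment> \<open>2K comes from the g^+ integral with |arctan| \<le> 2, and 3\<mu> from the lower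
    bound for the inner product. Neither depends on k, which is essential for letting k tend to
    infinity.\<close>
  define B where "B = (2 * K + 3 * \<mu>) * (1 + ip \<phi> \<phi>)"
  have B: "B \<ge> 0" unfolding B_def using K(1) \<mu> ip_nonneg[OF XW[OF \<phi>X]] by (intro mult_nonneg_nonneg) auto
  have ig: "integrable lebesgue (\<lambda>x. gm x * \<bar>u x * \<phi> x\<bar>)"
    by (rule square_add_finite(3)) (use gm_nonneg gm_finite[OF u] gm_finite[OF \<phi>X] in auto)
  obtain v where v: "\<And>n. v n \<in> test_functions" "(\<lambda>n. ip (\<lambda>x. v n x - u x) (\<lambda>x. v n x - u x)) \<longlonglongrightarrow> 0"
    "AE x in lebesgue. (\<lambda>n. v n x) \<longlonglongrightarrow> u x"
    by (rule W_approx[OF uW]) (rule that)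
  note [measurable] = test_measurable[OF v(1)]
  \<comment> \<open>Two limits are taken in order: for fixed k the approximations v_n tend to u, and
    only then does k grow. The \<delta> term carries the factor k, so \<delta> is chosen after k;
    this leaves an error of at most e, which is arbitrary.\<close>
  have k_bound: "(\<integral>x. gm x * (u x * \<phi> x * arctan (k * (u x * \<phi> x))) \<partial>lebesgue) \<le> B" if k: "k \<ge> 0" for k
  proof (rule field_le_epsilon)
    fix e :: real assume e: "e > 0"
    define \<delta> where "\<delta> = e / (\<mu> * (k * M\<^sup>2 + 1))"
    have kM: "k * M\<^sup>2 + 1 > 0" using k by (simp add: add_nonneg_pos)
    have \<delta>: "\<delta> > 0" using e \<mu> kM by (simp add: \<delta>_def)
    have \<delta>e: "\<mu> * (k * M\<^sup>2 * \<delta>) \<le> e"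
    proof -
      have "\<mu> * (k * M\<^sup>2 * \<delta>) \<le> \<mu> * ((k * M\<^sup>2 + 1) * \<delta>)" using \<mu> \<delta> by (intro mult_left_mono mult_right_mono) auto
      also have "\<dots> = e" using \<mu> kM by (simp add: \<delta>_def)
      finally show ?thesis .
    qed
    define \<psi> where "\<psi> n = (\<lambda>x. \<phi> x * arctan (k * (v n x * \<phi> x)))" for n
    note lb = ip_truncated_lower_bound[OF uW \<phi> v(1) k \<delta> M, folded \<psi>_def]
    note [measurable] = test_measurable[OF lb(1)]
    have le: "form gm u (\<psi> n) \<le> B + \<mu> * (k * M\<^sup>2 * (\<delta> + ip (\<lambda>x. v n x - u x) (\<lambda>x. v n x - u x) / \<delta>))" for n
    proof -
      have \<psi>X: "\<psi> n \<in> X" by (rule test_in_X[OF lb(1)])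
      have "form gp u (\<psi> n) \<le> (\<integral>x. 2 * (gp x * \<bar>u x * \<phi> x\<bar>) \<partial>lebesgue)"
        unfolding form_def
      proof (rule integral_mono)
        show "integrable lebesgue (\<lambda>x. gp x * (u x * \<psi> n x))"
          by (rule square_add_finite(2)) (use gp_nonneg gp_finite[OF uW] gp_finite[OF XW[OF \<psi>X]] in auto)
        show "integrable lebesgue (\<lambda>x. 2 * (gp x * \<bar>u x * \<phi> x\<bar>))"
          using gp_abs_integral(1)[OF uW XW[OF \<phi>X] zero_less_one] by simp
        fix x
        have "u x * \<psi> n x \<le> \<bar>u x * \<phi> x\<bar> * \<bar>arctan (k * (v n x * \<phi> x))\<bar>"
          unfolding \<psi>_def by (metis abs_ge_self abs_mult mult.assoc)
        also have "\<dots> \<le> \<bar>u x * \<phi> x\<bar> * 2" by (intro mult_left_mono arctan_abs_le_2) auto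
        finally have "gp x * (u x * \<psi> n x) \<le> gp x * (\<bar>u x * \<phi> x\<bar> * 2)" by (intro mult_left_mono gp_nonneg)
        then show "gp x * (u x * \<psi> n x) \<le> 2 * (gp x * \<bar>u x * \<phi> x\<bar>)" by (simp add: mult_ac)
      qed
      also have "\<dots> \<le> 2 * (K * (1 + ip \<phi> \<phi>))"
        using gp_abs_integral(2)[OF uW XW[OF \<phi>X] zero_less_one] by (simp add: normalized)
      finally have 1: "form gp u (\<psi> n) \<le> 2 * (K * (1 + ip \<phi> \<phi>))" .
      have "form gm u (\<psi> n) = form gp u (\<psi> n) + \<mu> * - ip u (\<psi> n)" using equation[OF \<psi>X] by simp
      also have "\<dots> \<le> 2 * (K * (1 + ip \<phi> \<phi>)) + \<mu> * (3 * (1 + ip \<phi> \<phi>) + k * M\<^sup>2 * (\<delta> + ip (\<lambda>x. v n x - u x) (\<lambda>x. v n x - u x) / \<delta>))"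
        using 1 lb(2)[of n] \<mu> by (intro add_mono mult_left_mono) (auto simp: normalized)
      finally show ?thesis by (simp add: B_def algebra_simps)
    qed
    \<comment> \<open>The majorant 2 g^- |u \<phi>| is integrable since both u and \<phi> belong to
      X; this gives finiteness but no bound in terms of the energy, which is what the limit
      supplies.\<close>
    have "(\<lambda>n. form gm u (\<psi> n)) \<longlonglongrightarrow> (\<integral>x. gm x * (u x * \<phi> x * arctan (k * (u x * \<phi> x))) \<partial>lebesgue)"
      unfolding form_def
    proof (rule integral_dominated_convergence)
      show "integrable lebesgue (\<lambda>x. 2 * (gm x * \<bar>u x * \<phi> x\<bar>))" using ig by simp
      show "AE x in lebesgue. (\<lambda>n. gm x * (u x * \<psi> n x)) \<longlonglongrightarrow> gm x * (u x * \<phi> x * arctan (k * (u x * \<phi> x)))"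
        using v(3)
      proof eventually_elim
        case (elim x)
        have "(\<lambda>n. gm x * (u x * (\<phi> x * arctan (k * (v n x * \<phi> x))))) \<longlonglongrightarrow> gm x * (u x * (\<phi> x * arctan (k * (u x * \<phi> x))))"
          by (intro tendsto_intros elim)
        then show ?case by (simp add: \<psi>_def mult.assoc)
      qed
      show "AE x in lebesgue. norm (gm x * (u x * \<psi> n x)) \<le> 2 * (gm x * \<bar>u x * \<phi> x\<bar>)" for n
      proof (rule AE_I2)
        fix x
        have "norm (gm x * (u x * \<psi> n x)) = (gm x * \<bar>u x * \<phi> x\<bar>) * \<bar>arctan (k * (v n x * \<phi> x))\<bar>"
          by (simp add: \<psi>_def abs_mult gm_nonneg mult.assoc)
        also have "\<dots> \<le> (gm x * \<bar>u x * \<phi> x\<bar>) * 2"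
          by (intro mult_left_mono arctan_abs_le_2) (simp add: gm_nonneg)
        finally show "norm (gm x * (u x * \<psi> n x)) \<le> 2 * (gm x * \<bar>u x * \<phi> x\<bar>)" by simp
      qed
    qed measurable
    moreover have "(\<lambda>n. B + \<mu> * (k * M\<^sup>2 * (\<delta> + ip (\<lambda>x. v n x - u x) (\<lambda>x. v n x - u x) / \<delta>))) \<longlonglongrightarrow> B + \<mu> * (k * M\<^sup>2 * (\<delta> + 0 / \<delta>))"
      using \<delta> by (intro tendsto_intros v(2)) auto
    ultimately have "(\<integral>x. gm x * (u x * \<phi> x * arctan (k * (u x * \<phi> x))) \<partial>lebesgue) \<le> B + \<mu> * (k * M\<^sup>2 * (\<delta> + 0 / \<delta>))"
      by (rule LIMSEQ_le) (use le in auto)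
    then show "(\<integral>x. gm x * (u x * \<phi> x * arctan (k * (u x * \<phi> x))) \<partial>lebesgue) \<le> B + e"
      using \<delta>e by simp
  qed
  have "(\<lambda>m. \<integral>x. gm x * (u x * \<phi> x * arctan (real m * (u x * \<phi> x))) \<partial>lebesgue) \<longlonglongrightarrow> (\<integral>x. gm x * (pi / 2 * \<bar>u x * \<phi> x\<bar>) \<partial>lebesgue)"
  proof (rule integral_dominated_convergence)
    show "integrable lebesgue (\<lambda>x. 2 * (gm x * \<bar>u x * \<phi> x\<bar>))" using ig by simp
    show "AE x in lebesgue. (\<lambda>m. gm x * (u x * \<phi> x * arctan (real m * (u x * \<phi> x)))) \<longlonglongrightarrow> gm x * (pi / 2 * \<bar>u x * \<phi> x\<bar>)"
      by (intro AE_I2 tendsto_intros mult_arctan_tendsto)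
    show "AE x in lebesgue. norm (gm x * (u x * \<phi> x * arctan (real m * (u x * \<phi> x)))) \<le> 2 * (gm x * \<bar>u x * \<phi> x\<bar>)" for m
    proof (rule AE_I2)
      fix x
      have "norm (gm x * (u x * \<phi> x * arctan (real m * (u x * \<phi> x)))) = (gm x * \<bar>u x * \<phi> x\<bar>) * \<bar>arctan (real m * (u x * \<phi> x))\<bar>"
        by (simp add: abs_mult gm_nonneg mult.assoc)
      also have "\<dots> \<le> (gm x * \<bar>u x * \<phi> x\<bar>) * 2"
        by (intro mult_left_mono arctan_abs_le_2) (simp add: gm_nonneg)
      finally show "norm (gm x * (u x * \<phi> x * arctan (real m * (u x * \<phi> x)))) \<le> 2 * (gm x * \<bar>u x * \<phi> x\<bar>)" by simp
    qed
  qed measurable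
  then have "(\<integral>x. gm x * (pi / 2 * \<bar>u x * \<phi> x\<bar>) \<partial>lebesgue) \<le> B"
    by (rule LIMSEQ_le_const2) (use k_bound in auto)
  \<comment> \<open>The limit k to infinity leaves the factor \<pi>/2 \<ge> 1, which is
    discarded.\<close>
  moreover have "(\<integral>x. gm x * \<bar>u x * \<phi> x\<bar> \<partial>lebesgue) \<le> (\<integral>x. gm x * (pi / 2 * \<bar>u x * \<phi> x\<bar>) \<partial>lebesgue)"
  proof (rule integral_mono[OF ig])
    have "integrable lebesgue (\<lambda>x. pi / 2 * (gm x * \<bar>u x * \<phi> x\<bar>))" using ig by simp
    then show "integrable lebesgue (\<lambda>x. gm x * (pi / 2 * \<bar>u x * \<phi> x\<bar>))" by (simp add: mult.left_commute)
    fix x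
    have "1 * \<bar>u x * \<phi> x\<bar> \<le> pi / 2 * \<bar>u x * \<phi> x\<bar>" using pi_ge_two by (intro mult_right_mono) auto
    then show "gm x * \<bar>u x * \<phi> x\<bar> \<le> gm x * (pi / 2 * \<bar>u x * \<phi> x\<bar>)" using gm_nonneg by (intro mult_left_mono) auto
  qed
  ultimately have "(\<integral>x. gm x * \<bar>u x * \<phi> x\<bar> \<partial>lebesgue) \<le> B" by linarith
  then show ?thesis unfolding B_def[symmetric]
    using ig by (subst nn_integral_eq_integral) (auto simp: gm_nonneg intro: ennreal_leI)
qed

text \<open>Rescaling to energy at most 1 turns the inhomogeneous bound 1 + energy into one
  proportional to the square root of t; Fatou's lemma then extends it from test functions. The
  inequality with t is strict so that approximating test functions satisfy it eventually.\<close>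

lemma gm_bound:
  assumes w: "w \<in> W" and t: "ip w w < t"
  shows "(\<integral>\<^sup>+x. ennreal (gm x * \<bar>u x * w x\<bar>) \<partial>lebesgue) \<le> ennreal (2 * (2 * K + 3 * \<mu>) * sqrt t)"
proof -
  have t0: "t > 0" using ip_nonneg[OF w] t by linarith
  have c: "2 * K + 3 * \<mu> \<ge> 0" using K(1) \<mu> by simp
  have test: "(\<integral>\<^sup>+x. ennreal (gm x * \<bar>u x * \<phi> x\<bar>) \<partial>lebesgue) \<le> ennreal (2 * (2 * K + 3 * \<mu>) * sqrt t)"
    if \<phi>: "\<phi> \<in> test_functions" "ip \<phi> \<phi> \<le> t" for \<phi>
  proof -
    note [measurable] = test_measurable[OF \<phi>(1)]
    let ?c = "1 / sqrt t"
    have \<psi>: "(\<lambda>x. ?c * \<phi> x) \<in> test_functions" using test_linear[OF \<phi>(1) \<phi>(1), of ?c 0] by simp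
    have "ip (\<lambda>x. ?c * \<phi> x) (\<lambda>x. ?c * \<phi> x) = ip \<phi> \<phi> / t"
      using W_scale(2)[OF test_in_W[OF \<phi>(1)], of ?c] t0 by (simp add: power_divide)
    also have "\<dots> \<le> 1" using \<phi>(2) t0 by simp
    finally have "(2 * K + 3 * \<mu>) * (1 + ip (\<lambda>x. ?c * \<phi> x) (\<lambda>x. ?c * \<phi> x)) \<le> (2 * K + 3 * \<mu>) * 2"
      using c by (intro mult_left_mono) auto
    then have "(\<integral>\<^sup>+x. ennreal (gm x * \<bar>u x * (?c * \<phi> x)\<bar>) \<partial>lebesgue) \<le> ennreal ((2 * K + 3 * \<mu>) * 2)"
      using gm_test_bound[OF \<psi>] by (meson ennreal_leI order_trans)
    then have "ennreal (sqrt t) * (\<integral>\<^sup>+x. ennreal (gm x * \<bar>u x * (?c * \<phi> x)\<bar>) \<partial>lebesgue) \<le> ennreal (sqrt t) * ennreal ((2 * K + 3 * \<mu>) * 2)"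
      by (rule mult_left_mono) simp
    also have "ennreal (sqrt t) * (\<integral>\<^sup>+x. ennreal (gm x * \<bar>u x * (?c * \<phi> x)\<bar>) \<partial>lebesgue) = (\<integral>\<^sup>+x. ennreal (gm x * \<bar>u x * \<phi> x\<bar>) \<partial>lebesgue)"
    proof -
      have "ennreal (gm x * \<bar>u x * \<phi> x\<bar>) = ennreal (sqrt t) * ennreal (gm x * \<bar>u x * (?c * \<phi> x)\<bar>)" for x
        using t0 gm_nonneg by (simp add: abs_mult flip: ennreal_mult)
      then show ?thesis by (simp add: nn_integral_cmult)
    qed
    also have "ennreal (sqrt t) * ennreal ((2 * K + 3 * \<mu>) * 2) = ennreal (2 * (2 * K + 3 * \<mu>) * sqrt t)"
      using c t0 by (simp add: mult_ac flip: ennreal_mult)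
    finally show ?thesis .
  qed
  obtain \<phi> where \<phi>: "\<And>n. \<phi> n \<in> test_functions" "(\<lambda>n. ip (\<lambda>x. \<phi> n x - w x) (\<lambda>x. \<phi> n x - w x)) \<longlonglongrightarrow> 0"
    "AE x in lebesgue. (\<lambda>n. \<phi> n x) \<longlonglongrightarrow> w x"
    by (rule W_approx[OF w]) (rule that)
  note [measurable] = test_measurable[OF \<phi>(1)]
  have psdW: "psd_form W ip"
    unfolding psd_form_def using W_linear ip_sym ip_linear ip_nonneg by blast
  have "(\<lambda>n. ip (\<phi> n) (\<phi> n)) \<longlonglongrightarrow> ip w w"
    by (rule psd_form_tendsto(2)[OF psdW test_in_W[OF \<phi>(1)] w \<phi>(2)])
  then have "\<forall>\<^sub>F n in sequentially. ip (\<phi> n) (\<phi> n) < t" using t by (rule order_tendstoD)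
  then have ev: "\<forall>\<^sub>F n in sequentially. (\<integral>\<^sup>+x. ennreal (gm x * \<bar>u x * \<phi> n x\<bar>) \<partial>lebesgue) \<le> ennreal (2 * (2 * K + 3 * \<mu>) * sqrt t)"
    by eventually_elim (use test[OF \<phi>(1)] in auto)
  have "(\<integral>\<^sup>+x. ennreal (gm x * \<bar>u x * w x\<bar>) \<partial>lebesgue) \<le> (\<integral>\<^sup>+x. liminf (\<lambda>n. ennreal (gm x * \<bar>u x * \<phi> n x\<bar>)) \<partial>lebesgue)"
  proof (rule nn_integral_mono_AE, use \<phi>(3) in eventually_elim)
    case (elim x)
    then have "(\<lambda>n. ennreal (gm x * \<bar>u x * \<phi> n x\<bar>)) \<longlonglongrightarrow> ennreal (gm x * \<bar>u x * w x\<bar>)" by (intro tendsto_intros)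
    from lim_imp_Liminf[OF trivial_limit_sequentially this] show ?case by simp
  qed
  also have "\<dots> \<le> liminf (\<lambda>n. \<integral>\<^sup>+x. ennreal (gm x * \<bar>u x * \<phi> n x\<bar>) \<partial>lebesgue)"
    by (rule nn_integral_liminf) measurable
  also have "\<dots> \<le> ennreal (2 * (2 * K + 3 * \<mu>) * sqrt t)" using ev by (intro Liminf_le) auto
  finally show ?thesis .
qed

lemma product_bound:
  assumes w: "w \<in> W" and t: "ip w w < t"
  shows "integrable lebesgue (\<lambda>x. g x * u x * w x)"
    "\<bar>\<integral>x. g x * u x * w x \<partial>lebesgue\<bar> \<le> (2 * K + 2 * (2 * K + 3 * \<mu>)) * sqrt t"
proof -
  note [measurable] = W_measurable[OF w]
  have t0: "t > 0" using ip_nonneg[OF w] t by linarith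
  have c: "2 * K + 3 * \<mu> \<ge> 0" using K(1) \<mu> by simp
  have gp: "(\<integral>\<^sup>+x. ennreal (gp x * \<bar>u x * w x\<bar>) \<partial>lebesgue) \<le> ennreal (2 * K * sqrt t)"
  proof -
    have s: "sqrt t > 0" using t0 by simp
    \<comment> \<open>The Young parameter sqrt t balances the energy 1 of u against the energy of w,
      which is below t.\<close>
    have "(\<integral>x. gp x * \<bar>u x * w x\<bar> \<partial>lebesgue) \<le> K * (sqrt t * 1 + ip w w / sqrt t)"
      using gp_abs_integral(2)[OF XW[OF u] w s] by (simp add: normalized)
    also have "\<dots> \<le> K * (sqrt t + t / sqrt t)" using K(1) s t by (intro mult_left_mono add_mono divide_right_mono) auto
    also have "t / sqrt t = sqrt t" using t0 by (simp add: real_div_sqrt)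
    finally have "(\<integral>x. gp x * \<bar>u x * w x\<bar> \<partial>lebesgue) \<le> 2 * K * sqrt t" by simp
    then show ?thesis
      using gp_abs_integral(1)[OF XW[OF u] w s] by (subst nn_integral_eq_integral) (auto simp: gp_nonneg intro: ennreal_leI)
  qed
  have "(\<integral>\<^sup>+x. ennreal (norm (g x * u x * w x)) \<partial>lebesgue) \<le> (\<integral>\<^sup>+x. ennreal (gp x * \<bar>u x * w x\<bar>) + ennreal (gm x * \<bar>u x * w x\<bar>) \<partial>lebesgue)"
  proof (rule nn_integral_mono)
    fix x
    have "\<bar>g x\<bar> \<le> gp x + gm x" by (auto simp: gp_def gm_def)
    then have "\<bar>g x\<bar> * \<bar>u x * w x\<bar> \<le> (gp x + gm x) * \<bar>u x * w x\<bar>" by (rule mult_right_mono) simp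
    then have "ennreal (norm (g x * u x * w x)) \<le> ennreal (gp x * \<bar>u x * w x\<bar> + gm x * \<bar>u x * w x\<bar>)"
      by (intro ennreal_leI) (simp add: abs_mult distrib_right mult.assoc)
    then show "ennreal (norm (g x * u x * w x)) \<le> ennreal (gp x * \<bar>u x * w x\<bar>) + ennreal (gm x * \<bar>u x * w x\<bar>)"
      using gp_nonneg gm_nonneg by simp
  qed
  also have "\<dots> = (\<integral>\<^sup>+x. ennreal (gp x * \<bar>u x * w x\<bar>) \<partial>lebesgue) + (\<integral>\<^sup>+x. ennreal (gm x * \<bar>u x * w x\<bar>) \<partial>lebesgue)"
    by (rule nn_integral_add) measurable
  also have "\<dots> \<le> ennreal (2 * K * sqrt t) + ennreal (2 * (2 * K + 3 * \<mu>) * sqrt t)"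
    by (rule add_mono[OF gp gm_bound[OF w t]])
  also have "\<dots> = ennreal ((2 * K + 2 * (2 * K + 3 * \<mu>)) * sqrt t)"
  proof -
    have "0 \<le> 2 * K * sqrt t" "0 \<le> 2 * (2 * K + 3 * \<mu>) * sqrt t"
      using K(1) c t0 by (intro mult_nonneg_nonneg; simp)+
    then show ?thesis by (subst ennreal_plus[symmetric]) (assumption | simp only: distrib_right)+
  qed
  finally have le: "(\<integral>\<^sup>+x. ennreal (norm (g x * u x * w x)) \<partial>lebesgue) \<le> ennreal ((2 * K + 2 * (2 * K + 3 * \<mu>)) * sqrt t)" .
  have "(\<integral>\<^sup>+x. ennreal (norm (g x * u x * w x)) \<partial>lebesgue) < \<infinity>" by (rule le_less_trans[OF le]) simp
  then show i: "integrable lebesgue (\<lambda>x. g x * u x * w x)" by (intro integrableI_bounded) auto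
  have "ennreal \<bar>\<integral>x. g x * u x * w x \<partial>lebesgue\<bar> \<le> ennreal ((2 * K + 2 * (2 * K + 3 * \<mu>)) * sqrt t)"
    using order_trans[OF integral_norm_bound_ennreal[OF i] le] by (simp only: real_norm_def)
  then show "\<bar>\<integral>x. g x * u x * w x \<partial>lebesgue\<bar> \<le> (2 * K + 2 * (2 * K + 3 * \<mu>)) * sqrt t"
    using K(1) c t0 by (subst (asm) ennreal_le_iff) auto
qed

text \<open>The bound by sqrt t says that integration against g u is continuous in the energy norm;
  test functions lie in X, where the equation is known, and are dense.\<close>

lemma equation_W:
  assumes w: "w \<in> W"
  shows "(\<integral>x. g x * u x * w x \<partial>lebesgue) = \<mu> * ip u w"
proof -
  obtain \<phi> where \<phi>: "\<And>n. \<phi> n \<in> test_functions" "(\<lambda>n. ip (\<lambda>x. \<phi> n x - w x) (\<lambda>x. \<phi> n x - w x)) \<longlonglongrightarrow> 0"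
    by (rule W_approx[OF w]) (rule that)
  have psdW: "psd_form W ip"
    unfolding psd_form_def using W_linear ip_sym ip_linear ip_nonneg by blast
  have int: "integrable lebesgue (\<lambda>x. g x * u x * z x)" if "z \<in> W" for z
    by (rule product_bound(1)[OF that, of "ip z z + 1"]) simp
  let ?t = "\<lambda>n. ip (\<lambda>x. \<phi> n x - w x) (\<lambda>x. \<phi> n x - w x) + inverse (real (Suc n))"
  let ?C = "2 * K + 2 * (2 * K + 3 * \<mu>)"
  have "(\<lambda>n. ?C * sqrt (?t n)) \<longlonglongrightarrow> ?C * sqrt (0 + 0)"
    by (intro tendsto_intros \<phi>(2) LIMSEQ_inverse_real_of_nat)
  then have lim: "(\<lambda>n. ?C * sqrt (?t n)) \<longlonglongrightarrow> 0" by simp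
  have "\<bar>(\<integral>x. g x * u x * \<phi> n x \<partial>lebesgue) - (\<integral>x. g x * u x * w x \<partial>lebesgue)\<bar> \<le> ?C * sqrt (?t n)" for n
  proof -
    have d: "(\<lambda>x. \<phi> n x - w x) \<in> W" by (rule W_diff[OF test_in_W[OF \<phi>(1)] w])
    have "(\<integral>x. g x * u x * \<phi> n x \<partial>lebesgue) - (\<integral>x. g x * u x * w x \<partial>lebesgue) = (\<integral>x. g x * u x * (\<phi> n x - w x) \<partial>lebesgue)"
      using int[OF test_in_W[OF \<phi>(1)]] int[OF w] by (simp add: right_diff_distrib)
    also have "\<bar>\<dots>\<bar> \<le> ?C * sqrt (?t n)" by (rule product_bound(2)[OF d]) simp
    finally show ?thesis .
  qed
  then have "(\<lambda>n. (\<integral>x. g x * u x * \<phi> n x \<partial>lebesgue) - (\<integral>x. g x * u x * w x \<partial>lebesgue)) \<longlonglongrightarrow> 0"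
    by (intro Lim_null_comparison[OF _ lim]) simp
  then have "(\<lambda>n. \<integral>x. g x * u x * \<phi> n x \<partial>lebesgue) \<longlonglongrightarrow> (\<integral>x. g x * u x * w x \<partial>lebesgue)" by (simp add: LIM_zero_iff)
  moreover have "(\<integral>x. g x * u x * \<phi> n x \<partial>lebesgue) = \<mu> * ip u (\<phi> n)" for n
    using form_g(2)[OF u test_in_X[OF \<phi>(1)], of n] equation[OF test_in_X[OF \<phi>(1)], of n] by (simp add: mult.assoc)
  moreover have "(\<lambda>n. \<mu> * ip u (\<phi> n)) \<longlonglongrightarrow> \<mu> * ip u w"
    by (intro tendsto_intros psd_form_tendsto(1)[OF psdW test_in_W[OF \<phi>(1)] w \<phi>(2) XW[OF u]])
  ultimately show ?thesis using LIMSEQ_unique by simp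
qed

lemma eigenfunction: "is_eigenfunction \<alpha> g (1 / \<mu>) u"
  unfolding is_eigenfunction_def
proof (intro conjI ballI)
  show "u \<in> W" by (rule XW[OF u])
  show "\<not> (AE x in lebesgue. u x = 0)"
  proof
    assume "AE x in lebesgue. u x = 0"
    \<comment> \<open>A function that vanishes almost everywhere has vanishing gradient, so its
      energy would be 0 rather than 1.\<close>
    then have z: "AE x in lebesgue. weighted_gradient \<alpha> u x = 0"
      by (rule gradient_zero_unique[OF hwg_weighted_gradient[OF XW[OF u]]])
    have "ip u u = integral\<^sup>L lebesgue (\<lambda>x::real^'n. 0)"
      unfolding weighted_inner_def using hwgD(2)[OF hwg_weighted_gradient[OF XW[OF u]]]
      by (intro integral_cong_AE) (use z in auto)
    then show False using normalized by simp
  qed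
  fix w assume w: "w \<in> W"
  show "integrable lebesgue (\<lambda>x. g x * u x * w x)"
    by (rule product_bound(1)[OF w, of "ip w w + 1"]) simp
  show "ip u w = 1 / \<mu> * (\<integral>x. g x * u x * w x \<partial>lebesgue)"
    using \<mu> by (simp add: equation_W[OF w])
qed

end

section \<open>Eigenvalues above every bound\<close>

context weighted_problem
begin

lemma large_eigenvalue: "\<exists>l>c. is_eigenvalue \<alpha> g l"
proof -
  define \<epsilon> where "\<epsilon> = 1 / (\<bar>c\<bar> + 1)"
  have \<epsilon>: "\<epsilon> > 0" by (simp add: \<epsilon>_def)
  obtain \<mu> u where \<mu>: "0 < \<mu>" "\<mu> < \<epsilon>" and "u \<in> X" "ip u u = 1" "\<And>\<phi>. \<phi> \<in> X \<Longrightarrow> form gp u \<phi> - form gm u \<phi> = \<mu> * ip u \<phi>"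
    using small_weak_eigenvalue[OF \<epsilon>] by blast
  then interpret weak_eigenvector \<alpha> dim g \<mu> u by unfold_locales
  have "c < \<bar>c\<bar> + 1" by simp
  also have "\<dots> = 1 / \<epsilon>" by (simp add: \<epsilon>_def)
  also have "\<dots> < 1 / \<mu>" using \<mu>(1) \<epsilon> by (intro divide_strict_left_mono[OF \<open>\<mu> < \<epsilon>\<close>]) auto
  finally show ?thesis using eigenfunction \<mu> by (auto simp: is_eigenvalue_def)
qed

end

theorem theorem1:
  fixes g g1 g2 :: "real ^ 'n::finite \<Rightarrow> real" and \<alpha> :: real
  assumes "CARD('n) \<ge> 3"
    and "0 < \<alpha>" and "\<alpha> < 2"
    and "locally_integrable g"
    and "AE x in lebesgue. max (g x) 0 = g1 x + g2 x"
    and "\<not> (AE x in lebesgue. max (g x) 0 = 0)"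
    and "in_Lp (real CARD('n) / (2 - \<alpha>)) g1"
    and "\<And>y. ((\<lambda>x. norm (x - y) powr (2 - \<alpha>) * g2 x) \<longlongrightarrow> 0) (at y)"
    and "((\<lambda>x. norm x powr (2 - \<alpha>) * g2 x) \<longlongrightarrow> 0) at_infinity"
  shows "\<exists>lam :: nat \<Rightarrow> real. strict_mono lam \<and> \<not> bdd_above (range lam) \<and>
           (\<forall>n. is_eigenvalue \<alpha> g (lam n))"
proof -
  interpret weighted_space \<alpha> "TYPE('n)" using assms(1-3) by unfold_locales
  \<comment> \<open>Measurability of g is contained in integrability on balls, whose truncations
    converge pointwise to g.\<close>
  have g_meas: "g \<in> borel_measurable lebesgue"
  proof (rule borel_measurable_LIMSEQ_real)
    show "(\<lambda>x. indicator (cball 0 (real n)) x * g x) \<in> borel_measurable lebesgue" for n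
      using assms(4) by (intro borel_measurable_integrable) (auto simp: locally_integrable_def set_integrable_def)
    show "(\<lambda>n. indicator (cball 0 (real n)) x * g x) \<longlonglongrightarrow> g x" for x
    proof (rule tendsto_eventually)
      obtain k :: nat where "norm x \<le> real k" using real_arch_simple by blast
      then show "\<forall>\<^sub>F n in sequentially. indicator (cball 0 (real n)) x * g x = g x"
        unfolding eventually_sequentially by (intro exI[of _ k]) auto
    qed
  qed
  have g1_meas: "g1 \<in> borel_measurable lebesgue" using assms(7) by (simp add: in_Lp_def)
  \<comment> \<open>g2 agrees almost everywhere with a measurable function, and Lebesgue measure is
    complete.\<close>
  have g2_meas: "g2 \<in> borel_measurable lebesgue"
  proof (rule borel_measurable_AE)
    show "(\<lambda>x. max (g x) 0 - g1 x) \<in> borel_measurable lebesgue" using g_meas g1_meas by measurable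
    show "AE x in lebesgue. max (g x) 0 - g1 x = g2 x" using assms(5) by eventually_elim simp
  qed
  have "small_plus_local (\<lambda>x. max (g x) 0)"
  proof (rule small_plus_local_add[OF _ _ _ _ small_plus_local_Lp[OF assms(7)] small_plus_local_singular[OF g2_meas assms(8,9)]])
    show "AE x in lebesgue. max (g x) 0 \<le> \<bar>g1 x\<bar> + \<bar>g2 x\<bar>" using assms(5) by eventually_elim simp
  qed (use g1_meas g2_meas in auto)
  then have "finite_rank (\<lambda>x. max (g x) 0)"
    by (intro finite_rank_if_small_plus_local) (use g_meas in auto)
  then interpret weighted_problem \<alpha> "TYPE('n)" g using assms(4,6) by unfold_locales
  have "\<exists>lam :: nat \<Rightarrow> real. \<forall>n. is_eigenvalue \<alpha> g (lam n) \<and> real n < lam n \<and> lam n < lam (Suc n)"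
  proof -
    have "\<exists>lam :: nat \<Rightarrow> real. \<forall>n. (is_eigenvalue \<alpha> g (lam n) \<and> real n < lam n) \<and> lam n < lam (Suc n)"
    \<comment> \<open>Each new eigenvalue exceeds both its predecessor and its index, which gives
      strict monotonicity and unboundedness together.\<close>
    proof (rule dependent_nat_choice)
      show "\<exists>x. is_eigenvalue \<alpha> g x \<and> real 0 < x" using large_eigenvalue[of "real 0"] by blast
      show "\<exists>y. (is_eigenvalue \<alpha> g y \<and> real (Suc n) < y) \<and> x < y" for x n
        using large_eigenvalue[of "max x (real (Suc n))"] by auto
    qed
    then show ?thesis by blast
  qed
  then obtain lam :: "nat \<Rightarrow> real" where lam: "\<And>n. is_eigenvalue \<alpha> g (lam n)" "\<And>n. real n < lam n" "\<And>n. lam n < lam (Suc n)"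
    by blast
  have "\<not> bdd_above (range lam)"
  proof
    assume "bdd_above (range lam)"
    then obtain b where b: "\<And>n. lam n \<le> b" by (auto simp: bdd_above_def)
    obtain n :: nat where "b < real n" using reals_Archimedean2 by blast
    then show False using b[of n] lam(2)[of n] by simp
  qed
  moreover have "strict_mono lam" using lam(3) by (simp add: strict_mono_Suc_iff)
  ultimately show ?thesis using lam(1) by (intro exI[of _ lam] conjI allI)
qed

end
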